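(* Let $K$ be a spherically complete field with a non-Archimedean valuation, let $G$ be a discrete group, and let $l(G)=l^1(G)$ be the Banach $K$-algebra (under convolution) of all functions $G\to K$ vanishing at infinity. Then $l(G)$ is amenable if and only if $G$ is Johnson $K$-amenable.
   Context: All Banach spaces, algebras and modules are over the spherically complete non-Archimedean valued field $K$, with norms satisfying the strong triangle inequality $\|x+y\|\le\max(\|x\|,\|y\|)$. Modules over a Banach algebra are Banach modules (Banach spaces with continuous bilinear actions), and morphisms are continuous $K$-linear module maps. $E^*$ denotes the Banach space of continuous $K$-linear functionals on $E$. **The algebra $l(G)$.** $l(G)=l^1(G)$ is the space of all functions $f\colon G\to K$ vanishing at infinity (for every $\epsilon>0$ the set $\{g: |f(g)|\geq\epsilon\}$ is finite), with norm $\|f\|=\max_{g\in G}|f(g)|$ and the convolution product determined by $\delta_g\delta_h=\delta_{gh}$, where $\delta_g$ is the function equal to $1$ at $g$ and $0$ elsewhere. It is a unital Banach algebra with identity $\delta_e$. **Johnson $K$-amenability.** $l^\infty(G)$ is the Banach space of all bounded functions $G\to K$ with the sup norm. $G$ acts on it on the left by $(g\cdot f)(h)=f(g^{-1}h)$. $\mathbf{1}\in l^\infty(G)$ is the function identically equal to $1$. The discrete group $G$ is Johnson $K$-amenable if there exists $m\in (l^\infty(G))^*$ which is left-invariant, i.e. $m(g\cdot f)=m(f)$ for all $g\in G$, $f\in l^\infty(G)$, and such that $m(\mathbf{1})\neq 0$. **Amenable Banach algebras.** For Banach spaces $E,F$, $E\widehat{\otimes}F$ is the completed (non-Archimedean projective)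 tensor product, i.e. the completion of $E\otimes_K F$ with respect to $\|t\|=\inf\{\max_i\|x_i\|\|y_i\| : t=\sum_i x_i\otimes y_i\}$. For a right $A$-module $M$ and a left $A$-module $N$, $M\widehat{\otimes}_A N=(M\widehat\otimes N)/J$ where $J$ is the closed linear span of all $m\cdot a\otimes n-m\otimes a\cdot n$ ($m\in M$, $n\in N$, $a\in A$). For $A$-bimodules $X,Y$ the tensor product of bimodules is the quotient of $X\widehat\otimes Y$ by the closed linear span of all $x\cdot a\otimes y-x\otimes a\cdot y$ and $a\cdot x\otimes y-x\otimes y\cdot a$. A complex of $A$-modules (or $A$-bimodules) is admissible if it splits as a complex of Banach spaces (i.e. has a contracting homotopy consisting of continuous $K$-linear maps). A right $A$-module $M$ is flat if the functor $M\widehat{\otimes}_A(-)$ takes admissible complexes of left $A$-modules to exact complexes. Flat left modules and flat bimodules are defined similarly (for bimodules, using the tensor product of bimodules and admissible complexes of bimodules). $A_+$ denotes the unitization of $A$. A Banach algebra $A$ is amenable if $A_+$ is flat as an $A$-bimodule. *)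

theory Defs
  imports
    "HOL-Analysis.Analysis"
    "HOL-Algebra.Module"
    "HOL-Algebra.AbelCoset"
    "HOL-Library.Poly_Mapping"
begin

section \<open>Spherically complete non-Archimedean valued fields\<close>

text \<open>
  The absolute value \<open>vabs\<close> is not required to be non-trivial.  It is not the constant \<open>norm\<close>
  because the library restricts that to real normed vector spaces.
\<close>

class nonarch_field = field + metric_space +
  fixes vabs :: "'a \<Rightarrow> real"
  assumes dist_vabs: "dist x y = vabs (x - y)"
    and vabs_mult: "vabs (x * y) = vabs x * vabs y"
    and vabs_add: "vabs (x + y) \<le> max (vabs x) (vabs y)"

class spherically_complete_field = nonarch_field +
  assumes spherically_complete:
    "\<lbrakk>\<And>n. 0 < r n; \<And>n. {x. dist (c (Suc n)) x \<le> r (Suc n)} \<subseteq> {x. dist (c n) x \<le> r n}\<rbrakk>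
      \<Longrightarrow> (\<Inter>n::nat. {x. dist (c n) x \<le> r n}) \<noteq> {}"


section \<open>Banach spaces and bounded maps\<close>

text \<open>
  Since \<open>module\<close> extends \<open>ring\<close>, one record type serves for Banach algebras and for Banach
  spaces; the fields \<open>mult\<close> and \<open>one\<close> are irrelevant for the latter.
\<close>

record ('k, 'x) nspace = "('k, 'x) module" +
  nrm :: "'x \<Rightarrow> real"

definition scalars :: "('k::nonarch_field, 'k) nspace" where
  "scalars = \<lparr>carrier = UNIV, mult = (*), one = 1, zero = 0, add = (+), smult = (*), nrm = vabs\<rparr>"

definition nrm_Cauchy :: "('k, 'x, 'm) nspace_scheme \<Rightarrow> (nat \<Rightarrow> 'x) \<Rightarrow> bool" where
  "nrm_Cauchy E \<sigma> \<longleftrightarrow> (\<forall>e>0. \<exists>N. \<forall>m\<ge>N. \<forall>n\<ge>N. nrm E (\<sigma> m \<ominus>\<^bsub>E\<^esub> \<sigma> n) < e)"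

definition nrm_tendsto :: "('k, 'x, 'm) nspace_scheme \<Rightarrow> (nat \<Rightarrow> 'x) \<Rightarrow> 'x \<Rightarrow> bool" where
  "nrm_tendsto E \<sigma> x \<longleftrightarrow> (\<lambda>n. nrm E (\<sigma> n \<ominus>\<^bsub>E\<^esub> x)) \<longlonglongrightarrow> 0"

locale nonarch_banach_space = module "scalars :: ('k::nonarch_field, 'k) nspace" E
  for E :: "('k::nonarch_field, 'x, 'm) nspace_scheme" +
  assumes nrm_nonneg: "x \<in> carrier E \<Longrightarrow> 0 \<le> nrm E x"
    and nrm_eq_0_iff: "x \<in> carrier E \<Longrightarrow> nrm E x = 0 \<longleftrightarrow> x = \<zero>\<^bsub>E\<^esub>"
    and nrm_smult: "x \<in> carrier E \<Longrightarrow> nrm E (c \<odot>\<^bsub>E\<^esub> x) = vabs c * nrm E x"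
    and nrm_add: "\<lbrakk>x \<in> carrier E; y \<in> carrier E\<rbrakk> \<Longrightarrow> nrm E (x \<oplus>\<^bsub>E\<^esub> y) \<le> max (nrm E x) (nrm E y)"
    and nrm_complete: "\<lbrakk>range \<sigma> \<subseteq> carrier E; nrm_Cauchy E \<sigma>\<rbrakk> \<Longrightarrow> \<exists>x\<in>carrier E. nrm_tendsto E \<sigma> x"

text \<open>
  Continuity of linear and bilinear maps is expressed by boundedness; over a non-trivially valued
  field the two are the same.
\<close>

definition bounded_linear_map ::
  "('k::nonarch_field, 'x, 'm) nspace_scheme \<Rightarrow> ('k, 'y, 'n) nspace_scheme \<Rightarrow> ('x \<Rightarrow> 'y) \<Rightarrow> bool" where
  "bounded_linear_map E F f \<longleftrightarrow>
     f \<in> carrier E \<rightarrow> carrier F \<and>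
     (\<forall>x\<in>carrier E. \<forall>y\<in>carrier E. f (x \<oplus>\<^bsub>E\<^esub> y) = f x \<oplus>\<^bsub>F\<^esub> f y) \<and>
     (\<forall>c. \<forall>x\<in>carrier E. f (c \<odot>\<^bsub>E\<^esub> x) = c \<odot>\<^bsub>F\<^esub> f x) \<and>
     (\<exists>C. \<forall>x\<in>carrier E. nrm F (f x) \<le> C * nrm E x)"

definition bounded_bilinear_map ::
  "('k::nonarch_field, 'x, 'm) nspace_scheme \<Rightarrow> ('k, 'y, 'n) nspace_scheme \<Rightarrow>
   ('k, 'z, 'p) nspace_scheme \<Rightarrow> ('x \<Rightarrow> 'y \<Rightarrow> 'z) \<Rightarrow> bool" where
  "bounded_bilinear_map E F H b \<longleftrightarrow>
     (\<forall>x\<in>carrier E. bounded_linear_map F H (\<lambda>y. b x y)) \<and>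
     (\<forall>y\<in>carrier F. bounded_linear_map E H (\<lambda>x. b x y)) \<and>
     (\<exists>C. \<forall>x\<in>carrier E. \<forall>y\<in>carrier F. nrm H (b x y) \<le> C * nrm E x * nrm F y)"

definition linear_span :: "('k::nonarch_field, 'x, 'm) nspace_scheme \<Rightarrow> 'x set \<Rightarrow> 'x set" where
  "linear_span E S = \<Inter>{N. submodule N (scalars :: ('k, 'k) nspace) E \<and> S \<subseteq> N}"

definition closed_subspace :: "('k::nonarch_field, 'x, 'm) nspace_scheme \<Rightarrow> 'x set \<Rightarrow> bool" where
  "closed_subspace E N \<longleftrightarrow>
     submodule N (scalars :: ('k, 'k) nspace) E \<and>
     (\<forall>\<sigma> x. range \<sigma> \<subseteq> N \<and> x \<in> carrier E \<and> nrm_tendsto E \<sigma> x \<longrightarrow> x \<in> N)"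

definition closed_linear_span :: "('k::nonarch_field, 'x, 'm) nspace_scheme \<Rightarrow> 'x set \<Rightarrow> 'x set" where
  "closed_linear_span E S = \<Inter>{N. closed_subspace E N \<and> S \<subseteq> N}"


section \<open>Quotients and completions\<close>

text \<open>
  The constructions below are also applied to spaces whose \<open>nrm\<close> is only a seminorm, and to
  subspaces that are not closed.
\<close>

definition quotient_space :: "('k, 'x, 'm) nspace_scheme \<Rightarrow> 'x set \<Rightarrow> ('k, 'x set) nspace" where
  "quotient_space E N =
     \<lparr>carrier = a_rcosets\<^bsub>E\<^esub> N, mult = undefined, one = undefined, zero = N, add = set_add E,
      smult = (\<lambda>c S. \<Union>x\<in>S. N +>\<^bsub>E\<^esub> (c \<odot>\<^bsub>E\<^esub> x)), nrm = (\<lambda>S. INF x\<in>S. nrm E x)\<rparr>"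

text \<open>The map into the quotient of \<open>F\<close> by \<open>N\<close> which \<open>f\<close> induces on cosets.\<close>

definition coset_map :: "('k, 'y, 'n) nspace_scheme \<Rightarrow> 'y set \<Rightarrow> ('x \<Rightarrow> 'y) \<Rightarrow> 'x set \<Rightarrow> 'y set" where
  "coset_map F N f S = (\<Union>x\<in>S. N +>\<^bsub>F\<^esub> f x)"

definition cauchy_space :: "('k, 'x, 'm) nspace_scheme \<Rightarrow> ('k, nat \<Rightarrow> 'x) nspace" where
  "cauchy_space E =
     \<lparr>carrier = {\<sigma>. range \<sigma> \<subseteq> carrier E \<and> nrm_Cauchy E \<sigma>}, mult = undefined, one = undefined,
      zero = (\<lambda>_. \<zero>\<^bsub>E\<^esub>), add = (\<lambda>\<sigma> \<tau> n. \<sigma> n \<oplus>\<^bsub>E\<^esub> \<tau> n), smult = (\<lambda>c \<sigma> n. c \<odot>\<^bsub>E\<^esub> \<sigma> n),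
      nrm = (\<lambda>\<sigma>. lim (\<lambda>n. nrm E (\<sigma> n)))\<rparr>"

definition null_sequences :: "('k, 'x, 'm) nspace_scheme \<Rightarrow> (nat \<Rightarrow> 'x) set" where
  "null_sequences E = {\<sigma>. range \<sigma> \<subseteq> carrier E \<and> nrm_tendsto E \<sigma> \<zero>\<^bsub>E\<^esub>}"

definition nspace_completion :: "('k, 'x, 'm) nspace_scheme \<Rightarrow> ('k, (nat \<Rightarrow> 'x) set) nspace" where
  "nspace_completion E = quotient_space (cauchy_space E) (null_sequences E)"

definition completion_map ::
  "('k, 'y, 'n) nspace_scheme \<Rightarrow> ('x \<Rightarrow> 'y) \<Rightarrow> (nat \<Rightarrow> 'x) set \<Rightarrow> (nat \<Rightarrow> 'y) set" where
  "completion_map F f = coset_map (cauchy_space F) (null_sequences F) (\<lambda>\<sigma>. f \<circ> \<sigma>)"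


section \<open>The completed projective tensor product\<close>

text \<open>
  A formal combination of pairs with coefficients \<open>c\<^sub>i\<close> at \<open>(x\<^sub>i, y\<^sub>i)\<close> represents the tensor
  that is the sum of the \<open>(c\<^sub>i x\<^sub>i) \<otimes> y\<^sub>i\<close>.  With the seminorm below, the quotient seminorm on the
  algebraic tensor product is therefore the infimum of the maxima of \<open>\<parallel>x\<^sub>i\<parallel> \<parallel>y\<^sub>i\<parallel>\<close> over all
  representations of a tensor.
\<close>

definition free_space ::
  "('k::nonarch_field, 'x, 'm) nspace_scheme \<Rightarrow> ('k, 'y, 'n) nspace_scheme \<Rightarrow>
   ('k, 'x \<times> 'y \<Rightarrow>\<^sub>0 'k) nspace" where
  "free_space E F =
     \<lparr>carrier = {t. Poly_Mapping.keys t \<subseteq> carrier E \<times> carrier F}, mult = undefined, one = undefined,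
      zero = 0, add = (+), smult = (\<lambda>c. Poly_Mapping.map ((*) c)),
      nrm = (\<lambda>t. Max (insert 0 ((\<lambda>(x, y). vabs (Poly_Mapping.lookup t (x, y)) * nrm E x * nrm F y) ` Poly_Mapping.keys t)))\<rparr>"

definition tensor_relations ::
  "('k::nonarch_field, 'x, 'm) nspace_scheme \<Rightarrow> ('k, 'y, 'n) nspace_scheme \<Rightarrow>
   ('x \<times> 'y \<Rightarrow>\<^sub>0 'k) set" where
  "tensor_relations E F = linear_span (free_space E F)
     ({Poly_Mapping.single (x \<oplus>\<^bsub>E\<^esub> x', y) 1 - Poly_Mapping.single (x, y) 1
         - Poly_Mapping.single (x', y) 1 |
         x x' y. x \<in> carrier E \<and> x' \<in> carrier E \<and> y \<in> carrier F}
      \<union> {Poly_Mapping.single (x, y \<oplus>\<^bsub>F\<^esub> y') 1 - Poly_Mapping.single (x, y) 1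
         - Poly_Mapping.single (x, y') 1 |
         x y y'. x \<in> carrier E \<and> y \<in> carrier F \<and> y' \<in> carrier F}
      \<union> {Poly_Mapping.single (c \<odot>\<^bsub>E\<^esub> x, y) 1 - Poly_Mapping.single (x, y) c |
         c x y. x \<in> carrier E \<and> y \<in> carrier F}
      \<union> {Poly_Mapping.single (x, c \<odot>\<^bsub>F\<^esub> y) 1 - Poly_Mapping.single (x, y) c |
         c x y. x \<in> carrier E \<and> y \<in> carrier F})"

definition alg_tensor ::
  "('k::nonarch_field, 'x, 'm) nspace_scheme \<Rightarrow> ('k, 'y, 'n) nspace_scheme \<Rightarrow>
   ('k, ('x \<times> 'y \<Rightarrow>\<^sub>0 'k) set) nspace" where
  "alg_tensor E F = quotient_space (free_space E F) (tensor_relations E F)"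

type_synonym ('k, 'x, 'y) ctensor = "(nat \<Rightarrow> ('x \<times> 'y \<Rightarrow>\<^sub>0 'k) set) set"

definition completed_tensor ::
  "('k::nonarch_field, 'x, 'm) nspace_scheme \<Rightarrow> ('k, 'y, 'n) nspace_scheme \<Rightarrow>
   ('k, ('k, 'x, 'y) ctensor) nspace" where
  "completed_tensor E F = nspace_completion (alg_tensor E F)"

definition pure_tensor ::
  "('k::nonarch_field, 'x, 'm) nspace_scheme \<Rightarrow> ('k, 'y, 'n) nspace_scheme \<Rightarrow>
   'x \<Rightarrow> 'y \<Rightarrow> ('k, 'x, 'y) ctensor" where
  "pure_tensor E F x y =
     null_sequences (alg_tensor E F) +>\<^bsub>cauchy_space (alg_tensor E F)\<^esub>
       (\<lambda>_. tensor_relations E F +>\<^bsub>free_space E F\<^esub> Poly_Mapping.single (x, y) 1)"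

text \<open>The linear map sending \<open>x \<otimes> y\<close> to \<open>x \<otimes> f y\<close>, first on formal combinations.\<close>

definition free_map :: "('y \<Rightarrow> 'z) \<Rightarrow> ('x \<times> 'y \<Rightarrow>\<^sub>0 'k::nonarch_field) \<Rightarrow> ('x \<times> 'z \<Rightarrow>\<^sub>0 'k)" where
  "free_map f t = (\<Sum>(x, y)\<in>Poly_Mapping.keys t. Poly_Mapping.single (x, f y) (Poly_Mapping.lookup t (x, y)))"

definition completed_tensor_map ::
  "('k::nonarch_field, 'x, 'm) nspace_scheme \<Rightarrow> ('k, 'z, 'n) nspace_scheme \<Rightarrow> ('y \<Rightarrow> 'z) \<Rightarrow>
   ('k, 'x, 'y) ctensor \<Rightarrow> ('k, 'x, 'z) ctensor" where
  "completed_tensor_map E H f =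
     completion_map (alg_tensor E H) (coset_map (free_space E H) (tensor_relations E H) (free_map f))"


section \<open>Banach bimodules\<close>

record ('k, 'a, 'x) bimodule = "('k, 'x) nspace" +
  lact :: "'a \<Rightarrow> 'x \<Rightarrow> 'x"
  ract :: "'x \<Rightarrow> 'a \<Rightarrow> 'x"

locale banach_bimodule = nonarch_banach_space X
  for A :: "('k::nonarch_field, 'a, 'm) nspace_scheme"
    and X :: "('k::nonarch_field, 'a, 'x, 'n) bimodule_scheme" +
  assumes lact_bilinear: "bounded_bilinear_map A X X (lact X)"
    and ract_bilinear: "bounded_bilinear_map X A X (ract X)"
    and lact_assoc: "\<lbrakk>a \<in> carrier A; b \<in> carrier A; x \<in> carrier X\<rbrakk>
      \<Longrightarrow> lact X (a \<otimes>\<^bsub>A\<^esub> b) x = lact X a (lact X b x)"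
    and ract_assoc: "\<lbrakk>a \<in> carrier A; b \<in> carrier A; x \<in> carrier X\<rbrakk>
      \<Longrightarrow> ract X x (a \<otimes>\<^bsub>A\<^esub> b) = ract X (ract X x a) b"
    and lact_ract: "\<lbrakk>a \<in> carrier A; b \<in> carrier A; x \<in> carrier X\<rbrakk>
      \<Longrightarrow> ract X (lact X a x) b = lact X a (ract X x b)"

definition bimodule_hom ::
  "('k::nonarch_field, 'a, 'm) nspace_scheme \<Rightarrow> ('k, 'a, 'x, 'n) bimodule_scheme \<Rightarrow>
   ('k, 'a, 'y, 'p) bimodule_scheme \<Rightarrow> ('x \<Rightarrow> 'y) \<Rightarrow> bool" where
  "bimodule_hom A X Y f \<longleftrightarrow>
     bounded_linear_map X Y f \<and>
     (\<forall>a\<in>carrier A. \<forall>x\<in>carrier X. f (lact X a x) = lact Y a (f x) \<and> f (ract X x a) = ract Y (f x) a)"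

definition balanced_relations ::
  "('k::nonarch_field, 'a, 'm) nspace_scheme \<Rightarrow> ('k, 'a, 'x, 'n) bimodule_scheme \<Rightarrow>
   ('k, 'a, 'y, 'p) bimodule_scheme \<Rightarrow> ('k, 'x, 'y) ctensor set" where
  "balanced_relations A X Y = closed_linear_span (completed_tensor X Y)
     ({pure_tensor X Y (ract X x a) y \<ominus>\<^bsub>completed_tensor X Y\<^esub> pure_tensor X Y x (lact Y a y) |
         a x y. a \<in> carrier A \<and> x \<in> carrier X \<and> y \<in> carrier Y}
      \<union> {pure_tensor X Y (lact X a x) y \<ominus>\<^bsub>completed_tensor X Y\<^esub> pure_tensor X Y x (ract Y y a) |
         a x y. a \<in> carrier A \<and> x \<in> carrier X \<and> y \<in> carrier Y})"

definition bimodule_tensor ::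
  "('k::nonarch_field, 'a, 'm) nspace_scheme \<Rightarrow> ('k, 'a, 'x, 'n) bimodule_scheme \<Rightarrow>
   ('k, 'a, 'y, 'p) bimodule_scheme \<Rightarrow> ('k, ('k, 'x, 'y) ctensor set) nspace" where
  "bimodule_tensor A X Y = quotient_space (completed_tensor X Y) (balanced_relations A X Y)"

definition bimodule_tensor_map ::
  "('k::nonarch_field, 'a, 'm) nspace_scheme \<Rightarrow> ('k, 'a, 'x, 'n) bimodule_scheme \<Rightarrow>
   ('k, 'a, 'z, 'p) bimodule_scheme \<Rightarrow> ('y \<Rightarrow> 'z) \<Rightarrow>
   ('k, 'x, 'y) ctensor set \<Rightarrow> ('k, 'x, 'z) ctensor set" where
  "bimodule_tensor_map A X Z f =
     coset_map (completed_tensor X Z) (balanced_relations A X Z) (completed_tensor_map X Z f)"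


section \<open>Flatness and amenability\<close>

text \<open>\<open>d n\<close> is the differential from \<open>Y n\<close> to \<open>Y (n - 1)\<close>.\<close>

definition bimodule_complex ::
  "('k::nonarch_field, 'a, 'm) nspace_scheme \<Rightarrow> (int \<Rightarrow> ('k, 'a, 'u) bimodule) \<Rightarrow>
   (int \<Rightarrow> 'u \<Rightarrow> 'u) \<Rightarrow> bool" where
  "bimodule_complex A Y d \<longleftrightarrow>
     (\<forall>n. banach_bimodule A (Y n) \<and> bimodule_hom A (Y n) (Y (n - 1)) (d n)) \<and>
     (\<forall>n. \<forall>y\<in>carrier (Y n). d (n - 1) (d n y) = \<zero>\<^bsub>Y (n - 2)\<^esub>)"

definition admissible_complex ::
  "(int \<Rightarrow> ('k::nonarch_field, 'a, 'u) bimodule) \<Rightarrow> (int \<Rightarrow> 'u \<Rightarrow> 'u) \<Rightarrow> bool" where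
  "admissible_complex Y d \<longleftrightarrow>
     (\<exists>s. (\<forall>n. bounded_linear_map (Y n) (Y (n + 1)) (s n)) \<and>
       (\<forall>n. \<forall>y\<in>carrier (Y n). d (n + 1) (s n y) \<oplus>\<^bsub>Y n\<^esub> s (n - 1) (d n y) = y))"

definition exact_complex :: "(int \<Rightarrow> ('k, 'x) nspace) \<Rightarrow> (int \<Rightarrow> 'x \<Rightarrow> 'x) \<Rightarrow> bool" where
  "exact_complex T d \<longleftrightarrow>
     (\<forall>n. a_kernel (T n) (T (n - 1)) (d n) = d (n + 1) ` carrier (T (n + 1)))"

text \<open>
  HOL cannot quantify over types inside a definition, so flatness and amenability carry as a
  parameter the type \<open>'u\<close> (a universe) to which the elements of the modules tested belong.  The
  modules are carrier sets in \<open>'u\<close>, hence every module of cardinality at most that of \<open>'u\<close>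
  occurs up to isomorphism.  A statement about the universe \<open>'t + 'u\<close> with \<open>'u\<close> free concerns all
  universes in which \<open>'t\<close> embeds.
\<close>

definition flat_bimodule ::
  "'u itself \<Rightarrow> ('k::nonarch_field, 'a, 'm) nspace_scheme \<Rightarrow> ('k, 'a, 'x, 'n) bimodule_scheme \<Rightarrow>
   bool" where
  "flat_bimodule _ A X \<longleftrightarrow>
     (\<forall>(Y :: int \<Rightarrow> ('k, 'a, 'u) bimodule) d. bimodule_complex A Y d \<and> admissible_complex Y d \<longrightarrow>
        exact_complex (\<lambda>n. bimodule_tensor A X (Y n)) (\<lambda>n. bimodule_tensor_map A X (Y (n - 1)) (d n)))"

text \<open>A unit is adjoined even if \<open>A\<close> already has one.\<close>

definition unitization ::
  "('k::nonarch_field, 'a, 'm) nspace_scheme \<Rightarrow> ('k, 'a \<times> 'k) nspace" where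
  "unitization A =
     \<lparr>carrier = carrier A \<times> UNIV,
      mult = (\<lambda>(a, s) (b, t). (a \<otimes>\<^bsub>A\<^esub> b \<oplus>\<^bsub>A\<^esub> s \<odot>\<^bsub>A\<^esub> b \<oplus>\<^bsub>A\<^esub> t \<odot>\<^bsub>A\<^esub> a, s * t)),
      one = (\<zero>\<^bsub>A\<^esub>, 1), zero = (\<zero>\<^bsub>A\<^esub>, 0),
      add = (\<lambda>(a, s) (b, t). (a \<oplus>\<^bsub>A\<^esub> b, s + t)),
      smult = (\<lambda>c (a, s). (c \<odot>\<^bsub>A\<^esub> a, c * s)),
      nrm = (\<lambda>(a, s). max (nrm A a) (vabs s))\<rparr>"

definition unitization_bimodule ::
  "('k::nonarch_field, 'a, 'm) nspace_scheme \<Rightarrow> ('k, 'a, 'a \<times> 'k) bimodule" where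
  "unitization_bimodule A =
     nspace.extend (unitization A)
       \<lparr>lact = (\<lambda>a x. (a, 0) \<otimes>\<^bsub>unitization A\<^esub> x), ract = (\<lambda>x a. x \<otimes>\<^bsub>unitization A\<^esub> (a, 0))\<rparr>"

definition amenable :: "'u itself \<Rightarrow> ('k::nonarch_field, 'a, 'm) nspace_scheme \<Rightarrow> bool" where
  "amenable U A \<longleftrightarrow> flat_bimodule U A (unitization_bimodule A)"


section \<open>The algebra \<open>l(G)\<close> and Johnson amenability\<close>

text \<open>Functions on \<open>G\<close> are extended by 0 outside the carrier of \<open>G\<close>.\<close>

definition l_algebra :: "('g, 'm) monoid_scheme \<Rightarrow> ('k::nonarch_field, 'g \<Rightarrow> 'k) nspace" where
  "l_algebra G =
     \<lparr>carrier = {f. (\<forall>g. g \<notin> carrier G \<longrightarrow> f g = 0) \<and> (\<forall>e>0. finite {g \<in> carrier G. e \<le> vabs (f g)})},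
      mult = (\<lambda>f h x. if x \<in> carrier G then \<Sum>\<^sub>\<infinity>g\<in>carrier G. f g * h (inv\<^bsub>G\<^esub> g \<otimes>\<^bsub>G\<^esub> x) else 0),
      one = (\<lambda>g. if g = \<one>\<^bsub>G\<^esub> then 1 else 0), zero = (\<lambda>_. 0),
      add = (\<lambda>f h g. f g + h g), smult = (\<lambda>c f g. c * f g),
      nrm = (\<lambda>f. SUP g\<in>carrier G. vabs (f g))\<rparr>"

definition l_infinity :: "('g, 'm) monoid_scheme \<Rightarrow> ('k::nonarch_field, 'g \<Rightarrow> 'k) nspace" where
  "l_infinity G =
     \<lparr>carrier = {f. (\<forall>g. g \<notin> carrier G \<longrightarrow> f g = 0) \<and> (\<exists>C. \<forall>g\<in>carrier G. vabs (f g) \<le> C)},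
      mult = undefined, one = undefined, zero = (\<lambda>_. 0),
      add = (\<lambda>f h g. f g + h g), smult = (\<lambda>c f g. c * f g),
      nrm = (\<lambda>f. SUP g\<in>carrier G. vabs (f g))\<rparr>"

definition translate :: "('g, 'm) monoid_scheme \<Rightarrow> 'g \<Rightarrow> ('g \<Rightarrow> 'k::zero) \<Rightarrow> 'g \<Rightarrow> 'k" where
  "translate G g f = (\<lambda>h. if h \<in> carrier G then f (inv\<^bsub>G\<^esub> g \<otimes>\<^bsub>G\<^esub> h) else 0)"

definition johnson_amenable :: "'k::nonarch_field itself \<Rightarrow> ('g, 'm) monoid_scheme \<Rightarrow> bool" where
  "johnson_amenable _ G \<longleftrightarrow>
     (\<exists>m. bounded_linear_map (l_infinity G) (scalars :: ('k, 'k) nspace) m \<and>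
       (\<forall>g\<in>carrier G. \<forall>f\<in>carrier (l_infinity G). m (translate G g f) = m f) \<and>
       m (\<lambda>g. if g \<in> carrier G then 1 else 0) \<noteq> 0)"

end

theory Submission
  imports Defs
begin

text \<open>
  As a bimodule over \<open>A = l(G)\<close> the unitization is generated by its unit, so tensoring a bimodule
  \<open>Y\<close> with it amounts to dividing \<open>Y\<close> by the closed span of the commutators \<open>a y - y a\<close>; hence
  amenability says that these completed coinvariants are exact on admissible complexes.

  If \<open>G\<close> carries an invariant \<open>m\<close> with \<open>m 1 \<noteq> 0\<close>, then every finitely generated subgroup is finite:
  on an infinite one the constant 1 is a sum of differences \<open>f - s f\<close>, obtained from an
  integer-valued flow to infinity on a spanning tree of the Cayley graph.  Moreover
  \<open>m 1 = |H| m f\<close> for the indicator \<open>f\<close> of a transversal of a finite subgroup \<open>H\<close>, so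
  \<open>1/|H|\<close> is bounded.  Conjugation averages over finite subgroups are therefore uniformly bounded, do
  not change classes of coinvariants, and tend to 0 on commutators.  Inserting them into a
  linear contracting homotopy solves the exactness problem up to an arbitrarily small error,
  and iterating removes the error.

  Conversely, exactness on \<open>0 \<rightarrow> K1 \<rightarrow> l\<^sup>\<infinity>(G) \<rightarrow> l\<^sup>\<infinity>(G)/K1 \<rightarrow> 0\<close> at \<open>K1\<close> keeps the constant 1 out of the
  closed span of the \<open>g f - f\<close>, and Ingleton's form of the Hahn-Banach theorem provides the
  invariant functional.
\<close>

section \<open>Scalars\<close>

text \<open>Every integer has absolute value at most 1 in \<open>'k\<close>, so an integer-valued
  flow is a bounded function however large its values are; even an infinite cyclic group is thereby
  excluded. The same inequality lets integers be small or zero in \<open>'k\<close>, which is why a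
  bound on the inverse orders of finite subgroups has to be extracted from the functional as well.

  The obstacle to exactness is that the contracting homotopy is merely linear: it need not carry
  commutators to commutators. It is therefore applied only after averaging, to an element whose
  differential is already small in norm. Smallness is the most one can ask, because a finite
  subgroup catches finitely many group elements while the differential lies in a closed span. The
  primitives found in this way are bounded by a fixed multiple of the norm of the cocycle, whatever
  the error, and this makes the iteration converge.

  Bimodules are not assumed unital, hence the correction terms around \<open>delta \<one>\<close>.
  In the converse direction the right action goes through the augmentation, so that commutators with
  point masses become the differences \<open>g f - f\<close>.\<close>

lemma scalars_simps [simp]:
  "carrier scalars = UNIV" "mult scalars = (*)" "one scalars = 1" "zero scalars = 0"
  "add scalars = (+)" "smult scalars = (*)" "nrm scalars = vabs"
  by (simp_all add: scalars_def)

lemma cring_scalars: "cring (scalars :: ('k::nonarch_field, 'k) nspace)"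
proof (rule cringI)
  show "abelian_group (scalars :: ('k::nonarch_field, 'k) nspace)"
  proof (rule abelian_groupI)
    fix x assume "x \<in> carrier scalars"
    show "\<exists>y\<in>carrier scalars. y \<oplus>\<^bsub>scalars\<^esub> x = \<zero>\<^bsub>scalars\<^esub>"
      by (rule bexI[of _ "- x"]) auto
  qed (auto simp: algebra_simps)
  show "Group.comm_monoid (scalars :: ('k::nonarch_field, 'k) nspace)"
    by unfold_locales (auto simp: algebra_simps)
qed (auto simp: algebra_simps)

lemma a_inv_scalars [simp]: "a_inv scalars x = - (x :: 'k::nonarch_field)"
proof -
  interpret cring "scalars :: ('k, 'k) nspace" by (rule cring_scalars)
  show ?thesis using minus_equality[of "- x" x] by simp
qed

lemma a_minus_scalars [simp]: "x \<ominus>\<^bsub>scalars\<^esub> y = x - (y :: 'k::nonarch_field)"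
  by (simp add: a_minus_def)

lemma vabs_nonneg [simp]: "0 \<le> vabs (x :: 'k::nonarch_field)"
  using dist_vabs[of x 0] zero_le_dist[of x 0] by simp

lemma vabs_eq_0 [simp]: "vabs (x :: 'k::nonarch_field) = 0 \<longleftrightarrow> x = 0"
  using dist_vabs[of x 0] dist_eq_0_iff[of x 0] by simp

lemma vabs_zero [simp]: "vabs (0 :: 'k::nonarch_field) = 0"
  by simp

lemma vabs_one [simp]: "vabs (1 :: 'k::nonarch_field) = 1"
  using vabs_mult[of "1::'k" 1] vabs_eq_0[of "1::'k"] by (simp del: vabs_eq_0)

lemma vabs_minus [simp]: "vabs (- x) = vabs (x :: 'k::nonarch_field)"
proof -
  have "vabs (- x) = dist 0 x" by (simp add: dist_vabs)
  also have "\<dots> = vabs x" by (subst dist_commute) (simp add: dist_vabs)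
  finally show ?thesis .
qed

lemma vabs_minus_commute: "vabs (x - y) = vabs (y - (x :: 'k::nonarch_field))"
  using vabs_minus[of "x - y"] by simp

lemma vabs_diff: "vabs (x - y) \<le> max (vabs x) (vabs (y :: 'k::nonarch_field))"
  using vabs_add[of x "- y"] by simp

lemma vabs_pos: "x \<noteq> 0 \<Longrightarrow> 0 < vabs (x :: 'k::nonarch_field)"
  using vabs_nonneg[of x] vabs_eq_0[of x] by linarith

lemma vabs_inverse: "vabs (inverse x) = inverse (vabs (x :: 'k::nonarch_field))"
proof (cases "x = 0")
  case False
  then have "vabs x * vabs (inverse x) = 1" by (simp flip: vabs_mult)
  then show ?thesis by (metis inverse_unique)
qed simp

text \<open>The ultrametric inequality keeps every sum 1 + ... + 1 in the unit ball. This is the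
  only reason why the flows constructed later are bounded functions.\<close>

lemma vabs_of_nat_le: "vabs (of_nat n :: 'k::nonarch_field) \<le> 1"
  by (induction n) (auto intro: order_trans[OF vabs_add])

lemma vabs_of_int_le: "vabs (of_int i :: 'k::nonarch_field) \<le> 1"
  by (cases i) (auto intro: vabs_of_nat_le simp del: of_nat_Suc)

lemma vabs_sum_le:
  fixes f :: "'i \<Rightarrow> 'k::nonarch_field"
  assumes "\<And>i. i \<in> I \<Longrightarrow> vabs (f i) \<le> C" "0 \<le> C"
  shows "vabs (sum f I) \<le> C"
  using assms
proof (induction I rule: infinite_finite_induct)
  case (insert i I)
  then have "vabs (f i) \<le> C" "vabs (sum f I) \<le> C" by auto
  then show ?case using vabs_add[of "f i" "sum f I"] insert.hyps by auto
qed auto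


section \<open>Seminormed spaces and bounded linear maps\<close>

text \<open>Closure points, tested with \<open>e\<close> instead of sequences: closedness then
  transfers along a bounded map by rescaling \<open>e\<close>.\<close>

definition adherent :: "('k, 'x, 'm) nspace_scheme \<Rightarrow> 'x set \<Rightarrow> 'x \<Rightarrow> bool" where
  "adherent E N x \<longleftrightarrow> (\<forall>e>0. \<exists>y\<in>N. nrm E (x \<ominus>\<^bsub>E\<^esub> y) < e)"

lemma adherentD: "\<lbrakk>adherent E N x; e > 0\<rbrakk> \<Longrightarrow> \<exists>y\<in>N. nrm E (x \<ominus>\<^bsub>E\<^esub> y) < e"
  by (simp add: adherent_def)

lemma adherentI: "(\<And>e. e > 0 \<Longrightarrow> \<exists>y\<in>N. nrm E (x \<ominus>\<^bsub>E\<^esub> y) < e) \<Longrightarrow> adherent E N x"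
  by (simp add: adherent_def)

lemma adherent_mono: "\<lbrakk>adherent E M x; M \<subseteq> N\<rbrakk> \<Longrightarrow> adherent E N x"
  unfolding adherent_def by (meson subset_iff)

text \<open>Definiteness and completeness are dropped because spaces of formal combinations,
  quotients by subspaces that are not closed, and spaces of Cauchy sequences carry seminorms
  only.\<close>

locale nonarch_seminormed_space = module "scalars :: ('k::nonarch_field, 'k) nspace" E
  for E :: "('k::nonarch_field, 'x, 'm) nspace_scheme" (structure) +
  assumes nrm_nonneg: "x \<in> carrier E \<Longrightarrow> 0 \<le> nrm E x"
    and nrm_smult: "x \<in> carrier E \<Longrightarrow> nrm E (c \<odot> x) = vabs c * nrm E x"
    and nrm_add: "\<lbrakk>x \<in> carrier E; y \<in> carrier E\<rbrakk> \<Longrightarrow> nrm E (x \<oplus> y) \<le> max (nrm E x) (nrm E y)"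

sublocale nonarch_banach_space \<subseteq> nonarch_seminormed_space
  by unfold_locales (auto intro: nrm_nonneg nrm_smult nrm_add)

text \<open>Additive inverses are obtained by multiplying with -1, so a concrete space never has to
  describe \<open>a_inv\<close>.\<close>

lemma nonarch_seminormed_spaceI:
  fixes E :: "('k::nonarch_field, 'x, 'm) nspace_scheme" (structure)
  assumes "\<And>x y. \<lbrakk>x \<in> carrier E; y \<in> carrier E\<rbrakk> \<Longrightarrow> x \<oplus> y \<in> carrier E"
    and "\<zero> \<in> carrier E"
    and "\<And>x y z. \<lbrakk>x \<in> carrier E; y \<in> carrier E; z \<in> carrier E\<rbrakk> \<Longrightarrow> x \<oplus> y \<oplus> z = x \<oplus> (y \<oplus> z)"
    and "\<And>x y. \<lbrakk>x \<in> carrier E; y \<in> carrier E\<rbrakk> \<Longrightarrow> x \<oplus> y = y \<oplus> x"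
    and "\<And>x. x \<in> carrier E \<Longrightarrow> \<zero> \<oplus> x = x"
    and "\<And>x. x \<in> carrier E \<Longrightarrow> (- 1) \<odot> x \<oplus> x = \<zero>"
    and "\<And>c x. x \<in> carrier E \<Longrightarrow> c \<odot> x \<in> carrier E"
    and "\<And>c d x. x \<in> carrier E \<Longrightarrow> (c + d) \<odot> x = c \<odot> x \<oplus> d \<odot> x"
    and "\<And>c x y. \<lbrakk>x \<in> carrier E; y \<in> carrier E\<rbrakk> \<Longrightarrow> c \<odot> (x \<oplus> y) = c \<odot> x \<oplus> c \<odot> y"
    and "\<And>c d x. x \<in> carrier E \<Longrightarrow> (c * d) \<odot> x = c \<odot> (d \<odot> x)"
    and "\<And>x. x \<in> carrier E \<Longrightarrow> 1 \<odot> x = x"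
    and "\<And>x. x \<in> carrier E \<Longrightarrow> 0 \<le> nrm E x"
    and "\<And>c x. x \<in> carrier E \<Longrightarrow> nrm E (c \<odot> x) = vabs c * nrm E x"
    and "\<And>x y. \<lbrakk>x \<in> carrier E; y \<in> carrier E\<rbrakk> \<Longrightarrow> nrm E (x \<oplus> y) \<le> max (nrm E x) (nrm E y)"
  shows "nonarch_seminormed_space E"
proof -
  have "abelian_group E"
  proof (rule abelian_groupI)
    fix x assume "x \<in> carrier E"
    then show "\<exists>y\<in>carrier E. y \<oplus> x = \<zero>"
      using assms(6,7) by (intro bexI[of _ "(- 1) \<odot> x"]) auto
  qed (use assms(1-5) in auto)
  then have "module scalars E"
    by (intro moduleI cring_scalars) (simp_all add: assms(7-11))
  then show ?thesis
    by (intro nonarch_seminormed_space.intro nonarch_seminormed_space_axioms.intro) (simp_all add: assms(12-14))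
qed

section \<open>Vector arithmetic and consequences of the ultrametric inequality\<close>

context nonarch_seminormed_space
begin

lemma smult_mem [simp, intro]: "x \<in> carrier E \<Longrightarrow> c \<odot> x \<in> carrier E"
  by (rule smult_closed) auto

lemma smult_add_left: "x \<in> carrier E \<Longrightarrow> (c + d) \<odot> x = c \<odot> x \<oplus> d \<odot> x"
  using smult_l_distr[of c d x] by simp

lemma smult_add_right: "\<lbrakk>x \<in> carrier E; y \<in> carrier E\<rbrakk> \<Longrightarrow> c \<odot> (x \<oplus> y) = c \<odot> x \<oplus> c \<odot> y"
  using smult_r_distr[of c x y] by simp

lemma smult_mult: "x \<in> carrier E \<Longrightarrow> (c * d) \<odot> x = c \<odot> (d \<odot> x)"
  using smult_assoc1[of c d x] by simp

lemma smult_1 [simp]: "x \<in> carrier E \<Longrightarrow> 1 \<odot> x = x"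
  using smult_one[of x] by simp

lemma smult_0 [simp]: "x \<in> carrier E \<Longrightarrow> 0 \<odot> x = \<zero>"
  using smult_l_null[of x] by simp

lemma smult_zero [simp]: "c \<odot> \<zero> = \<zero>"
  by (rule smult_r_null) simp

lemma a_inv_eq_smult: "x \<in> carrier E \<Longrightarrow> \<ominus> x = (- 1) \<odot> x"
  using smult_l_minus[of 1 x] by simp

lemma a_minus_eq_smult: "x \<ominus> y = x \<oplus> (- 1) \<odot> y" if "y \<in> carrier E"
  using that by (simp add: a_minus_def a_inv_eq_smult)

lemma smult_minus_left: "x \<in> carrier E \<Longrightarrow> (- c) \<odot> x = \<ominus> (c \<odot> x)"
  using smult_l_minus[of c x] by simp

lemma smult_minus_right: "x \<in> carrier E \<Longrightarrow> c \<odot> (\<ominus> x) = \<ominus> (c \<odot> x)"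
  using smult_r_minus[of c x] by simp

lemma smult_diff_right: "\<lbrakk>x \<in> carrier E; y \<in> carrier E\<rbrakk> \<Longrightarrow> c \<odot> (x \<ominus> y) = c \<odot> x \<ominus> c \<odot> y"
  by (simp add: a_minus_def smult_add_right smult_minus_right)

lemma minus_mem [simp, intro]: "\<lbrakk>x \<in> carrier E; y \<in> carrier E\<rbrakk> \<Longrightarrow> x \<ominus> y \<in> carrier E"
  by simp

lemma minus_eq_zero_iff: "\<lbrakk>x \<in> carrier E; y \<in> carrier E\<rbrakk> \<Longrightarrow> x \<ominus> y = \<zero> \<longleftrightarrow> x = y"
  by (metis M.add.inv_closed M.minus_equality M.minus_minus M.r_neg a_minus_def)

lemma diff_add_diff: "\<lbrakk>x \<in> carrier E; y \<in> carrier E; z \<in> carrier E\<rbrakk> \<Longrightarrow> (x \<ominus> y) \<oplus> (y \<ominus> z) = x \<ominus> z"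
  by (simp add: a_minus_def M.a_assoc M.r_neg1)

lemma add_diff_add:
  "\<lbrakk>x \<in> carrier E; y \<in> carrier E; z \<in> carrier E; w \<in> carrier E\<rbrakk>
    \<Longrightarrow> (x \<oplus> y) \<ominus> (z \<oplus> w) = (x \<ominus> z) \<oplus> (y \<ominus> w)"
  by (simp add: a_minus_def M.minus_add M.a_ac)

lemma add_diff_cancel [simp]: "\<lbrakk>x \<in> carrier E; y \<in> carrier E\<rbrakk> \<Longrightarrow> y \<oplus> (x \<ominus> y) = x"
  by (simp add: a_minus_def M.a_comm[of x] M.r_neg2)

lemma diff_add_cancel [simp]: "\<lbrakk>x \<in> carrier E; y \<in> carrier E\<rbrakk> \<Longrightarrow> (x \<ominus> y) \<oplus> y = x"
  by (simp add: a_minus_def M.a_assoc M.l_neg)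

lemma diff_diff_cancel: "\<lbrakk>x \<in> carrier E; y \<in> carrier E\<rbrakk> \<Longrightarrow> x \<ominus> (x \<ominus> y) = y"
  by (simp add: a_minus_def M.minus_add M.r_neg2)

lemma diff_self [simp]: "x \<in> carrier E \<Longrightarrow> x \<ominus> x = \<zero>"
  by (simp add: minus_eq_zero_iff)

lemma diff_zero [simp]: "x \<in> carrier E \<Longrightarrow> x \<ominus> \<zero> = x"
  by (simp add: a_minus_def)

lemma add_diff_cancel_left:
  "\<lbrakk>x \<in> carrier E; y \<in> carrier E\<rbrakk> \<Longrightarrow> (x \<oplus> y) \<ominus> x = y"
  by (simp add: a_minus_def M.a_comm[of x] M.a_assoc M.r_neg)

lemma diff_diff_eq:
  "\<lbrakk>x \<in> carrier E; y \<in> carrier E; z \<in> carrier E\<rbrakk> \<Longrightarrow> (x \<ominus> y) \<ominus> z = x \<ominus> (y \<oplus> z)"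
  by (simp add: a_minus_def M.minus_add M.a_ac)

lemma diff_diff_cancel_left:
  "\<lbrakk>x \<in> carrier E; y \<in> carrier E; z \<in> carrier E\<rbrakk> \<Longrightarrow> (x \<ominus> y) \<ominus> (x \<ominus> z) = z \<ominus> y"
  using diff_add_diff[of z x y] by (simp add: a_minus_def M.minus_add M.a_ac)

lemma nrm_zero [simp]: "nrm E \<zero> = 0"
  using nrm_smult[of \<zero> 0] by simp

lemma nrm_a_inv [simp]: "x \<in> carrier E \<Longrightarrow> nrm E (\<ominus> x) = nrm E x"
  by (simp add: a_inv_eq_smult nrm_smult)

lemma nrm_diff: "\<lbrakk>x \<in> carrier E; y \<in> carrier E\<rbrakk> \<Longrightarrow> nrm E (x \<ominus> y) \<le> max (nrm E x) (nrm E y)"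
  unfolding a_minus_def using nrm_add[of x "\<ominus> y"] by simp

lemma nrm_diff_commute: "\<lbrakk>x \<in> carrier E; y \<in> carrier E\<rbrakk> \<Longrightarrow> nrm E (x \<ominus> y) = nrm E (y \<ominus> x)"
proof -
  assume xy: "x \<in> carrier E" "y \<in> carrier E"
  then have "\<ominus> (x \<ominus> y) = y \<ominus> x" by (simp add: a_minus_def M.minus_add M.a_comm)
  then show ?thesis using nrm_a_inv[of "x \<ominus> y"] xy by simp
qed

lemma nrm_diff_triangle:
  assumes "x \<in> carrier E" "y \<in> carrier E" "z \<in> carrier E"
  shows "nrm E (x \<ominus> z) \<le> max (nrm E (x \<ominus> y)) (nrm E (y \<ominus> z))"
  using nrm_add[of "x \<ominus> y" "y \<ominus> z"] assms by (simp add: diff_add_diff)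

lemma nrm_le_max_diff:
  assumes "x \<in> carrier E" "y \<in> carrier E"
  shows "nrm E x \<le> max (nrm E (x \<ominus> y)) (nrm E y)"
  using nrm_add[of "x \<ominus> y" y] assms by simp

lemma abs_nrm_diff_le:
  assumes "x \<in> carrier E" "y \<in> carrier E"
  shows "\<bar>nrm E x - nrm E y\<bar> \<le> nrm E (x \<ominus> y)"
  using nrm_le_max_diff[OF assms] nrm_le_max_diff[OF assms(2,1)] nrm_diff_commute[OF assms]
    nrm_nonneg[OF assms(1)] nrm_nonneg[OF assms(2)]
  nrm_nonneg[of "x \<ominus> y"] assms by (auto simp: max_def abs_if split: if_splits)

section \<open>Submodules, closed subspaces and spans\<close>

lemma submodule_mem:
  assumes "submodule N scalars E"
  shows "N \<subseteq> carrier E" "\<zero> \<in> N" "\<And>x y. \<lbrakk>x \<in> N; y \<in> N\<rbrakk> \<Longrightarrow> x \<oplus> y \<in> N"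
    "\<And>x. x \<in> N \<Longrightarrow> \<ominus> x \<in> N" "\<And>x y. \<lbrakk>x \<in> N; y \<in> N\<rbrakk> \<Longrightarrow> x \<ominus> y \<in> N"
    "\<And>c x. x \<in> N \<Longrightarrow> c \<odot> x \<in> N"
proof -
  note s = submoduleE[OF assms]
  show "N \<subseteq> carrier E" "\<And>x y. \<lbrakk>x \<in> N; y \<in> N\<rbrakk> \<Longrightarrow> x \<oplus> y \<in> N"
    "\<And>x. x \<in> N \<Longrightarrow> \<ominus> x \<in> N" "\<And>c x. x \<in> N \<Longrightarrow> c \<odot> x \<in> N"
    using s by auto
  obtain x where "x \<in> N" using s by auto
  then have "0 \<odot> x \<in> N" "0 \<odot> x = \<zero>" using s by auto
  then show "\<zero> \<in> N" by simp
  show "\<And>x y. \<lbrakk>x \<in> N; y \<in> N\<rbrakk> \<Longrightarrow> x \<ominus> y \<in> N"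
    unfolding a_minus_def using s by auto
qed

lemma submoduleI':
  assumes "N \<subseteq> carrier E" "\<zero> \<in> N" "\<And>x y. \<lbrakk>x \<in> N; y \<in> N\<rbrakk> \<Longrightarrow> x \<oplus> y \<in> N"
    "\<And>c x. x \<in> N \<Longrightarrow> c \<odot> x \<in> N"
  shows "submodule N scalars E"
  by (rule submoduleI) (use assms in \<open>auto simp: a_inv_eq_smult subset_iff\<close>)

lemma nrm_tendsto_iff:
  assumes "range \<sigma> \<subseteq> carrier E" "x \<in> carrier E"
  shows "nrm_tendsto E \<sigma> x \<longleftrightarrow> (\<forall>e>0. \<exists>N. \<forall>n\<ge>N. nrm E (\<sigma> n \<ominus> x) < e)"
proof -
  have "0 \<le> nrm E (\<sigma> n \<ominus> x)" for n
    using assms by (intro nrm_nonneg) auto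
  then show ?thesis
    by (simp add: nrm_tendsto_def LIMSEQ_iff)
qed

text \<open>An adherent point is the limit of approximants chosen at distance below 1/(n+1), so
  sequential closedness and closedness in terms of \<open>adherent\<close> agree.\<close>

lemma closed_subspace_iff:
  "closed_subspace E N \<longleftrightarrow> submodule N scalars E \<and>
     (\<forall>x\<in>carrier E. adherent E N x \<longrightarrow> x \<in> N)"
proof (cases "submodule N scalars E")
  case True
  note N = submodule_mem[OF True]
  have "x \<in> N" if *: "\<And>\<sigma> x. range \<sigma> \<subseteq> N \<and> x \<in> carrier E \<and> nrm_tendsto E \<sigma> x \<longrightarrow> x \<in> N"
    and x: "x \<in> carrier E" and ex: "adherent E N x" for x
  proof -
    have "\<forall>n. \<exists>y\<in>N. nrm E (x \<ominus> y) < inverse (Suc n)" using adherentD[OF ex] by simp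
    then obtain \<sigma> where \<sigma>: "\<And>n. \<sigma> n \<in> N" "\<And>n. nrm E (x \<ominus> \<sigma> n) < inverse (Suc n)" by metis
    have c: "\<sigma> n \<in> carrier E" for n using \<sigma> N by auto
    have "(\<lambda>n. nrm E (\<sigma> n \<ominus> x)) \<longlonglongrightarrow> 0"
    proof (rule tendsto_sandwich[OF _ _ tendsto_const LIMSEQ_inverse_real_of_nat])
      show "\<forall>\<^sub>F n in sequentially. 0 \<le> nrm E (\<sigma> n \<ominus> x)"
        using c x nrm_nonneg by (auto intro!: always_eventually)
      show "\<forall>\<^sub>F n in sequentially. nrm E (\<sigma> n \<ominus> x) \<le> inverse (Suc n)"
        using \<sigma>(2) nrm_diff_commute[OF x c] by (intro always_eventually allI less_imp_le) metis
    qed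
    then show ?thesis using *[of \<sigma> x] \<sigma> x by (auto simp: nrm_tendsto_def)
  qed
  moreover have "x \<in> N" if *: "\<forall>x\<in>carrier E. adherent E N x \<longrightarrow> x \<in> N"
    and \<sigma>: "range \<sigma> \<subseteq> N" and x: "x \<in> carrier E" and t: "nrm_tendsto E \<sigma> x" for \<sigma> x
  proof -
    have c: "\<sigma> n \<in> carrier E" for n using \<sigma> N by auto
    have "\<exists>y\<in>N. nrm E (x \<ominus> y) < e" if "e > 0" for e
    proof -
      have "range \<sigma> \<subseteq> carrier E" using c by auto
      then have "\<exists>N. \<forall>n\<ge>N. nrm E (\<sigma> n \<ominus> x) < e"
        using nrm_tendsto_iff[of \<sigma> x] t that x by simp
      then obtain n where "nrm E (\<sigma> n \<ominus> x) < e" by auto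
      then show ?thesis using \<sigma> nrm_diff_commute[OF c[of n] x] by (intro bexI[of _ "\<sigma> n"]) auto
    qed
    then show ?thesis using * x adherentI[of N E x] by blast
  qed
  ultimately have "(\<forall>\<sigma> x. range \<sigma> \<subseteq> N \<and> x \<in> carrier E \<and> nrm_tendsto E \<sigma> x \<longrightarrow> x \<in> N) \<longleftrightarrow>
     (\<forall>x\<in>carrier E. adherent E N x \<longrightarrow> x \<in> N)" by metis
  then show ?thesis using True by (simp only: closed_subspace_def simp_thms)
qed (simp add: closed_subspace_def)

lemma closed_subspaceD:
  assumes "closed_subspace E N"
  shows "submodule N scalars E"
    and "\<And>x. \<lbrakk>x \<in> carrier E; adherent E N x\<rbrakk> \<Longrightarrow> x \<in> N"
  using assms unfolding closed_subspace_iff by blast+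

lemma closed_subspace_carrier: "closed_subspace E (carrier E)"
  by (auto simp: closed_subspace_iff intro: submoduleI')

lemma closed_linear_span:
  assumes "S \<subseteq> carrier E"
  shows "closed_subspace E (closed_linear_span E S)" "S \<subseteq> closed_linear_span E S"
proof -
  let ?M = "{N. closed_subspace E N \<and> S \<subseteq> N}"
  have ne: "carrier E \<in> ?M" using closed_subspace_carrier assms by auto
  have sub: "submodule (\<Inter>?M) scalars E"
  proof (rule submoduleI')
    show "\<Inter>?M \<subseteq> carrier E" using ne by blast
    show "\<zero> \<in> \<Inter>?M" using submodule_mem(2) by (auto simp: closed_subspace_iff)
    show "x \<oplus> y \<in> \<Inter>?M" if "x \<in> \<Inter>?M" "y \<in> \<Inter>?M" for x y
      using that submodule_mem(3) by (auto simp: closed_subspace_iff)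
    show "c \<odot> x \<in> \<Inter>?M" if "x \<in> \<Inter>?M" for x c
      using that submodule_mem(6) by (auto simp: closed_subspace_iff)
  qed
  have "x \<in> \<Inter>?M" if "x \<in> carrier E" "adherent E (\<Inter>?M) x" for x
  proof
    fix N assume N: "N \<in> ?M"
    then show "x \<in> N" by (intro closed_subspaceD(2)[of N] that adherent_mono[OF that(2)]) blast+
  qed
  then show "closed_subspace E (closed_linear_span E S)"
    using sub by (auto simp: closed_subspace_iff closed_linear_span_def)
  show "S \<subseteq> closed_linear_span E S" by (auto simp: closed_linear_span_def)
qed

lemma closed_linear_span_minimal:
  assumes "closed_subspace E N" "S \<subseteq> N"
  shows "closed_linear_span E S \<subseteq> N"
  using assms by (auto simp: closed_linear_span_def)

lemma linear_span:
  assumes "S \<subseteq> carrier E"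
  shows "submodule (linear_span E S) scalars E" "S \<subseteq> linear_span E S"
proof -
  let ?M = "{N. submodule N scalars E \<and> S \<subseteq> N}"
  have ne: "carrier E \<in> ?M" using carrier_is_submodule assms by auto
  have "submodule (\<Inter>?M) scalars E"
  proof (rule submoduleI')
    show "\<Inter>?M \<subseteq> carrier E" using ne by blast
    show "\<zero> \<in> \<Inter>?M" using submodule_mem(2) by auto
    show "x \<oplus> y \<in> \<Inter>?M" if "x \<in> \<Inter>?M" "y \<in> \<Inter>?M" for x y
      using that submodule_mem(3) by auto
    show "c \<odot> x \<in> \<Inter>?M" if "x \<in> \<Inter>?M" for x c
      using that submodule_mem(6) by auto
  qed
  then show "submodule (linear_span E S) scalars E" by (simp add: linear_span_def)
  show "S \<subseteq> linear_span E S" by (auto simp: linear_span_def)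
qed

end

text \<open>Definiteness of the norm enters here. Together with
  \<open>closed_subspace_vimage\<close>, applied to the difference of two bounded maps, it shows
  that the maps agree as soon as they agree on topological generators.\<close>

lemma (in nonarch_banach_space) closed_subspace_zero: "closed_subspace E {\<zero>\<^bsub>E\<^esub>}"
  unfolding closed_subspace_iff
proof (intro conjI ballI impI)
  fix z assume z: "z \<in> carrier E" "adherent E {\<zero>\<^bsub>E\<^esub>} z"
  have "nrm E z \<le> 0 + e" if "e > 0" for e
    using adherentD[OF z(2) that] z by (auto intro: less_imp_le)
  then have "nrm E z \<le> 0" by (rule field_le_epsilon)
  then show "z \<in> {\<zero>\<^bsub>E\<^esub>}" using z nrm_nonneg[of z] nrm_eq_0_iff[of z] by auto
qed (auto intro!: submoduleI')

lemma linear_span_minimal: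
  assumes "submodule N (scalars :: ('k::nonarch_field, 'k) nspace) E" "S \<subseteq> N"
  shows "linear_span E S \<subseteq> N"
  using assms by (auto simp: linear_span_def)

section \<open>Bounded linear maps\<close>

lemma bounded_linear_mapD:
  assumes "bounded_linear_map E F f"
  shows "\<And>x. x \<in> carrier E \<Longrightarrow> f x \<in> carrier F"
    and "\<And>x y. \<lbrakk>x \<in> carrier E; y \<in> carrier E\<rbrakk> \<Longrightarrow> f (x \<oplus>\<^bsub>E\<^esub> y) = f x \<oplus>\<^bsub>F\<^esub> f y"
    and "\<And>c x. x \<in> carrier E \<Longrightarrow> f (c \<odot>\<^bsub>E\<^esub> x) = c \<odot>\<^bsub>F\<^esub> f x"
  using assms by (auto simp: bounded_linear_map_def)

lemma bounded_linear_mapI: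
  assumes "\<And>x. x \<in> carrier E \<Longrightarrow> f x \<in> carrier F"
    and "\<And>x y. \<lbrakk>x \<in> carrier E; y \<in> carrier E\<rbrakk> \<Longrightarrow> f (x \<oplus>\<^bsub>E\<^esub> y) = f x \<oplus>\<^bsub>F\<^esub> f y"
    and "\<And>c x. x \<in> carrier E \<Longrightarrow> f (c \<odot>\<^bsub>E\<^esub> x) = c \<odot>\<^bsub>F\<^esub> f x"
    and "\<And>x. x \<in> carrier E \<Longrightarrow> nrm F (f x) \<le> C * nrm E x"
  shows "bounded_linear_map E F f"
  unfolding bounded_linear_map_def using assms by blast

locale bounded_map = E: nonarch_seminormed_space E + F: nonarch_seminormed_space F
  for E :: "('k::nonarch_field, 'x, 'm) nspace_scheme"
    and F :: "('k, 'y, 'n) nspace_scheme" +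
  fixes f
  assumes blm: "bounded_linear_map E F f"
begin

lemmas mem [simp, intro] = bounded_linear_mapD(1)[OF blm]
lemmas add = bounded_linear_mapD(2)[OF blm]
lemmas smult = bounded_linear_mapD(3)[OF blm]

lemma zero [simp]: "f \<zero>\<^bsub>E\<^esub> = \<zero>\<^bsub>F\<^esub>"
  using smult[of "\<zero>\<^bsub>E\<^esub>" 0] by simp

lemma diff: "\<lbrakk>x \<in> carrier E; y \<in> carrier E\<rbrakk> \<Longrightarrow> f (x \<ominus>\<^bsub>E\<^esub> y) = f x \<ominus>\<^bsub>F\<^esub> f y"
  by (simp add: E.a_minus_eq_smult F.a_minus_eq_smult add smult)

text \<open>The constant in the definition may be negative or zero; a positive one can be divided
  by.\<close>

lemma bound: obtains C where "C > 0" "\<And>x. x \<in> carrier E \<Longrightarrow> nrm F (f x) \<le> C * nrm E x"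
proof -
  obtain C where C: "\<And>x. x \<in> carrier E \<Longrightarrow> nrm F (f x) \<le> C * nrm E x"
    using blm unfolding bounded_linear_map_def by blast
  show ?thesis
  proof (rule that[of "max C 1"])
    show "nrm F (f x) \<le> max C 1 * nrm E x" if "x \<in> carrier E" for x
      using C[OF that] E.nrm_nonneg[OF that] by (meson max.cobounded1 mult_right_mono order_trans)
  qed simp
qed

lemma submodule_vimage:
  assumes "submodule M scalars F"
  shows "submodule {x \<in> carrier E. f x \<in> M} scalars E"
  using F.submodule_mem[OF assms] by (intro E.submoduleI') (auto simp: add smult)

text \<open>The main device for extending a membership or an identity from generators to a whole
  space: the elements that satisfy it form a closed subspace of this kind, which then contains the
  closed span of the generators.\<close>

lemma closed_subspace_vimage:
  assumes "closed_subspace F M"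
  shows "closed_subspace E {x \<in> carrier E. f x \<in> M}"
proof -
  note M = F.closed_subspaceD[OF assms]
  note M' = F.submodule_mem[OF M(1)]
  obtain C where C: "C > 0" "\<And>x. x \<in> carrier E \<Longrightarrow> nrm F (f x) \<le> C * nrm E x" by (rule bound) auto
  have "f x \<in> M" if x: "x \<in> carrier E" and ex: "adherent E {x \<in> carrier E. f x \<in> M} x" for x
  proof (rule M(2))
    show "f x \<in> carrier F" using x by simp
    show "adherent F M (f x)"
    proof (rule adherentI)
      fix e :: real assume "e > 0"
      then have "e / C > 0" using C by simp
      then obtain y where y: "y \<in> carrier E" "f y \<in> M" "nrm E (x \<ominus>\<^bsub>E\<^esub> y) < e / C" using adherentD[OF ex] by blast
      have "nrm F (f x \<ominus>\<^bsub>F\<^esub> f y) = nrm F (f (x \<ominus>\<^bsub>E\<^esub> y))" using x y by (simp add: diff)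
      also have "\<dots> \<le> C * nrm E (x \<ominus>\<^bsub>E\<^esub> y)" using x y by (intro C) auto
      also have "\<dots> < e" using y C by (simp add: field_simps)
      finally show "\<exists>y\<in>M. nrm F (f x \<ominus>\<^bsub>F\<^esub> y) < e" using y by blast
    qed
  qed
  then show ?thesis
    using submodule_vimage[OF M(1)] by (auto simp: E.closed_subspace_iff)
qed

end

lemma bounded_mapI:
  assumes "nonarch_seminormed_space E" "nonarch_seminormed_space F" "bounded_linear_map E F f"
  shows "bounded_map E F f"
  using assms by (simp add: bounded_map_def bounded_map_axioms_def)

lemma bounded_linear_map_id: "bounded_linear_map E E (\<lambda>x. x)"
  by (rule bounded_linear_mapI[where C = 1]) auto

lemma bounded_linear_map_comp:
  assumes "nonarch_seminormed_space E" "nonarch_seminormed_space F" "nonarch_seminormed_space H"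
    and f: "bounded_linear_map E F f" and g: "bounded_linear_map F H g"
  shows "bounded_linear_map E H (\<lambda>x. g (f x))"
proof -
  interpret f: bounded_map E F f by (rule bounded_mapI) fact+
  interpret g: bounded_map F H g by (rule bounded_mapI) fact+
  obtain C where C: "C > 0" "\<And>x. x \<in> carrier E \<Longrightarrow> nrm F (f x) \<le> C * nrm E x" by (rule f.bound) auto
  obtain D where D: "D > 0" "\<And>x. x \<in> carrier F \<Longrightarrow> nrm H (g x) \<le> D * nrm F x" by (rule g.bound) auto
  show ?thesis
  proof (rule bounded_linear_mapI[where C = "D * C"])
    fix x assume x: "x \<in> carrier E"
    have "nrm H (g (f x)) \<le> D * nrm F (f x)" using x D by simp
    also have "\<dots> \<le> D * (C * nrm E x)" using C x D by (intro mult_left_mono) auto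
    finally show "nrm H (g (f x)) \<le> D * C * nrm E x" by simp
  qed (auto simp: f.add f.smult g.add g.smult)
qed

lemma bounded_linear_map_add:
  assumes "nonarch_seminormed_space E" "nonarch_seminormed_space F"
    and f: "bounded_linear_map E F f" and g: "bounded_linear_map E F g"
  shows "bounded_linear_map E F (\<lambda>x. f x \<oplus>\<^bsub>F\<^esub> g x)"
proof -
  interpret f: bounded_map E F f by (rule bounded_mapI) fact+
  interpret g: bounded_map E F g by (rule bounded_mapI) fact+
  obtain C where C: "C > 0" "\<And>x. x \<in> carrier E \<Longrightarrow> nrm F (f x) \<le> C * nrm E x" by (rule f.bound) auto
  obtain D where D: "D > 0" "\<And>x. x \<in> carrier E \<Longrightarrow> nrm F (g x) \<le> D * nrm E x" by (rule g.bound) auto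
  show ?thesis
  proof (rule bounded_linear_mapI[where C = "max C D"])
    fix x assume x: "x \<in> carrier E"
    have "nrm F (f x \<oplus>\<^bsub>F\<^esub> g x) \<le> max (nrm F (f x)) (nrm F (g x))" using x by (intro f.F.nrm_add) auto
    also have "\<dots> \<le> max (C * nrm E x) (D * nrm E x)" using C D x by (meson max.mono)
    also have "\<dots> = max C D * nrm E x" using f.E.nrm_nonneg[OF x] by (simp add: max_mult_distrib_right)
    finally show "nrm F (f x \<oplus>\<^bsub>F\<^esub> g x) \<le> max C D * nrm E x" .
    show "f (x \<oplus>\<^bsub>E\<^esub> y) \<oplus>\<^bsub>F\<^esub> g (x \<oplus>\<^bsub>E\<^esub> y) = (f x \<oplus>\<^bsub>F\<^esub> g x) \<oplus>\<^bsub>F\<^esub> (f y \<oplus>\<^bsub>F\<^esub> g y)" if "y \<in> carrier E" for y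
      using x that by (simp add: f.add g.add f.F.a_ac)
  qed (auto simp: f.smult g.smult f.F.smult_add_right)
qed

lemma bounded_linear_map_smult:
  assumes "nonarch_seminormed_space E" "nonarch_seminormed_space F"
    and f: "bounded_linear_map E F f"
  shows "bounded_linear_map E F (\<lambda>x. c \<odot>\<^bsub>F\<^esub> f x)"
proof -
  interpret f: bounded_map E F f by (rule bounded_mapI) fact+
  obtain C where C: "C > 0" "\<And>x. x \<in> carrier E \<Longrightarrow> nrm F (f x) \<le> C * nrm E x" by (rule f.bound) auto
  show ?thesis
  proof (rule bounded_linear_mapI[where C = "vabs c * C"])
    fix x assume x: "x \<in> carrier E"
    show "nrm F (c \<odot>\<^bsub>F\<^esub> f x) \<le> vabs c * C * nrm E x"
      using x C(2)[OF x] by (simp add: f.F.nrm_smult mult_left_mono mult.assoc)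
    show "c \<odot>\<^bsub>F\<^esub> f (d \<odot>\<^bsub>E\<^esub> x) = d \<odot>\<^bsub>F\<^esub> (c \<odot>\<^bsub>F\<^esub> f x)" for d
      using x by (simp add: f.smult mult.commute flip: f.F.smult_mult)
  qed (auto simp: f.add f.F.smult_add_right)
qed

lemma bounded_linear_map_diff:
  assumes "nonarch_seminormed_space E" "nonarch_seminormed_space F"
    and f: "bounded_linear_map E F f" and g: "bounded_linear_map E F g"
  shows "bounded_linear_map E F (\<lambda>x. f x \<ominus>\<^bsub>F\<^esub> g x)"
proof -
  interpret g: bounded_map E F g by (rule bounded_mapI) fact+
  have "bounded_linear_map E F (\<lambda>x. f x \<oplus>\<^bsub>F\<^esub> (- 1) \<odot>\<^bsub>F\<^esub> g x)"
    by (intro bounded_linear_map_add bounded_linear_map_smult assms)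
  then show ?thesis
    unfolding bounded_linear_map_def by (simp add: g.F.a_minus_eq_smult Pi_iff)
qed

lemma bounded_linear_map_cong:
  assumes "bounded_linear_map E F f" "\<And>x. x \<in> carrier E \<Longrightarrow> f x = g x"
    and "nonarch_seminormed_space E"
  shows "bounded_linear_map E F g"
proof -
  interpret nonarch_seminormed_space E by fact
  show ?thesis using assms(1,2) unfolding bounded_linear_map_def by (simp add: Pi_iff)
qed

section \<open>Quotients\<close>

locale seminormed_quotient = nonarch_seminormed_space E
  for E :: "('k::nonarch_field, 'x, 'm) nspace_scheme" (structure) +
  fixes N
  assumes N: "submodule N scalars E"
begin

lemmas N_subset = submodule_mem(1)[OF N]
  and N_zero = submodule_mem(2)[OF N]
  and N_add = submodule_mem(3)[OF N]
  and N_minus = submodule_mem(5)[OF N]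
  and N_smult = submodule_mem(6)[OF N]

abbreviation Q where "Q \<equiv> quotient_space E N"

lemma coset_subset: "x \<in> carrier E \<Longrightarrow> N +> x \<subseteq> carrier E"
  using N_subset by (auto simp: a_r_coset_def')

lemma mem_coset_iff: "x \<in> carrier E \<Longrightarrow> y \<in> N +> x \<longleftrightarrow> y \<in> carrier E \<and> y \<ominus> x \<in> N"
proof
  assume x: "x \<in> carrier E"
  { assume "y \<in> N +> x"
    then obtain h where h: "h \<in> N" "y = h \<oplus> x" by (auto simp: a_r_coset_def')
    then have "h \<in> carrier E" using N_subset by auto
    then show "y \<in> carrier E \<and> y \<ominus> x \<in> N"
      using h x by (simp add: a_minus_def M.a_assoc M.r_neg) }
  assume y: "y \<in> carrier E \<and> y \<ominus> x \<in> N"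
  then have "y = (y \<ominus> x) \<oplus> x" using x by simp
  then show "y \<in> N +> x" using y by (auto simp: a_r_coset_def')
qed

lemma coset_self: "x \<in> carrier E \<Longrightarrow> x \<in> N +> x"
  by (simp add: mem_coset_iff N_zero)

lemma coset_eq_iff:
  assumes "x \<in> carrier E" "y \<in> carrier E"
  shows "N +> x = N +> y \<longleftrightarrow> x \<ominus> y \<in> N"
proof
  assume "N +> x = N +> y"
  then show "x \<ominus> y \<in> N" using coset_self[OF assms(1)] mem_coset_iff[OF assms(2)] by auto
next
  assume xy: "x \<ominus> y \<in> N"
  have "y \<ominus> x = \<zero> \<ominus> (x \<ominus> y)"
    using assms by (simp add: a_minus_def M.minus_add M.a_comm)
  then have yx: "y \<ominus> x \<in> N" using xy N_zero N_minus by auto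
  have "z \<ominus> x \<in> N \<longleftrightarrow> z \<ominus> y \<in> N" if "z \<in> carrier E" for z
    using diff_add_diff[OF that assms] diff_add_diff[OF that assms(2,1)] N_add xy yx by metis
  then show "N +> x = N +> y" using assms by (auto simp: mem_coset_iff)
qed

lemma coset_zero: "N +> \<zero> = N"
  using N_subset by (auto simp: mem_coset_iff)

lemma Q_carrier: "carrier Q = (\<lambda>x. N +> x) ` carrier E"
  by (auto simp: quotient_space_def A_RCOSETS_def')

lemma Q_zero: "zero Q = N"
  by (simp add: quotient_space_def)

lemma Q_add: "\<lbrakk>x \<in> carrier E; y \<in> carrier E\<rbrakk> \<Longrightarrow> (N +> x) \<oplus>\<^bsub>Q\<^esub> (N +> y) = N +> (x \<oplus> y)"
proof -
  have "abelian_subgroup N E"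
  proof (rule abelian_subgroupI3)
    show "additive_subgroup N E"
      using N by (auto intro: additive_subgroup.intro dest: submodule.axioms)
  qed (rule M.abelian_group_axioms)
  then show "\<lbrakk>x \<in> carrier E; y \<in> carrier E\<rbrakk> \<Longrightarrow> (N +> x) \<oplus>\<^bsub>Q\<^esub> (N +> y) = N +> (x \<oplus> y)"
    by (simp add: quotient_space_def abelian_subgroup.a_rcos_sum)
qed

lemma Q_smult: "x \<in> carrier E \<Longrightarrow> c \<odot>\<^bsub>Q\<^esub> (N +> x) = N +> (c \<odot> x)"
proof -
  assume x: "x \<in> carrier E"
  have "N +> (c \<odot> y) = N +> (c \<odot> x)" if "y \<in> N +> x" for y
    using that x N_smult[of "y \<ominus> x" c]
    by (auto simp: coset_eq_iff mem_coset_iff smult_diff_right)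
  then have "(\<Union>y\<in>N +> x. N +> (c \<odot> y)) = N +> (c \<odot> x)"
    by (intro UN_constant_eq[OF coset_self[OF x]] ballI)
  then show ?thesis by (simp add: quotient_space_def)
qed

lemma Q_nrm: "nrm Q S = (INF x\<in>S. nrm E x)"
  by (simp add: quotient_space_def)

lemma Q_nrm_le: "\<lbrakk>x \<in> carrier E; y \<in> N +> x\<rbrakk> \<Longrightarrow> nrm Q (N +> x) \<le> nrm E y"
  unfolding Q_nrm using coset_subset nrm_nonneg
  by (intro cINF_lower bdd_belowI[of _ 0]) auto

lemma Q_nrm_coset_le: "x \<in> carrier E \<Longrightarrow> nrm Q (N +> x) \<le> nrm E x"
  by (rule Q_nrm_le) (auto intro: coset_self)

lemma Q_nrm_approx:
  assumes "x \<in> carrier E" "nrm Q (N +> x) < r"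
  shows "\<exists>y\<in>N +> x. nrm E y < r"
  using cInf_lessD[of "nrm E ` (N +> x)" r] assms(2) coset_self[OF assms(1)] by (auto simp: Q_nrm)

lemma Q_nrm_ge:
  assumes "x \<in> carrier E" "\<And>y. y \<in> N +> x \<Longrightarrow> r \<le> nrm E y"
  shows "r \<le> nrm Q (N +> x)"
  using Q_nrm_approx[OF assms(1)] assms(2) by (meson leD leI)

lemma Q_nrm_smult_le:
  assumes "x \<in> carrier E"
  shows "nrm Q (N +> (c \<odot> x)) \<le> vabs c * nrm Q (N +> x)"
proof (cases "c = 0")
  case True
  then show ?thesis using assms Q_nrm_coset_le[of \<zero>] by simp
next
  case False
  have "nrm Q (N +> (c \<odot> x)) / vabs c \<le> nrm Q (N +> x)"
  proof (rule Q_nrm_ge[OF assms])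
    fix y assume y: "y \<in> N +> x"
    then have "c \<odot> y \<in> N +> (c \<odot> x)"
      using assms N_smult[of "y \<ominus> x" c] by (auto simp: mem_coset_iff smult_diff_right)
    then have "nrm Q (N +> (c \<odot> x)) \<le> vabs c * nrm E y"
      using Q_nrm_le[of "c \<odot> x" "c \<odot> y"] assms y coset_subset[OF assms] by (auto simp: nrm_smult)
    then show "nrm Q (N +> (c \<odot> x)) / vabs c \<le> nrm E y"
      using vabs_pos[OF False] by (simp add: field_simps)
  qed
  then show ?thesis using vabs_pos[OF False] by (simp add: field_simps)
qed

text \<open>If it failed, both cosets would have representatives of norm below that of the sum of
  the cosets, and adding these representatives would contradict the ultrametric inequality in
  \<open>E\<close>.\<close>

lemma Q_nrm_add_le:
  assumes "x \<in> carrier E" "y \<in> carrier E"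
  shows "nrm Q (N +> (x \<oplus> y)) \<le> max (nrm Q (N +> x)) (nrm Q (N +> y))"
proof (rule ccontr)
  assume "\<not> ?thesis"
  then have "nrm Q (N +> x) < nrm Q (N +> (x \<oplus> y))" "nrm Q (N +> y) < nrm Q (N +> (x \<oplus> y))" by auto
  then obtain x' y' where *: "x' \<in> N +> x" "nrm E x' < nrm Q (N +> (x \<oplus> y))"
    "y' \<in> N +> y" "nrm E y' < nrm Q (N +> (x \<oplus> y))"
    using Q_nrm_approx assms by metis
  have c: "x' \<in> carrier E" "y' \<in> carrier E" using * coset_subset assms by auto
  have "x' \<oplus> y' \<in> N +> (x \<oplus> y)"
    using * c assms by (auto simp: mem_coset_iff add_diff_add intro: N_add)
  then have "nrm Q (N +> (x \<oplus> y)) \<le> nrm E (x' \<oplus> y')" using assms by (intro Q_nrm_le) auto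
  then show False using nrm_add[OF c] * by auto
qed

lemma seminormed_Q: "nonarch_seminormed_space Q"
proof (rule nonarch_seminormed_spaceI)
  fix S T :: "'x set" and c :: 'k
  assume "S \<in> carrier Q" "T \<in> carrier Q"
  then obtain x y where S: "S = N +> x" "T = N +> y" "x \<in> carrier E" "y \<in> carrier E"
    by (auto simp: Q_carrier)
  show "S \<oplus>\<^bsub>Q\<^esub> T \<in> carrier Q"
    using S by (auto simp: Q_add Q_carrier)
  show "S \<oplus>\<^bsub>Q\<^esub> T = T \<oplus>\<^bsub>Q\<^esub> S"
    using S by (simp add: Q_add M.a_ac)
  show "S \<oplus>\<^bsub>Q\<^esub> T \<oplus>\<^bsub>Q\<^esub> U = S \<oplus>\<^bsub>Q\<^esub> (T \<oplus>\<^bsub>Q\<^esub> U)" if "U \<in> carrier Q" for U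
    using S that by (auto simp: Q_carrier Q_add M.a_ac)
  show "c \<odot>\<^bsub>Q\<^esub> (S \<oplus>\<^bsub>Q\<^esub> T) = c \<odot>\<^bsub>Q\<^esub> S \<oplus>\<^bsub>Q\<^esub> c \<odot>\<^bsub>Q\<^esub> T"
    using S by (simp add: Q_add Q_smult smult_add_right)
  show "nrm Q (S \<oplus>\<^bsub>Q\<^esub> T) \<le> max (nrm Q S) (nrm Q T)"
    using S by (simp add: Q_add Q_nrm_add_le)
next
  fix S :: "'x set" and c d :: 'k
  assume "S \<in> carrier Q"
  then obtain x where S: "S = N +> x" "x \<in> carrier E"
    by (auto simp: Q_carrier)
  show "c \<odot>\<^bsub>Q\<^esub> S \<in> carrier Q"
    using S by (auto simp: Q_smult Q_carrier)
  have 0: "\<zero>\<^bsub>Q\<^esub> = N +> \<zero>" by (simp add: Q_zero coset_zero)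
  show "\<zero>\<^bsub>Q\<^esub> \<oplus>\<^bsub>Q\<^esub> S = S" "1 \<odot>\<^bsub>Q\<^esub> S = S"
    using S by (simp_all add: Q_add Q_smult 0)
  have "(-1) \<odot> x \<oplus> x = \<zero>" using S smult_add_left[of x "-1" 1] by simp
  then show "(- 1) \<odot>\<^bsub>Q\<^esub> S \<oplus>\<^bsub>Q\<^esub> S = \<zero>\<^bsub>Q\<^esub>"
    using S by (simp add: Q_add Q_smult 0)
  show "(c + d) \<odot>\<^bsub>Q\<^esub> S = c \<odot>\<^bsub>Q\<^esub> S \<oplus>\<^bsub>Q\<^esub> d \<odot>\<^bsub>Q\<^esub> S" "(c * d) \<odot>\<^bsub>Q\<^esub> S = c \<odot>\<^bsub>Q\<^esub> (d \<odot>\<^bsub>Q\<^esub> S)"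
    using S by (simp_all add: Q_add Q_smult smult_add_left smult_mult)
  show "0 \<le> nrm Q S"
    unfolding S using S coset_subset[OF S(2)] nrm_nonneg by (intro Q_nrm_ge) auto
  show "nrm Q (c \<odot>\<^bsub>Q\<^esub> S) = vabs c * nrm Q S"
  proof (rule antisym)
    show "nrm Q (c \<odot>\<^bsub>Q\<^esub> S) \<le> vabs c * nrm Q S" using S by (simp add: Q_smult Q_nrm_smult_le)
    show "vabs c * nrm Q S \<le> nrm Q (c \<odot>\<^bsub>Q\<^esub> S)"
    proof (cases "c = 0")
      case True
      have "0 \<le> nrm Q (N +> \<zero>)" using coset_subset nrm_nonneg by (intro Q_nrm_ge) auto
      then show ?thesis using True S by (simp add: Q_smult)
    next
      case False
      \<comment> \<open>\<open>Q_nrm_smult_le\<close> gives only one inequality; the other one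
        follows from it by scaling back with \<open>inverse c\<close>.\<close>
      have "inverse c \<odot> (c \<odot> x) = x" using S False by (simp flip: smult_mult)
      then have "nrm Q S \<le> inverse (vabs c) * nrm Q (N +> (c \<odot> x))"
        using Q_nrm_smult_le[of "c \<odot> x" "inverse c"] S by (simp add: vabs_inverse)
      then show ?thesis using S vabs_pos[OF False] by (simp add: Q_smult field_simps)
    qed
  qed
next
  show "\<zero>\<^bsub>Q\<^esub> \<in> carrier Q"
    unfolding Q_carrier Q_zero by (rule image_eqI[where x = "\<zero>"]) (simp_all add: coset_zero)
qed

lemma coset_bounded: "bounded_linear_map E Q (\<lambda>x. N +> x)"
  by (rule bounded_linear_mapI[where C = 1]) (auto simp: Q_carrier Q_add Q_smult Q_nrm_coset_le)

text \<open>\<open>f\<close> is constant on cosets and the seminorm of a coset is an infimum over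
  its members, so a bound for \<open>f\<close> passes to the quotient with the same
  constant.\<close>

lemma bounded_linear_map_lift:
  assumes F: "nonarch_seminormed_space F" and f: "bounded_linear_map E F f"
    and kill: "\<And>x. x \<in> N \<Longrightarrow> f x = \<zero>\<^bsub>F\<^esub>"
  obtains g where "bounded_linear_map Q F g" "\<And>x. x \<in> carrier E \<Longrightarrow> g (N +> x) = f x"
proof -
  interpret f: bounded_map E F f
    by (intro bounded_mapI F f) unfold_locales
  define g where "g S = f (SOME x. x \<in> S)" for S
  have const: "f y = f x" if "x \<in> carrier E" "y \<in> N +> x" for x y
  proof -
    have y: "y \<in> carrier E" "y \<ominus> x \<in> N" using that by (auto simp: mem_coset_iff)
    then have "f y \<ominus>\<^bsub>F\<^esub> f x = \<zero>\<^bsub>F\<^esub>" using kill that by (simp flip: f.diff)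
    then show ?thesis using that y by (simp add: f.F.minus_eq_zero_iff)
  qed
  have g: "g (N +> x) = f x" if "x \<in> carrier E" for x
    unfolding g_def by (rule const[OF that]) (rule someI[of "\<lambda>y. y \<in> N +> x", OF coset_self[OF that]])
  obtain C where C: "C > 0" "\<And>x. x \<in> carrier E \<Longrightarrow> nrm F (f x) \<le> C * nrm E x" by (rule f.bound) auto
  have "bounded_linear_map Q F g"
  proof (rule bounded_linear_mapI[where C = C])
    fix S assume "S \<in> carrier Q"
    then obtain x where S: "S = N +> x" "x \<in> carrier E"
      by (auto simp: Q_carrier)
    show "g S \<in> carrier F" using S by (simp add: g)
    show "g (c \<odot>\<^bsub>Q\<^esub> S) = c \<odot>\<^bsub>F\<^esub> g S" for c using S by (simp add: g Q_smult f.smult)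
    show "g (S \<oplus>\<^bsub>Q\<^esub> T) = g S \<oplus>\<^bsub>F\<^esub> g T" if "T \<in> carrier Q" for T
      using S that by (auto simp: g Q_add Q_carrier f.add)
    have "nrm F (f x) / C \<le> nrm Q (N +> x)"
    proof (rule Q_nrm_ge[OF S(2)])
      fix y assume y: "y \<in> N +> x"
      then have "nrm F (f y) \<le> C * nrm E y" using C coset_subset[OF S(2)] by auto
      then show "nrm F (f x) / C \<le> nrm E y" using const[OF S(2) y] C(1) by (simp add: field_simps)
    qed
    then show "nrm F (g S) \<le> C * nrm Q S" using S C(1) by (simp add: g field_simps)
  qed
  then show ?thesis using g that by blast
qed

end

lemma seminormed_quotientI:
  assumes "nonarch_seminormed_space E" "submodule N (scalars :: ('k::nonarch_field, 'k) nspace) E"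
  shows "seminormed_quotient E N"
  using assms by (simp add: seminormed_quotient_def seminormed_quotient_axioms_def)

text \<open>The union in \<open>coset_map\<close> is a union of equal cosets, because
  representatives that differ by an element of \<open>N\<close> have images that differ by an
  element of \<open>M\<close>.\<close>

lemma coset_map:
  assumes E: "seminormed_quotient E N" and F: "seminormed_quotient F M"
    and f: "bounded_linear_map E F f" and NM: "f ` N \<subseteq> M"
  shows "x \<in> carrier E \<Longrightarrow> coset_map F M f (N +>\<^bsub>E\<^esub> x) = M +>\<^bsub>F\<^esub> f x"
    and "bounded_linear_map (quotient_space E N) (quotient_space F M) (coset_map F M f)"
proof -
  interpret E: seminormed_quotient E N by fact
  interpret F: seminormed_quotient F M by fact
  interpret f: bounded_map E F f by (intro bounded_mapI f) unfold_locales
  show cm: "coset_map F M f (N +>\<^bsub>E\<^esub> x) = M +>\<^bsub>F\<^esub> f x" if x: "x \<in> carrier E" for x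
  proof -
    have "M +>\<^bsub>F\<^esub> f y = M +>\<^bsub>F\<^esub> f x" if y: "y \<in> N +>\<^bsub>E\<^esub> x" for y
    proof -
      have "y \<in> carrier E" "y \<ominus>\<^bsub>E\<^esub> x \<in> N" using x y by (auto simp: E.mem_coset_iff)
      then show ?thesis using x NM by (auto simp: F.coset_eq_iff f.diff[symmetric])
    qed
    then show ?thesis unfolding coset_map_def by (intro UN_constant_eq[OF E.coset_self[OF x]] ballI)
  qed
  have "bounded_linear_map E F.Q (\<lambda>x. M +>\<^bsub>F\<^esub> f x)"
    by (intro bounded_linear_map_comp[OF _ _ _ f F.coset_bounded] F.seminormed_Q) unfold_locales
  moreover have "M +>\<^bsub>F\<^esub> f x = \<zero>\<^bsub>F.Q\<^esub>" if "x \<in> N" for x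
    using F.coset_eq_iff[of "f x" "\<zero>\<^bsub>F\<^esub>"] NM that F.N_subset F.coset_zero F.Q_zero by auto
  ultimately obtain g where g: "bounded_linear_map E.Q F.Q g"
    "\<And>x. x \<in> carrier E \<Longrightarrow> g (N +>\<^bsub>E\<^esub> x) = M +>\<^bsub>F\<^esub> f x"
    using E.bounded_linear_map_lift[OF F.seminormed_Q] by blast
  show "bounded_linear_map E.Q F.Q (coset_map F M f)"
    by (rule bounded_linear_map_cong[OF g(1) _ E.seminormed_Q]) (auto simp: E.Q_carrier g(2) cm)
qed


section \<open>Completions\<close>

context nonarch_seminormed_space
begin

abbreviation C where "C \<equiv> cauchy_space E"

lemma cauchyI:
  assumes "\<And>e. e > 0 \<Longrightarrow> \<exists>N. \<forall>m\<ge>N. \<forall>n\<ge>N. nrm E (\<sigma> m \<ominus> \<sigma> n) < e" "\<And>n. \<sigma> n \<in> carrier E"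
  shows "\<sigma> \<in> carrier C"
  using assms unfolding cauchy_space_def nrm_Cauchy_def by auto

lemma cauchyD:
  assumes "\<sigma> \<in> carrier C"
  shows "\<sigma> n \<in> carrier E" "e > 0 \<Longrightarrow> \<exists>N. \<forall>m\<ge>N. \<forall>n\<ge>N. nrm E (\<sigma> m \<ominus> \<sigma> n) < e"
  using assms unfolding cauchy_space_def nrm_Cauchy_def by auto

lemma C_simps: "\<zero>\<^bsub>C\<^esub> = (\<lambda>_. \<zero>)" "\<sigma> \<oplus>\<^bsub>C\<^esub> \<tau> = (\<lambda>n. \<sigma> n \<oplus> \<tau> n)" "c \<odot>\<^bsub>C\<^esub> \<sigma> = (\<lambda>n. c \<odot> \<sigma> n)"
  by (simp_all add: cauchy_space_def)

lemma const_cauchy: "x \<in> carrier E \<Longrightarrow> (\<lambda>_. x) \<in> carrier C"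
  by (rule cauchyI) auto

text \<open>The reverse triangle inequality makes the norms a Cauchy sequence of reals, so
  \<open>lim\<close> in \<open>cauchy_space\<close> denotes an actual limit and not an arbitrary
  value.\<close>

lemma tendsto_C_nrm:
  assumes "\<sigma> \<in> carrier C"
  shows "(\<lambda>n. nrm E (\<sigma> n)) \<longlonglongrightarrow> nrm C \<sigma>"
proof -
  have "Cauchy (\<lambda>n. nrm E (\<sigma> n))"
  proof (rule metric_CauchyI)
    fix e :: real assume "e > 0"
    then obtain N where N: "\<forall>m\<ge>N. \<forall>n\<ge>N. nrm E (\<sigma> m \<ominus> \<sigma> n) < e" using cauchyD(2)[OF assms] by blast
    have "dist (nrm E (\<sigma> m)) (nrm E (\<sigma> n)) < e" if "m \<ge> N" "n \<ge> N" for m n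
      using N[rule_format, OF that] abs_nrm_diff_le[OF cauchyD(1)[OF assms] cauchyD(1)[OF assms], of m n]
      by (simp add: dist_real_def)
    then show "\<exists>M. \<forall>m\<ge>M. \<forall>n\<ge>M. dist (nrm E (\<sigma> m)) (nrm E (\<sigma> n)) < e" by blast
  qed
  then have "convergent (\<lambda>n. nrm E (\<sigma> n))" by (rule Cauchy_convergent)
  then show ?thesis by (simp add: cauchy_space_def convergent_LIMSEQ_iff)
qed

lemma C_add_mem:
  assumes "\<sigma> \<in> carrier C" "\<tau> \<in> carrier C"
  shows "(\<lambda>n. \<sigma> n \<oplus> \<tau> n) \<in> carrier C"
proof (rule cauchyI)
  note s = cauchyD(1)[OF assms(1)] cauchyD(1)[OF assms(2)]
  fix e :: real assume e: "e > 0"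
  obtain N1 where N1: "\<forall>m\<ge>N1. \<forall>n\<ge>N1. nrm E (\<sigma> m \<ominus> \<sigma> n) < e" using cauchyD(2)[OF assms(1) e] ..
  obtain N2 where N2: "\<forall>m\<ge>N2. \<forall>n\<ge>N2. nrm E (\<tau> m \<ominus> \<tau> n) < e" using cauchyD(2)[OF assms(2) e] ..
  have "nrm E ((\<sigma> m \<oplus> \<tau> m) \<ominus> (\<sigma> n \<oplus> \<tau> n)) < e" if "m \<ge> max N1 N2" "n \<ge> max N1 N2" for m n
  proof -
    have "nrm E ((\<sigma> m \<oplus> \<tau> m) \<ominus> (\<sigma> n \<oplus> \<tau> n)) = nrm E ((\<sigma> m \<ominus> \<sigma> n) \<oplus> (\<tau> m \<ominus> \<tau> n))"
      using s by (simp add: add_diff_add)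
    also have "\<dots> \<le> max (nrm E (\<sigma> m \<ominus> \<sigma> n)) (nrm E (\<tau> m \<ominus> \<tau> n))" using s by (intro nrm_add) auto
    also have "\<dots> < e" using N1 N2 that by auto
    finally show ?thesis .
  qed
  then show "\<exists>N. \<forall>m\<ge>N. \<forall>n\<ge>N. nrm E ((\<sigma> m \<oplus> \<tau> m) \<ominus> (\<sigma> n \<oplus> \<tau> n)) < e" by blast
qed (use cauchyD(1)[OF assms(1)] cauchyD(1)[OF assms(2)] in auto)

end

lemma (in bounded_map) cauchy_comp:
  assumes "\<sigma> \<in> carrier (cauchy_space E)"
  shows "f \<circ> \<sigma> \<in> carrier (cauchy_space F)"
proof (rule F.cauchyI)
  note s = E.cauchyD(1)[OF assms]
  obtain C where C: "C > 0" "\<And>x. x \<in> carrier E \<Longrightarrow> nrm F (f x) \<le> C * nrm E x" by (rule bound) auto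
  fix e :: real assume e: "e > 0"
  then have "e / C > 0" using C by simp
  from E.cauchyD(2)[OF assms this] obtain N where N: "\<forall>m\<ge>N. \<forall>n\<ge>N. nrm E (\<sigma> m \<ominus>\<^bsub>E\<^esub> \<sigma> n) < e / C" ..
  have "nrm F ((f \<circ> \<sigma>) m \<ominus>\<^bsub>F\<^esub> (f \<circ> \<sigma>) n) < e" if "m \<ge> N" "n \<ge> N" for m n
  proof -
    have "nrm F ((f \<circ> \<sigma>) m \<ominus>\<^bsub>F\<^esub> (f \<circ> \<sigma>) n) = nrm F (f (\<sigma> m \<ominus>\<^bsub>E\<^esub> \<sigma> n))" using s by (simp add: diff)
    also have "\<dots> \<le> C * nrm E (\<sigma> m \<ominus>\<^bsub>E\<^esub> \<sigma> n)" using s by (intro C) auto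
    also have "\<dots> < e" using N[rule_format, OF that] C(1) by (simp add: field_simps)
    finally show ?thesis .
  qed
  then show "\<exists>N. \<forall>m\<ge>N. \<forall>n\<ge>N. nrm F ((f \<circ> \<sigma>) m \<ominus>\<^bsub>F\<^esub> (f \<circ> \<sigma>) n) < e" by blast
qed (use E.cauchyD(1)[OF assms] in auto)

context nonarch_seminormed_space
begin

lemma C_smult_mem: "\<sigma> \<in> carrier C \<Longrightarrow> (\<lambda>n. c \<odot> \<sigma> n) \<in> carrier C"
proof -
  interpret c: bounded_map E E "\<lambda>x. c \<odot> x"
    by (intro bounded_mapI bounded_linear_map_smult bounded_linear_map_id) unfold_locales
  show "\<sigma> \<in> carrier C \<Longrightarrow> (\<lambda>n. c \<odot> \<sigma> n) \<in> carrier C"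
    using c.cauchy_comp by (simp add: comp_def)
qed

lemma seminormed_C: "nonarch_seminormed_space C"
proof (rule nonarch_seminormed_spaceI)
  fix \<sigma> \<tau> assume st: "\<sigma> \<in> carrier C" "\<tau> \<in> carrier C"
  note s = cauchyD(1)[OF st(1)] cauchyD(1)[OF st(2)]
  show "\<sigma> \<oplus>\<^bsub>C\<^esub> \<tau> \<in> carrier C" using st by (simp add: C_simps C_add_mem)
  show "\<sigma> \<oplus>\<^bsub>C\<^esub> \<tau> = \<tau> \<oplus>\<^bsub>C\<^esub> \<sigma>" using s by (simp add: C_simps M.a_ac)
  show "\<sigma> \<oplus>\<^bsub>C\<^esub> \<tau> \<oplus>\<^bsub>C\<^esub> \<rho> = \<sigma> \<oplus>\<^bsub>C\<^esub> (\<tau> \<oplus>\<^bsub>C\<^esub> \<rho>)" if "\<rho> \<in> carrier C" for \<rho>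
    using s cauchyD(1)[OF that] by (simp add: C_simps M.a_ac)
  show "c \<odot>\<^bsub>C\<^esub> (\<sigma> \<oplus>\<^bsub>C\<^esub> \<tau>) = c \<odot>\<^bsub>C\<^esub> \<sigma> \<oplus>\<^bsub>C\<^esub> c \<odot>\<^bsub>C\<^esub> \<tau>" for c
    using s by (simp add: C_simps smult_add_right)
  show "nrm C (\<sigma> \<oplus>\<^bsub>C\<^esub> \<tau>) \<le> max (nrm C \<sigma>) (nrm C \<tau>)"
  proof (rule LIMSEQ_le)
    show "(\<lambda>n. nrm E (\<sigma> n \<oplus> \<tau> n)) \<longlonglongrightarrow> nrm C (\<sigma> \<oplus>\<^bsub>C\<^esub> \<tau>)"
      using tendsto_C_nrm[OF C_add_mem[OF st]] by (simp add: C_simps)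
    show "(\<lambda>n. max (nrm E (\<sigma> n)) (nrm E (\<tau> n))) \<longlonglongrightarrow> max (nrm C \<sigma>) (nrm C \<tau>)"
      by (intro tendsto_max tendsto_C_nrm st)
  qed (use s nrm_add in blast)
next
  show "\<zero>\<^bsub>C\<^esub> \<in> carrier C" by (simp add: C_simps const_cauchy)
next
  fix \<sigma> c d assume st: "\<sigma> \<in> carrier C"
  note s = cauchyD(1)[OF st]
  show "\<zero>\<^bsub>C\<^esub> \<oplus>\<^bsub>C\<^esub> \<sigma> = \<sigma>" "1 \<odot>\<^bsub>C\<^esub> \<sigma> = \<sigma>" using s by (simp_all add: C_simps)
  have "(-1) \<odot> \<sigma> n \<oplus> \<sigma> n = \<zero>" for n using s smult_add_left[of "\<sigma> n" "-1" 1] by simp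
  then show "(- 1) \<odot>\<^bsub>C\<^esub> \<sigma> \<oplus>\<^bsub>C\<^esub> \<sigma> = \<zero>\<^bsub>C\<^esub>" by (simp add: C_simps)
  show "c \<odot>\<^bsub>C\<^esub> \<sigma> \<in> carrier C" using st by (simp add: C_simps C_smult_mem)
  show "(c + d) \<odot>\<^bsub>C\<^esub> \<sigma> = c \<odot>\<^bsub>C\<^esub> \<sigma> \<oplus>\<^bsub>C\<^esub> d \<odot>\<^bsub>C\<^esub> \<sigma>" "(c * d) \<odot>\<^bsub>C\<^esub> \<sigma> = c \<odot>\<^bsub>C\<^esub> (d \<odot>\<^bsub>C\<^esub> \<sigma>)"
    using s by (simp_all add: C_simps smult_add_left smult_mult)
  show "0 \<le> nrm C \<sigma>"
    using tendsto_C_nrm[OF st] s nrm_nonneg by (intro LIMSEQ_le_const) auto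
  show "nrm C (c \<odot>\<^bsub>C\<^esub> \<sigma>) = vabs c * nrm C \<sigma>"
  proof (rule LIMSEQ_unique)
    show "(\<lambda>n. nrm E (c \<odot> \<sigma> n)) \<longlonglongrightarrow> nrm C (c \<odot>\<^bsub>C\<^esub> \<sigma>)"
      using tendsto_C_nrm[OF C_smult_mem[OF st]] by (simp add: C_simps)
    show "(\<lambda>n. nrm E (c \<odot> \<sigma> n)) \<longlonglongrightarrow> vabs c * nrm C \<sigma>"
      using tendsto_mult_left[OF tendsto_C_nrm[OF st]] s by (simp add: nrm_smult)
  qed
qed

lemma C_diff:
  assumes "\<sigma> \<in> carrier C" "\<tau> \<in> carrier C"
  shows "\<sigma> \<ominus>\<^bsub>C\<^esub> \<tau> = (\<lambda>n. \<sigma> n \<ominus> \<tau> n)"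
proof -
  interpret C: nonarch_seminormed_space C by (rule seminormed_C)
  show ?thesis using assms cauchyD(1) by (simp add: C.a_minus_eq_smult a_minus_eq_smult C_simps)
qed

text \<open>What the completion divides out is exactly the kernel of the seminorm on Cauchy
  sequences; from this form the subspace property is immediate.\<close>

lemma null_sequences_eq: "null_sequences E = {\<sigma> \<in> carrier C. nrm C \<sigma> = 0}"
proof (intro equalityI subsetI)
  fix \<sigma> assume "\<sigma> \<in> null_sequences E"
  then have s: "\<sigma> n \<in> carrier E" and t: "nrm_tendsto E \<sigma> \<zero>" for n
    by (auto simp: null_sequences_def)
  have lim: "(\<lambda>n. nrm E (\<sigma> n)) \<longlonglongrightarrow> 0" using t s by (simp add: nrm_tendsto_def)
  have "\<sigma> \<in> carrier C"
  proof (rule cauchyI)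
    fix e :: real assume "e > 0"
    with lim obtain N where N: "\<forall>n\<ge>N. nrm E (\<sigma> n) < e"
      using nrm_nonneg[OF s] by (auto simp: LIMSEQ_iff)
    have "nrm E (\<sigma> m \<ominus> \<sigma> n) < e" if "m \<ge> N" "n \<ge> N" for m n
    proof -
      have "nrm E (\<sigma> m) < e" "nrm E (\<sigma> n) < e" using N that by auto
      then show ?thesis using nrm_diff[OF s[of m] s[of n]] by auto
    qed
    then show "\<exists>N. \<forall>m\<ge>N. \<forall>n\<ge>N. nrm E (\<sigma> m \<ominus> \<sigma> n) < e" by blast
  qed (rule s)
  then show "\<sigma> \<in> {\<sigma> \<in> carrier C. nrm C \<sigma> = 0}"
    using LIMSEQ_unique[OF lim tendsto_C_nrm] by simp
next
  fix \<sigma> assume "\<sigma> \<in> {\<sigma> \<in> carrier C. nrm C \<sigma> = 0}"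
  then have s: "\<sigma> \<in> carrier C" "nrm C \<sigma> = 0" by auto
  then show "\<sigma> \<in> null_sequences E"
    using tendsto_C_nrm[OF s(1)] cauchyD(1)[OF s(1)] by (auto simp: null_sequences_def nrm_tendsto_def)
qed

lemma null_submodule: "submodule (null_sequences E) scalars C"
proof -
  interpret C: nonarch_seminormed_space C by (rule seminormed_C)
  show ?thesis
  proof (rule C.submoduleI')
    fix \<sigma> \<tau> assume "\<sigma> \<in> null_sequences E" "\<tau> \<in> null_sequences E"
    then show "\<sigma> \<oplus>\<^bsub>C\<^esub> \<tau> \<in> null_sequences E"
      using C.nrm_add[of \<sigma> \<tau>] C.nrm_nonneg[of "\<sigma> \<oplus>\<^bsub>C\<^esub> \<tau>"] by (auto simp: null_sequences_eq)
  qed (auto simp: null_sequences_eq C.nrm_smult)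
qed

lemma quotient_C: "seminormed_quotient C (null_sequences E)"
  by (intro seminormed_quotientI seminormed_C null_submodule)

definition completion_emb where
  "completion_emb x = null_sequences E +>\<^bsub>C\<^esub> (\<lambda>_. x)"

lemma seminormed_completion: "nonarch_seminormed_space (nspace_completion E)"
  unfolding nspace_completion_def by (intro seminormed_quotient.seminormed_Q quotient_C)

lemma completion_emb_bounded: "bounded_linear_map E (nspace_completion E) completion_emb"
proof -
  interpret C: seminormed_quotient C "null_sequences E" by (rule quotient_C)
  have "nrm C (\<lambda>_. x) = nrm E x" if "x \<in> carrier E" for x
    using LIMSEQ_unique[OF tendsto_C_nrm[OF const_cauchy[OF that]] tendsto_const] .
  then have "bounded_linear_map E C (\<lambda>x. (\<lambda>_. x))"
    by (intro bounded_linear_mapI[where C = 1]) (auto simp: C_simps const_cauchy)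
  then show ?thesis
    unfolding nspace_completion_def completion_emb_def
    by (intro bounded_linear_map_comp[OF _ _ _ _ C.coset_bounded] C.seminormed_Q) unfold_locales
qed

text \<open>A Cauchy sequence is close to the constant sequence formed from one of its late
  terms.\<close>

lemma completion_emb_dense:
  assumes "t \<in> carrier (nspace_completion E)"
  shows "adherent (nspace_completion E) (completion_emb ` carrier E) t"
proof (rule adherentI)
  interpret C: seminormed_quotient C "null_sequences E" by (rule quotient_C)
  interpret q: bounded_map C C.Q "\<lambda>\<sigma>. null_sequences E +>\<^bsub>C\<^esub> \<sigma>"
    by (intro bounded_mapI C.coset_bounded C.seminormed_Q) unfold_locales
  fix e :: real assume e: "e > 0"
  obtain \<sigma> where t: "t = null_sequences E +>\<^bsub>C\<^esub> \<sigma>" and s: "\<sigma> \<in> carrier C"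
    using assms by (auto simp: nspace_completion_def C.Q_carrier)
  \<comment> \<open>Half of \<open>e\<close>, because passing to the limit weakens the strict
    inequality.\<close>
  from e have "e / 2 > 0" by simp
  from cauchyD(2)[OF s this] obtain N where N: "\<forall>m\<ge>N. \<forall>n\<ge>N. nrm E (\<sigma> m \<ominus> \<sigma> n) < e / 2" ..
  let ?y = "\<lambda>_. \<sigma> N"
  have y: "?y \<in> carrier C" by (intro const_cauchy cauchyD(1) s)
  have "nrm C (\<sigma> \<ominus>\<^bsub>C\<^esub> ?y) \<le> e / 2"
  proof (rule LIMSEQ_le_const2)
    show "(\<lambda>n. nrm E (\<sigma> n \<ominus> \<sigma> N)) \<longlonglongrightarrow> nrm C (\<sigma> \<ominus>\<^bsub>C\<^esub> ?y)"
      using tendsto_C_nrm[OF C.minus_mem[OF s y]] by (simp add: C_diff[OF s y])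
    show "\<exists>M. \<forall>n\<ge>M. nrm E (\<sigma> n \<ominus> \<sigma> N) \<le> e / 2" using N by (intro exI[of _ N]) (auto intro: less_imp_le)
  qed
  then have "nrm C.Q (t \<ominus>\<^bsub>C.Q\<^esub> completion_emb (\<sigma> N)) \<le> e / 2"
    unfolding t completion_emb_def q.diff[OF s y, symmetric]
    using C.Q_nrm_coset_le[of "\<sigma> \<ominus>\<^bsub>C\<^esub> ?y"] s y by auto
  then show "\<exists>y\<in>completion_emb ` carrier E. nrm (nspace_completion E) (t \<ominus>\<^bsub>nspace_completion E\<^esub> y) < e"
    using e cauchyD(1)[OF s] by (intro bexI[of _ "completion_emb (\<sigma> N)"]) (auto simp: nspace_completion_def)
qed

end

section \<open>Maps between completions and extension to the completion\<close>

lemma (in bounded_map) bounded_linear_map_cauchy: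
  "bounded_linear_map (cauchy_space E) (cauchy_space F) (\<lambda>\<sigma>. f \<circ> \<sigma>)"
proof -
  obtain C where C: "C > 0" "\<And>x. x \<in> carrier E \<Longrightarrow> nrm F (f x) \<le> C * nrm E x" by (rule bound) auto
  show ?thesis
  proof (rule bounded_linear_mapI[where C = C])
    fix \<sigma> assume s: "\<sigma> \<in> carrier (cauchy_space E)"
    note s' = E.cauchyD(1)[OF s]
    show "f \<circ> \<sigma> \<in> carrier (cauchy_space F)" by (rule cauchy_comp[OF s])
    show "f \<circ> (c \<odot>\<^bsub>cauchy_space E\<^esub> \<sigma>) = c \<odot>\<^bsub>cauchy_space F\<^esub> (f \<circ> \<sigma>)" for c
      using s' by (simp add: E.C_simps F.C_simps comp_def smult)
    show "f \<circ> (\<sigma> \<oplus>\<^bsub>cauchy_space E\<^esub> \<tau>) = (f \<circ> \<sigma>) \<oplus>\<^bsub>cauchy_space F\<^esub> (f \<circ> \<tau>)"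
      if "\<tau> \<in> carrier (cauchy_space E)" for \<tau>
      using s' E.cauchyD(1)[OF that] by (simp add: E.C_simps F.C_simps comp_def add)
    show "nrm (cauchy_space F) (f \<circ> \<sigma>) \<le> C * nrm (cauchy_space E) \<sigma>"
    proof (rule LIMSEQ_le)
      show "(\<lambda>n. nrm F (f (\<sigma> n))) \<longlonglongrightarrow> nrm (cauchy_space F) (f \<circ> \<sigma>)"
        using F.tendsto_C_nrm[OF cauchy_comp[OF s]] by simp
      show "(\<lambda>n. C * nrm E (\<sigma> n)) \<longlonglongrightarrow> C * nrm (cauchy_space E) \<sigma>"
        by (intro tendsto_mult_left E.tendsto_C_nrm s)
    qed (use C s' in blast)
  qed
qed

lemma (in bounded_map) completion_map:
  shows "bounded_linear_map (nspace_completion E) (nspace_completion F) (completion_map F f)"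
    and "x \<in> carrier E \<Longrightarrow> completion_map F f (E.completion_emb x) = F.completion_emb (f x)"
proof -
  have "f \<circ> \<sigma> \<in> null_sequences F" if "\<sigma> \<in> null_sequences E" for \<sigma>
  proof -
    interpret c: bounded_map "cauchy_space E" "cauchy_space F" "\<lambda>\<sigma>. f \<circ> \<sigma>"
      by (intro bounded_mapI E.seminormed_C F.seminormed_C bounded_linear_map_cauchy)
    obtain C where "\<And>\<sigma>. \<sigma> \<in> carrier (cauchy_space E) \<Longrightarrow> nrm (cauchy_space F) (f \<circ> \<sigma>) \<le> C * nrm (cauchy_space E) \<sigma>"
      by (rule c.bound) auto
    from this[of \<sigma>] that show ?thesis
      using c.F.nrm_nonneg[of "f \<circ> \<sigma>"] by (auto simp: E.null_sequences_eq F.null_sequences_eq)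
  qed
  then have "(\<lambda>\<sigma>. f \<circ> \<sigma>) ` null_sequences E \<subseteq> null_sequences F" by blast
  note * = coset_map[OF E.quotient_C F.quotient_C bounded_linear_map_cauchy this]
  show "bounded_linear_map (nspace_completion E) (nspace_completion F) (completion_map F f)"
    using *(2) by (simp add: nspace_completion_def completion_map_def)
  show "completion_map F f (E.completion_emb x) = F.completion_emb (f x)" if "x \<in> carrier E"
    using *(1)[OF E.const_cauchy[OF that]]
    by (simp add: E.completion_emb_def F.completion_emb_def completion_map_def comp_def)
qed

text \<open>Completeness of \<open>F\<close> provides a limit \<open>L \<sigma>\<close> for the
  image of each Cauchy sequence. \<open>L\<close> is linear because limits are unique, it keeps the
  bound of \<open>f\<close>, and this bound forces it to vanish on null sequences.\<close>

lemma (in bounded_map) bounded_linear_map_completion: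
  assumes "nonarch_banach_space F"
  obtains g where "bounded_linear_map (nspace_completion E) F g"
    "\<And>x. x \<in> carrier E \<Longrightarrow> g (E.completion_emb x) = f x"
proof -
  interpret F': nonarch_banach_space F by fact
  obtain C where C: "C > 0" "\<And>x. x \<in> carrier E \<Longrightarrow> nrm F (f x) \<le> C * nrm E x" by (rule bound) auto
  have "\<exists>y\<in>carrier F. nrm_tendsto F (f \<circ> \<sigma>) y" if "\<sigma> \<in> carrier (cauchy_space E)" for \<sigma>
    using cauchy_comp[OF that] by (intro F'.nrm_complete) (auto simp: cauchy_space_def)
  then obtain L where L: "\<And>\<sigma>. \<sigma> \<in> carrier (cauchy_space E) \<Longrightarrow> L \<sigma> \<in> carrier F"
    "\<And>\<sigma>. \<sigma> \<in> carrier (cauchy_space E) \<Longrightarrow> nrm_tendsto F (f \<circ> \<sigma>) (L \<sigma>)" by metis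
  \<comment> \<open>Additivity, homogeneity and the values on constant sequences are all verified by
    exhibiting a limit and appealing to this uniqueness.\<close>
  have unique: "y = L \<sigma>" if s: "\<sigma> \<in> carrier (cauchy_space E)" and y: "y \<in> carrier F"
    and lim: "(\<lambda>n. nrm F (f (\<sigma> n) \<ominus>\<^bsub>F\<^esub> y)) \<longlonglongrightarrow> 0" for \<sigma> y
  proof -
    have lim': "(\<lambda>n. nrm F (f (\<sigma> n) \<ominus>\<^bsub>F\<^esub> L \<sigma>)) \<longlonglongrightarrow> 0"
      using L(2)[OF s] by (simp add: nrm_tendsto_def)
    have "nrm F (y \<ominus>\<^bsub>F\<^esub> L \<sigma>) \<le> max 0 0"
    proof (rule LIMSEQ_le[OF tendsto_const tendsto_max[OF lim lim']])
      have "nrm F (y \<ominus>\<^bsub>F\<^esub> L \<sigma>) \<le> max (nrm F (f (\<sigma> n) \<ominus>\<^bsub>F\<^esub> y)) (nrm F (f (\<sigma> n) \<ominus>\<^bsub>F\<^esub> L \<sigma>))" for n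
        using F.nrm_diff_triangle[of y "f (\<sigma> n)" "L \<sigma>"] F.nrm_diff_commute[of y "f (\<sigma> n)"] y L(1)[OF s] E.cauchyD(1)[OF s]
        by simp
      then show "\<exists>N. \<forall>n\<ge>N. nrm F (y \<ominus>\<^bsub>F\<^esub> L \<sigma>) \<le> max (nrm F (f (\<sigma> n) \<ominus>\<^bsub>F\<^esub> y)) (nrm F (f (\<sigma> n) \<ominus>\<^bsub>F\<^esub> L \<sigma>))" by blast
    qed
    then have "nrm F (y \<ominus>\<^bsub>F\<^esub> L \<sigma>) = 0" using F.nrm_nonneg[of "y \<ominus>\<^bsub>F\<^esub> L \<sigma>"] y L(1)[OF s] by simp
    then show ?thesis using F'.nrm_eq_0_iff[of "y \<ominus>\<^bsub>F\<^esub> L \<sigma>"] y L(1)[OF s] by (simp add: F.minus_eq_zero_iff)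
  qed
  have bound: "nrm F (L \<sigma>) \<le> C * nrm (cauchy_space E) \<sigma>" if s: "\<sigma> \<in> carrier (cauchy_space E)" for \<sigma>
  proof -
    have lim: "(\<lambda>n. nrm F (f (\<sigma> n) \<ominus>\<^bsub>F\<^esub> L \<sigma>)) \<longlonglongrightarrow> 0"
      using L(2)[OF s] by (simp add: nrm_tendsto_def)
    have "nrm F (L \<sigma>) \<le> max 0 (C * nrm (cauchy_space E) \<sigma>)"
    proof (rule LIMSEQ_le[OF tendsto_const tendsto_max[OF lim tendsto_mult_left[OF E.tendsto_C_nrm[OF s]]]])
      have "nrm F (L \<sigma>) \<le> max (nrm F (f (\<sigma> n) \<ominus>\<^bsub>F\<^esub> L \<sigma>)) (C * nrm E (\<sigma> n))" for n
        using F.nrm_le_max_diff[of "L \<sigma>" "f (\<sigma> n)"] F.nrm_diff_commute[of "L \<sigma>" "f (\<sigma> n)"]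
          C(2)[of "\<sigma> n"] L(1)[OF s] E.cauchyD(1)[OF s]
        by fastforce
      then show "\<exists>N. \<forall>n\<ge>N. nrm F (L \<sigma>) \<le> max (nrm F (f (\<sigma> n) \<ominus>\<^bsub>F\<^esub> L \<sigma>)) (C * nrm E (\<sigma> n))" by blast
    qed
    moreover have "0 \<le> C * nrm (cauchy_space E) \<sigma>"
      using C nonarch_seminormed_space.nrm_nonneg[OF E.seminormed_C s] by simp
    ultimately show ?thesis by simp
  qed
  have "bounded_linear_map (cauchy_space E) F L"
  proof (rule bounded_linear_mapI[where C = C, OF L(1) _ _ bound])
    fix \<sigma> \<tau> assume st: "\<sigma> \<in> carrier (cauchy_space E)" "\<tau> \<in> carrier (cauchy_space E)"
    note c = E.cauchyD(1)[OF st(1)] E.cauchyD(1)[OF st(2)] L(1)[OF st(1)] L(1)[OF st(2)]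
    have lim: "(\<lambda>n. max (nrm F (f (\<sigma> n) \<ominus>\<^bsub>F\<^esub> L \<sigma>)) (nrm F (f (\<tau> n) \<ominus>\<^bsub>F\<^esub> L \<tau>))) \<longlonglongrightarrow> max 0 0"
      using L(2)[OF st(1)] L(2)[OF st(2)] by (intro tendsto_max) (simp_all add: nrm_tendsto_def)
    show "L (\<sigma> \<oplus>\<^bsub>cauchy_space E\<^esub> \<tau>) = L \<sigma> \<oplus>\<^bsub>F\<^esub> L \<tau>"
    proof (rule unique[symmetric])
      show "(\<lambda>n. nrm F (f ((\<sigma> \<oplus>\<^bsub>cauchy_space E\<^esub> \<tau>) n) \<ominus>\<^bsub>F\<^esub> (L \<sigma> \<oplus>\<^bsub>F\<^esub> L \<tau>))) \<longlonglongrightarrow> 0"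
      proof (rule tendsto_sandwich[OF _ _ tendsto_const])
        have "nrm F ((f (\<sigma> n) \<ominus>\<^bsub>F\<^esub> L \<sigma>) \<oplus>\<^bsub>F\<^esub> (f (\<tau> n) \<ominus>\<^bsub>F\<^esub> L \<tau>)) \<le> max (nrm F (f (\<sigma> n) \<ominus>\<^bsub>F\<^esub> L \<sigma>)) (nrm F (f (\<tau> n) \<ominus>\<^bsub>F\<^esub> L \<tau>))" for n
          using c by (intro F.nrm_add) auto
        then show "\<forall>\<^sub>F n in sequentially. nrm F (f ((\<sigma> \<oplus>\<^bsub>cauchy_space E\<^esub> \<tau>) n) \<ominus>\<^bsub>F\<^esub> (L \<sigma> \<oplus>\<^bsub>F\<^esub> L \<tau>))
            \<le> max (nrm F (f (\<sigma> n) \<ominus>\<^bsub>F\<^esub> L \<sigma>)) (nrm F (f (\<tau> n) \<ominus>\<^bsub>F\<^esub> L \<tau>))"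
          using c by (simp add: E.C_simps add F.add_diff_add)
        show "(\<lambda>n. max (nrm F (f (\<sigma> n) \<ominus>\<^bsub>F\<^esub> L \<sigma>)) (nrm F (f (\<tau> n) \<ominus>\<^bsub>F\<^esub> L \<tau>))) \<longlonglongrightarrow> 0" using lim by simp
      qed (use c in \<open>auto simp: E.C_simps intro!: always_eventually F.nrm_nonneg\<close>)
    qed (use st c E.C_add_mem in \<open>auto simp: E.C_simps\<close>)
  next
    fix \<sigma> and c :: 'k assume s: "\<sigma> \<in> carrier (cauchy_space E)"
    note c = E.cauchyD(1)[OF s] L(1)[OF s]
    have "(\<lambda>n. vabs c * nrm F (f (\<sigma> n) \<ominus>\<^bsub>F\<^esub> L \<sigma>)) \<longlonglongrightarrow> vabs c * 0"
      using L(2)[OF s] by (intro tendsto_mult_left) (simp add: nrm_tendsto_def)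
    then show "L (c \<odot>\<^bsub>cauchy_space E\<^esub> \<sigma>) = c \<odot>\<^bsub>F\<^esub> L \<sigma>"
      using c E.C_smult_mem[OF s] by (intro unique[symmetric])
        (auto simp: E.C_simps smult F.nrm_smult simp flip: F.smult_diff_right)
  qed
  moreover have "L \<sigma> = \<zero>\<^bsub>F\<^esub>" if "\<sigma> \<in> null_sequences E" for \<sigma>
    using bound[of \<sigma>] L(1)[of \<sigma>] that F.nrm_nonneg[of "L \<sigma>"] F'.nrm_eq_0_iff[of "L \<sigma>"]
    by (simp add: E.null_sequences_eq)
  ultimately obtain g where g: "bounded_linear_map (nspace_completion E) F g"
    "\<And>\<sigma>. \<sigma> \<in> carrier (cauchy_space E) \<Longrightarrow> g (null_sequences E +>\<^bsub>cauchy_space E\<^esub> \<sigma>) = L \<sigma>"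
    using seminormed_quotient.bounded_linear_map_lift[OF E.quotient_C F.nonarch_seminormed_space_axioms]
    unfolding nspace_completion_def by metis
  show ?thesis
  proof (rule that[OF g(1)])
    show "g (E.completion_emb x) = f x" if "x \<in> carrier E" for x
      unfolding E.completion_emb_def g(2)[OF E.const_cauchy[OF that]]
      using that E.const_cauchy by (intro unique[symmetric]) auto
  qed
qed

section \<open>Tensor products\<close>

lemma (in nonarch_seminormed_space) nrm_finsum_le:
  assumes "\<And>i. i \<in> A \<Longrightarrow> f i \<in> carrier E" "\<And>i. i \<in> A \<Longrightarrow> nrm E (f i) \<le> B" "0 \<le> B"
  shows "nrm E (finsum E f A) \<le> B"
  using assms
proof (induction A rule: infinite_finite_induct)
  case (infinite A)
  then show ?case by (simp add: M.finsum_infinite)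
next
  case (insert i A)
  then have "nrm E (f i) \<le> B" "nrm E (finsum E f A) \<le> B" by auto
  moreover have "f \<in> A \<rightarrow> carrier E" "f i \<in> carrier E" using insert by auto
  ultimately show ?case
    using insert.hyps nrm_add[of "f i" "finsum E f A"] by (auto simp: M.finsum_insert)
qed auto

lemma bounded_bilinear_mapD:
  assumes "bounded_bilinear_map E F H b"
  shows "\<And>x. x \<in> carrier E \<Longrightarrow> bounded_linear_map F H (\<lambda>y. b x y)"
    and "\<And>y. y \<in> carrier F \<Longrightarrow> bounded_linear_map E H (\<lambda>x. b x y)"
    and "\<And>x y. \<lbrakk>x \<in> carrier E; y \<in> carrier F\<rbrakk> \<Longrightarrow> b x y \<in> carrier H"
    and "\<And>x x' y. \<lbrakk>x \<in> carrier E; x' \<in> carrier E; y \<in> carrier F\<rbrakk> \<Longrightarrow> b (x \<oplus>\<^bsub>E\<^esub> x') y = b x y \<oplus>\<^bsub>H\<^esub> b x' y"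
    and "\<And>x y y'. \<lbrakk>x \<in> carrier E; y \<in> carrier F; y' \<in> carrier F\<rbrakk> \<Longrightarrow> b x (y \<oplus>\<^bsub>F\<^esub> y') = b x y \<oplus>\<^bsub>H\<^esub> b x y'"
    and "\<And>c x y. \<lbrakk>x \<in> carrier E; y \<in> carrier F\<rbrakk> \<Longrightarrow> b (c \<odot>\<^bsub>E\<^esub> x) y = c \<odot>\<^bsub>H\<^esub> b x y"
    and "\<And>c x y. \<lbrakk>x \<in> carrier E; y \<in> carrier F\<rbrakk> \<Longrightarrow> b x (c \<odot>\<^bsub>F\<^esub> y) = c \<odot>\<^bsub>H\<^esub> b x y"
proof -
  show 1: "\<And>x. x \<in> carrier E \<Longrightarrow> bounded_linear_map F H (\<lambda>y. b x y)"
    and 2: "\<And>y. y \<in> carrier F \<Longrightarrow> bounded_linear_map E H (\<lambda>x. b x y)"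
    using assms by (auto simp: bounded_bilinear_map_def)
  show "\<And>x y. \<lbrakk>x \<in> carrier E; y \<in> carrier F\<rbrakk> \<Longrightarrow> b x y \<in> carrier H"
    "\<And>x y y'. \<lbrakk>x \<in> carrier E; y \<in> carrier F; y' \<in> carrier F\<rbrakk> \<Longrightarrow> b x (y \<oplus>\<^bsub>F\<^esub> y') = b x y \<oplus>\<^bsub>H\<^esub> b x y'"
    "\<And>c x y. \<lbrakk>x \<in> carrier E; y \<in> carrier F\<rbrakk> \<Longrightarrow> b x (c \<odot>\<^bsub>F\<^esub> y) = c \<odot>\<^bsub>H\<^esub> b x y"
    using bounded_linear_mapD[OF 1] by auto
  show "\<And>x x' y. \<lbrakk>x \<in> carrier E; x' \<in> carrier E; y \<in> carrier F\<rbrakk> \<Longrightarrow> b (x \<oplus>\<^bsub>E\<^esub> x') y = b x y \<oplus>\<^bsub>H\<^esub> b x' y"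
    "\<And>c x y. \<lbrakk>x \<in> carrier E; y \<in> carrier F\<rbrakk> \<Longrightarrow> b (c \<odot>\<^bsub>E\<^esub> x) y = c \<odot>\<^bsub>H\<^esub> b x y"
    using bounded_linear_mapD[OF 2] by auto
qed

lemma lookup_smult: "Poly_Mapping.lookup (Poly_Mapping.map ((*) c) t) p = c * Poly_Mapping.lookup t (p :: 'p)"
  for c :: "'k::nonarch_field"
  by (simp add: Poly_Mapping.map.rep_eq when_def)

lemma smult_single: "Poly_Mapping.map ((*) c) (Poly_Mapping.single p d) = Poly_Mapping.single p (c * d)"
  for c :: "'k::nonarch_field"
  by (rule poly_mapping_eqI) (simp add: lookup_smult lookup_single when_def)

section \<open>Formal combinations of pairs and the tensor relations\<close>

locale tensor_pair = E: nonarch_seminormed_space E + F: nonarch_seminormed_space F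
  for E :: "('k::nonarch_field, 'x, 'm) nspace_scheme"
    and F :: "('k, 'y, 'n) nspace_scheme"
begin

abbreviation FS where "FS \<equiv> free_space E F"

abbreviation weight :: "('x \<times> 'y \<Rightarrow>\<^sub>0 'k) \<Rightarrow> 'x \<times> 'y \<Rightarrow> real" where
  "weight t p \<equiv> vabs (Poly_Mapping.lookup t p) * (nrm E (fst p) * nrm F (snd p))"

lemma FS_simps: "carrier FS = {t. Poly_Mapping.keys t \<subseteq> carrier E \<times> carrier F}"
  "\<zero>\<^bsub>FS\<^esub> = 0" "s \<oplus>\<^bsub>FS\<^esub> t = s + t" "c \<odot>\<^bsub>FS\<^esub> t = Poly_Mapping.map ((*) c) t"
  by (simp_all add: free_space_def)

lemma nrm_prod_nonneg: "p \<in> carrier E \<times> carrier F \<Longrightarrow> 0 \<le> nrm E (fst p) * nrm F (snd p)"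
  by (auto intro!: mult_nonneg_nonneg E.nrm_nonneg F.nrm_nonneg)

lemma FS_nrm: "nrm FS t = Max (insert 0 (weight t ` Poly_Mapping.keys t))"
  by (simp add: free_space_def case_prod_beta mult.assoc)

lemma FS_nrm_le:
  assumes "0 \<le> B" "\<And>p. p \<in> Poly_Mapping.keys t \<Longrightarrow> weight t p \<le> B"
  shows "nrm FS t \<le> B"
  unfolding FS_nrm using assms by (subst Max_le_iff) auto

lemma FS_nrm_nonneg: "0 \<le> nrm FS t"
  unfolding FS_nrm by (rule Max_ge) auto

lemma weight_le: "weight t p \<le> nrm FS t"
proof (cases "p \<in> Poly_Mapping.keys t")
  case True
  then show ?thesis unfolding FS_nrm by (intro Max_ge) auto
next
  case False
  then show ?thesis using FS_nrm_nonneg by (simp add: in_keys_iff)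
qed

lemma keys_smult_subset: "Poly_Mapping.keys (Poly_Mapping.map ((*) c) t) \<subseteq> Poly_Mapping.keys (t :: 'p \<Rightarrow>\<^sub>0 'k)"
  by (auto simp: in_keys_iff lookup_smult)

lemma FS_nrm_smult_le: "nrm FS (Poly_Mapping.map ((*) c) t) \<le> vabs c * nrm FS t"
proof (rule FS_nrm_le)
  show "weight (Poly_Mapping.map ((*) c) t) p \<le> vabs c * nrm FS t" for p
    using mult_left_mono[OF weight_le[of t p], of "vabs c"] by (simp add: lookup_smult vabs_mult mult.assoc)
qed (simp add: FS_nrm_nonneg)

lemma seminormed_FS: "nonarch_seminormed_space FS"
proof (rule nonarch_seminormed_spaceI)
  fix s t assume st: "s \<in> carrier FS" "t \<in> carrier FS"
  show "s \<oplus>\<^bsub>FS\<^esub> t \<in> carrier FS" using st keys_add[of s t] by (auto simp: FS_simps)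
  show "nrm FS (s \<oplus>\<^bsub>FS\<^esub> t) \<le> max (nrm FS s) (nrm FS t)"
    unfolding FS_simps
  proof (rule FS_nrm_le)
    fix p assume p: "p \<in> Poly_Mapping.keys (s + t)"
    then have "p \<in> carrier E \<times> carrier F" using st keys_add[of s t] by (auto simp: FS_simps)
    then have "weight (s + t) p \<le> max (weight s p) (weight t p)"
      using mult_right_mono[OF vabs_add[of "Poly_Mapping.lookup s p" "Poly_Mapping.lookup t p"] nrm_prod_nonneg[of p]]
        nrm_prod_nonneg[of p]
      by (simp add: lookup_add max_mult_distrib_right)
    also have "\<dots> \<le> max (nrm FS s) (nrm FS t)" by (intro max.mono weight_le)
    finally show "weight (s + t) p \<le> max (nrm FS s) (nrm FS t)" .
  qed (simp add: FS_nrm_nonneg max.coboundedI1)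
next
  fix t c d assume t: "t \<in> carrier FS"
  show "c \<odot>\<^bsub>FS\<^esub> t \<in> carrier FS" using t keys_smult_subset[of c t] by (auto simp: FS_simps)
  show "nrm FS (c \<odot>\<^bsub>FS\<^esub> t) = vabs c * nrm FS t"
  proof (rule antisym)
    show "vabs c * nrm FS t \<le> nrm FS (c \<odot>\<^bsub>FS\<^esub> t)"
    proof (cases "c = 0")
      case False
      have "Poly_Mapping.map ((*) (inverse c)) (Poly_Mapping.map ((*) c) t) = t"
        using False by (intro poly_mapping_eqI) (simp add: lookup_smult)
      then have "nrm FS t \<le> inverse (vabs c) * nrm FS (Poly_Mapping.map ((*) c) t)"
        using FS_nrm_smult_le[of "inverse c" "Poly_Mapping.map ((*) c) t"] by (simp add: vabs_inverse)
      then show ?thesis using vabs_pos[OF False] by (simp add: FS_simps field_simps)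
    qed (simp add: FS_nrm_nonneg)
  qed (simp add: FS_simps FS_nrm_smult_le)
qed (auto simp: FS_simps FS_nrm_nonneg algebra_simps lookup_smult lookup_add intro!: poly_mapping_eqI)

sublocale FS: nonarch_seminormed_space FS
  by (rule seminormed_FS)

lemma FS_diff: "\<lbrakk>s \<in> carrier FS; t \<in> carrier FS\<rbrakk> \<Longrightarrow> s \<ominus>\<^bsub>FS\<^esub> t = s - t"
  by (subst FS.a_minus_eq_smult)
    (auto simp: FS_simps lookup_smult lookup_add lookup_minus intro!: poly_mapping_eqI)

lemma single_mem: "p \<in> carrier E \<times> carrier F \<Longrightarrow> Poly_Mapping.single p c \<in> carrier FS"
  by (auto simp: FS_simps)

lemma nrm_single: "\<lbrakk>x \<in> carrier E; y \<in> carrier F\<rbrakk> \<Longrightarrow> nrm FS (Poly_Mapping.single (x, y) c) \<le> vabs c * (nrm E x * nrm F y)"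
  using nrm_prod_nonneg[of "(x, y)"] by (intro FS_nrm_le) (auto simp: split: if_splits)

lemma FS_sum_mem:
  assumes "submodule S scalars FS" "\<And>i. i \<in> A \<Longrightarrow> g i \<in> S"
  shows "sum g A \<in> S"
  using assms(2)
proof (induction A rule: infinite_finite_induct)
  case (insert i A)
  then show ?case using FS.submodule_mem(3)[OF assms(1), of "g i" "sum g A"] by (simp add: FS_simps)
qed (use FS.submodule_mem(2)[OF assms(1)] in \<open>auto simp: FS_simps\<close>)

lemma FS_nrm_sum_le:
  assumes "\<And>i. i \<in> A \<Longrightarrow> g i \<in> carrier FS" "\<And>i. i \<in> A \<Longrightarrow> nrm FS (g i) \<le> B" "0 \<le> B"
  shows "nrm FS (sum g A) \<le> B"
  using assms
proof (induction A rule: infinite_finite_induct)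
  case (insert i A)
  then have "nrm FS (g i) \<le> B" "nrm FS (sum g A) \<le> B" by auto
  moreover have "sum g A \<in> carrier FS" "g i \<in> carrier FS"
    using insert.prems by (auto intro: FS_sum_mem[OF FS.carrier_is_submodule])
  ultimately show ?case
    using insert.hyps FS.nrm_add[of "g i" "sum g A"] by (auto simp: FS_simps)
qed (use FS.nrm_zero in \<open>auto simp: FS_simps\<close>)

lemma poly_mapping_sum_single:
  assumes "finite A" "Poly_Mapping.keys t \<subseteq> A"
  shows "(\<Sum>p\<in>A. Poly_Mapping.single p (Poly_Mapping.lookup t p)) = t"
proof (rule poly_mapping_eqI)
  fix q
  have "(\<Sum>p\<in>A. Poly_Mapping.lookup t p when p = q) = Poly_Mapping.lookup t q"
    using assms by (auto simp: when_def in_keys_iff)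
  then show "Poly_Mapping.lookup (\<Sum>p\<in>A. Poly_Mapping.single p (Poly_Mapping.lookup t p)) q = Poly_Mapping.lookup t q"
    by (simp add: lookup_sum lookup_single)
qed

lemma FS_span:
  assumes S: "submodule S scalars FS"
    and "\<And>x y. \<lbrakk>x \<in> carrier E; y \<in> carrier F\<rbrakk> \<Longrightarrow> Poly_Mapping.single (x, y) 1 \<in> S"
  shows "carrier FS \<subseteq> S"
proof
  fix t assume t: "t \<in> carrier FS"
  have "Poly_Mapping.single p c \<in> S" if k: "p \<in> Poly_Mapping.keys t" for p c
  proof -
    obtain x y where p: "p = (x, y)" "x \<in> carrier E" "y \<in> carrier F"
      using k t by (cases p) (auto simp: FS_simps)
    show ?thesis
      using FS.submodule_mem(6)[OF S assms(2)[OF p(2,3)], of c] by (simp add: FS_simps smult_single p)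
  qed
  then have "(\<Sum>p\<in>Poly_Mapping.keys t. Poly_Mapping.single p (Poly_Mapping.lookup t p)) \<in> S"
    by (intro FS_sum_mem[OF S])
  then show "t \<in> S" by (simp add: poly_mapping_sum_single)
qed

abbreviation TR where "TR \<equiv> tensor_relations E F"

lemma TR:
  shows TR_submodule: "submodule TR scalars FS"
    and "\<lbrakk>x \<in> carrier E; x' \<in> carrier E; y \<in> carrier F\<rbrakk> \<Longrightarrow>
      Poly_Mapping.single (x \<oplus>\<^bsub>E\<^esub> x', y) 1 - Poly_Mapping.single (x, y) 1 - Poly_Mapping.single (x', y) 1 \<in> TR"
    and "\<lbrakk>x \<in> carrier E; y \<in> carrier F; y' \<in> carrier F\<rbrakk> \<Longrightarrow>
      Poly_Mapping.single (x, y \<oplus>\<^bsub>F\<^esub> y') 1 - Poly_Mapping.single (x, y) 1 - Poly_Mapping.single (x, y') 1 \<in> TR"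
    and "\<lbrakk>x \<in> carrier E; y \<in> carrier F\<rbrakk> \<Longrightarrow>
      Poly_Mapping.single (c \<odot>\<^bsub>E\<^esub> x, y) 1 - Poly_Mapping.single (x, y) c \<in> TR"
    and "\<lbrakk>x \<in> carrier E; y \<in> carrier F\<rbrakk> \<Longrightarrow>
      Poly_Mapping.single (x, c \<odot>\<^bsub>F\<^esub> y) 1 - Poly_Mapping.single (x, y) c \<in> TR"
proof -
  have minus: "s - t \<in> carrier FS" if "s \<in> carrier FS" "t \<in> carrier FS" for s t
    using FS.minus_mem[OF that] by (simp add: FS_diff that)
  have "submodule TR scalars FS \<and>
    {Poly_Mapping.single (x \<oplus>\<^bsub>E\<^esub> x', y) 1 - Poly_Mapping.single (x, y) 1
         - Poly_Mapping.single (x', y) 1 |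
         x x' y. x \<in> carrier E \<and> x' \<in> carrier E \<and> y \<in> carrier F}
      \<union> {Poly_Mapping.single (x, y \<oplus>\<^bsub>F\<^esub> y') 1 - Poly_Mapping.single (x, y) 1
         - Poly_Mapping.single (x, y') 1 |
         x y y'. x \<in> carrier E \<and> y \<in> carrier F \<and> y' \<in> carrier F}
      \<union> {Poly_Mapping.single (c \<odot>\<^bsub>E\<^esub> x, y) 1 - Poly_Mapping.single (x, y) c |
         c x y. x \<in> carrier E \<and> y \<in> carrier F}
      \<union> {Poly_Mapping.single (x, c \<odot>\<^bsub>F\<^esub> y) 1 - Poly_Mapping.single (x, y) c |
         c x y. x \<in> carrier E \<and> y \<in> carrier F} \<subseteq> TR" (is "_ \<and> ?S \<subseteq> _")
    unfolding tensor_relations_def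
  proof (intro conjI FS.linear_span)
    show "?S \<subseteq> carrier FS" "?S \<subseteq> carrier FS"
      by (auto intro!: minus single_mem)
  qed
  then have TR: "submodule TR scalars FS" and S: "?S \<subseteq> TR"
    by (rule conjunct1, rule conjunct2)
  show "submodule TR scalars FS" by (rule TR)
  show "\<lbrakk>x \<in> carrier E; x' \<in> carrier E; y \<in> carrier F\<rbrakk> \<Longrightarrow>
      Poly_Mapping.single (x \<oplus>\<^bsub>E\<^esub> x', y) 1 - Poly_Mapping.single (x, y) 1 - Poly_Mapping.single (x', y) 1 \<in> TR"
    by (rule subsetD[OF S], rule UnI1, rule UnI1, rule UnI1) (rule CollectI, (rule exI)+, rule conjI, rule refl, simp)
  show "\<lbrakk>x \<in> carrier E; y \<in> carrier F; y' \<in> carrier F\<rbrakk> \<Longrightarrow>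
      Poly_Mapping.single (x, y \<oplus>\<^bsub>F\<^esub> y') 1 - Poly_Mapping.single (x, y) 1 - Poly_Mapping.single (x, y') 1 \<in> TR"
    by (rule subsetD[OF S], rule UnI1, rule UnI1, rule UnI2) (rule CollectI, (rule exI)+, rule conjI, rule refl, simp)
  show "\<lbrakk>x \<in> carrier E; y \<in> carrier F\<rbrakk> \<Longrightarrow>
      Poly_Mapping.single (c \<odot>\<^bsub>E\<^esub> x, y) 1 - Poly_Mapping.single (x, y) c \<in> TR"
    by (rule subsetD[OF S], rule UnI1, rule UnI2) (rule CollectI, (rule exI)+, rule conjI, rule refl, simp)
  show "\<lbrakk>x \<in> carrier E; y \<in> carrier F\<rbrakk> \<Longrightarrow>
      Poly_Mapping.single (x, c \<odot>\<^bsub>F\<^esub> y) 1 - Poly_Mapping.single (x, y) c \<in> TR"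
    by (rule subsetD[OF S], rule UnI2) (rule CollectI, (rule exI)+, rule conjI, rule refl, simp)
qed

text \<open>How a map is shown to kill or to preserve the tensor relations: the combinations it
  treats correctly form a submodule, so only the four kinds of generators need inspection.\<close>

lemma TR_minimal:
  assumes "submodule S scalars FS"
    and "\<And>x x' y. \<lbrakk>x \<in> carrier E; x' \<in> carrier E; y \<in> carrier F\<rbrakk> \<Longrightarrow>
      Poly_Mapping.single (x \<oplus>\<^bsub>E\<^esub> x', y) 1 - Poly_Mapping.single (x, y) 1 - Poly_Mapping.single (x', y) 1 \<in> S"
    and "\<And>x y y'. \<lbrakk>x \<in> carrier E; y \<in> carrier F; y' \<in> carrier F\<rbrakk> \<Longrightarrow>
      Poly_Mapping.single (x, y \<oplus>\<^bsub>F\<^esub> y') 1 - Poly_Mapping.single (x, y) 1 - Poly_Mapping.single (x, y') 1 \<in> S"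
    and "\<And>c x y. \<lbrakk>x \<in> carrier E; y \<in> carrier F\<rbrakk> \<Longrightarrow>
      Poly_Mapping.single (c \<odot>\<^bsub>E\<^esub> x, y) 1 - Poly_Mapping.single (x, y) c \<in> S"
    and "\<And>c x y. \<lbrakk>x \<in> carrier E; y \<in> carrier F\<rbrakk> \<Longrightarrow>
      Poly_Mapping.single (x, c \<odot>\<^bsub>F\<^esub> y) 1 - Poly_Mapping.single (x, y) c \<in> S"
  shows "TR \<subseteq> S"
  unfolding tensor_relations_def
  by (rule linear_span_minimal[OF assms(1)], intro Un_least subsetI;
      elim CollectE exE conjE; simp only: assms(2-5))

sublocale FS: seminormed_quotient FS TR
  by (intro seminormed_quotientI seminormed_FS TR_submodule)

section \<open>The completed tensor product and its universal property\<close>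

abbreviation AT where "AT \<equiv> alg_tensor E F"

lemma seminormed_AT: "nonarch_seminormed_space AT"
  unfolding alg_tensor_def by (rule FS.seminormed_Q)

sublocale AT: nonarch_seminormed_space AT
  by (rule seminormed_AT)

abbreviation CT where "CT \<equiv> completed_tensor E F"

lemma seminormed_CT: "nonarch_seminormed_space CT"
  unfolding completed_tensor_def by (rule AT.seminormed_completion)

sublocale CT: nonarch_seminormed_space CT
  by (rule seminormed_CT)

abbreviation free_class :: "('x \<times> 'y \<Rightarrow>\<^sub>0 'k) \<Rightarrow> ('k, 'x, 'y) ctensor" where
  "free_class t \<equiv> AT.completion_emb (TR +>\<^bsub>FS\<^esub> t)"

lemma pure_tensor_eq: "pure_tensor E F x y = free_class (Poly_Mapping.single (x, y) 1)"
  by (simp add: pure_tensor_def AT.completion_emb_def)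

lemma free_class_bounded: "bounded_linear_map FS CT free_class"
  unfolding completed_tensor_def alg_tensor_def
  by (rule bounded_linear_map_comp[OF _ _ _ FS.coset_bounded
        AT.completion_emb_bounded[unfolded alg_tensor_def]])
    (rule FS.nonarch_seminormed_space_axioms FS.seminormed_Q AT.seminormed_completion[unfolded alg_tensor_def])+

sublocale free_class: bounded_map FS CT free_class
  by (intro bounded_mapI seminormed_FS seminormed_CT free_class_bounded)

lemma free_class_dense:
  assumes "t \<in> carrier CT"
  shows "adherent CT (free_class ` carrier FS) t"
proof -
  have "carrier AT = (\<lambda>t. TR +>\<^bsub>FS\<^esub> t) ` carrier FS"
    unfolding alg_tensor_def by (rule FS.Q_carrier)
  then have "free_class ` carrier FS = AT.completion_emb ` carrier AT" by (simp add: image_image)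
  then show ?thesis
    using AT.completion_emb_dense assms by (simp add: completed_tensor_def)
qed

lemma free_class_eqI:
  assumes "s \<in> carrier FS" "t \<in> carrier FS" "s - t \<in> TR"
  shows "free_class s = free_class t"
  using FS.coset_eq_iff[OF assms(1,2)] assms by (simp add: FS_diff)

lemma pure_mem: "\<lbrakk>x \<in> carrier E; y \<in> carrier F\<rbrakk> \<Longrightarrow> pure_tensor E F x y \<in> carrier CT"
  unfolding pure_tensor_eq by (intro free_class.mem single_mem) auto

text \<open>Classes of formal combinations are linear combinations of pure tensors and are dense.
  Bounded maps on the completed tensor product can therefore be compared on pure tensors.\<close>

lemma completed_tensor_span:
  assumes "closed_subspace CT S"
    and "\<And>x y. \<lbrakk>x \<in> carrier E; y \<in> carrier F\<rbrakk> \<Longrightarrow> pure_tensor E F x y \<in> S"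
  shows "carrier CT \<subseteq> S"
proof
  fix t assume t: "t \<in> carrier CT"
  note S = CT.closed_subspaceD[OF assms(1)]
  have "carrier FS \<subseteq> {s \<in> carrier FS. free_class s \<in> S}"
    by (rule FS_span[OF free_class.submodule_vimage[OF S(1)]])
      (use assms(2) in \<open>auto simp: pure_tensor_eq intro!: single_mem\<close>)
  then have "free_class ` carrier FS \<subseteq> S" by blast
  then show "t \<in> S" using S(2)[OF t] adherent_mono[OF free_class_dense[OF t]] by blast
qed

lemma pure_bilinear: "bounded_bilinear_map E F CT (pure_tensor E F)"
proof -
  have mem: "Poly_Mapping.single (x, y) c \<in> carrier FS" if "x \<in> carrier E" "y \<in> carrier F" for x y c
    using that by (auto intro: single_mem)
  have plus: "s + t \<in> carrier FS" if "s \<in> carrier FS" "t \<in> carrier FS" for s t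
    using FS.M.add.m_closed[OF that] by (simp add: FS_simps)
  obtain C where C: "C > 0" "\<And>t. t \<in> carrier FS \<Longrightarrow> nrm CT (free_class t) \<le> C * nrm FS t"
    by (rule free_class.bound) auto
  have bound: "nrm CT (pure_tensor E F x y) \<le> C * nrm E x * nrm F y" if "x \<in> carrier E" "y \<in> carrier F" for x y
  proof -
    have "nrm CT (pure_tensor E F x y) \<le> C * nrm FS (Poly_Mapping.single (x, y) 1)"
      unfolding pure_tensor_eq by (intro C(2) mem that)
    also have "\<dots> \<le> C * (nrm E x * nrm F y)"
      using nrm_single[OF that, of 1] C(1) by (intro mult_left_mono) auto
    finally show ?thesis by simp
  qed
  have smult: "free_class (Poly_Mapping.single (x, y) c) = c \<odot>\<^bsub>CT\<^esub> pure_tensor E F x y"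
    if "x \<in> carrier E" "y \<in> carrier F" for x y c
    using free_class.smult[OF mem[OF that], of c 1] by (simp add: pure_tensor_eq FS_simps smult_single)
  show ?thesis
    unfolding bounded_bilinear_map_def
  proof (intro conjI ballI exI)
    fix x assume x: "x \<in> carrier E"
    show "bounded_linear_map F CT (pure_tensor E F x)"
    proof (rule bounded_linear_mapI[where C = "C * nrm E x"])
      fix y assume y: "y \<in> carrier F"
      show "pure_tensor E F x y \<in> carrier CT" using x y by (rule pure_mem)
      show "nrm CT (pure_tensor E F x y) \<le> C * nrm E x * nrm F y" using x y by (rule bound)
      show "pure_tensor E F x (c \<odot>\<^bsub>F\<^esub> y) = c \<odot>\<^bsub>CT\<^esub> pure_tensor E F x y" for c
        unfolding smult[OF x y, symmetric] unfolding pure_tensor_eq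
        using x y TR(5) by (intro free_class_eqI mem) auto
      show "pure_tensor E F x (y \<oplus>\<^bsub>F\<^esub> y') = pure_tensor E F x y \<oplus>\<^bsub>CT\<^esub> pure_tensor E F x y'"
        if y': "y' \<in> carrier F" for y'
      proof -
        have "pure_tensor E F x (y \<oplus>\<^bsub>F\<^esub> y') =
          free_class (Poly_Mapping.single (x, y) 1 \<oplus>\<^bsub>FS\<^esub> Poly_Mapping.single (x, y') 1)"
          unfolding pure_tensor_eq FS_simps
          using x y y' TR(3)[OF x y y'] by (intro free_class_eqI mem plus) (auto simp: diff_diff_eq)
        then show ?thesis unfolding pure_tensor_eq using x y y' by (simp add: free_class.add mem)
      qed
    qed
  next
    fix y assume y: "y \<in> carrier F"
    show "bounded_linear_map E CT (\<lambda>x. pure_tensor E F x y)"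
    proof (rule bounded_linear_mapI[where C = "C * nrm F y"])
      fix x assume x: "x \<in> carrier E"
      show "pure_tensor E F x y \<in> carrier CT" using x y by (rule pure_mem)
      show "nrm CT (pure_tensor E F x y) \<le> C * nrm F y * nrm E x" using bound[OF x y] by (simp add: mult_ac)
      show "pure_tensor E F (c \<odot>\<^bsub>E\<^esub> x) y = c \<odot>\<^bsub>CT\<^esub> pure_tensor E F x y" for c
        unfolding smult[OF x y, symmetric] unfolding pure_tensor_eq
        using x y TR(4) by (intro free_class_eqI mem) auto
      show "pure_tensor E F (x \<oplus>\<^bsub>E\<^esub> x') y = pure_tensor E F x y \<oplus>\<^bsub>CT\<^esub> pure_tensor E F x' y"
        if x': "x' \<in> carrier E" for x'
      proof -
        have "pure_tensor E F (x \<oplus>\<^bsub>E\<^esub> x') y =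
          free_class (Poly_Mapping.single (x, y) 1 \<oplus>\<^bsub>FS\<^esub> Poly_Mapping.single (x', y) 1)"
          unfolding pure_tensor_eq FS_simps
          using x y x' TR(2)[OF x x' y] by (intro free_class_eqI mem plus) (auto simp: diff_diff_eq)
        then show ?thesis unfolding pure_tensor_eq using x y x' by (simp add: free_class.add mem)
      qed
    qed
  next
    fix x y assume "x \<in> carrier E" "y \<in> carrier F"
    then show "nrm CT (pure_tensor E F x y) \<le> C * nrm E x * nrm F y" by (rule bound)
  qed
qed

text \<open>The bilinear map is first extended linearly to formal combinations. There the maximum
  norm controls it, since by the ultrametric inequality a sum is no larger than its largest term. It
  kills the relations by bilinearity, and completeness of \<open>H\<close> carries it over to the
  completion.\<close>

lemma completed_tensor_lift:
  assumes H: "nonarch_banach_space H" and b: "bounded_bilinear_map E F H b"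
  obtains g where "bounded_linear_map CT H g"
    "\<And>x y. \<lbrakk>x \<in> carrier E; y \<in> carrier F\<rbrakk> \<Longrightarrow> g (pure_tensor E F x y) = b x y"
proof -
  interpret H: nonarch_banach_space H by fact
  note b' = bounded_bilinear_mapD[OF b]
  define b2 where "b2 p = b (fst p) (snd p)" for p
  have b2: "b2 p \<in> carrier H" if "p \<in> carrier E \<times> carrier F" for p
    using that b' by (auto simp: b2_def)
  define lin where "lin t = finsum H (\<lambda>p. Poly_Mapping.lookup t p \<odot>\<^bsub>H\<^esub> b2 p) (Poly_Mapping.keys t)" for t
  \<comment> \<open>The sum may run over any finite set containing the support, which gives two
    combinations a common index set and makes additivity a termwise statement.\<close>
  have lin: "lin t = finsum H (\<lambda>p. Poly_Mapping.lookup t p \<odot>\<^bsub>H\<^esub> b2 p) A"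
    if "finite A" "Poly_Mapping.keys t \<subseteq> A" "A \<subseteq> carrier E \<times> carrier F" for t A
    unfolding lin_def
  proof (rule H.add.finprod_mono_neutral_cong_left)
    fix p assume p: "p \<in> A - Poly_Mapping.keys t"
    then have "b2 p \<in> carrier H" using that by (intro b2) auto
    then show "Poly_Mapping.lookup t p \<odot>\<^bsub>H\<^esub> b2 p = \<zero>\<^bsub>H\<^esub>" using p by (simp add: in_keys_iff)
  qed (use that b2 in auto)
  have fin: "finite (Poly_Mapping.keys t)" for t :: "'x \<times> 'y \<Rightarrow>\<^sub>0 'k" by simp
  have lin_single: "lin (Poly_Mapping.single (x, y) c) = c \<odot>\<^bsub>H\<^esub> b x y"
    if "x \<in> carrier E" "y \<in> carrier F" for x y c
    using lin[of "{(x, y)}" "Poly_Mapping.single (x, y) c"] b'(3)[OF that] that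
    by (simp add: H.add.finprod_insert b2_def)
  obtain C where C: "\<And>x y. \<lbrakk>x \<in> carrier E; y \<in> carrier F\<rbrakk> \<Longrightarrow> nrm H (b x y) \<le> C * nrm E x * nrm F y"
    using b unfolding bounded_bilinear_map_def by blast
  define D where "D = max C 0"
  have D: "0 \<le> D" "\<And>p. p \<in> carrier E \<times> carrier F \<Longrightarrow> nrm H (b2 p) \<le> D * (nrm E (fst p) * nrm F (snd p))"
  proof -
    fix p assume p: "p \<in> carrier E \<times> carrier F"
    then have "nrm H (b2 p) \<le> C * (nrm E (fst p) * nrm F (snd p))" using C by (auto simp: b2_def mult.assoc)
    also have "\<dots> \<le> D * (nrm E (fst p) * nrm F (snd p))"
      using nrm_prod_nonneg[OF p] by (intro mult_right_mono) (auto simp: D_def)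
    finally show "nrm H (b2 p) \<le> D * (nrm E (fst p) * nrm F (snd p))" .
  qed (simp add: D_def)
  have lin_bounded: "bounded_linear_map FS H lin"
  proof (rule bounded_linear_mapI[where C = D])
    fix t assume t: "t \<in> carrier FS"
    then have k: "Poly_Mapping.keys t \<subseteq> carrier E \<times> carrier F" by (simp add: FS_simps)
    show "lin t \<in> carrier H" unfolding lin_def using b2 k by (intro H.M.finsum_closed) auto
    show "lin (c \<odot>\<^bsub>FS\<^esub> t) = c \<odot>\<^bsub>H\<^esub> lin t" for c
    proof -
      have "lin (c \<odot>\<^bsub>FS\<^esub> t) = finsum H (\<lambda>p. c \<odot>\<^bsub>H\<^esub> (Poly_Mapping.lookup t p \<odot>\<^bsub>H\<^esub> b2 p)) (Poly_Mapping.keys t)"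
        unfolding FS_simps lin[OF fin keys_smult_subset k, of c] using k b2
        by (intro H.M.finsum_cong') (auto simp: lookup_smult H.smult_mult)
      also have "\<dots> = c \<odot>\<^bsub>H\<^esub> lin t"
        unfolding lin_def using k b2 by (intro H.finsum_smult_ldistr[symmetric]) auto
      finally show ?thesis .
    qed
    show "lin (t \<oplus>\<^bsub>FS\<^esub> s) = lin t \<oplus>\<^bsub>H\<^esub> lin s" if s: "s \<in> carrier FS" for s
    proof -
      let ?A = "Poly_Mapping.keys t \<union> Poly_Mapping.keys s"
      have A: "finite ?A" "?A \<subseteq> carrier E \<times> carrier F" using k s by (auto simp: FS_simps)
      have "lin (t \<oplus>\<^bsub>FS\<^esub> s) = finsum H (\<lambda>p. (Poly_Mapping.lookup t p \<odot>\<^bsub>H\<^esub> b2 p) \<oplus>\<^bsub>H\<^esub> (Poly_Mapping.lookup s p \<odot>\<^bsub>H\<^esub> b2 p)) ?A"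
        unfolding FS_simps lin[OF A(1) keys_add A(2)] using A b2
        by (intro H.M.finsum_cong') (auto simp: lookup_add H.smult_add_left)
      also have "\<dots> = lin t \<oplus>\<^bsub>H\<^esub> lin s"
        unfolding lin[OF A(1) Un_upper1 A(2)] lin[OF A(1) Un_upper2 A(2)] using A b2
        by (intro H.M.finsum_addf) auto
      finally show ?thesis .
    qed
    show "nrm H (lin t) \<le> D * nrm FS t"
      unfolding lin_def
    proof (rule H.nrm_finsum_le)
      fix p assume "p \<in> Poly_Mapping.keys t"
      then have p: "p \<in> carrier E \<times> carrier F" using k by auto
      then show "Poly_Mapping.lookup t p \<odot>\<^bsub>H\<^esub> b2 p \<in> carrier H" using b2 by auto
      have "nrm H (Poly_Mapping.lookup t p \<odot>\<^bsub>H\<^esub> b2 p) \<le> vabs (Poly_Mapping.lookup t p) * (D * (nrm E (fst p) * nrm F (snd p)))"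
        using D(2)[OF p] b2[OF p] by (auto simp: H.nrm_smult intro: mult_left_mono)
      also have "\<dots> = D * weight t p" by simp
      also have "\<dots> \<le> D * nrm FS t" by (intro mult_left_mono weight_le D)
      finally show "nrm H (Poly_Mapping.lookup t p \<odot>\<^bsub>H\<^esub> b2 p) \<le> D * nrm FS t" .
    qed (simp add: D FS_nrm_nonneg)
  qed
  have sH: "nonarch_seminormed_space H" by unfold_locales
  interpret lin: bounded_map FS H lin by (intro bounded_mapI seminormed_FS sH lin_bounded)
  have mem: "Poly_Mapping.single (x, y) c \<in> carrier FS" if "x \<in> carrier E" "y \<in> carrier F" for x y c
    using that by (auto intro: single_mem)
  have lin_diff: "lin (s - t) = lin s \<ominus>\<^bsub>H\<^esub> lin t" "s - t \<in> carrier FS" if "s \<in> carrier FS" "t \<in> carrier FS" for s t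
    using that lin.diff[OF that] FS.minus_mem[OF that] by (simp_all add: FS_diff)
  have zero_sub: "submodule {\<zero>\<^bsub>H\<^esub>} scalars H"
    by (rule H.submoduleI') auto
  have cancel: "(u \<oplus>\<^bsub>H\<^esub> v) \<ominus>\<^bsub>H\<^esub> u \<ominus>\<^bsub>H\<^esub> v = \<zero>\<^bsub>H\<^esub>" if "u \<in> carrier H" "v \<in> carrier H" for u v
    using that by (simp add: H.add_diff_cancel_left)
  have "TR \<subseteq> {t \<in> carrier FS. lin t \<in> {\<zero>\<^bsub>H\<^esub>}}"
    by (rule TR_minimal[OF lin.submodule_vimage[OF zero_sub]])
      (simp_all add: lin_diff mem lin_single b' cancel)
  then have kill: "lin t = \<zero>\<^bsub>H\<^esub>" if "t \<in> TR" for t using that by blast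
  obtain g0 where g0: "bounded_linear_map AT H g0" "\<And>t. t \<in> carrier FS \<Longrightarrow> g0 (TR +>\<^bsub>FS\<^esub> t) = lin t"
    using FS.bounded_linear_map_lift[OF sH lin_bounded kill] unfolding alg_tensor_def by blast
  interpret g0: bounded_map AT H g0 by (intro bounded_mapI seminormed_AT sH g0)
  obtain g where g: "bounded_linear_map CT H g" "\<And>s. s \<in> carrier AT \<Longrightarrow> g (AT.completion_emb s) = g0 s"
    using g0.bounded_linear_map_completion[OF H] unfolding completed_tensor_def by blast
  show ?thesis
  proof (rule that[OF g(1)])
    fix x y assume xy: "x \<in> carrier E" "y \<in> carrier F"
    have "TR +>\<^bsub>FS\<^esub> Poly_Mapping.single (x, y) 1 \<in> carrier AT"
      unfolding alg_tensor_def FS.Q_carrier using mem[OF xy] by blast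
    then have "g (pure_tensor E F x y) = lin (Poly_Mapping.single (x, y) 1)"
      unfolding pure_tensor_eq by (simp add: g g0 mem[OF xy])
    also have "\<dots> = b x y" using lin_single[OF xy, of 1] b'(3)[OF xy] by simp
    finally show "g (pure_tensor E F x y) = b x y" .
  qed
qed

end

section \<open>Functoriality in the second factor\<close>

locale tensor_functor = E: nonarch_seminormed_space E + f: bounded_map F H f
  for E :: "('k::nonarch_field, 'x, 'm) nspace_scheme"
    and F :: "('k, 'y, 'n) nspace_scheme"
    and H :: "('k, 'z, 'p) nspace_scheme"
    and f
begin

sublocale EF: tensor_pair E F by unfold_locales
sublocale EH: tensor_pair E H by unfold_locales

lemma free_map_eq:
  assumes "finite A" "Poly_Mapping.keys t \<subseteq> A"
  shows "free_map f t = (\<Sum>p\<in>A. Poly_Mapping.single (fst p, f (snd p)) (Poly_Mapping.lookup t p))"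
  unfolding free_map_def case_prod_beta using assms
  by (intro sum.mono_neutral_cong_left) (auto simp: in_keys_iff)

lemma free_map_single: "free_map f (Poly_Mapping.single (x, y) c) = Poly_Mapping.single (x, f y) (c :: 'k)"
  using free_map_eq[of "{(x, y)}" "Poly_Mapping.single (x, y) c"] by simp

lemma free_map_bounded: "bounded_linear_map EF.FS EH.FS (free_map f)"
proof -
  obtain C where C: "C > 0" "\<And>y. y \<in> carrier F \<Longrightarrow> nrm H (f y) \<le> C * nrm F y" by (rule f.bound) auto
  show ?thesis
  proof (rule bounded_linear_mapI[where C = C])
    fix t assume t: "t \<in> carrier EF.FS"
    have g: "Poly_Mapping.single (fst p, f (snd p)) (Poly_Mapping.lookup t p) \<in> carrier EH.FS"
      if "p \<in> Poly_Mapping.keys t" for p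
      using that t by (intro EH.single_mem) (auto simp: EF.FS_simps)
    have eq: "free_map f t = (\<Sum>p\<in>Poly_Mapping.keys t. Poly_Mapping.single (fst p, f (snd p)) (Poly_Mapping.lookup t p))"
      by (rule free_map_eq) auto
    show "free_map f t \<in> carrier EH.FS"
      unfolding eq by (rule EH.FS_sum_mem[OF EH.FS.carrier_is_submodule g])
    show "nrm EH.FS (free_map f t) \<le> C * nrm EF.FS t"
      unfolding eq
    proof (rule EH.FS_nrm_sum_le[OF g])
      fix p assume p: "p \<in> Poly_Mapping.keys t"
      then have pc: "fst p \<in> carrier E" "snd p \<in> carrier F" using t by (auto simp: EF.FS_simps)
      have "nrm EH.FS (Poly_Mapping.single (fst p, f (snd p)) (Poly_Mapping.lookup t p))
          \<le> vabs (Poly_Mapping.lookup t p) * (nrm E (fst p) * nrm H (f (snd p)))"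
        using pc by (intro EH.nrm_single) auto
      also have "\<dots> \<le> vabs (Poly_Mapping.lookup t p) * (nrm E (fst p) * (C * nrm F (snd p)))"
        using pc C by (intro mult_left_mono E.nrm_nonneg) auto
      also have "\<dots> = C * EF.weight t p" by simp
      also have "\<dots> \<le> C * nrm EF.FS t" using C EF.weight_le by (intro mult_left_mono) auto
      finally show "nrm EH.FS (Poly_Mapping.single (fst p, f (snd p)) (Poly_Mapping.lookup t p)) \<le> C * nrm EF.FS t" .
    qed (use C EF.FS_nrm_nonneg in auto)
    show "free_map f (c \<odot>\<^bsub>EF.FS\<^esub> t) = c \<odot>\<^bsub>EH.FS\<^esub> free_map f t" for c
      unfolding EF.FS_simps EH.FS_simps eq free_map_eq[OF finite_keys EF.keys_smult_subset]
      by (rule poly_mapping_eqI) (simp add: lookup_sum lookup_smult lookup_single sum_distrib_left when_def if_distrib cong: if_cong)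
    show "free_map f (t \<oplus>\<^bsub>EF.FS\<^esub> s) = free_map f t \<oplus>\<^bsub>EH.FS\<^esub> free_map f s" for s
    proof -
      have fin: "finite (Poly_Mapping.keys t \<union> Poly_Mapping.keys s)" by simp
      show ?thesis
        unfolding EF.FS_simps EH.FS_simps free_map_eq[OF fin keys_add] free_map_eq[OF fin Un_upper1] free_map_eq[OF fin Un_upper2]
        by (simp add: lookup_add single_add sum.distrib)
    qed
  qed
qed

sublocale free_map: bounded_map EF.FS EH.FS "free_map f"
  by (intro bounded_mapI EF.seminormed_FS EH.seminormed_FS free_map_bounded)

lemma free_map_relations: "free_map f ` EF.TR \<subseteq> EH.TR"
proof -
  have mem: "Poly_Mapping.single (x, y) c \<in> carrier EF.FS" if "x \<in> carrier E" "y \<in> carrier F" for x y c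
    using that by (auto intro: EF.single_mem)
  have diff: "free_map f (s - t) = free_map f s - free_map f t" "s - t \<in> carrier EF.FS"
    if "s \<in> carrier EF.FS" "t \<in> carrier EF.FS" for s t
    using that free_map.diff[OF that] EF.FS.minus_mem[OF that] by (simp_all add: EF.FS_diff EH.FS_diff)
  have "EF.TR \<subseteq> {t \<in> carrier EF.FS. free_map f t \<in> EH.TR}"
    by (rule EF.TR_minimal[OF free_map.submodule_vimage[OF EH.TR_submodule]])
      (simp_all add: diff mem free_map_single f.add f.smult EH.TR)
  then show ?thesis by blast
qed

lemma completed_tensor_map_bounded: "bounded_linear_map EF.CT EH.CT (completed_tensor_map E H f)"
  and completed_tensor_map_pure: "\<lbrakk>x \<in> carrier E; y \<in> carrier F\<rbrakk>
    \<Longrightarrow> completed_tensor_map E H f (pure_tensor E F x y) = pure_tensor E H x (f y)"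
proof -
  let ?g = "coset_map EH.FS EH.TR (free_map f)"
  note g = coset_map[OF EF.FS.seminormed_quotient_axioms EH.FS.seminormed_quotient_axioms free_map_bounded free_map_relations]
  interpret g: bounded_map EF.AT EH.AT ?g
    using g(2) by (intro bounded_mapI EF.seminormed_AT EH.seminormed_AT) (simp add: alg_tensor_def)
  show "bounded_linear_map EF.CT EH.CT (completed_tensor_map E H f)"
    using g.completion_map(1) by (simp add: completed_tensor_def completed_tensor_map_def)
  assume xy: "x \<in> carrier E" "y \<in> carrier F"
  then have m: "Poly_Mapping.single (x, y) 1 \<in> carrier EF.FS" by (auto intro: EF.single_mem)
  then have m': "EF.TR +>\<^bsub>EF.FS\<^esub> Poly_Mapping.single (x, y) 1 \<in> carrier EF.AT"
    unfolding alg_tensor_def EF.FS.Q_carrier by blast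
  show "completed_tensor_map E H f (pure_tensor E F x y) = pure_tensor E H x (f y)"
    using g.completion_map(2)[OF m'] g(1)[OF m]
    by (simp add: EF.pure_tensor_eq EH.pure_tensor_eq completed_tensor_map_def free_map_single)
qed

end

section \<open>Flatness of the unitization\<close>

locale seminormed_algebra = nonarch_seminormed_space A
  for A :: "('k::nonarch_field, 'a, 'm) nspace_scheme" (structure) +
  assumes mult_mem: "\<lbrakk>a \<in> carrier A; b \<in> carrier A\<rbrakk> \<Longrightarrow> a \<otimes> b \<in> carrier A"
    and mult_zero_left: "a \<in> carrier A \<Longrightarrow> \<zero> \<otimes> a = \<zero>"
    and mult_zero_right: "a \<in> carrier A \<Longrightarrow> a \<otimes> \<zero> = \<zero>"
begin

abbreviation X where "X \<equiv> unitization_bimodule A"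

lemma X_simps: "carrier X = carrier A \<times> UNIV" "\<zero>\<^bsub>X\<^esub> = (\<zero>, 0)"
  "(a, s) \<oplus>\<^bsub>X\<^esub> (b, t) = (a \<oplus> b, s + t)" "c \<odot>\<^bsub>X\<^esub> (a, s) = (c \<odot> a, c * s)"
  "nrm X (a, s) = max (nrm A a) (vabs s)"
  by (simp_all add: unitization_bimodule_def unitization_def nspace.extend_def)

lemma lact_X: "\<lbrakk>a \<in> carrier A; b \<in> carrier A\<rbrakk> \<Longrightarrow> lact X a (b, s) = (a \<otimes> b \<oplus> s \<odot> a, 0)"
  by (simp add: unitization_bimodule_def unitization_def nspace.extend_def mult_mem)

lemma ract_X: "\<lbrakk>a \<in> carrier A; b \<in> carrier A\<rbrakk> \<Longrightarrow> ract X (b, s) a = (b \<otimes> a \<oplus> s \<odot> a, 0)"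
  by (simp add: unitization_bimodule_def unitization_def nspace.extend_def mult_mem)

lemma seminormed_X: "nonarch_seminormed_space X"
proof (rule nonarch_seminormed_spaceI)
  fix x y assume "x \<in> carrier X" "y \<in> carrier X"
  then obtain a s b t where *: "x = (a, s)" "y = (b, t)" "a \<in> carrier A" "b \<in> carrier A"
    by (auto simp: X_simps)
  show "nrm X (x \<oplus>\<^bsub>X\<^esub> y) \<le> max (nrm X x) (nrm X y)"
    using nrm_add[OF *(3,4)] vabs_add[of s t] unfolding *(1,2) X_simps by linarith
next
  fix x assume "x \<in> carrier X"
  then obtain a s where *: "x = (a, s)" "a \<in> carrier A"
    by (auto simp: X_simps)
  have "(-1) \<odot> a \<oplus> a = \<zero>" using * smult_add_left[of a "-1" 1] by simp
  then show "(- 1) \<odot>\<^bsub>X\<^esub> x \<oplus>\<^bsub>X\<^esub> x = \<zero>\<^bsub>X\<^esub>" using * by (simp add: X_simps)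
  show "nrm X (c \<odot>\<^bsub>X\<^esub> x) = vabs c * nrm X x" for c
    using * by (simp add: X_simps nrm_smult vabs_mult max_mult_distrib_left)
qed (auto simp: X_simps M.a_ac smult_add_left smult_add_right smult_mult algebra_simps nrm_nonneg
    le_max_iff_disj)

text \<open>Acting on the adjoined unit from the left and from the right gives the same element.
  Balancing therefore identifies \<open>1 \<otimes> a y\<close> with \<open>1 \<otimes> y a\<close>,
  and this is where the commutators come from.\<close>

lemma unit_action_X: "a \<in> carrier A \<Longrightarrow> lact X a (\<zero>, 1) = (a, 0)" "a \<in> carrier A \<Longrightarrow> ract X (\<zero>, 1) a = (a, 0)"
  by (simp_all add: lact_X ract_X mult_zero_left mult_zero_right)

end

text \<open>Dividing \<open>Y\<close> by this subspace gives the completed coinvariants of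
  \<open>Y\<close>, that is, Hochschild homology in degree zero with closed relations.\<close>

definition commutator_span :: "('k::nonarch_field, 'a, 'm) nspace_scheme \<Rightarrow> ('k, 'a, 'x, 'n) bimodule_scheme \<Rightarrow> 'x set" where
  "commutator_span A Y = closed_linear_span Y
     {lact Y a y \<ominus>\<^bsub>Y\<^esub> ract Y y a | a y. a \<in> carrier A \<and> y \<in> carrier Y}"

context banach_bimodule
begin

lemmas lact_mem = bounded_bilinear_mapD(3)[OF lact_bilinear]
  and lact_add_left = bounded_bilinear_mapD(4)[OF lact_bilinear]
  and lact_add_right = bounded_bilinear_mapD(5)[OF lact_bilinear]
  and lact_smult_left = bounded_bilinear_mapD(6)[OF lact_bilinear]
  and lact_smult_right = bounded_bilinear_mapD(7)[OF lact_bilinear]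
  and ract_mem = bounded_bilinear_mapD(3)[OF ract_bilinear]
  and ract_add_left = bounded_bilinear_mapD(4)[OF ract_bilinear]
  and ract_smult_left = bounded_bilinear_mapD(6)[OF ract_bilinear]

lemma commutator_span_closed: "closed_subspace X (commutator_span A X)"
  and commutator_mem: "\<lbrakk>a \<in> carrier A; y \<in> carrier X\<rbrakk> \<Longrightarrow> lact X a y \<ominus>\<^bsub>X\<^esub> ract X y a \<in> commutator_span A X"
proof -
  have "{lact X a y \<ominus>\<^bsub>X\<^esub> ract X y a | a y. a \<in> carrier A \<and> y \<in> carrier X} \<subseteq> carrier X"
    using lact_mem ract_mem by blast
  note s = closed_linear_span[OF this]
  show "closed_subspace X (commutator_span A X)"
    using s by (simp add: commutator_span_def)
  show "\<lbrakk>a \<in> carrier A; y \<in> carrier X\<rbrakk> \<Longrightarrow> lact X a y \<ominus>\<^bsub>X\<^esub> ract X y a \<in> commutator_span A X"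
    using s(2) unfolding commutator_span_def by blast
qed

lemmas commutator_span_submodule = closed_subspaceD(1)[OF commutator_span_closed]

lemma commutator_span_minimal:
  assumes "closed_subspace X N" "\<And>a y. \<lbrakk>a \<in> carrier A; y \<in> carrier X\<rbrakk> \<Longrightarrow> lact X a y \<ominus>\<^bsub>X\<^esub> ract X y a \<in> N"
  shows "commutator_span A X \<subseteq> N"
  unfolding commutator_span_def by (rule closed_linear_span_minimal[OF assms(1)]) (use assms(2) in blast)

end

section \<open>Contracting the tensor product with the unitization onto the module\<close>

locale algebra_bimodule = A: seminormed_algebra A + Y: banach_bimodule A Y
  for A :: "('k::nonarch_field, 'a, 'm) nspace_scheme"
    and Y :: "('k, 'a, 'y, 'n) bimodule_scheme"
begin

sublocale X: nonarch_seminormed_space A.X by (rule A.seminormed_X)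

sublocale T: tensor_pair A.X Y by unfold_locales

text \<open>The left action extended to the unitization. The adjoined unit acts as the identity even
  when \<open>A\<close> has a unit that acts differently.\<close>

definition unit_act where
  "unit_act x y = lact Y (fst x) y \<oplus>\<^bsub>Y\<^esub> snd x \<odot>\<^bsub>Y\<^esub> y"

lemma unit_act_bilinear: "bounded_bilinear_map A.X Y Y unit_act"
proof -
  obtain C where C: "\<And>a y. \<lbrakk>a \<in> carrier A; y \<in> carrier Y\<rbrakk> \<Longrightarrow> nrm Y (lact Y a y) \<le> C * nrm A a * nrm Y y"
    using Y.lact_bilinear unfolding bounded_bilinear_map_def by blast
  define D where "D = max C 1"
  have D: "C \<le> D" "1 \<le> D" by (auto simp: D_def)
  have bound: "nrm Y (unit_act x y) \<le> D * nrm A.X x * nrm Y y" if xy: "x \<in> carrier A.X" "y \<in> carrier Y" for x y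
  proof -
    obtain a s where x: "x = (a, s)" "a \<in> carrier A" using xy(1) by (auto simp: A.X_simps)
    have n: "0 \<le> nrm Y y" "0 \<le> nrm A a" using xy x by (auto intro: Y.nrm_nonneg A.nrm_nonneg)
    have "nrm Y (lact Y a y) \<le> C * nrm A a * nrm Y y" using C x xy by auto
    also have "\<dots> \<le> D * nrm A.X x * nrm Y y"
      unfolding x A.X_simps using n D by (intro mult_right_mono mult_mono) auto
    finally have 1: "nrm Y (lact Y a y) \<le> D * nrm A.X x * nrm Y y" .
    have "nrm Y (s \<odot>\<^bsub>Y\<^esub> y) = 1 * vabs s * nrm Y y" using xy by (simp add: Y.nrm_smult)
    also have "\<dots> \<le> D * nrm A.X x * nrm Y y"
      unfolding x A.X_simps using n D by (intro mult_right_mono mult_mono) auto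
    finally show ?thesis
      using 1 Y.nrm_add[of "lact Y a y" "s \<odot>\<^bsub>Y\<^esub> y"] x xy Y.lact_mem by (auto simp: unit_act_def)
  qed
  show ?thesis
    unfolding bounded_bilinear_map_def
  proof (intro conjI ballI exI)
    fix x assume x: "x \<in> carrier A.X"
    show "bounded_linear_map Y Y (unit_act x)"
    proof (rule bounded_linear_mapI[where C = "D * nrm A.X x"])
      show "nrm Y (unit_act x y) \<le> D * nrm A.X x * nrm Y y" if "y \<in> carrier Y" for y
        using bound[OF x that] .
    qed (use x in \<open>auto simp: unit_act_def A.X_simps Y.lact_mem Y.lact_add_right Y.lact_smult_right
          Y.smult_add_right Y.M.a_ac mult.commute simp flip: Y.smult_mult\<close>)
  next
    fix y assume y: "y \<in> carrier Y"
    show "bounded_linear_map A.X Y (\<lambda>x. unit_act x y)"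
    proof (rule bounded_linear_mapI[where C = "D * nrm Y y"])
      show "nrm Y (unit_act x y) \<le> D * nrm Y y * nrm A.X x" if "x \<in> carrier A.X" for x
        using bound[OF that y] by (simp add: mult_ac)
    qed (use y in \<open>auto simp: unit_act_def A.X_simps Y.lact_mem Y.lact_add_left Y.lact_smult_left
          Y.smult_add_right Y.smult_add_left Y.smult_mult Y.M.a_ac\<close>)
  qed (use bound in blast)
qed

definition contract where
  "contract = (SOME g. bounded_linear_map T.CT Y g \<and>
     (\<forall>x\<in>carrier A.X. \<forall>y\<in>carrier Y. g (pure_tensor A.X Y x y) = unit_act x y))"

lemma contract_bounded: "bounded_linear_map T.CT Y contract"
  and contract_pure: "\<lbrakk>x \<in> carrier A.X; y \<in> carrier Y\<rbrakk> \<Longrightarrow> contract (pure_tensor A.X Y x y) = unit_act x y"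
proof -
  have "\<exists>g. bounded_linear_map T.CT Y g \<and>
     (\<forall>x\<in>carrier A.X. \<forall>y\<in>carrier Y. g (pure_tensor A.X Y x y) = unit_act x y)"
    using T.completed_tensor_lift[OF Y.nonarch_banach_space_axioms unit_act_bilinear] by metis
  from someI_ex[OF this] show "bounded_linear_map T.CT Y contract"
    and "\<lbrakk>x \<in> carrier A.X; y \<in> carrier Y\<rbrakk> \<Longrightarrow> contract (pure_tensor A.X Y x y) = unit_act x y"
    unfolding contract_def by blast+
qed

sublocale contract: bounded_map T.CT Y contract
  by (intro bounded_mapI T.seminormed_CT contract_bounded) unfold_locales

abbreviation B where "B \<equiv> balanced_relations A A.X Y"
abbreviation N where "N \<equiv> commutator_span A Y"
abbreviation e where "e y \<equiv> pure_tensor A.X Y (\<zero>\<^bsub>A\<^esub>, 1) y"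

lemma unit_mem: "(\<zero>\<^bsub>A\<^esub>, 1) \<in> carrier A.X"
  by (simp add: A.X_simps)

lemma e_bounded: "bounded_linear_map Y T.CT e"
  by (rule bounded_bilinear_mapD(1)[OF T.pure_bilinear unit_mem])

lemma Y_seminormed: "nonarch_seminormed_space Y"
  by unfold_locales

sublocale e: bounded_map Y T.CT e
  by (intro bounded_mapI T.seminormed_CT e_bounded Y_seminormed)

lemma contract_e: "y \<in> carrier Y \<Longrightarrow> contract (e y) = y"
  using bounded_linear_mapD(3)[OF bounded_bilinear_mapD(2)[OF Y.lact_bilinear, of y], of "\<zero>\<^bsub>A\<^esub>" 0] Y.lact_mem[of "\<zero>\<^bsub>A\<^esub>" y]
  by (simp add: contract_pure unit_mem unit_act_def)

lemma balanced: shows B_closed: "closed_subspace T.CT B"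
  and balanced_right: "\<lbrakk>a \<in> carrier A; x \<in> carrier A.X; y \<in> carrier Y\<rbrakk> \<Longrightarrow>
    pure_tensor A.X Y (ract A.X x a) y \<ominus>\<^bsub>T.CT\<^esub> pure_tensor A.X Y x (lact Y a y) \<in> B"
  and balanced_left: "\<lbrakk>a \<in> carrier A; x \<in> carrier A.X; y \<in> carrier Y\<rbrakk> \<Longrightarrow>
    pure_tensor A.X Y (lact A.X a x) y \<ominus>\<^bsub>T.CT\<^esub> pure_tensor A.X Y x (ract Y y a) \<in> B"
proof -
  let ?R = "{pure_tensor A.X Y (ract A.X x a) y \<ominus>\<^bsub>T.CT\<^esub> pure_tensor A.X Y x (lact Y a y) |
         a x y. a \<in> carrier A \<and> x \<in> carrier A.X \<and> y \<in> carrier Y}"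
  let ?L = "{pure_tensor A.X Y (lact A.X a x) y \<ominus>\<^bsub>T.CT\<^esub> pure_tensor A.X Y x (ract Y y a) |
         a x y. a \<in> carrier A \<and> x \<in> carrier A.X \<and> y \<in> carrier Y}"
  have act: "lact A.X a x \<in> carrier A.X" "ract A.X x a \<in> carrier A.X" if "a \<in> carrier A" "x \<in> carrier A.X" for a x
    using that by (auto simp: A.X_simps A.lact_X A.ract_X A.mult_mem)
  have "?R \<union> ?L \<subseteq> carrier T.CT"
    by (auto intro!: T.CT.minus_mem T.pure_mem act Y.lact_mem Y.ract_mem)
  note s = T.CT.closed_linear_span[OF this]
  show "closed_subspace T.CT B" using s(1) by (simp add: balanced_relations_def)
  have RL: "?R \<union> ?L \<subseteq> B" using s(2) by (simp add: balanced_relations_def)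
  show "\<lbrakk>a \<in> carrier A; x \<in> carrier A.X; y \<in> carrier Y\<rbrakk> \<Longrightarrow>
    pure_tensor A.X Y (ract A.X x a) y \<ominus>\<^bsub>T.CT\<^esub> pure_tensor A.X Y x (lact Y a y) \<in> B"
    by (rule subsetD[OF RL], rule UnI1, rule CollectI, (rule exI)+, rule conjI, rule refl, simp)
  show "\<lbrakk>a \<in> carrier A; x \<in> carrier A.X; y \<in> carrier Y\<rbrakk> \<Longrightarrow>
    pure_tensor A.X Y (lact A.X a x) y \<ominus>\<^bsub>T.CT\<^esub> pure_tensor A.X Y x (ract Y y a) \<in> B"
    by (rule subsetD[OF RL], rule UnI2, rule CollectI, (rule exI)+, rule conjI, rule refl, simp)
qed

lemma B_minimal:
  assumes "closed_subspace T.CT S"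
   and "\<And>a x y. \<lbrakk>a \<in> carrier A; x \<in> carrier A.X; y \<in> carrier Y\<rbrakk> \<Longrightarrow>
    pure_tensor A.X Y (ract A.X x a) y \<ominus>\<^bsub>T.CT\<^esub> pure_tensor A.X Y x (lact Y a y) \<in> S"
  and "\<And>a x y. \<lbrakk>a \<in> carrier A; x \<in> carrier A.X; y \<in> carrier Y\<rbrakk> \<Longrightarrow>
    pure_tensor A.X Y (lact A.X a x) y \<ominus>\<^bsub>T.CT\<^esub> pure_tensor A.X Y x (ract Y y a) \<in> S"
  shows "B \<subseteq> S"
  unfolding balanced_relations_def
  by (rule T.CT.closed_linear_span_minimal[OF assms(1)], intro Un_least subsetI;
      elim CollectE exE conjE; simp only: assms(2,3))

text \<open>Modulo the balancing relations both \<open>1 \<otimes> a y\<close> and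
  \<open>1 \<otimes> y a\<close> equal \<open>(a, 0) \<otimes> y\<close>, so \<open>e\<close> sends
  a commutator to the difference of two relations.\<close>

lemma e_N: "e ` N \<subseteq> B"
proof -
  note B = T.CT.submodule_mem[OF T.CT.closed_subspaceD(1)[OF B_closed]]
  have "N \<subseteq> {y \<in> carrier Y. e y \<in> B}"
  proof (rule Y.commutator_span_minimal[OF e.closed_subspace_vimage[OF B_closed]])
    fix a y assume ay: "a \<in> carrier A" "y \<in> carrier Y"
    let ?p = "pure_tensor A.X Y (a, 0) y"
    note m = Y.lact_mem[OF ay] Y.ract_mem[OF ay(2,1)]
    have p: "?p \<in> carrier T.CT" using ay by (intro T.pure_mem) (auto simp: A.X_simps)
    have 1: "?p \<ominus>\<^bsub>T.CT\<^esub> e (lact Y a y) \<in> B" "?p \<ominus>\<^bsub>T.CT\<^esub> e (ract Y y a) \<in> B"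
      using balanced_right[OF ay(1) unit_mem ay(2)] balanced_left[OF ay(1) unit_mem ay(2)]
      by (simp_all add: A.unit_action_X ay)
    have "e (lact Y a y \<ominus>\<^bsub>Y\<^esub> ract Y y a) =
      (?p \<ominus>\<^bsub>T.CT\<^esub> e (ract Y y a)) \<ominus>\<^bsub>T.CT\<^esub> (?p \<ominus>\<^bsub>T.CT\<^esub> e (lact Y a y))"
      using m p e.mem[OF m(1)] e.mem[OF m(2)]
      by (simp add: e.diff a_minus_def[of T.CT] T.CT.M.minus_add T.CT.M.a_ac T.CT.M.r_neg1 T.CT.M.r_neg2)
    then show "lact Y a y \<ominus>\<^bsub>Y\<^esub> ract Y y a \<in> {y \<in> carrier Y. e y \<in> B}"
      using m B(5)[OF 1(2,1)] by simp
  qed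
  then show ?thesis by blast
qed

text \<open>On a pure tensor with first factor \<open>(a, s)\<close> the scalar part cancels, and
  \<open>(a, 0) \<otimes> y - 1 \<otimes> a y\<close> remains, which is a right balancing relation.
  Pure tensors suffice because \<open>B\<close> is closed.\<close>

lemma diff_e_contract_mem:
  assumes "t \<in> carrier T.CT"
  shows "t \<ominus>\<^bsub>T.CT\<^esub> e (contract t) \<in> B"
proof -
  note B = T.CT.submodule_mem[OF T.CT.closed_subspaceD(1)[OF B_closed]]
  let ?f = "\<lambda>t. t \<ominus>\<^bsub>T.CT\<^esub> e (contract t)"
  interpret f: bounded_map T.CT T.CT ?f
    by (intro bounded_mapI bounded_linear_map_diff bounded_linear_map_id T.seminormed_CT
        bounded_linear_map_comp[OF _ _ _ contract_bounded e_bounded] Y_seminormed)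
  have "carrier T.CT \<subseteq> {t \<in> carrier T.CT. ?f t \<in> B}"
  proof (rule T.completed_tensor_span[OF f.closed_subspace_vimage[OF B_closed]])
    fix x y assume xy: "x \<in> carrier A.X" "y \<in> carrier Y"
    then obtain a s where x: "x = (a, s)" "a \<in> carrier A" by (auto simp: A.X_simps)
    let ?p = "pure_tensor A.X Y (a, 0) y"
    have a0: "(a, 0) \<in> carrier A.X" using x by (simp add: A.X_simps)
    have p: "?p \<in> carrier T.CT" using xy a0 by (intro T.pure_mem)
    note pb = bounded_bilinear_mapD[OF T.pure_bilinear]
    have "x = (a, 0) \<oplus>\<^bsub>A.X\<^esub> s \<odot>\<^bsub>A.X\<^esub> (\<zero>\<^bsub>A\<^esub>, 1)" using x by (simp add: A.X_simps)
    then have "pure_tensor A.X Y x y = ?p \<oplus>\<^bsub>T.CT\<^esub> s \<odot>\<^bsub>T.CT\<^esub> e y"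
      using xy unit_mem a0 by (simp add: pb)
    moreover have "e (contract (pure_tensor A.X Y x y)) = e (lact Y a y) \<oplus>\<^bsub>T.CT\<^esub> s \<odot>\<^bsub>T.CT\<^esub> e y"
      using xy x Y.lact_mem by (simp add: contract_pure unit_act_def e.add e.smult)
    ultimately have "?f (pure_tensor A.X Y x y) = ?p \<ominus>\<^bsub>T.CT\<^esub> e (lact Y a y)"
      using p xy x Y.lact_mem by (simp add: T.CT.add_diff_add)
    also have "\<dots> \<in> B"
      using balanced_right[OF x(2) unit_mem xy(2)] x by (simp add: A.unit_action_X)
    finally show "pure_tensor A.X Y x y \<in> {t \<in> carrier T.CT. ?f t \<in> B}"
      using T.pure_mem[OF xy] by simp
  qed
  then show ?thesis using assms by blast
qed

text \<open>Right balancing relations contract to zero by associativity of the action. A left one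
  contracts to the commutator of \<open>a\<close> with \<open>unit_act x y\<close>.\<close>

lemma contract_B: "contract ` B \<subseteq> N"
proof -
  note N = Y.submodule_mem[OF Y.commutator_span_submodule]
  have "B \<subseteq> {t \<in> carrier T.CT. contract t \<in> N}"
  proof (rule B_minimal[OF contract.closed_subspace_vimage[OF Y.commutator_span_closed]])
    fix a x y assume axy: "a \<in> carrier A" "x \<in> carrier A.X" "y \<in> carrier Y"
    then obtain b s where x: "x = (b, s)" "b \<in> carrier A" by (auto simp: A.X_simps)
    note mem = Y.lact_mem Y.ract_mem A.mult_mem
    let ?r = "ract A.X x a" and ?l = "lact A.X a x"
    have r: "?r = (b \<otimes>\<^bsub>A\<^esub> a \<oplus>\<^bsub>A\<^esub> s \<odot>\<^bsub>A\<^esub> a, 0)" and l: "?l = (a \<otimes>\<^bsub>A\<^esub> b \<oplus>\<^bsub>A\<^esub> s \<odot>\<^bsub>A\<^esub> a, 0)"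
      using x axy by (simp_all add: A.ract_X A.lact_X)
    have rl: "?r \<in> carrier A.X" "?l \<in> carrier A.X"
      unfolding r l using x axy by (auto simp: A.X_simps mem)
    have "contract (pure_tensor A.X Y ?r y) = contract (pure_tensor A.X Y x (lact Y a y))"
      using axy x rl mem unfolding r
      by (simp add: contract_pure unit_act_def Y.lact_add_left Y.lact_smult_left Y.lact_assoc)
    then have 1: "contract (pure_tensor A.X Y ?r y \<ominus>\<^bsub>T.CT\<^esub> pure_tensor A.X Y x (lact Y a y)) \<in> N"
      using axy rl mem T.pure_mem N(2) by (simp add: contract.diff)
    then show "pure_tensor A.X Y ?r y \<ominus>\<^bsub>T.CT\<^esub> pure_tensor A.X Y x (lact Y a y) \<in> {t \<in> carrier T.CT. contract t \<in> N}"
      using axy rl mem T.pure_mem by simp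
    have "contract (pure_tensor A.X Y ?l y) = lact Y a (lact Y b y) \<oplus>\<^bsub>Y\<^esub> s \<odot>\<^bsub>Y\<^esub> lact Y a y"
      using axy x rl mem unfolding l
      by (simp add: contract_pure unit_act_def Y.lact_add_left Y.lact_smult_left Y.lact_assoc)
    also have "\<dots> = lact Y a (lact Y b y \<oplus>\<^bsub>Y\<^esub> s \<odot>\<^bsub>Y\<^esub> y)"
      using axy x mem by (simp add: Y.lact_add_right Y.lact_smult_right)
    finally have L: "contract (pure_tensor A.X Y ?l y) = lact Y a (lact Y b y \<oplus>\<^bsub>Y\<^esub> s \<odot>\<^bsub>Y\<^esub> y)" .
    have "contract (pure_tensor A.X Y x (ract Y y a)) = lact Y b (ract Y y a) \<oplus>\<^bsub>Y\<^esub> s \<odot>\<^bsub>Y\<^esub> ract Y y a"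
      using axy x mem by (simp add: contract_pure unit_act_def)
    also have "\<dots> = ract Y (lact Y b y \<oplus>\<^bsub>Y\<^esub> s \<odot>\<^bsub>Y\<^esub> y) a"
      using axy x mem by (simp add: Y.ract_add_left Y.ract_smult_left Y.lact_ract)
    finally have R: "contract (pure_tensor A.X Y x (ract Y y a)) = ract Y (lact Y b y \<oplus>\<^bsub>Y\<^esub> s \<odot>\<^bsub>Y\<^esub> y) a" .
    have "contract (pure_tensor A.X Y ?l y \<ominus>\<^bsub>T.CT\<^esub> pure_tensor A.X Y x (ract Y y a)) \<in> N"
      using axy rl mem T.pure_mem Y.commutator_mem[of a "lact Y b y \<oplus>\<^bsub>Y\<^esub> s \<odot>\<^bsub>Y\<^esub> y"] x(2)
      by (simp add: contract.diff L R)
    then show "pure_tensor A.X Y ?l y \<ominus>\<^bsub>T.CT\<^esub> pure_tensor A.X Y x (ract Y y a) \<in> {t \<in> carrier T.CT. contract t \<in> N}"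
      using axy rl mem T.pure_mem by simp
  qed
  then show ?thesis by blast
qed

text \<open>Since \<open>e\<close> is a section of \<open>contract\<close>, this identifies the
  bimodule tensor product with \<open>Y\<close> modulo \<open>N\<close> on the level of
  representatives.\<close>

lemma mem_B_iff:
  assumes "t \<in> carrier T.CT"
  shows "t \<in> B \<longleftrightarrow> contract t \<in> N"
proof
  note B = T.CT.submodule_mem[OF T.CT.closed_subspaceD(1)[OF B_closed]]
  assume "contract t \<in> N"
  then have "e (contract t) \<in> B" using e_N by blast
  then have "(t \<ominus>\<^bsub>T.CT\<^esub> e (contract t)) \<oplus>\<^bsub>T.CT\<^esub> e (contract t) \<in> B"
    using diff_e_contract_mem[OF assms] B by blast
  then show "t \<in> B" using assms by simp
qed (use contract_B in blast)

sublocale BT: seminormed_quotient T.CT B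
  by (intro seminormed_quotientI T.seminormed_CT T.CT.closed_subspaceD(1)[OF B_closed])

end

section \<open>Naturality of the contraction and exactness in terms of commutators\<close>

locale bimodule_map = Y: algebra_bimodule A Y + Z: algebra_bimodule A Z
  for A :: "('k::nonarch_field, 'a, 'm) nspace_scheme"
    and Y :: "('k, 'a, 'y, 'n) bimodule_scheme"
    and Z :: "('k, 'a, 'z, 'p) bimodule_scheme" +
  fixes d
  assumes hom: "bimodule_hom A Y Z d"
begin

lemma d_bounded: "bounded_linear_map Y Z d"
  using hom by (simp add: bimodule_hom_def)

lemma d_lact: "\<lbrakk>a \<in> carrier A; y \<in> carrier Y\<rbrakk> \<Longrightarrow> d (lact Y a y) = lact Z a (d y)"
  and d_ract: "\<lbrakk>a \<in> carrier A; y \<in> carrier Y\<rbrakk> \<Longrightarrow> d (ract Y y a) = ract Z (d y) a"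
  using hom by (simp_all add: bimodule_hom_def)

sublocale d: bounded_map Y Z d
  by (intro bounded_mapI d_bounded Y.Y_seminormed Z.Y_seminormed)

lemma d_commutator_span: "d ` Y.N \<subseteq> Z.N"
proof -
  have "Y.N \<subseteq> {y \<in> carrier Y. d y \<in> Z.N}"
    by (rule Y.Y.commutator_span_minimal[OF d.closed_subspace_vimage[OF Z.Y.commutator_span_closed]])
      (simp add: Y.Y.lact_mem Y.Y.ract_mem d.diff d_lact d_ract Z.Y.commutator_mem)
  then show ?thesis by blast
qed

abbreviation m where "m \<equiv> completed_tensor_map Y.A.X Z d"

sublocale F: tensor_functor Y.A.X Y Z d
  by unfold_locales

sublocale m: bounded_map Y.T.CT Z.T.CT m
  by (intro bounded_mapI Y.T.seminormed_CT Z.T.seminormed_CT F.completed_tensor_map_bounded)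

text \<open>Both sides are bounded in \<open>t\<close>, and on pure tensors the identity expresses
  that \<open>d\<close> commutes with the left action.\<close>

lemma contract_natural:
  assumes "t \<in> carrier Y.T.CT"
  shows "Z.contract (m t) = d (Y.contract t)"
proof -
  let ?f = "\<lambda>t. Z.contract (m t) \<ominus>\<^bsub>Z\<^esub> d (Y.contract t)"
  interpret f: bounded_map Y.T.CT Z ?f
    by (intro bounded_mapI bounded_linear_map_diff Y.T.seminormed_CT Z.Y_seminormed
        bounded_linear_map_comp[OF _ _ _ F.completed_tensor_map_bounded Z.contract_bounded]
        bounded_linear_map_comp[OF _ _ _ Y.contract_bounded d_bounded] Z.T.seminormed_CT Y.Y_seminormed)
  have "carrier Y.T.CT \<subseteq> {t \<in> carrier Y.T.CT. ?f t \<in> {\<zero>\<^bsub>Z\<^esub>}}"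
  proof (rule Y.T.completed_tensor_span[OF f.closed_subspace_vimage[OF Z.Y.closed_subspace_zero]])
    fix x y assume xy: "x \<in> carrier Y.A.X" "y \<in> carrier Y"
    then obtain a s where x: "x = (a, s)" "a \<in> carrier A" by (auto simp: Y.A.X_simps)
    have "Z.contract (m (pure_tensor Y.A.X Y x y)) = d (Y.contract (pure_tensor Y.A.X Y x y))"
      using xy x by (simp add: F.completed_tensor_map_pure Z.contract_pure Y.contract_pure Z.unit_act_def Y.unit_act_def
          d.add d.smult d_lact Y.Y.lact_mem)
    then show "pure_tensor Y.A.X Y x y \<in> {t \<in> carrier Y.T.CT. ?f t \<in> {\<zero>\<^bsub>Z\<^esub>}}"
      using xy Y.T.pure_mem[OF xy] by simp
  qed
  then have "?f t = \<zero>\<^bsub>Z\<^esub>" using assms by blast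
  then show ?thesis using assms by (simp add: Z.Y.minus_eq_zero_iff)
qed

lemma m_B: "m ` Y.B \<subseteq> Z.B"
proof
  fix u assume "u \<in> m ` Y.B"
  then obtain t where t: "t \<in> Y.B" "u = m t" by blast
  then have tc: "t \<in> carrier Y.T.CT" using Y.BT.N_subset by blast
  then have "d (Y.contract t) \<in> Z.N" using t d_commutator_span Y.contract_B by blast
  then show "u \<in> Z.B" using t tc by (simp add: Z.mem_B_iff contract_natural)
qed

lemma bimodule_tensor_map_coset:
  "t \<in> carrier Y.T.CT \<Longrightarrow> bimodule_tensor_map A Y.A.X Z d (Y.B +>\<^bsub>Y.T.CT\<^esub> t) = Z.B +>\<^bsub>Z.T.CT\<^esub> m t"
  unfolding bimodule_tensor_map_def
  by (rule coset_map(1)[OF Y.BT.seminormed_quotient_axioms Z.BT.seminormed_quotient_axioms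
        F.completed_tensor_map_bounded m_B])

end

text \<open>
  Since the unitization is generated by its unit as a bimodule, tensoring with it is the same
  as dividing by the closed span of the commutators \<open>a y - y a\<close>.
\<close>

lemma bimodule_tensor_exact_iff:
  assumes "bimodule_map A Y Z d" "bimodule_map A Z W d'"
  shows "a_kernel (bimodule_tensor A (unitization_bimodule A) Z) (bimodule_tensor A (unitization_bimodule A) W)
      (bimodule_tensor_map A (unitization_bimodule A) W d') =
      bimodule_tensor_map A (unitization_bimodule A) Z d ` carrier (bimodule_tensor A (unitization_bimodule A) Y) \<longleftrightarrow>
    (\<forall>z\<in>carrier Z. d' z \<in> commutator_span A W \<longleftrightarrow> (\<exists>y\<in>carrier Y. z \<ominus>\<^bsub>Z\<^esub> d y \<in> commutator_span A Z))"
proof -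
  interpret d: bimodule_map A Y Z d by fact
  interpret d': bimodule_map A Z W d' by fact
  let ?D = "bimodule_tensor_map A d.Y.A.X Z d" and ?D' = "bimodule_tensor_map A d.Y.A.X W d'"
  let ?c = "\<lambda>t. d.Z.B +>\<^bsub>d.Z.T.CT\<^esub> t"
  have ker: "?D' (?c t) = d'.Z.B \<longleftrightarrow> d' (d.Z.contract t) \<in> d'.Z.N" if t: "t \<in> carrier d.Z.T.CT" for t
  proof -
    have "?D' (?c t) = d'.Z.B \<longleftrightarrow> d'.m t \<in> d'.Z.B"
      using d'.Z.BT.coset_eq_iff[of "d'.m t" "\<zero>\<^bsub>d'.Z.T.CT\<^esub>"] t
      by (simp add: d'.bimodule_tensor_map_coset d'.Z.BT.coset_zero)
    then show ?thesis using t by (simp add: d'.Z.mem_B_iff d'.contract_natural)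
  qed
  have im: "?c t \<in> ?D ` carrier (bimodule_tensor A d.Y.A.X Y) \<longleftrightarrow>
      (\<exists>y\<in>carrier Y. d.Z.contract t \<ominus>\<^bsub>Z\<^esub> d y \<in> d.Z.N)" if t: "t \<in> carrier d.Z.T.CT" for t
  proof -
    have "carrier (bimodule_tensor A d.Y.A.X Y) = (\<lambda>u. d.Y.B +>\<^bsub>d.Y.T.CT\<^esub> u) ` carrier d.Y.T.CT"
      unfolding bimodule_tensor_def by (rule d.Y.BT.Q_carrier)
    then have "?D ` carrier (bimodule_tensor A d.Y.A.X Y) = (\<lambda>u. ?c (d.m u)) ` carrier d.Y.T.CT"
      by (simp add: image_image d.bimodule_tensor_map_coset)
    then have "?c t \<in> ?D ` carrier (bimodule_tensor A d.Y.A.X Y) \<longleftrightarrow> (\<exists>u\<in>carrier d.Y.T.CT. ?c t = ?c (d.m u))"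
      by (auto simp: image_iff)
    also have "\<dots> \<longleftrightarrow> (\<exists>u\<in>carrier d.Y.T.CT. d.Z.contract t \<ominus>\<^bsub>Z\<^esub> d (d.Y.contract u) \<in> d.Z.N)"
      using t by (intro bex_cong refl)
        (simp add: d.Z.BT.coset_eq_iff d.Z.mem_B_iff d.Z.contract.diff d.contract_natural)
    \<comment> \<open>\<open>contract\<close> is onto because \<open>e\<close> is a section of it,
      so its values run through all of \<open>Y\<close>.\<close>
    also have "\<dots> \<longleftrightarrow> (\<exists>y\<in>carrier Y. d.Z.contract t \<ominus>\<^bsub>Z\<^esub> d y \<in> d.Z.N)"
      by (metis d.Y.contract.mem d.Y.contract_e d.Y.e.mem)
    finally show ?thesis .
  qed
  have Tc: "carrier (bimodule_tensor A d.Y.A.X Z) = ?c ` carrier d.Z.T.CT"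
    unfolding bimodule_tensor_def by (rule d.Z.BT.Q_carrier)
  have sub: "?D ` carrier (bimodule_tensor A d.Y.A.X Y) \<subseteq> carrier (bimodule_tensor A d.Y.A.X Z)"
  proof -
    have "carrier (bimodule_tensor A d.Y.A.X Y) = (\<lambda>u. d.Y.B +>\<^bsub>d.Y.T.CT\<^esub> u) ` carrier d.Y.T.CT"
      unfolding bimodule_tensor_def by (rule d.Y.BT.Q_carrier)
    then show ?thesis by (auto simp: Tc d.bimodule_tensor_map_coset)
  qed
  \<comment> \<open>Turns the equality of kernel and image, which are sets of cosets, into a
    condition on representatives.\<close>
  have aux: "{u \<in> c ` S. P u} = V \<longleftrightarrow> (\<forall>t\<in>S. P (c t) \<longleftrightarrow> c t \<in> V)" if "V \<subseteq> c ` S"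
    for V and S :: "('k, 'a \<times> 'k, 'z) ctensor set" and c :: "_ \<Rightarrow> ('k, 'a \<times> 'k, 'y) ctensor set" and P
    using that by blast
  have zero: "\<zero>\<^bsub>bimodule_tensor A d.Y.A.X W\<^esub> = d'.Z.B"
    by (simp add: bimodule_tensor_def quotient_space_def)
  have "a_kernel (bimodule_tensor A d.Y.A.X Z) (bimodule_tensor A d.Y.A.X W) ?D'
      = ?D ` carrier (bimodule_tensor A d.Y.A.X Y) \<longleftrightarrow>
    (\<forall>t\<in>carrier d.Z.T.CT. ?D' (?c t) = d'.Z.B \<longleftrightarrow> ?c t \<in> ?D ` carrier (bimodule_tensor A d.Y.A.X Y))"
    using aux[OF sub[unfolded Tc], of "\<lambda>u. ?D' u = d'.Z.B"] by (simp add: a_kernel_def' zero Tc)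
  also have "\<dots> \<longleftrightarrow> (\<forall>t\<in>carrier d.Z.T.CT. d' (d.Z.contract t) \<in> d'.Z.N \<longleftrightarrow>
      (\<exists>y\<in>carrier Y. d.Z.contract t \<ominus>\<^bsub>Z\<^esub> d y \<in> d.Z.N))"
    by (intro ball_cong refl) (simp only: ker im)
  also have "\<dots> \<longleftrightarrow> (\<forall>z\<in>carrier Z. d' z \<in> d'.Z.N \<longleftrightarrow> (\<exists>y\<in>carrier Y. z \<ominus>\<^bsub>Z\<^esub> d y \<in> d.Z.N))"
    by (metis d.Z.contract.mem d.Z.contract_e d.Z.e.mem)
  finally show ?thesis .
qed

text \<open>From here on no tensor product occurs. What remains to be decided is whether every
  cocycle modulo commutators is a boundary modulo commutators, and conversely.\<close>

lemma (in seminormed_algebra) amenable_iff: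
  "amenable (U :: 'u itself) A \<longleftrightarrow>
    (\<forall>(Y :: int \<Rightarrow> ('k, 'a, 'u) bimodule) d. bimodule_complex A Y d \<and> admissible_complex Y d \<longrightarrow>
      (\<forall>n. \<forall>z\<in>carrier (Y n). d n z \<in> commutator_span A (Y (n - 1)) \<longleftrightarrow>
        (\<exists>y\<in>carrier (Y (n + 1)). z \<ominus>\<^bsub>Y n\<^esub> d (n + 1) y \<in> commutator_span A (Y n))))"
proof -
  have "exact_complex (\<lambda>n. bimodule_tensor A X (Y n)) (\<lambda>n. bimodule_tensor_map A X (Y (n - 1)) (d n)) \<longleftrightarrow>
      (\<forall>n. \<forall>z\<in>carrier (Y n). d n z \<in> commutator_span A (Y (n - 1)) \<longleftrightarrow>
        (\<exists>y\<in>carrier (Y (n + 1)). z \<ominus>\<^bsub>Y n\<^esub> d (n + 1) y \<in> commutator_span A (Y n)))"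
    if c: "bimodule_complex A Y d" for Y :: "int \<Rightarrow> ('k, 'a, 'u) bimodule" and d
  proof -
    have b: "banach_bimodule A (Y n)" and h: "bimodule_hom A (Y n) (Y (n - 1)) (d n)" for n
      using c by (auto simp: bimodule_complex_def)
    have ab: "algebra_bimodule A (Y n)" for n
      using b seminormed_algebra_axioms by (simp add: algebra_bimodule_def)
    have bm: "bimodule_map A (Y n) (Y (n - 1)) (d n)" for n
      using ab h by (simp add: bimodule_map_def bimodule_map_axioms_def)
    have "bimodule_map A (Y (n + 1)) (Y n) (d (n + 1))" for n
      using bm[of "n + 1"] by simp
    note * = bimodule_tensor_exact_iff[OF this bm]
    show ?thesis
      unfolding exact_complex_def using * by simp
  qed
  then show ?thesis
    unfolding amenable_def flat_bimodule_def
    by (intro iff_allI imp_cong refl) (elim conjE, assumption)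
qed

section \<open>Summation in spherically complete fields\<close>

text \<open>Continuity of addition is what permits infinite sums over the group to be added
  termwise, as bilinearity of the convolution requires.\<close>

instance nonarch_field \<subseteq> topological_comm_monoid_add
proof
  fix a b :: 'a
  show "((\<lambda>x. fst x + snd x) \<longlongrightarrow> a + b) (nhds a \<times>\<^sub>F nhds b)"
  proof (rule tendstoI)
    fix e :: real assume "e > 0"
    then have "eventually (\<lambda>x. dist x a < e) (nhds a)" "eventually (\<lambda>y. dist y b < e) (nhds b)"
      by (simp_all add: eventually_nhds_metric) (use \<open>e > 0\<close> in blast)+
    then have "eventually (\<lambda>x. dist (fst x) a < e \<and> dist (snd x) b < e) (nhds a \<times>\<^sub>F nhds b)"
      by (rule eventually_prodI[THEN eventually_mono]) auto
    then show "eventually (\<lambda>x. dist (fst x + snd x) (a + b) < e) (nhds a \<times>\<^sub>F nhds b)"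
    proof eventually_elim
      case (elim x)
      have "dist (fst x + snd x) (a + b) = vabs ((fst x - a) + (snd x - b))"
        by (simp add: dist_vabs algebra_simps)
      also have "\<dots> \<le> max (vabs (fst x - a)) (vabs (snd x - b))" by (rule vabs_add)
      finally show ?case using elim by (auto simp: dist_vabs)
    qed
  qed
qed

lemma dist_ultrametric: "dist x z \<le> max (dist x y) (dist y (z :: 'k::nonarch_field))"
  using vabs_add[of "x - y" "y - z"] by (simp add: dist_vabs)

text \<open>Balls of radius \<open>2^-n\<close> around suitable terms are nested by the ultrametric
  inequality. A point common to all of them is the limit.\<close>

lemma spherically_complete_Cauchy_convergent:
  fixes X :: "nat \<Rightarrow> 'k::spherically_complete_field"
  assumes "Cauchy X"
  shows "convergent X"
proof -
  define r where "r n = inverse (2 ^ n :: real)" for n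
  have r: "0 < r n" "r (Suc n) \<le> r n" for n by (auto simp: r_def field_simps)
  have "\<exists>M. \<forall>m\<ge>M. \<forall>n\<ge>M. dist (X m) (X n) < r k" for k
    using assms r(1) unfolding Cauchy_def by blast
  then obtain M where M: "\<And>k m n. \<lbrakk>m \<ge> M k; n \<ge> M k\<rbrakk> \<Longrightarrow> dist (X m) (X n) < r k" by metis
  \<comment> \<open>The maximum makes \<open>N\<close> monotone, so that \<open>c k\<close> and
    \<open>c (Suc k)\<close> both lie in the tail in which all terms are within \<open>r k\<close>
    of each other.\<close>
  define N where "N k = Max (M ` {..k})" for k
  have N: "M k \<le> N k" "N k \<le> N (Suc k)" for k
    unfolding N_def by (auto intro!: Max_mono)
  define c where "c k = X (N k)" for k
  have "(\<Inter>n. {x. dist (c n) x \<le> r n}) \<noteq> {}"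
  proof (rule spherically_complete)
    fix n
    have "dist (c n) (c (Suc n)) \<le> r n"
      using M[of n "N n" "N (Suc n)"] N[of n] by (simp add: c_def)
    then show "{x. dist (c (Suc n)) x \<le> r (Suc n)} \<subseteq> {x. dist (c n) x \<le> r n}"
      using dist_ultrametric[of "c n" _ "c (Suc n)"] r(2)[of n] by (force intro: order_trans)
  qed (rule r)
  then obtain L where L: "\<And>n. dist (c n) L \<le> r n" by blast
  have r0: "r \<longlonglongrightarrow> 0" unfolding r_def using LIMSEQ_inverse_realpow_zero[of 2] by simp
  have "X \<longlonglongrightarrow> L"
  proof (rule metric_LIMSEQ_I)
    fix e :: real assume "e > 0"
    then obtain k where k: "r k < e" using order_tendstoD(2)[OF r0] by (auto simp: eventually_sequentially)
    have "dist (X n) L < e" if "n \<ge> N k" for n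
    proof -
      have "dist (X n) (c k) < r k" using M[of k n "N k"] N[of k] that by (simp add: c_def)
      then show ?thesis using dist_ultrametric[of "X n" L "c k"] L[of k] k by linarith
    qed
    then show "\<exists>no. \<forall>n\<ge>no. dist (X n) L < e" by blast
  qed
  then show ?thesis by (rule convergentI)
qed

definition null_on :: "'i set \<Rightarrow> ('i \<Rightarrow> 'k::nonarch_field) \<Rightarrow> bool" where
  "null_on A b \<longleftrightarrow> (\<forall>e>0. finite {i \<in> A. e \<le> vabs (b i)})"

lemma null_onD: "\<lbrakk>null_on A b; e > 0\<rbrakk> \<Longrightarrow> finite {i \<in> A. e \<le> vabs (b i)}"
  by (simp add: null_on_def)

lemma null_on_mult_bounded:
  assumes "null_on A a" "\<And>i. i \<in> A \<Longrightarrow> vabs (f i) \<le> C"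
  shows "null_on A (\<lambda>i. a i * f i)"
  unfolding null_on_def
proof (intro allI impI)
  fix e :: real assume e: "e > 0"
  define D where "D = max C 1"
  have "vabs (a i * f i) \<le> vabs (a i) * D" if "i \<in> A" for i
    using assms(2)[OF that] by (simp add: vabs_mult D_def mult_left_mono)
  then have "{i \<in> A. e \<le> vabs (a i * f i)} \<subseteq> {i \<in> A. e / D \<le> vabs (a i)}"
    by (auto simp: D_def field_simps) (meson order_trans)
  then show "finite {i \<in> A. e \<le> vabs (a i * f i)}"
    using null_onD[OF assms(1), of "e / D"] e by (auto simp: D_def intro: finite_subset)
qed

text \<open>In a complete ultrametric field it suffices that the terms tend to zero: beyond the
  finitely many terms of size at least 1/(n+1), every finite partial sum is itself at most
  1/(n+1).\<close>

lemma null_on_summable: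
  fixes b :: "'i \<Rightarrow> 'k::spherically_complete_field"
  assumes "null_on A b"
  shows "b summable_on A"
proof -
  define F where "F n = {i \<in> A. inverse (real (Suc n)) \<le> vabs (b i)}" for n
  have F: "finite (F n)" "F n \<subseteq> A" for n
    unfolding F_def by (auto intro: null_onD[OF assms])
  have tail: "dist (sum b H) (sum b (F n)) \<le> inverse (real (Suc n))" if "finite H" "F n \<subseteq> H" "H \<subseteq> A" for H n
  proof -
    have "vabs (sum b H - sum b (F n)) = vabs (sum b (H - F n))"
      using sum_diff[OF that(1,2), of b] by simp
    also have "\<dots> \<le> inverse (real (Suc n))"
      using that(3) by (intro vabs_sum_le) (auto simp: F_def)
    finally show ?thesis by (simp add: dist_vabs)
  qed
  have mono: "F m \<subseteq> F n" if "m \<le> n" for m n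
  proof -
    have "inverse (real (Suc n)) \<le> inverse (real (Suc m))" using that by (intro le_imp_inverse_le) auto
    then show ?thesis unfolding F_def by (blast intro: order_trans)
  qed
  have "Cauchy (\<lambda>n. sum b (F n))"
  proof (rule metric_CauchyI)
    fix e :: real assume "e > 0"
    then obtain N where N: "inverse (real (Suc N)) < e" using reals_Archimedean by blast
    have "dist (sum b (F m)) (sum b (F n)) < e" if "m \<ge> N" "n \<ge> N" for m n
      using tail[OF F(1) mono[OF that(1)] F(2)] tail[OF F(1) mono[OF that(2)] F(2)] N
        dist_ultrametric[of "sum b (F m)" "sum b (F n)" "sum b (F N)"]
      by (simp add: dist_commute)
    then show "\<exists>M. \<forall>m\<ge>M. \<forall>n\<ge>M. dist (sum b (F m)) (sum b (F n)) < e" by blast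
  qed
  then obtain L where L: "(\<lambda>n. sum b (F n)) \<longlonglongrightarrow> L"
    using spherically_complete_Cauchy_convergent by (auto simp: convergent_def)
  have "(b has_sum L) A"
    unfolding has_sum_def
  proof (rule tendstoI)
    fix e :: real assume e: "e > 0"
    obtain N where N: "inverse (real (Suc N)) < e" using reals_Archimedean e by blast
    obtain M where M: "\<And>n. n \<ge> M \<Longrightarrow> dist (sum b (F n)) L < e" using metric_LIMSEQ_D[OF L e] by blast
    let ?n = "max M N"
    have n: "inverse (real (Suc ?n)) < e"
      using N by (rule le_less_trans[rotated]) (intro le_imp_inverse_le, auto)
    have "dist (sum b H) L < e" if "finite H" "F ?n \<subseteq> H" "H \<subseteq> A" for H
      using tail[OF that] n M[of ?n] dist_ultrametric[of "sum b H" L "sum b (F ?n)"] by linarith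
    then show "eventually (\<lambda>H. dist (sum b H) L < e) (finite_subsets_at_top A)"
      unfolding eventually_finite_subsets_at_top using F[of ?n] by (intro exI[of _ "F ?n"]) simp
  qed
  then show ?thesis by (auto simp: summable_on_def)
qed

lemma vabs_infsum_le:
  fixes b :: "'i \<Rightarrow> 'k::nonarch_field"
  assumes "\<And>i. i \<in> A \<Longrightarrow> vabs (b i) \<le> C" "0 \<le> C"
  shows "vabs (infsum b A) \<le> C"
proof (cases "b summable_on A")
  case True
  show ?thesis
  proof (rule field_le_epsilon)
    fix e :: real assume e: "e > 0"
    have "(sum b \<longlongrightarrow> infsum b A) (finite_subsets_at_top A)"
      using has_sum_infsum[OF True] by (simp add: has_sum_def)
    from tendstoD[OF this e] obtain H where H: "finite H" "H \<subseteq> A" "dist (sum b H) (infsum b A) < e"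
      unfolding eventually_finite_subsets_at_top by blast
    have "vabs (sum b H) \<le> C" using H assms by (intro vabs_sum_le) auto
    then show "vabs (infsum b A) \<le> C + e"
      using H(3) vabs_diff[of "sum b H" "sum b H - infsum b A"] assms(2) e by (simp add: dist_vabs)
  qed
\<comment> \<open>A family that is not summable has the default sum 0.\<close>
qed (use assms in \<open>simp add: infsum_not_exists\<close>)

lemma infsum_nonarch_cmult:
  fixes b :: "'i \<Rightarrow> 'k::nonarch_field"
  assumes "b summable_on A"
  shows "infsum (\<lambda>i. c * b i) A = c * infsum b A"
proof (rule infsumI)
  have t: "(sum b \<longlongrightarrow> infsum b A) (finite_subsets_at_top A)"
    using has_sum_infsum[OF assms] by (simp add: has_sum_def)
  show "((\<lambda>i. c * b i) has_sum c * infsum b A) A"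
    unfolding has_sum_def
  proof (rule tendstoI)
    fix e :: real assume e: "e > 0"
    \<comment> \<open>Adding 1 covers the case \<open>c = 0\<close>.\<close>
    then have "e / (vabs c + 1) > 0" using vabs_nonneg[of c] by (simp add: add_nonneg_pos)
    from tendstoD[OF t this]
    show "eventually (\<lambda>H. dist (\<Sum>i\<in>H. c * b i) (c * infsum b A) < e) (finite_subsets_at_top A)"
    proof eventually_elim
      case (elim H)
      have "dist (\<Sum>i\<in>H. c * b i) (c * infsum b A) = vabs c * dist (sum b H) (infsum b A)"
        by (simp add: dist_vabs vabs_mult flip: sum_distrib_left right_diff_distrib)
      also have "\<dots> \<le> (vabs c + 1) * dist (sum b H) (infsum b A)" by (intro mult_right_mono) auto
      also have "\<dots> < e"
        using elim vabs_nonneg[of c] by (simp add: field_simps add_nonneg_pos)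
      finally show ?case .
    qed
  qed
qed


section \<open>Bounded functions on a group and convolution\<close>

locale group_convolution = group G for G :: "('g, 'm) monoid_scheme" (structure) +
  fixes K :: "'k::spherically_complete_field itself"
begin

abbreviation A :: "('k, 'g \<Rightarrow> 'k) nspace" where "A \<equiv> l_algebra G"
abbreviation L :: "('k, 'g \<Rightarrow> 'k) nspace" where "L \<equiv> l_infinity G"

lemma L_simps: "\<zero>\<^bsub>L\<^esub> = (\<lambda>_. 0)" "f \<oplus>\<^bsub>L\<^esub> h = (\<lambda>g. f g + h g)" "c \<odot>\<^bsub>L\<^esub> f = (\<lambda>g. c * f g)"
  by (simp_all add: l_infinity_def)

lemma A_simps: "\<zero>\<^bsub>A\<^esub> = (\<lambda>_. 0)" "f \<oplus>\<^bsub>A\<^esub> h = (\<lambda>g. f g + h g)" "c \<odot>\<^bsub>A\<^esub> f = (\<lambda>g. c * f g)" "nrm A = nrm L"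
  by (simp_all add: l_algebra_def l_infinity_def)

lemma L_mem: "f \<in> carrier L \<longleftrightarrow> (\<forall>g. g \<notin> carrier G \<longrightarrow> f g = 0) \<and> (\<exists>C. \<forall>g\<in>carrier G. vabs (f g) \<le> C)"
  by (simp add: l_infinity_def)

lemma A_mem: "f \<in> carrier A \<longleftrightarrow> (\<forall>g. g \<notin> carrier G \<longrightarrow> f g = 0) \<and> null_on (carrier G) f"
  by (simp add: l_algebra_def null_on_def)

lemma A_subset_L: "carrier A \<subseteq> carrier L"
proof
  fix f assume f: "f \<in> carrier A"
  let ?F = "{i \<in> carrier G. 1 \<le> vabs (f i)}"
  have fin: "finite ?F" using f null_onD[of _ f 1] by (auto simp: A_mem)
  have "vabs (f g) \<le> Max (insert 1 ((\<lambda>g. vabs (f g)) ` ?F))" if "g \<in> carrier G" for g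
  proof (cases "1 \<le> vabs (f g)")
    case True
    then show ?thesis using fin that by (intro Max_ge) auto
  next
    case False
    then show ?thesis using fin by (intro order_trans[OF _ Max_ge[of _ 1]]) auto
  qed
  then show "f \<in> carrier L" using f unfolding L_mem A_mem by blast
qed

lemma L_nrm: "nrm L f = (SUP g\<in>carrier G. vabs (f g))"
  by (simp add: l_infinity_def)

lemma le_nrm: "f \<in> carrier L \<Longrightarrow> vabs (f g) \<le> nrm L f"
proof -
  assume f: "f \<in> carrier L"
  then obtain C where C: "\<forall>g\<in>carrier G. vabs (f g) \<le> C" by (auto simp: L_mem)
  have *: "vabs (f g) \<le> nrm L f" if "g \<in> carrier G" for g
    unfolding L_nrm using C that by (intro cSUP_upper bdd_aboveI2[of _ _ C]) auto
  show ?thesis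
  proof (cases "g \<in> carrier G")
    case False
    then have "f g = 0" using f by (auto simp: L_mem)
    then show ?thesis using order_trans[OF vabs_nonneg *[OF one_closed]] by simp
  qed (rule *)
qed

lemma nrm_le: "(\<And>g. g \<in> carrier G \<Longrightarrow> vabs (f g) \<le> C) \<Longrightarrow> nrm L f \<le> C"
  unfolding L_nrm by (rule cSUP_least) auto

lemma L_memI: "\<lbrakk>\<And>g. g \<notin> carrier G \<Longrightarrow> f g = 0; \<And>g. g \<in> carrier G \<Longrightarrow> vabs (f g) \<le> C\<rbrakk> \<Longrightarrow> f \<in> carrier L"
  unfolding L_mem by blast

lemma L_add_mem: "\<lbrakk>f \<in> carrier L; h \<in> carrier L\<rbrakk> \<Longrightarrow> (\<lambda>g. f g + h g) \<in> carrier L"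
  using order_trans[OF vabs_add max.mono[OF le_nrm le_nrm], of f h]
  by (intro L_memI[where C = "max (nrm L f) (nrm L h)"]) (auto simp: L_mem)

lemma L_smult_mem: "f \<in> carrier L \<Longrightarrow> (\<lambda>g. c * f g) \<in> carrier L"
  by (rule L_memI[where C = "vabs c * nrm L f"]) (auto simp: vabs_mult intro: mult_left_mono le_nrm, simp add: L_mem)

lemma L_nrm_smult_le: "f \<in> carrier L \<Longrightarrow> nrm L (\<lambda>g. c * f g) \<le> vabs c * nrm L f"
  by (rule nrm_le) (simp add: vabs_mult mult_left_mono le_nrm)

lemma seminormed_L: "nonarch_seminormed_space L"
proof (rule nonarch_seminormed_spaceI)
  fix f h assume f: "f \<in> carrier L" and h: "h \<in> carrier L"
  show "f \<oplus>\<^bsub>L\<^esub> h \<in> carrier L" using L_add_mem[OF f h] by (simp add: L_simps)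
  show "nrm L (f \<oplus>\<^bsub>L\<^esub> h) \<le> max (nrm L f) (nrm L h)"
    unfolding L_simps by (rule nrm_le) (intro order_trans[OF vabs_add] max.mono le_nrm f h)
next
  fix f c assume f: "f \<in> carrier L"
  show "c \<odot>\<^bsub>L\<^esub> f \<in> carrier L" using L_smult_mem[OF f] by (simp add: L_simps)
  show "0 \<le> nrm L f" using le_nrm[OF f, of \<one>] vabs_nonneg[of "f \<one>"] by linarith
  show "nrm L (c \<odot>\<^bsub>L\<^esub> f) = vabs c * nrm L f"
  proof (cases "c = 0")
    case True
    have "nrm L (\<lambda>_. 0) = 0" unfolding L_nrm using one_closed by (subst cSUP_const) auto
    then show ?thesis using True by (simp add: L_simps)
  next
    case False
    have "nrm L f \<le> inverse (vabs c) * nrm L (\<lambda>g. c * f g)"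
      using L_nrm_smult_le[OF L_smult_mem[OF f, of c], of "inverse c"] False
      by (simp add: vabs_inverse flip: mult.assoc)
    then show ?thesis
      using L_nrm_smult_le[OF f, of c] vabs_pos[OF False] by (simp add: L_simps field_simps)
  qed
qed (auto simp: L_simps algebra_simps intro: L_memI[where C = 0])

sublocale L: nonarch_seminormed_space L by (rule seminormed_L)

lemma L_diff: "\<lbrakk>f \<in> carrier L; h \<in> carrier L\<rbrakk> \<Longrightarrow> f \<ominus>\<^bsub>L\<^esub> h = (\<lambda>g. f g - h g)"
  by (simp add: L.a_minus_eq_smult) (simp add: L_simps)

lemma L_nrm_eq_0: "f \<in> carrier L \<Longrightarrow> nrm L f = 0 \<longleftrightarrow> f = \<zero>\<^bsub>L\<^esub>"
proof
  assume f: "f \<in> carrier L" "nrm L f = 0"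
  have "vabs (f g) = 0" for g using le_nrm[OF f(1), of g] f(2) vabs_nonneg[of "f g"] by linarith
  then show "f = \<zero>\<^bsub>L\<^esub>" by (auto simp: L_simps)
qed simp

text \<open>Pointwise limits exist because \<open>'k\<close> is complete, and they are attained
  uniformly because the Cauchy condition does not depend on the point of the group.\<close>

lemma L_complete:
  assumes s: "range \<sigma> \<subseteq> carrier L" and "nrm_Cauchy L \<sigma>"
  shows "\<exists>f\<in>carrier L. nrm_tendsto L \<sigma> f"
proof -
  have s: "\<sigma> n \<in> carrier L" for n using s by auto
  have "\<sigma> \<in> carrier L.C" using assms by (simp add: cauchy_space_def)
  then have ca: "\<exists>N. \<forall>m\<ge>N. \<forall>n\<ge>N. nrm L (\<sigma> m \<ominus>\<^bsub>L\<^esub> \<sigma> n) < e" if "e > 0" for e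
    using L.cauchyD(2) that by blast
  have le: "dist (\<sigma> m g) (\<sigma> n g) \<le> nrm L (\<sigma> m \<ominus>\<^bsub>L\<^esub> \<sigma> n)" for m n g
    using le_nrm[OF L.minus_mem[OF s s], of m n g] by (simp add: L_diff s dist_vabs)
  have "Cauchy (\<lambda>n. \<sigma> n g)" for g
  proof (rule metric_CauchyI)
    fix e :: real assume "e > 0"
    from ca[OF this] show "\<exists>M. \<forall>m\<ge>M. \<forall>n\<ge>M. dist (\<sigma> m g) (\<sigma> n g) < e"
      using le by (meson le_less_trans)
  qed
  then have "\<exists>l. (\<lambda>n. \<sigma> n g) \<longlonglongrightarrow> l" for g
    using spherically_complete_Cauchy_convergent by (auto simp: convergent_def)
  then obtain f where f: "\<And>g. (\<lambda>n. \<sigma> n g) \<longlonglongrightarrow> f g" by metis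
  have close: "\<exists>N. \<forall>n\<ge>N. \<forall>g. dist (\<sigma> n g) (f g) \<le> e" if e: "e > 0" for e
  proof -
    obtain N where N: "\<forall>m\<ge>N. \<forall>n\<ge>N. nrm L (\<sigma> m \<ominus>\<^bsub>L\<^esub> \<sigma> n) < e" using ca[OF e] ..
    have "dist (\<sigma> n g) (f g) \<le> e" if "n \<ge> N" for n g
    proof (rule LIMSEQ_le_const2[OF tendsto_dist[OF tendsto_const f]])
      show "\<exists>M. \<forall>m\<ge>M. dist (\<sigma> n g) (\<sigma> m g) \<le> e"
        using N that le[of n g] by (meson le_less_trans less_imp_le)
    qed
    then show ?thesis by blast
  qed
  have fL: "f \<in> carrier L"
  proof -
    obtain N where N: "\<And>g. dist (\<sigma> N g) (f g) \<le> 1" using close[of 1] by auto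
    show ?thesis
    proof (rule L_memI[where C = "max (nrm L (\<sigma> N)) 1"])
      fix g assume g: "g \<notin> carrier G"
      have "(\<lambda>n. \<sigma> n g) = (\<lambda>n. 0)" using s g by (auto simp: L_mem)
      then show "f g = 0" using f[of g] LIMSEQ_unique[OF _ tendsto_const] by metis
    next
      fix g
      show "vabs (f g) \<le> max (nrm L (\<sigma> N)) 1"
        using vabs_diff[of "\<sigma> N g" "\<sigma> N g - f g"] N[of g] le_nrm[OF s, of N g] by (simp add: dist_vabs)
    qed
  qed
  have "nrm_tendsto L \<sigma> f"
  proof (subst L.nrm_tendsto_iff)
    show "\<forall>e>0. \<exists>N. \<forall>n\<ge>N. nrm L (\<sigma> n \<ominus>\<^bsub>L\<^esub> f) < e"
    proof (intro allI impI)
      fix e :: real assume "e > 0"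
      then obtain N where N: "\<forall>n\<ge>N. \<forall>g. dist (\<sigma> n g) (f g) \<le> e / 2" using close[of "e / 2"] by auto
      have "nrm L (\<sigma> n \<ominus>\<^bsub>L\<^esub> f) < e" if "n \<ge> N" for n
      proof -
        have "nrm L (\<sigma> n \<ominus>\<^bsub>L\<^esub> f) \<le> e / 2"
          by (rule nrm_le) (use N that in \<open>simp add: L_diff s fL dist_vabs\<close>)
        then show ?thesis using \<open>e > 0\<close> by simp
      qed
      then show "\<exists>N. \<forall>n\<ge>N. nrm L (\<sigma> n \<ominus>\<^bsub>L\<^esub> f) < e" by blast
    qed
  qed (use s fL in auto)
  then show ?thesis using fL by blast
qed

lemma L_banach: "nonarch_banach_space L"
  by (intro nonarch_banach_space.intro nonarch_banach_space_axioms.intro L.module_axioms)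
    (auto simp: L.nrm_nonneg L_nrm_eq_0 L.nrm_smult L.nrm_add intro: L_complete)

sublocale L: nonarch_banach_space L by (rule L_banach)

lemma A_mem_L: "f \<in> carrier A \<Longrightarrow> f \<in> carrier L"
  using A_subset_L by blast

text \<open>If \<open>h\<close> is at distance less than \<open>e\<close> from \<open>f\<close>,
  then the ultrametric inequality makes \<open>h\<close> at least \<open>e\<close> in size wherever
  \<open>f\<close> is. The large values of \<open>f\<close> thus sit among the finitely many large
  values of \<open>h\<close>, with the same threshold.\<close>

lemma A_closed: "closed_subspace L (carrier A)"
  unfolding L.closed_subspace_iff
proof (intro conjI ballI impI)
  show "submodule (carrier A) scalars L"
  proof (rule L.submoduleI'[OF A_subset_L])
    show "\<zero>\<^bsub>L\<^esub> \<in> carrier A" by (simp add: A_mem L_simps null_on_def)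
    show "f \<oplus>\<^bsub>L\<^esub> h \<in> carrier A" if "f \<in> carrier A" "h \<in> carrier A" for f h
    proof -
      have "null_on (carrier G) (\<lambda>g. f g + h g)"
        unfolding null_on_def
      proof (intro allI impI)
        fix e :: real assume e: "e > 0"
        have "{i \<in> carrier G. e \<le> vabs (f i + h i)} \<subseteq> {i \<in> carrier G. e \<le> vabs (f i)} \<union> {i \<in> carrier G. e \<le> vabs (h i)}"
          using vabs_add[of "f _" "h _"] by (auto simp: le_max_iff_disj dest: order_trans)
        then show "finite {i \<in> carrier G. e \<le> vabs (f i + h i)}"
          using that e by (auto simp: A_mem null_on_def intro: finite_subset)
      qed
      then show ?thesis using that by (simp add: A_mem L_simps)
    qed
    show "c \<odot>\<^bsub>L\<^esub> f \<in> carrier A" if "f \<in> carrier A" for f c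
      using that null_on_mult_bounded[of "carrier G" f "\<lambda>_. c" "vabs c"] by (simp add: A_mem L_simps mult.commute)
  qed
  fix f assume f: "f \<in> carrier L" "adherent L (carrier A) f"
  have "null_on (carrier G) f"
    unfolding null_on_def
  proof (intro allI impI)
    fix e :: real assume e: "e > 0"
    obtain h where h: "h \<in> carrier A" "nrm L (f \<ominus>\<^bsub>L\<^esub> h) < e" using adherentD[OF f(2) e] by blast
    have "e \<le> vabs (h i)" if "e \<le> vabs (f i)" for i
    proof -
      have "vabs (f i - h i) < e"
        using le_nrm[OF L.minus_mem[OF f(1) A_mem_L[OF h(1)]], of i] h f by (simp add: L_diff A_mem_L)
      then show ?thesis using vabs_add[of "f i - h i" "h i"] that by simp
    qed
    then have "{i \<in> carrier G. e \<le> vabs (f i)} \<subseteq> {i \<in> carrier G. e \<le> vabs (h i)}" by auto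
    then show "finite {i \<in> carrier G. e \<le> vabs (f i)}"
      using h e by (auto simp: A_mem null_on_def intro: finite_subset)
  qed
  then show "f \<in> carrier A" using f by (simp add: A_mem L_mem)
qed

lemmas A_sub = L.submodule_mem[OF L.closed_subspaceD(1)[OF A_closed]]

lemma seminormed_A: "nonarch_seminormed_space A"
proof (rule nonarch_seminormed_spaceI)
  fix f h assume f: "f \<in> carrier A" and h: "h \<in> carrier A"
  show "f \<oplus>\<^bsub>A\<^esub> h \<in> carrier A" using A_sub(3)[OF f h] by (simp add: A_simps L_simps)
  show "nrm A (f \<oplus>\<^bsub>A\<^esub> h) \<le> max (nrm A f) (nrm A h)"
    using L.nrm_add[OF A_mem_L[OF f] A_mem_L[OF h]] by (simp add: A_simps L_simps)
next
  fix f c assume f: "f \<in> carrier A"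
  show "c \<odot>\<^bsub>A\<^esub> f \<in> carrier A" using A_sub(6)[OF f] by (simp add: A_simps L_simps)
  show "0 \<le> nrm A f" "nrm A (c \<odot>\<^bsub>A\<^esub> f) = vabs c * nrm A f"
    using L.nrm_nonneg[OF A_mem_L[OF f]] L.nrm_smult[OF A_mem_L[OF f], of c] by (simp_all add: A_simps L_simps)
next
  show "\<zero>\<^bsub>A\<^esub> \<in> carrier A" using A_sub(2) by (simp add: A_simps L_simps)
qed (auto simp: A_simps algebra_simps)

sublocale A: nonarch_seminormed_space A by (rule seminormed_A)

lemma A_diff: "\<lbrakk>f \<in> carrier A; h \<in> carrier A\<rbrakk> \<Longrightarrow> f \<ominus>\<^bsub>A\<^esub> h = (\<lambda>g. f g - h g)"
  by (simp add: A.a_minus_eq_smult) (simp add: A_simps)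

text \<open>The second argument may be merely bounded, so one operation serves both as the product
  of \<open>l_algebra\<close> and as its action on \<open>l_infinity\<close>.\<close>

definition conv :: "('g \<Rightarrow> 'k) \<Rightarrow> ('g \<Rightarrow> 'k) \<Rightarrow> 'g \<Rightarrow> 'k" where
  "conv a f x = (if x \<in> carrier G then \<Sum>\<^sub>\<infinity>g\<in>carrier G. a g * f (inv g \<otimes> x) else 0)"

lemma A_mult: "a \<otimes>\<^bsub>A\<^esub> b = conv a b"
  by (rule ext) (simp add: l_algebra_def conv_def)

lemma conv_summable:
  assumes "a \<in> carrier A" "f \<in> carrier L"
  shows "(\<lambda>g. a g * f (inv g \<otimes> x)) summable_on carrier G"
  using assms le_nrm[OF assms(2)] by (intro null_on_summable null_on_mult_bounded[where C = "nrm L f"]) (auto simp: A_mem)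

lemma vabs_conv_le:
  assumes "a \<in> carrier A" "f \<in> carrier L"
  shows "vabs (conv a f x) \<le> nrm L a * nrm L f"
  unfolding conv_def
  using L.nrm_nonneg[OF assms(2)] L.nrm_nonneg[OF A_mem_L[OF assms(1)]]
  by (auto intro!: vabs_infsum_le mult_mono le_nrm assms A_mem_L simp: vabs_mult)

lemma conv_bilinear: "bounded_bilinear_map A L L conv"
  unfolding bounded_bilinear_map_def
proof (intro conjI ballI exI)
  have mem: "conv a f \<in> carrier L" if "a \<in> carrier A" "f \<in> carrier L" for a f
    by (rule L_memI[where C = "nrm L a * nrm L f"]) (auto simp: vabs_conv_le that, simp add: conv_def)
  have bound: "nrm L (conv a f) \<le> 1 * nrm A a * nrm L f" if "a \<in> carrier A" "f \<in> carrier L" for a f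
    unfolding A_simps by (rule nrm_le) (simp add: vabs_conv_le that)
  then show "nrm L (conv a f) \<le> 1 * nrm A a * nrm L f" if "a \<in> carrier A" "f \<in> carrier L" for a f
    using that .
  show "bounded_linear_map L L (conv a)" if a: "a \<in> carrier A" for a
  proof (rule bounded_linear_mapI[where C = "1 * nrm A a"])
    fix f assume f: "f \<in> carrier L"
    show "conv a f \<in> carrier L" "nrm L (conv a f) \<le> 1 * nrm A a * nrm L f" by (intro mem bound a f)+
    show "conv a (f \<oplus>\<^bsub>L\<^esub> h) = conv a f \<oplus>\<^bsub>L\<^esub> conv a h" if h: "h \<in> carrier L" for h
      by (rule ext) (simp add: conv_def L_simps distrib_left infsum_add conv_summable a f h)
    show "conv a (c \<odot>\<^bsub>L\<^esub> f) = c \<odot>\<^bsub>L\<^esub> conv a f" for c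
      by (rule ext) (simp add: conv_def L_simps mult.left_commute[of _ c] infsum_nonarch_cmult conv_summable a f)
  qed
  show "bounded_linear_map A L (\<lambda>a. conv a f)" if f: "f \<in> carrier L" for f
  proof (rule bounded_linear_mapI[where C = "nrm L f"])
    fix a assume a: "a \<in> carrier A"
    show "conv a f \<in> carrier L" "nrm L (conv a f) \<le> nrm L f * nrm A a" using mem bound[OF a f] a f by (simp_all add: mult.commute)
    show "conv (a \<oplus>\<^bsub>A\<^esub> b) f = conv a f \<oplus>\<^bsub>L\<^esub> conv b f" if b: "b \<in> carrier A" for b
      by (rule ext) (simp add: conv_def L_simps A_simps distrib_right infsum_add conv_summable a f b)
    show "conv (c \<odot>\<^bsub>A\<^esub> a) f = c \<odot>\<^bsub>L\<^esub> conv a f" for c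
      by (rule ext) (simp add: conv_def L_simps A_simps mult.assoc infsum_nonarch_cmult conv_summable a f)
  qed
qed

lemmas conv_mem = bounded_bilinear_mapD(3)[OF conv_bilinear]

definition delta :: "'g \<Rightarrow> 'g \<Rightarrow> 'k" where
  "delta g h = (if h = g then 1 else 0)"

lemma delta_mem: "g \<in> carrier G \<Longrightarrow> delta g \<in> carrier A"
proof -
  assume g: "g \<in> carrier G"
  have "{i \<in> carrier G. e \<le> vabs (delta g i)} \<subseteq> {g}" if "e > 0" for e
    using that by (auto simp: delta_def split: if_splits)
  then show ?thesis using g by (auto simp: A_mem null_on_def delta_def[abs_def] intro: finite_subset)
qed

lemma nrm_delta: "g \<in> carrier G \<Longrightarrow> nrm L (delta g) = 1"
  using le_nrm[OF A_mem_L[OF delta_mem], of g g] nrm_le[of "delta g" 1] by (auto simp: delta_def)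

lemma conv_delta:
  assumes g: "g \<in> carrier G"
  shows "conv (delta g) f = translate G g f"
proof
  fix x
  have "(\<Sum>\<^sub>\<infinity>h\<in>carrier G. delta g h * f (inv h \<otimes> x)) = (\<Sum>\<^sub>\<infinity>h\<in>{g}. f (inv h \<otimes> x))"
    using g by (intro infsum_cong_neutral) (auto simp: delta_def)
  then show "conv (delta g) f x = translate G g f x"
    by (simp add: conv_def translate_def)
qed

text \<open>A function vanishing at infinity is within \<open>e / 2\<close> of its restriction to
  the finitely many points where it has size at least \<open>e / 2\<close>, and that restriction is
  a finite combination of point masses.\<close>

lemma A_span:
  assumes S: "closed_subspace A S" and d: "\<And>g. g \<in> carrier G \<Longrightarrow> delta g \<in> S"
  shows "carrier A \<subseteq> S"
proof
  fix a assume a: "a \<in> carrier A"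
  note S' = A.closed_subspaceD[OF S]
  note S'' = A.submodule_mem[OF S'(1)]
  have sum: "(\<lambda>x. if x \<in> F then a x else 0) \<in> S" if "finite F" "F \<subseteq> carrier G" for F
    using that
  proof (induction F)
    case (insert g F)
    have "(\<lambda>x. if x \<in> insert g F then a x else 0) = a g \<odot>\<^bsub>A\<^esub> delta g \<oplus>\<^bsub>A\<^esub> (\<lambda>x. if x \<in> F then a x else 0)"
      using insert.hyps by (auto simp: A_simps delta_def)
    then show ?case using insert d by (auto intro: S''(3,6))
  qed (use S''(2) in \<open>simp add: A_simps\<close>)
  show "a \<in> S"
  proof (rule S'(2)[OF a], rule adherentI)
    fix e :: real assume e: "e > 0"
    let ?F = "{i \<in> carrier G. e / 2 \<le> vabs (a i)}"
    let ?b = "\<lambda>x. if x \<in> ?F then a x else 0"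
    have "finite ?F" using a e null_onD[of "carrier G" a "e / 2"] by (simp add: A_mem)
    then have b: "?b \<in> S" by (intro sum) auto
    then have bA: "?b \<in> carrier A" using S''(1) by blast
    have "nrm A (a \<ominus>\<^bsub>A\<^esub> ?b) \<le> e / 2"
      unfolding A_diff[OF a bA] A_simps by (rule nrm_le) (use e in auto)
    then show "\<exists>y\<in>S. nrm A (a \<ominus>\<^bsub>A\<^esub> y) < e" using b e by (intro bexI[OF _ b]) simp
  qed
qed

lemma translate_mem_L: "\<lbrakk>g \<in> carrier G; f \<in> carrier L\<rbrakk> \<Longrightarrow> translate G g f \<in> carrier L"
  by (rule L_memI[where C = "nrm L f"]) (auto simp: translate_def le_nrm)

lemma translate_mem_A:
  assumes "g \<in> carrier G" "f \<in> carrier A"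
  shows "translate G g f \<in> carrier A"
proof -
  have "finite {i \<in> carrier G. e \<le> vabs (translate G g f i)}" if "e > 0" for e
  proof (rule finite_subset)
    show "{i \<in> carrier G. e \<le> vabs (translate G g f i)} \<subseteq> (\<lambda>h. g \<otimes> h) ` {i \<in> carrier G. e \<le> vabs (f i)}"
    proof
      fix i assume i: "i \<in> {i \<in> carrier G. e \<le> vabs (translate G g f i)}"
      then have "i = g \<otimes> (inv g \<otimes> i)" using assms(1) by (simp flip: m_assoc)
      then show "i \<in> (\<lambda>h. g \<otimes> h) ` {i \<in> carrier G. e \<le> vabs (f i)}"
        using i assms(1) by (auto simp: translate_def)
    qed
    show "finite ((\<lambda>h. g \<otimes> h) ` {i \<in> carrier G. e \<le> vabs (f i)})"
      using assms(2) that by (auto simp: A_mem null_on_def)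
  qed
  then show ?thesis by (simp add: A_mem null_on_def) (simp add: translate_def)
qed

text \<open>For fixed \<open>b\<close> the condition on \<open>a\<close> defines a closed subspace.
  For a point mass the convolution is a translate of \<open>b\<close>.\<close>

lemma conv_mem_A:
  assumes "a \<in> carrier A" "b \<in> carrier A"
  shows "conv a b \<in> carrier A"
proof -
  interpret b: bounded_map A L "\<lambda>a. conv a b"
    using assms(2) by (intro bounded_mapI seminormed_A seminormed_L bounded_bilinear_mapD(2)[OF conv_bilinear] A_mem_L)
  have "carrier A \<subseteq> {a \<in> carrier A. conv a b \<in> carrier A}"
    by (rule A_span[OF b.closed_subspace_vimage[OF A_closed]])
      (simp add: delta_mem conv_delta translate_mem_A assms)
  then show ?thesis using assms by blast
qed

lemma conv_translate_left:
  assumes "g \<in> carrier G"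
  shows "conv (translate G g b) f = translate G g (conv b f)"
proof
  fix x
  show "conv (translate G g b) f x = translate G g (conv b f) x"
  proof (cases "x \<in> carrier G")
    case True
    have bij: "bij_betw (\<lambda>h. g \<otimes> h) (carrier G) (carrier G)"
      by (rule bij_betwI[where g = "\<lambda>h. inv g \<otimes> h"]) (use assms in \<open>auto simp flip: m_assoc\<close>)
    have "(\<Sum>\<^sub>\<infinity>h\<in>carrier G. translate G g b h * f (inv h \<otimes> x))
      = (\<Sum>\<^sub>\<infinity>h\<in>carrier G. translate G g b (g \<otimes> h) * f (inv (g \<otimes> h) \<otimes> x))"
      by (rule infsum_reindex_bij_betw[OF bij, symmetric])
    also have "\<dots> = (\<Sum>\<^sub>\<infinity>h\<in>carrier G. b h * f (inv h \<otimes> (inv g \<otimes> x)))"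
      using assms True by (intro infsum_cong) (simp add: translate_def inv_mult_group m_assoc flip: m_assoc[of "inv g" g])
    finally show ?thesis using assms True by (simp add: conv_def translate_def)
  qed (simp add: conv_def translate_def)
qed

text \<open>Both sides are bounded in \<open>a\<close>, so \<open>a\<close> may be taken to be a
  point mass, for which the claim is that translation commutes with convolution from the right. No
  double sum has to be rearranged.\<close>

lemma conv_assoc:
  assumes "a \<in> carrier A" "b \<in> carrier A" "f \<in> carrier L"
  shows "conv (conv a b) f = conv a (conv b f)"
proof -
  have conv_b: "bounded_linear_map A A (\<lambda>a. conv a b)"
  proof (rule bounded_linear_mapI[where C = "nrm L b"])
    note cb = bounded_linear_mapD[OF bounded_bilinear_mapD(2)[OF conv_bilinear A_mem_L[OF assms(2)]]]
    show "nrm A (conv a b) \<le> nrm L b * nrm A a" if "a \<in> carrier A" for a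
      unfolding A_simps using vabs_conv_le[OF that A_mem_L[OF assms(2)]]
      by (intro nrm_le) (simp add: mult.commute)
    show "conv (a \<oplus>\<^bsub>A\<^esub> a') b = conv a b \<oplus>\<^bsub>A\<^esub> conv a' b" if "a \<in> carrier A" "a' \<in> carrier A" for a a'
      using cb(2)[OF that] by (simp add: A_simps L_simps)
    show "conv (c \<odot>\<^bsub>A\<^esub> a) b = c \<odot>\<^bsub>A\<^esub> conv a b" if "a \<in> carrier A" for a c
      using cb(3)[OF that] by (simp add: A_simps L_simps)
  qed (rule conv_mem_A[OF _ assms(2)])
  let ?F = "\<lambda>a. conv (conv a b) f \<ominus>\<^bsub>L\<^esub> conv a (conv b f)"
  interpret F: bounded_map A L ?F
    using assms by (intro bounded_mapI bounded_linear_map_diff seminormed_A seminormed_L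
        bounded_linear_map_comp[OF _ _ _ conv_b] bounded_bilinear_mapD(2)[OF conv_bilinear] conv_mem)
  have "carrier A \<subseteq> {a \<in> carrier A. ?F a \<in> {\<zero>\<^bsub>L\<^esub>}}"
    by (rule A_span[OF F.closed_subspace_vimage[OF L.closed_subspace_zero]])
      (use assms in \<open>simp add: delta_mem conv_delta conv_translate_left translate_mem_L conv_mem\<close>)
  then have "?F a = \<zero>\<^bsub>L\<^esub>" using assms by blast
  then show ?thesis using assms by (simp add: L.minus_eq_zero_iff conv_mem conv_mem_A)
qed

sublocale A: seminormed_algebra A
proof
  fix a assume a: "a \<in> carrier A"
  show "\<zero>\<^bsub>A\<^esub> \<otimes>\<^bsub>A\<^esub> a = \<zero>\<^bsub>A\<^esub>" "a \<otimes>\<^bsub>A\<^esub> \<zero>\<^bsub>A\<^esub> = \<zero>\<^bsub>A\<^esub>"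
    by (auto simp: A_mult A_simps conv_def)
qed (simp add: A_mult conv_mem_A)

lemma delta_mult: "\<lbrakk>g \<in> carrier G; h \<in> carrier G\<rbrakk> \<Longrightarrow> delta g \<otimes>\<^bsub>A\<^esub> delta h = delta (g \<otimes> h)"
proof -
  assume gh: "g \<in> carrier G" "h \<in> carrier G"
  have "translate G g (delta h) = delta (g \<otimes> h)"
  proof
    fix x
    have "inv g \<otimes> x = h \<longleftrightarrow> x = g \<otimes> h" if "x \<in> carrier G"
      using that gh by (metis inv_solve_left)
    then show "translate G g (delta h) x = delta (g \<otimes> h) x"
      using gh by (auto simp: translate_def delta_def)
  qed
  then show ?thesis using gh by (simp add: A_mult conv_delta)
qed

end

section \<open>Johnson amenable groups are locally finite\<close>

text \<open>
  In an infinite, locally finite rooted tree every vertex can send one unit of mass to infinity: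
  \<open>F v\<close> is the flow from \<open>v\<close> to its parent.  A vertex with finitely many descendants passes all
  their mass up, any other vertex passes what it holds down to a child with infinitely many
  descendants.
\<close>

lemma infinite_tree_flow:
  fixes V :: "'v set" and par :: "'v \<Rightarrow> 'v" and lev :: "'v \<Rightarrow> nat"
  assumes inf: "infinite V" and r: "r \<in> V" "lev r = 0"
    and par: "\<And>v. \<lbrakk>v \<in> V; v \<noteq> r\<rbrakk> \<Longrightarrow> par v \<in> V" "\<And>v. \<lbrakk>v \<in> V; v \<noteq> r\<rbrakk> \<Longrightarrow> lev v = Suc (lev (par v))"
    and fin: "\<And>v. v \<in> V \<Longrightarrow> finite {c \<in> V - {r}. par c = v}"
  obtains F :: "'v \<Rightarrow> int" where "F r = 0" "\<And>v. v \<in> V \<Longrightarrow> F v = 1 + (\<Sum>c | c \<in> V - {r} \<and> par c = v. F c)"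
proof -
  define kids where "kids v = {c \<in> V - {r}. par c = v}" for v
  define R where "R = {(c, v). c \<in> kids v}"
  \<comment> \<open>The accessible vertices are those from which no infinite path of children
    starts. Describing them through well-foundedness instead of counting descendants is what makes
    recursion from the children available.\<close>
  define W where "W = Wellfounded.acc R"
  have W_kids: "v \<in> W \<longleftrightarrow> kids v \<subseteq> W" for v
  proof
    assume "v \<in> W"
    then show "kids v \<subseteq> W" unfolding W_def by (auto simp: R_def intro: acc_downward)
  next
    assume "kids v \<subseteq> W"
    then show "v \<in> W" unfolding W_def by - (rule accI, auto simp: R_def)
  qed
  \<comment> \<open>Koenig's argument: since vertices have finitely many children, induction over
    accessibility makes the set \<open>D v\<close> of descendants finite, whereas every vertex of
    the infinite tree descends from the root.\<close>
  have r_W: "r \<notin> W"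
  proof
    assume rW: "r \<in> W"
    define D where "D v = {u \<in> V. \<exists>k. (par ^^ k) u = v \<and> (\<forall>j<k. (par ^^ j) u \<in> V - {r})}" for v
    have "finite (D v)" if "v \<in> Wellfounded.acc R" "v \<in> V" for v
      using that
    proof (induction v rule: acc.induct)
      case (accI v)
      have "D v \<subseteq> insert v (\<Union>c\<in>kids v. D c)"
      proof
        fix u assume u: "u \<in> D v"
        then obtain k where k: "(par ^^ k) u = v" "\<forall>j<k. (par ^^ j) u \<in> V - {r}" unfolding D_def by blast
        show "u \<in> insert v (\<Union>c\<in>kids v. D c)"
        proof (cases k)
          case (Suc j)
          then have "(par ^^ j) u \<in> kids v" using k by (auto simp: kids_def)
          moreover have "u \<in> V" using u by (simp add: D_def)
          then have "u \<in> D ((par ^^ j) u)"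
            unfolding D_def using k(2) Suc by (intro CollectI conjI exI[of _ j]) auto
          ultimately show ?thesis by (intro insertI2 UN_I)
        qed (use k in simp)
      qed
      moreover have "finite (D c)" if "c \<in> kids v" for c
        using that by (intro accI.IH) (auto simp: R_def kids_def)
      moreover have "finite (kids v)" using fin[OF accI.prems] by (simp add: kids_def)
      ultimately show ?case by (meson finite.insertI finite_UN_I finite_subset)
    qed
    then have "finite (D r)" using rW r by (simp add: W_def)
    moreover have "V \<subseteq> D r"
    proof
      fix u assume "u \<in> V"
      then have "\<exists>k. (par ^^ k) u = r \<and> (\<forall>j<k. (par ^^ j) u \<in> V - {r})"
      proof (induction "lev u" arbitrary: u)
        case 0
        then have "u = r" using par(2)[of u] by fastforce
        then show ?case by (intro exI[of _ 0]) auto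
      next
        case (Suc n)
        show ?case
        proof (cases "u = r")
          case False
          then have p: "par u \<in> V" "n = lev (par u)" using Suc par by auto
          obtain k where k: "(par ^^ k) (par u) = r" "\<forall>j<k. (par ^^ j) (par u) \<in> V - {r}" using Suc.hyps(1)[OF p(2,1)] by blast
          have "(par ^^ j) u \<in> V - {r}" if "j < Suc k" for j
            using that k(2) False Suc.prems by (cases j) (auto simp: funpow_swap1)
          then show ?thesis using k(1) by (intro exI[of _ "Suc k"]) (simp add: funpow_swap1)
        qed (intro exI[of _ 0], auto)
      qed
      then show "u \<in> D r" using \<open>u \<in> V\<close> unfolding D_def by blast
    qed
    ultimately show False using inf finite_subset by blast
  qed
  \<comment> \<open>Restricting the relation to accessible parents makes it well-founded on the
    whole type, as \<open>wfrec\<close> demands.\<close>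
  define R' where "R' = {(c, v) \<in> R. v \<in> W}"
  have "wf R'"
  proof (rule acc_wfI, rule allI)
    fix v
    have acc': "v \<in> Wellfounded.acc R'" if "v \<notin> W" for v
      by (rule accI) (use that in \<open>auto simp: R'_def\<close>)
    have "v \<in> Wellfounded.acc R'" if "v \<in> Wellfounded.acc R" for v
      using that
    proof (induction v rule: acc.induct)
      case (accI v)
      then show ?case by - (rule Wellfounded.accI, auto simp: R'_def)
    qed
    then show "v \<in> Wellfounded.acc R'" using acc' by (auto simp: W_def)
  qed
  \<comment> \<open>For an accessible vertex this is the number of its descendants, itself included,
    all of whose mass is passed up.\<close>
  define w :: "'v \<Rightarrow> int" where "w = wfrec R' (\<lambda>w v. 1 + (\<Sum>c\<in>kids v. w c))"
  have w: "w v = 1 + (\<Sum>c\<in>kids v. w c)" if "v \<in> W" for v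
  proof -
    have "w v = 1 + (\<Sum>c\<in>kids v. cut w R' v c)"
      unfolding w_def by (subst wfrec[OF \<open>wf R'\<close>]) simp
    also have "(\<Sum>c\<in>kids v. cut w R' v c) = (\<Sum>c\<in>kids v. w c)"
      using that by (intro sum.cong refl) (simp add: cut_def R'_def R_def)
    finally show ?thesis .
  qed
  have "\<forall>v. v \<notin> W \<longrightarrow> (\<exists>c. c \<in> kids v - W)" using W_kids by blast
  then obtain ch where ch: "\<And>v. v \<notin> W \<Longrightarrow> ch v \<in> kids v - W" by metis
  \<comment> \<open>On the other vertices the value depends on that of the parent, so the recursion
    runs over the level. The chosen child receives what solves the conservation equation at its
    parent; further inaccessible children receive 0.\<close>
  define FF :: "nat \<Rightarrow> 'v \<Rightarrow> int" where
    "FF n = rec_nat (\<lambda>_. 0) (\<lambda>_ f v. if v \<in> W then w v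
       else if v = ch (par v) then f (par v) - 1 - (\<Sum>c\<in>kids (par v) \<inter> W. w c) else 0) n" for n
  define F where "F v = FF (lev v) v" for v
  have F0: "F r = 0" by (simp add: F_def FF_def r)
  have F: "F v = (if v \<in> W then w v
       else if v = ch (par v) then F (par v) - 1 - (\<Sum>c\<in>kids (par v) \<inter> W. w c) else 0)"
    if "v \<in> V" "v \<noteq> r" for v
    unfolding F_def par(2)[OF that] by (simp add: FF_def)
  have "F v = 1 + (\<Sum>c\<in>kids v. F c)" if v: "v \<in> V" for v
  proof (cases "v \<in> W")
    case True
    then have "v \<noteq> r" using r_W by blast
    then have "F v = w v" using F[OF v] True by simp
    also have "\<dots> = 1 + (\<Sum>c\<in>kids v. w c)" by (rule w[OF True])
    also have "(\<Sum>c\<in>kids v. w c) = (\<Sum>c\<in>kids v. F c)"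
      using True W_kids[of v] by (intro sum.cong refl) (auto simp: F kids_def)
    finally show ?thesis .
  next
    case False
    note c = ch[OF False]
    have finK: "finite (kids v)" using fin[OF v] by (simp add: kids_def)
    have "(\<Sum>x\<in>kids v. F x) = (\<Sum>x\<in>kids v \<inter> W. F x) + (\<Sum>x\<in>kids v - W. F x)"
      using finK by (subst sum.Int_Diff[where B = W]) auto
    also have "(\<Sum>x\<in>kids v \<inter> W. F x) = (\<Sum>x\<in>kids v \<inter> W. w x)"
      by (intro sum.cong refl) (auto simp: F kids_def)
    also have "(\<Sum>x\<in>kids v - W. F x) = (\<Sum>x\<in>{ch v}. F x)"
      using finK c by (intro sum.mono_neutral_right) (auto simp: F kids_def)
    also have "\<dots> = F v - 1 - (\<Sum>x\<in>kids v \<inter> W. w x)"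
      using c by (auto simp: F kids_def)
    finally show ?thesis by simp
  qed
  then show ?thesis using F0 by (intro that[of F]) (auto simp: kids_def)
qed

section \<open>Flows on finitely generated subgroups and coset representatives\<close>

context group
begin

text \<open>Letters are attached on the left, in agreement with the left translation of
  functions.\<close>

primrec word_ball :: "'a set \<Rightarrow> nat \<Rightarrow> 'a set" where
  "word_ball S 0 = {\<one>}"
| "word_ball S (Suc n) = word_ball S n \<union> {s \<otimes> v | s v. s \<in> S \<and> v \<in> word_ball S n}"

lemma word_ball_carrier: "S \<subseteq> carrier G \<Longrightarrow> word_ball S n \<subseteq> carrier G"
  by (induction n) auto

lemma word_ball_mult:
  assumes S: "S \<subseteq> carrier G" and x: "x \<in> word_ball S k" and y: "y \<in> word_ball S n"
  shows "x \<otimes> y \<in> word_ball S (k + n)"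
  using x
proof (induction k arbitrary: x)
  case 0
  then show ?case using y subsetD[OF word_ball_carrier[OF S] y] by simp
next
  case (Suc k)
  show ?case
  proof (cases "x \<in> word_ball S k")
    case True
    then show ?thesis using Suc.IH by simp
  next
    case False
    then obtain s v where "x = s \<otimes> v" "s \<in> S" "v \<in> word_ball S k" using Suc.prems by auto
    moreover have "s \<otimes> v \<otimes> y = s \<otimes> (v \<otimes> y)"
      using calculation S y word_ball_carrier[OF S] by (intro m_assoc) auto
    ultimately show ?thesis using Suc.IH by auto
  qed
qed

lemma word_ball_subgroup:
  assumes S: "S \<subseteq> carrier G" and inv: "\<And>s. s \<in> S \<Longrightarrow> inv s \<in> S"
  shows "subgroup (\<Union>n. word_ball S n) G"
proof
  show "(\<Union>n. word_ball S n) \<subseteq> carrier G" using word_ball_carrier[OF S] by blast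
  show "\<one> \<in> (\<Union>n. word_ball S n)" by (rule UN_I[of 0]) auto
  show "x \<otimes> y \<in> (\<Union>n. word_ball S n)" if "x \<in> (\<Union>n. word_ball S n)" "y \<in> (\<Union>n. word_ball S n)" for x y
    using that word_ball_mult[OF S] by blast
  have "inv x \<in> word_ball S n" if "x \<in> word_ball S n" for x n
    using that
  proof (induction n arbitrary: x)
    case (Suc n)
    show ?case
    proof (cases "x \<in> word_ball S n")
      case False
      then obtain s v where x: "x = s \<otimes> v" "s \<in> S" "v \<in> word_ball S n" using Suc.prems by auto
      then have c: "s \<in> carrier G" "v \<in> carrier G" using S word_ball_carrier[OF S] by auto
      have "inv s \<otimes> \<one> \<in> word_ball S (Suc 0)" using inv[OF x(2)] by auto
      then have "inv s \<in> word_ball S (Suc 0)" using c by simp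
      then have "inv v \<otimes> inv s \<in> word_ball S (n + Suc 0)"
        using Suc.IH[OF x(3)] word_ball_mult[OF S] by blast
      then show ?thesis using c x by (simp add: inv_mult_group)
    qed (use Suc.IH in auto)
  qed simp
  then show "inv x \<in> (\<Union>n. word_ball S n)" if "x \<in> (\<Union>n. word_ball S n)" for x
    using that by blast
qed

text \<open>The tree is a spanning tree of the Cayley graph: the parent of \<open>v\<close> arises
  by stripping the first letter \<open>gen v\<close> of a shortest word for \<open>v\<close>.
  \<open>F s v\<close> is the tree flow leaving \<open>v\<close> along the letter \<open>s\<close>,
  and \<open>F s (s \<otimes> v)\<close> is the flow entering \<open>v\<close> along it, so the sum
  is the net outflow.\<close>

lemma infinite_subgroup_flow:
  assumes S: "S \<subseteq> carrier G" "finite S" and inv: "\<And>s. s \<in> S \<Longrightarrow> inv s \<in> S"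
    and inf: "infinite (\<Union>n. word_ball S n)"
  obtains F :: "'a \<Rightarrow> 'a \<Rightarrow> int" where
    "\<And>v. v \<in> (\<Union>n. word_ball S n) \<Longrightarrow> (\<Sum>s\<in>S. F s v - F s (s \<otimes> v)) = 1"
proof -
  define V where "V = (\<Union>n. word_ball S n)"
  interpret V: subgroup V G unfolding V_def by (rule word_ball_subgroup[OF S(1) inv])
  define lev where "lev v = (LEAST n. v \<in> word_ball S n)" for v
  have lev: "v \<in> word_ball S (lev v)" if v: "v \<in> V" for v
  proof -
    obtain n where "v \<in> word_ball S n" using v by (auto simp: V_def)
    then show ?thesis unfolding lev_def by (rule LeastI[where P = "\<lambda>n. v \<in> word_ball S n"])
  qed
  have lev_le: "lev v \<le> n" if "v \<in> word_ball S n" for v n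
    unfolding lev_def using that by (rule Least_le[where P = "\<lambda>n. v \<in> word_ball S n"])
  have S_V: "S \<subseteq> V"
  proof
    fix s assume s: "s \<in> S"
    then have "s \<otimes> \<one> \<in> word_ball S (Suc 0)" by auto
    moreover have "s \<otimes> \<one> = s" using s S(1) by auto
    ultimately show "s \<in> V" unfolding V_def by (metis UN_I UNIV_I)
  qed
  have step: "\<exists>s\<in>S. inv s \<otimes> v \<in> V \<and> lev v = Suc (lev (inv s \<otimes> v))" if v: "v \<in> V" "v \<noteq> \<one>" for v
  proof (cases "lev v")
    case 0
    then show ?thesis using lev[OF v(1)] v by simp
  next
    case (Suc n)
    then have "v \<notin> word_ball S n" using lev_le[of v n] by auto
    then obtain s u where u: "v = s \<otimes> u" "s \<in> S" "u \<in> word_ball S n"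
      using lev[OF v(1)] Suc by auto
    then have c: "s \<in> carrier G" "u \<in> carrier G" using S word_ball_carrier[OF S(1)] by auto
    have eq: "inv s \<otimes> v = u" using u(1) c by (simp flip: m_assoc)
    have "u \<in> V" using u(3) by (auto simp: V_def)
    have "v \<in> word_ball S (Suc (lev u))" using u(1,2) lev[OF \<open>u \<in> V\<close>] by auto
    then have "lev v \<le> Suc (lev u)" by (rule lev_le)
    moreover have "lev u \<le> n" using u(3) by (rule lev_le)
    ultimately have "lev v = Suc (lev u)" using Suc by simp
    then show ?thesis using u(2) eq \<open>u \<in> V\<close> by auto
  qed
  then obtain gen where gen: "\<And>v. \<lbrakk>v \<in> V; v \<noteq> \<one>\<rbrakk> \<Longrightarrow> gen v \<in> S"
      "\<And>v. \<lbrakk>v \<in> V; v \<noteq> \<one>\<rbrakk> \<Longrightarrow> inv (gen v) \<otimes> v \<in> V"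
      "\<And>v. \<lbrakk>v \<in> V; v \<noteq> \<one>\<rbrakk> \<Longrightarrow> lev v = Suc (lev (inv (gen v) \<otimes> v))" by metis
  define par where "par v = inv (gen v) \<otimes> v" for v
  have kid: "c = gen c \<otimes> v" if "c \<in> V" "c \<noteq> \<one>" "par c = v" for c v
    using that gen(1)[OF that(1,2)] S(1) V.subset by (auto simp: par_def simp flip: m_assoc)
  \<comment> \<open>Indexing the children of \<open>v\<close> by letters yields both the local
    finiteness demanded of the tree and the reindexing of the inflow.\<close>
  have kids: "bij_betw (\<lambda>s. s \<otimes> v) {s \<in> S. s \<otimes> v \<noteq> \<one> \<and> gen (s \<otimes> v) = s} {c \<in> V - {\<one>}. par c = v}"
    if v: "v \<in> V" for v
  proof (rule bij_betwI[where g = gen])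
    have vc: "v \<in> carrier G" using v V.subset by blast
    show "(\<lambda>s. s \<otimes> v) \<in> {s \<in> S. s \<otimes> v \<noteq> \<one> \<and> gen (s \<otimes> v) = s} \<rightarrow> {c \<in> V - {\<one>}. par c = v}"
      using S_V v vc S(1) V.m_closed by (auto simp: par_def subset_iff simp flip: m_assoc)
    show "gen \<in> {c \<in> V - {\<one>}. par c = v} \<rightarrow> {s \<in> S. s \<otimes> v \<noteq> \<one> \<and> gen (s \<otimes> v) = s}"
    proof
      fix c assume c: "c \<in> {c \<in> V - {\<one>}. par c = v}"
      then have "gen c \<otimes> v = c" using kid[of c v] by simp
      then show "gen c \<in> {s \<in> S. s \<otimes> v \<noteq> \<one> \<and> gen (s \<otimes> v) = s}" using c gen(1) by auto
    qed
    show "gen c \<otimes> v = c" if "c \<in> {c \<in> V - {\<one>}. par c = v}" for c using that kid[of c v] by simp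
  qed auto
  have "lev \<one> = 0" using lev_le[of \<one> 0] by simp
  moreover have "finite {c \<in> V - {\<one>}. par c = v}" if "v \<in> V" for v
    using bij_betw_finite[OF kids[OF that]] S(2) by simp
  moreover have "infinite V" using inf by (simp add: V_def)
  ultimately obtain f :: "'a \<Rightarrow> int" where f: "f \<one> = 0"
    "\<And>v. v \<in> V \<Longrightarrow> f v = 1 + (\<Sum>c | c \<in> V - {\<one>} \<and> par c = v. f c)"
    using infinite_tree_flow[of V \<one> lev par] gen(2,3) by (auto simp: par_def)
  \<comment> \<open>The unit has no letter to strip, so nothing leaves it; this is consistent
    because the tree flow is 0 at the root.\<close>
  define F where "F s v = (if v \<noteq> \<one> \<and> gen v = s then f v else 0)" for s v
  have "(\<Sum>s\<in>S. F s v - F s (s \<otimes> v)) = 1" if v: "v \<in> V" for v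
  proof -
    have "(\<Sum>s\<in>S. F s v) = f v"
    proof (cases "v = \<one>")
      case False
      then show ?thesis using S(2) gen(1)[OF v] by (simp add: F_def)
    qed (simp add: F_def f)
    moreover have "(\<Sum>s\<in>S. F s (s \<otimes> v)) = (\<Sum>c | c \<in> V - {\<one>} \<and> par c = v. f c)"
    proof -
      have "(\<Sum>s\<in>S. F s (s \<otimes> v)) = (\<Sum>s | s \<in> S \<and> s \<otimes> v \<noteq> \<one> \<and> gen (s \<otimes> v) = s. f (s \<otimes> v))"
        using S(2) by (simp add: F_def sum.If_cases Int_def conj_commute)
      also have "\<dots> = (\<Sum>c | c \<in> V - {\<one>} \<and> par c = v. f c)"
        by (rule sum.reindex_bij_betw[OF kids[OF v]])
      finally show ?thesis .
    qed
    ultimately show ?thesis using f(2)[OF v] by (simp add: sum_subtractf)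
  qed
  then show ?thesis using that V_def by blast
qed

text \<open>Each \<open>x\<close> factors as an element of \<open>H\<close> times a representative
  that depends only on the right coset of \<open>x\<close>. Through the first factor, functions on
  \<open>H\<close> extend to the whole group compatibly with left translation by
  \<open>H\<close>.\<close>

lemma coset_representatives:
  assumes H: "subgroup H G"
  obtains r where "\<And>x. x \<in> carrier G \<Longrightarrow> r x \<in> carrier G" "\<And>x. x \<in> carrier G \<Longrightarrow> x \<otimes> inv (r x) \<in> H"
    "\<And>h x. \<lbrakk>h \<in> H; x \<in> carrier G\<rbrakk> \<Longrightarrow> r (h \<otimes> x) = r x"
proof -
  interpret H: subgroup H G by (rule H)
  define r where "r x = (SOME y. y \<in> H #> x)" for x
  have r: "r x \<in> H #> x" if "x \<in> carrier G" for x
    unfolding r_def using rcos_self[OF that H] by (rule someI)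
  have 1: "r x \<in> carrier G" if "x \<in> carrier G" for x
    using r[OF that] r_coset_subset_G[OF H.subset that] by blast
  have 2: "x \<otimes> inv (r x) \<in> H" if x: "x \<in> carrier G" for x
  proof -
    obtain h where h: "h \<in> H" "r x = h \<otimes> x" using r[OF x] by (auto simp: r_coset_def)
    then have "x \<otimes> inv (r x) = inv h" using x H.subset by (auto simp: inv_mult_group simp flip: m_assoc)
    then show ?thesis using h by simp
  qed
  have 3: "r (h \<otimes> x) = r x" if "h \<in> H" "x \<in> carrier G" for h x
  proof -
    have "H #> (h \<otimes> x) = H #> x"
      using that H.subset coset_mult_assoc[OF H.subset, of h x] coset_join2[OF _ H] by (auto simp: subset_iff)
    then show ?thesis by (simp add: r_def)
  qed
  show ?thesis using that 1 2 3 by blast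
qed

end

section \<open>Consequences of an invariant functional\<close>

context group_convolution
begin

definition const1 :: "'g \<Rightarrow> 'k" where "const1 = (\<lambda>g. if g \<in> carrier G then 1 else 0)"

lemma const1_mem: "const1 \<in> carrier L"
  by (rule L_memI[where C = 1]) (auto simp: const1_def)

lemma L_sum_mem: "(\<And>i. i \<in> I \<Longrightarrow> u i \<in> carrier L) \<Longrightarrow> (\<lambda>x. \<Sum>i\<in>I. u i x) \<in> carrier L"
proof (induction I rule: infinite_finite_induct)
  case (insert i I)
  then show ?case using L_add_mem[of "u i" "\<lambda>x. \<Sum>i\<in>I. u i x"] by simp
qed (use L.M.zero_closed in \<open>auto simp: L_simps\<close>)

lemma functional_sum:
  assumes \<mu>: "bounded_linear_map L scalars \<mu>" and "\<And>i. i \<in> I \<Longrightarrow> u i \<in> carrier L"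
  shows "\<mu> (\<lambda>x. \<Sum>i\<in>I. u i x) = (\<Sum>i\<in>I. \<mu> (u i))"
  using assms(2)
proof (induction I rule: infinite_finite_induct)
  case (insert i I)
  then have "\<mu> (\<lambda>x. u i x + (\<Sum>i\<in>I. u i x)) = \<mu> (u i) + \<mu> (\<lambda>x. \<Sum>i\<in>I. u i x)"
    using bounded_linear_mapD(2)[OF \<mu>, of "u i" "\<lambda>x. \<Sum>i\<in>I. u i x"] L_sum_mem[of I u] by (simp add: L_simps)
  then show ?case using insert by simp
qed (use bounded_linear_mapD(3)[OF \<mu>, of "\<lambda>_. 0" 0] L.M.zero_closed in \<open>auto simp: L_simps\<close>)

context
  fixes \<mu> :: "('g \<Rightarrow> 'k) \<Rightarrow> 'k"
  assumes \<mu>: "bounded_linear_map L scalars \<mu>"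
    and invariant: "\<And>g f. \<lbrakk>g \<in> carrier G; f \<in> carrier L\<rbrakk> \<Longrightarrow> \<mu> (translate G g f) = \<mu> f"
    and nonzero: "\<mu> const1 \<noteq> 0"
begin

text \<open>The flow is defined on \<open>H\<close> only. Evaluating it at
  \<open>x \<otimes> inv (r x)\<close> spreads it over all right cosets, and left translation by a
  generator still acts there as it does on \<open>H\<close>, since \<open>r\<close> does not
  change.\<close>

lemma mean_locally_finite:
  assumes "T \<subseteq> carrier G" "finite T"
  shows "\<exists>H. subgroup H G \<and> finite H \<and> T \<subseteq> H"
proof -
  define S where "S = T \<union> (\<lambda>s. inv s) ` T"
  have S: "S \<subseteq> carrier G" "finite S" and inv: "\<And>s. s \<in> S \<Longrightarrow> inv s \<in> S"
    using assms by (auto simp: S_def)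
  define H where "H = (\<Union>n. word_ball S n)"
  have H: "subgroup H G" unfolding H_def by (rule word_ball_subgroup[OF S(1) inv])
  interpret H: subgroup H G by (rule H)
  have "T \<subseteq> H"
  proof
    fix s assume s: "s \<in> T"
    then have "s \<otimes> \<one> \<in> word_ball S (Suc 0)" by (auto simp: S_def)
    moreover have "s \<otimes> \<one> = s" using s assms(1) by auto
    ultimately show "s \<in> H" unfolding H_def by (metis UN_I UNIV_I)
  qed
  have S_H: "S \<subseteq> H" using \<open>T \<subseteq> H\<close> by (auto simp: S_def)
  have "finite H"
  proof (rule ccontr)
    assume "infinite H"
    then obtain F :: "'g \<Rightarrow> 'g \<Rightarrow> int" where F: "\<And>v. v \<in> H \<Longrightarrow> (\<Sum>s\<in>S. F s v - F s (s \<otimes> v)) = 1"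
      using infinite_subgroup_flow[OF S inv] unfolding H_def by metis
    obtain r where r: "\<And>x. x \<in> carrier G \<Longrightarrow> r x \<in> carrier G" "\<And>x. x \<in> carrier G \<Longrightarrow> x \<otimes> inv (r x) \<in> H"
      "\<And>h x. \<lbrakk>h \<in> H; x \<in> carrier G\<rbrakk> \<Longrightarrow> r (h \<otimes> x) = r x"
      using coset_representatives[OF H] by blast
    define f :: "'g \<Rightarrow> 'g \<Rightarrow> 'k" where
      "f s x = (if x \<in> carrier G then of_int (F s (x \<otimes> inv (r x))) else 0)" for s x
    \<comment> \<open>The bound 1 holds although the integers \<open>F s v\<close> themselves may be
      unbounded.\<close>
    have f: "f s \<in> carrier L" for s
      by (rule L_memI[where C = 1]) (auto simp: f_def vabs_of_int_le)
    have tf: "translate G (inv s) (f s) \<in> carrier L" if "s \<in> S" for s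
      using that S(1) by (intro translate_mem_L f) auto
    have eq: "const1 = (\<lambda>x. \<Sum>s\<in>S. f s x + (- 1) * translate G (inv s) (f s) x)"
    proof
      fix x
      show "const1 x = (\<Sum>s\<in>S. f s x + (- 1) * translate G (inv s) (f s) x)"
      proof (cases "x \<in> carrier G")
        case True
        have "f s x + (- 1) * translate G (inv s) (f s) x
          = of_int (F s (x \<otimes> inv (r x)) - F s (s \<otimes> (x \<otimes> inv (r x))))" if s: "s \<in> S" for s
          using s S(1) S_H True r by (auto simp: f_def translate_def m_assoc subset_iff)
        then have "(\<Sum>s\<in>S. f s x + (- 1) * translate G (inv s) (f s) x)
          = of_int (\<Sum>s\<in>S. F s (x \<otimes> inv (r x)) - F s (s \<otimes> (x \<otimes> inv (r x))))"
          by simp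
        also have "\<dots> = 1" using F[OF r(2)[OF True]] by simp
        finally show ?thesis using True by (simp add: const1_def)
      qed (simp add: const1_def f_def translate_def)
    qed
    have t': "(\<lambda>x. (- 1) * translate G (inv s) (f s) x) \<in> carrier L" if "s \<in> S" for s
      by (rule L_smult_mem[OF tf[OF that]])
    have "\<mu> (\<lambda>x. f s x + (- 1) * translate G (inv s) (f s) x) = 0" if s: "s \<in> S" for s
    proof -
      have "\<mu> (\<lambda>x. f s x + (- 1) * translate G (inv s) (f s) x) = \<mu> (f s) + (- 1) * \<mu> (translate G (inv s) (f s))"
        using bounded_linear_mapD(2)[OF \<mu> f t'[OF s], of s] bounded_linear_mapD(3)[OF \<mu> tf[OF s], of "- 1"]
        unfolding L_simps scalars_simps by simp
      then show ?thesis using invariant[of "inv s" "f s"] f s S(1) by auto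
    qed
    then have "\<mu> const1 = 0"
      unfolding eq using L_add_mem[OF f t'] by (subst functional_sum[OF \<mu>]) auto
    then show False using nonzero by simp
  qed
  then show ?thesis using H \<open>T \<subseteq> H\<close> by blast
qed

lemma mean_finite_subgroups_bound:
  obtains C where "C > 0" "\<And>H. \<lbrakk>subgroup H G; finite H\<rbrakk> \<Longrightarrow> inverse C \<le> vabs (of_nat (card H) :: 'k)"
proof -
  obtain D where D: "\<And>f. f \<in> carrier L \<Longrightarrow> vabs (\<mu> f) \<le> D * nrm L f"
    using \<mu> unfolding bounded_linear_map_def scalars_simps by blast
  define E where "E = max D 1"
  have E: "vabs (\<mu> f) \<le> E * nrm L f" if "f \<in> carrier L" for f
    by (rule order_trans[OF D[OF that]], rule mult_right_mono) (simp_all add: E_def L.nrm_nonneg that)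
  \<comment> \<open>If \<open>f\<close> is the indicator of a transversal, the absolute value of
    \<open>\<mu> const1\<close> is that of \<open>card H\<close> times that of
    \<open>\<mu> f\<close>, and the latter is at most \<open>E\<close>.\<close>
  define C where "C = E / vabs (\<mu> const1)"
  have C: "C > 0" using vabs_pos[OF nonzero] by (simp add: C_def E_def)
  have "inverse C \<le> vabs (of_nat (card H) :: 'k)" if H: "subgroup H G" and fin: "finite H" for H
  proof -
    interpret H: subgroup H G by (rule H)
    obtain r where r: "\<And>x. x \<in> carrier G \<Longrightarrow> r x \<in> carrier G" "\<And>x. x \<in> carrier G \<Longrightarrow> x \<otimes> inv (r x) \<in> H"
      "\<And>h x. \<lbrakk>h \<in> H; x \<in> carrier G\<rbrakk> \<Longrightarrow> r (h \<otimes> x) = r x"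
      using coset_representatives[OF H] by blast
    \<comment> \<open>The indicator of the chosen representatives. Its translates by elements of
      \<open>H\<close> partition the group: \<open>x\<close> lies in the translate by
      \<open>x \<otimes> inv (r x)\<close> and in no other.\<close>
    define f :: "'g \<Rightarrow> 'k" where "f x = (if x \<in> carrier G \<and> r x = x then 1 else 0)" for x
    have f: "f \<in> carrier L" by (rule L_memI[where C = 1]) (auto simp: f_def)
    have tf: "translate G h f \<in> carrier L" if "h \<in> H" for h
      using that by (intro translate_mem_L f) auto
    have "const1 = (\<lambda>x. \<Sum>h\<in>H. translate G h f x)"
    proof
      fix x
      show "const1 x = (\<Sum>h\<in>H. translate G h f x)"
      proof (cases "x \<in> carrier G")
        case True
        have "translate G h f x = (if h = x \<otimes> inv (r x) then 1 else 0)" if h: "h \<in> H" for h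
        proof -
          have "r (inv h \<otimes> x) = r x" using h True by (intro r) auto
          moreover have "r x = inv h \<otimes> x \<longleftrightarrow> h = x \<otimes> inv (r x)"
            using h True r(1)[OF True] by (metis H.mem_carrier inv_closed inv_inv inv_solve_left inv_solve_right m_closed)
          ultimately show ?thesis using h True by (simp add: translate_def f_def)
        qed
        then have "(\<Sum>h\<in>H. translate G h f x) = 1" using fin r(2)[OF True] by simp
        then show ?thesis using True by (simp add: const1_def)
      qed (simp add: const1_def translate_def)
    qed
    then have "\<mu> const1 = (\<Sum>h\<in>H. \<mu> (translate G h f))" using functional_sum[OF \<mu> tf] by simp
    also have "\<dots> = of_nat (card H) * \<mu> f" using invariant[OF _ f] by simp
    finally have "vabs (\<mu> const1) = vabs (of_nat (card H) :: 'k) * vabs (\<mu> f)" by (simp add: vabs_mult)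
    also have "\<dots> \<le> vabs (of_nat (card H) :: 'k) * E"
    proof (intro mult_left_mono)
      have "nrm L f \<le> 1" by (rule nrm_le) (auto simp: f_def)
      then have "E * nrm L f \<le> E * 1" by (intro mult_left_mono) (auto simp: E_def)
      then show "vabs (\<mu> f) \<le> E" using E[OF f] by simp
    qed simp
    finally show ?thesis by (simp add: C_def E_def field_simps)
  qed
  then show ?thesis using that C by blast
qed

end

end

section \<open>Averaging over finite subgroups\<close>

lemma bounded_linear_map_finsum:
  assumes E: "nonarch_seminormed_space E" and F: "nonarch_seminormed_space F"
    and "finite I" "\<And>i. i \<in> I \<Longrightarrow> bounded_linear_map E F (f i)"
  shows "bounded_linear_map E F (\<lambda>x. finsum F (\<lambda>i. f i x) I)"
  using assms(3,4)
proof (induction I)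
  case empty
  interpret F: nonarch_seminormed_space F by fact
  interpret E: nonarch_seminormed_space E by fact
  show ?case by (rule bounded_linear_mapI[where C = 0]) auto
next
  case (insert i I)
  interpret F: nonarch_seminormed_space F by fact
  have "bounded_linear_map E F (\<lambda>x. f i x \<oplus>\<^bsub>F\<^esub> finsum F (\<lambda>i. f i x) I)"
    using insert by (intro bounded_linear_map_add E F) auto
  then show ?case
  proof (rule bounded_linear_map_cong[OF _ _ E])
    fix x assume x: "x \<in> carrier E"
    show "f i x \<oplus>\<^bsub>F\<^esub> finsum F (\<lambda>i. f i x) I = finsum F (\<lambda>i. f i x) (insert i I)"
      using insert.hyps insert.prems[THEN bounded_linear_mapD(1), OF _ x]
      by (intro F.M.finsum_insert[symmetric]) auto
  qed
qed

context bounded_map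
begin

lemma finsum: "(\<And>i. i \<in> I \<Longrightarrow> u i \<in> carrier E) \<Longrightarrow> f (finsum E u I) = finsum F (\<lambda>i. f (u i)) I"
proof (induction I rule: infinite_finite_induct)
  case (insert i I)
  then have "u \<in> I \<rightarrow> carrier E" "(\<lambda>i. f (u i)) \<in> I \<rightarrow> carrier F" "u i \<in> carrier E" by auto
  then show ?case using insert by (simp add: E.M.finsum_insert F.M.finsum_insert add)
qed (auto simp: E.M.finsum_infinite F.M.finsum_infinite)

end

lemma (in group_convolution) conv_delta_one:
  assumes "a \<in> carrier A" shows "a \<otimes>\<^bsub>A\<^esub> delta \<one> = a" "delta \<one> \<otimes>\<^bsub>A\<^esub> a = a"
proof -
  show "a \<otimes>\<^bsub>A\<^esub> delta \<one> = a"
  proof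
    fix x
    have "(\<Sum>\<^sub>\<infinity>g\<in>carrier G. a g * delta \<one> (inv g \<otimes> x)) = (\<Sum>\<^sub>\<infinity>g\<in>{x}. a g)" if x: "x \<in> carrier G"
    proof (rule infsum_cong_neutral)
      show "a g * delta \<one> (inv g \<otimes> x) = 0" if "g \<in> carrier G - {x}" for g
        using that x inv_solve_left[of \<one> g x] by (auto simp: delta_def)
    qed (use x in \<open>auto simp: delta_def\<close>)
    then show "(a \<otimes>\<^bsub>A\<^esub> delta \<one>) x = a x"
      using assms by (auto simp: A_mult conv_def A_mem)
  qed
  show "delta \<one> \<otimes>\<^bsub>A\<^esub> a = a"
    using assms by (auto simp: A_mult conv_delta translate_def A_mem fun_eq_iff)
qed

section \<open>Conjugation averages on a bimodule\<close>

locale convolution_bimodule = group_convolution G K + Y: banach_bimodule A Y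
  for G :: "('g, 'm) monoid_scheme" (structure)
    and K :: "'k::spherically_complete_field itself"
    and Y :: "('k, 'g \<Rightarrow> 'k, 'y, 'n) bimodule_scheme"
begin

abbreviation N where "N \<equiv> commutator_span A Y"

abbreviation l :: "('g \<Rightarrow> 'k) \<Rightarrow> 'y \<Rightarrow> 'y" where "l \<equiv> lact Y"
abbreviation r :: "'y \<Rightarrow> ('g \<Rightarrow> 'k) \<Rightarrow> 'y" where "r \<equiv> ract Y"

lemma Y_seminormed: "nonarch_seminormed_space Y" by unfold_locales

lemma l_bounded: "a \<in> carrier A \<Longrightarrow> bounded_linear_map Y Y (l a)"
  by (rule bounded_bilinear_mapD(1)[OF Y.lact_bilinear])

lemma r_bounded: "a \<in> carrier A \<Longrightarrow> bounded_linear_map Y Y (\<lambda>y. r y a)"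
  by (rule bounded_bilinear_mapD(2)[OF Y.ract_bilinear])

lemmas lr_mem [simp] = Y.lact_mem Y.ract_mem delta_mem

text \<open>On a bimodule that is not unital, \<open>conj \<one>\<close> is the projection that
  multiplies by \<open>delta \<one>\<close> on both sides, rather than the identity.\<close>

definition conj :: "'g \<Rightarrow> 'y \<Rightarrow> 'y" where
  "conj h y = l (delta h) (r y (delta (inv h)))"

definition avg :: "'g set \<Rightarrow> 'y \<Rightarrow> 'y" where
  "avg H y = inverse (of_nat (card H)) \<odot>\<^bsub>Y\<^esub> finsum Y (\<lambda>h. conj h y) H"

text \<open>The part on which \<open>A\<close> acts by zero from both sides: \<open>(1 - \<delta>\<^sub>e) y (1 - \<delta>\<^sub>e)\<close>.\<close>

definition degenerate_part :: "'y \<Rightarrow> 'y" where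
  "degenerate_part y = y \<ominus>\<^bsub>Y\<^esub> ((l (delta \<one>) y \<ominus>\<^bsub>Y\<^esub> l (delta \<one>) (r y (delta \<one>))) \<oplus>\<^bsub>Y\<^esub> r y (delta \<one>))"

text \<open>Multiplication by \<open>delta \<one>\<close> on either side splits \<open>y\<close>
  into four components. The one fixed from both sides is averaged, the one killed from both sides is
  kept, and the two mixed ones are discarded because they are commutators.\<close>

definition full_avg :: "'g set \<Rightarrow> 'y \<Rightarrow> 'y" where
  "full_avg H y = avg H y \<oplus>\<^bsub>Y\<^esub> degenerate_part y"

lemma conj_bounded: "h \<in> carrier G \<Longrightarrow> bounded_linear_map Y Y (conj h)"
  unfolding conj_def
  by (rule bounded_linear_map_comp[OF _ _ _ r_bounded l_bounded]) (simp_all add: Y_seminormed)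

lemma conj_mem [simp]: "\<lbrakk>h \<in> carrier G; y \<in> carrier Y\<rbrakk> \<Longrightarrow> conj h y \<in> carrier Y"
  by (simp add: conj_def)

lemma avg_bounded: "\<lbrakk>finite H; H \<subseteq> carrier G\<rbrakk> \<Longrightarrow> bounded_linear_map Y Y (avg H)"
  unfolding avg_def
  by (intro bounded_linear_map_smult bounded_linear_map_finsum Y_seminormed conj_bounded) auto

lemma degenerate_part_bounded: "bounded_linear_map Y Y degenerate_part"
  unfolding degenerate_part_def
  by (intro bounded_linear_map_diff bounded_linear_map_add bounded_linear_map_id l_bounded r_bounded
      Y_seminormed bounded_linear_map_comp[OF _ _ _ r_bounded l_bounded]) simp_all

lemma full_avg_bounded: "\<lbrakk>finite H; H \<subseteq> carrier G\<rbrakk> \<Longrightarrow> bounded_linear_map Y Y (full_avg H)"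
  unfolding full_avg_def
  by (intro bounded_linear_map_add avg_bounded degenerate_part_bounded Y_seminormed)

text \<open>Point masses have norm 1, so conjugation costs a factor that does not depend on the
  group element, and a sum of conjugates costs no more than one of them. Only the factor 1/|H| could
  be large, and \<open>C\<close> controls it.\<close>

lemma full_avg_uniform_bound:
  assumes C: "C > 0" "\<And>H. \<lbrakk>subgroup H G; finite H\<rbrakk> \<Longrightarrow> inverse C \<le> vabs (of_nat (card H) :: 'k)"
  obtains B where "B > 0"
    "\<And>H y. \<lbrakk>subgroup H G; finite H; y \<in> carrier Y\<rbrakk> \<Longrightarrow> nrm Y (full_avg H y) \<le> B * nrm Y y"
proof -
  obtain C1 where C1: "\<forall>a\<in>carrier A. \<forall>y\<in>carrier Y. nrm Y (l a y) \<le> C1 * nrm A a * nrm Y y"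
    using Y.lact_bilinear unfolding bounded_bilinear_map_def by blast
  obtain C2 where C2: "\<forall>y\<in>carrier Y. \<forall>a\<in>carrier A. nrm Y (r y a) \<le> C2 * nrm Y y * nrm A a"
    using Y.ract_bilinear unfolding bounded_bilinear_map_def by blast
  interpret d: bounded_map Y Y degenerate_part
    by (intro bounded_mapI Y_seminormed degenerate_part_bounded)
  obtain D where D: "D > 0" "\<And>y. y \<in> carrier Y \<Longrightarrow> nrm Y (degenerate_part y) \<le> D * nrm Y y"
    by (rule d.bound) auto
  define M where "M = max C1 0 * max C2 0"
  have M: "M \<ge> 0" by (simp add: M_def)
  have conj_le: "nrm Y (conj h y) \<le> M * nrm Y y" if "h \<in> carrier G" "y \<in> carrier Y" for h y
  proof -
    let ?u = "r y (delta (inv h))"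
    have n: "0 \<le> nrm Y y" "0 \<le> nrm Y ?u" using that by (auto intro!: Y.nrm_nonneg)
    have "nrm Y (conj h y) \<le> C1 * 1 * nrm Y ?u"
      using C1[rule_format, of "delta h" ?u] that unfolding conj_def by (simp add: nrm_delta A_simps)
    also have "\<dots> \<le> max C1 0 * nrm Y ?u" using n by (simp add: mult_right_mono)
    also have "nrm Y ?u \<le> C2 * nrm Y y * 1"
      using C2[rule_format, of y "delta (inv h)"] that by (simp add: nrm_delta A_simps)
    also have "\<dots> \<le> max C2 0 * nrm Y y" using n by (simp add: mult_right_mono)
    finally show ?thesis by (simp add: M_def mult.assoc mult_left_mono)
  qed
  define B where "B = max (C * M) D"
  show ?thesis
  proof (rule that[of B])
    show "B > 0" using D(1) by (simp add: B_def)
    fix H y assume H: "subgroup H G" "finite H" and y: "y \<in> carrier Y"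
    interpret H: subgroup H G by (rule H)
    have n: "0 \<le> nrm Y y" using y by (rule Y.nrm_nonneg)
    have "vabs (inverse (of_nat (card H) :: 'k)) \<le> C"
      using C(2)[OF H] C(1) by (simp add: vabs_inverse) (metis inverse_inverse_eq le_imp_inverse_le positive_imp_inverse_positive)
    moreover have fm: "finsum Y (\<lambda>h. conj h y) H \<in> carrier Y"
      using y H.subset by (intro Y.M.finsum_closed) auto
    moreover have "nrm Y (finsum Y (\<lambda>h. conj h y) H) \<le> M * nrm Y y"
      using y conj_le H.subset M n by (intro Y.nrm_finsum_le) auto
    ultimately have "nrm Y (avg H y) \<le> C * (M * nrm Y y)"
      unfolding avg_def using C(1) Y.nrm_nonneg[OF fm] by (simp add: Y.nrm_smult mult_mono)
    also have "\<dots> \<le> B * nrm Y y" using n by (simp add: B_def mult_right_mono flip: mult.assoc)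
    finally have a: "nrm Y (avg H y) \<le> B * nrm Y y" .
    have "nrm Y (degenerate_part y) \<le> D * nrm Y y" using D y by blast
    also have "\<dots> \<le> B * nrm Y y" using n by (simp add: B_def mult_right_mono)
    finally have b: "nrm Y (degenerate_part y) \<le> B * nrm Y y" .
    have "avg H y \<in> carrier Y" unfolding avg_def using fm by simp
    then show "nrm Y (full_avg H y) \<le> B * nrm Y y"
      unfolding full_avg_def using Y.nrm_add[of "avg H y" "degenerate_part y"] a b y by auto
  qed
qed

lemmas N = Y.submodule_mem[OF Y.commutator_span_submodule]

lemma l_l: "\<lbrakk>g \<in> carrier G; h \<in> carrier G; y \<in> carrier Y\<rbrakk> \<Longrightarrow> l (delta g) (l (delta h) y) = l (delta (g \<otimes> h)) y"
  by (simp add: delta_mult flip: Y.lact_assoc)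

lemma r_r: "\<lbrakk>g \<in> carrier G; h \<in> carrier G; y \<in> carrier Y\<rbrakk> \<Longrightarrow> r (r y (delta g)) (delta h) = r y (delta (g \<otimes> h))"
  by (simp add: delta_mult flip: Y.ract_assoc)

lemma l_r: "\<lbrakk>g \<in> carrier G; h \<in> carrier G; y \<in> carrier Y\<rbrakk> \<Longrightarrow> r (l (delta g) y) (delta h) = l (delta g) (r y (delta h))"
  by (simp add: Y.lact_ract)

text \<open>The difference is the single commutator of \<open>delta h\<close> with
  \<open>l (delta \<one>) (r y (delta (inv h)))\<close>.\<close>

lemma conj_congruent:
  assumes "h \<in> carrier G" "y \<in> carrier Y"
  shows "conj h y \<ominus>\<^bsub>Y\<^esub> conj \<one> y \<in> N"
  using Y.commutator_mem[of "delta h" "l (delta \<one>) (r y (delta (inv h)))"] assms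
  by (simp add: conj_def l_l l_r r_r)

lemma avg_congruent:
  assumes H: "subgroup H G" "finite H" and c: "of_nat (card H) \<noteq> (0 :: 'k)" and y: "y \<in> carrier Y"
  shows "avg H y \<ominus>\<^bsub>Y\<^esub> conj \<one> y \<in> N"
proof -
  interpret H: subgroup H G by (rule H)
  have "finsum Y (\<lambda>h. conj h y) F \<ominus>\<^bsub>Y\<^esub> of_nat (card F) \<odot>\<^bsub>Y\<^esub> conj \<one> y \<in> N" if "finite F" "F \<subseteq> H" for F
    using that
  proof (induction F)
    case empty
    then show ?case using y N(2) by simp
  next
    case (insert h F)
    have m: "(\<lambda>h. conj h y) \<in> F \<rightarrow> carrier Y" "conj h y \<in> carrier Y" using insert.prems H.subset y by auto
    have "finsum Y (\<lambda>h. conj h y) (insert h F) \<ominus>\<^bsub>Y\<^esub> of_nat (card (insert h F)) \<odot>\<^bsub>Y\<^esub> conj \<one> y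
      = (conj h y \<ominus>\<^bsub>Y\<^esub> conj \<one> y) \<oplus>\<^bsub>Y\<^esub> (finsum Y (\<lambda>h. conj h y) F \<ominus>\<^bsub>Y\<^esub> of_nat (card F) \<odot>\<^bsub>Y\<^esub> conj \<one> y)"
      using insert.hyps m y by (simp add: Y.M.finsum_insert Y.smult_add_left Y.add_diff_add)
    moreover have "conj h y \<ominus>\<^bsub>Y\<^esub> conj \<one> y \<in> N"
      using insert.prems H.subset y by (intro conj_congruent) auto
    ultimately show ?case using N(3) insert by auto
  qed
  from N(6)[OF this[OF H(2) order_refl], of "inverse (of_nat (card H))"]
  show ?thesis using c y H.subset unfolding avg_def
    by (subst (asm) Y.smult_diff_right) (auto simp: Y.M.finsum_closed simp flip: Y.smult_mult)
qed

text \<open>What remains of \<open>y\<close> is the two mixed components, each a commutator with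
  \<open>delta \<one>\<close>, and the difference between the fixed component and its
  average.\<close>

lemma full_avg_congruent:
  assumes H: "subgroup H G" "finite H" and c: "of_nat (card H) \<noteq> (0 :: 'k)" and y: "y \<in> carrier Y"
  shows "y \<ominus>\<^bsub>Y\<^esub> full_avg H y \<in> N"
proof -
  let ?e = "delta \<one>"
  let ?a = "l ?e y" and ?b = "r y ?e" and ?p = "l ?e (r y ?e)"
  have p: "conj \<one> y = ?p" by (simp add: conj_def)
  have m: "?a \<in> carrier Y" "?b \<in> carrier Y" "?p \<in> carrier Y" using y by auto
  have am: "avg H y \<in> carrier Y"
    using bounded_linear_mapD(1)[OF avg_bounded[OF H(2) subgroup.subset[OF H(1)]]] y by simp
  have 1: "?a \<ominus>\<^bsub>Y\<^esub> ?p \<in> N"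
    using Y.commutator_mem[of ?e ?a] y by (simp add: l_l l_r)
  have "?p \<ominus>\<^bsub>Y\<^esub> ?b \<in> N" using Y.commutator_mem[of ?e ?b] y by (simp add: r_r)
  have 2: "avg H y \<ominus>\<^bsub>Y\<^esub> ?b \<in> N"
    using N(3)[OF avg_congruent[OF assms] \<open>?p \<ominus>\<^bsub>Y\<^esub> ?b \<in> N\<close>] m am by (simp add: p Y.diff_add_diff)
  let ?q = "degenerate_part y"
  have qm: "?q \<in> carrier Y" using bounded_linear_mapD(1)[OF degenerate_part_bounded y] .
  have "y \<ominus>\<^bsub>Y\<^esub> ?q = (?a \<ominus>\<^bsub>Y\<^esub> ?p) \<oplus>\<^bsub>Y\<^esub> ?b"
    unfolding degenerate_part_def using m y by (simp add: Y.diff_diff_cancel)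
  moreover have "y \<ominus>\<^bsub>Y\<^esub> full_avg H y = (y \<ominus>\<^bsub>Y\<^esub> ?q) \<ominus>\<^bsub>Y\<^esub> avg H y"
    unfolding full_avg_def using am qm y by (simp add: a_minus_def[of Y] Y.M.minus_add Y.M.a_ac)
  ultimately have "y \<ominus>\<^bsub>Y\<^esub> full_avg H y = (?a \<ominus>\<^bsub>Y\<^esub> ?p) \<ominus>\<^bsub>Y\<^esub> (avg H y \<ominus>\<^bsub>Y\<^esub> ?b)"
    using m am by (simp add: a_minus_def[of Y] Y.M.minus_add Y.M.a_ac)
  then show ?thesis using N(5)[OF 1 2] by simp
qed

text \<open>The factor \<open>1 - delta \<one>\<close> annihilates \<open>A\<close> from either
  side, \<open>delta \<one>\<close> being a unit of \<open>A\<close>.\<close>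

lemma degenerate_part_commutator:
  assumes "a \<in> carrier A" "y \<in> carrier Y"
  shows "degenerate_part (l a y) = \<zero>\<^bsub>Y\<^esub>" "degenerate_part (r y a) = \<zero>\<^bsub>Y\<^esub>"
proof -
  note simps = Y.lact_assoc[symmetric] Y.ract_assoc[symmetric] conv_delta_one
  have 1: "l (delta \<one>) (l a y) = l a y" using assms by (simp add: simps)
  have "r (l a y) (delta \<one>) = l a (r y (delta \<one>))" using assms by (simp add: Y.lact_ract)
  moreover have "l (delta \<one>) (l a (r y (delta \<one>))) = l a (r y (delta \<one>))" using assms by (simp add: simps)
  ultimately show "degenerate_part (l a y) = \<zero>\<^bsub>Y\<^esub>"
    unfolding degenerate_part_def using assms 1 by simp
  have "r (r y a) (delta \<one>) = r y a" using assms by (simp add: simps)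
  then show "degenerate_part (r y a) = \<zero>\<^bsub>Y\<^esub>"
    unfolding degenerate_part_def using assms by simp
qed

text \<open>Both sides sum the terms \<open>?f h\<close> over \<open>H\<close>: the right one
  directly, the left one after the substitution of \<open>h \<otimes> g\<close> for
  \<open>h\<close>, which permutes \<open>H\<close> because \<open>g\<close> belongs to it.\<close>

lemma avg_commutator:
  assumes H: "subgroup H G" and g: "g \<in> H" and y: "y \<in> carrier Y"
  shows "avg H (l (delta g) y) = avg H (r y (delta g))"
proof -
  interpret H: subgroup H G by (rule H)
  let ?f = "\<lambda>h. l (delta h) (r y (delta (g \<otimes> inv h)))"
  have f: "?f \<in> H \<rightarrow> carrier Y" using y g H.subset by auto
  have bij: "bij_betw (\<lambda>h. h \<otimes> g) H H"
    by (rule bij_betwI[where g = "\<lambda>h. h \<otimes> inv g"]) (use g in \<open>auto simp: m_assoc\<close>)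
  have "finsum Y (\<lambda>h. conj h (l (delta g) y)) H = finsum Y (\<lambda>h. ?f (h \<otimes> g)) H"
  proof (rule Y.M.finsum_cong')
    fix h assume h: "h \<in> H"
    have "g \<otimes> inv (h \<otimes> g) = inv h" using h g by (simp add: inv_mult_group flip: m_assoc)
    then show "conj h (l (delta g) y) = ?f (h \<otimes> g)"
      using h g y by (simp add: conj_def l_r l_l)
  qed (use f g in auto)
  also have "\<dots> = finsum Y ?f ((\<lambda>h. h \<otimes> g) ` H)"
    using bij f by (intro Y.M.finsum_reindex[symmetric]) (auto simp: bij_betw_def)
  also have "\<dots> = finsum Y (\<lambda>h. conj h (r y (delta g))) H"
    unfolding bij_betw_imp_surj_on[OF bij]
    by (rule Y.M.finsum_cong') (use g y H.subset in \<open>auto simp: conj_def r_r\<close>)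
  finally show ?thesis by (simp add: avg_def)
qed

text \<open>Averages converge to 0 along the directed family of finite subgroups. A commutator with
  the point mass at \<open>g\<close> is averaged to zero as soon as \<open>g\<close> lies in
  \<open>H\<close>, and the uniform bound carries smallness to the closed span.\<close>

lemma full_avg_vanishes:
  assumes C: "C > 0" "\<And>H. \<lbrakk>subgroup H G; finite H\<rbrakk> \<Longrightarrow> inverse C \<le> vabs (of_nat (card H) :: 'k)"
    and w: "w \<in> N" and e: "e > 0"
  shows "\<exists>S. finite S \<and> S \<subseteq> carrier G \<and> (\<forall>H. subgroup H G \<and> finite H \<and> S \<subseteq> H \<longrightarrow> nrm Y (full_avg H w) < e)"
proof -
  define small where "small e w S \<longleftrightarrow> finite S \<and> S \<subseteq> carrier G \<and>
      (\<forall>H. subgroup H G \<and> finite H \<and> S \<subseteq> H \<longrightarrow> nrm Y (full_avg H w) < e)" for e w S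
  \<comment> \<open>The elements whose averages tend to 0. It remains to see that they form a closed
    subspace containing the commutators; a set \<open>S\<close> plays the part of a threshold beyond
    which the averages are small.\<close>
  define M where "M = {w \<in> carrier Y. \<forall>e>0. \<exists>S. small e w S}"
  obtain B where B: "B > 0"
    "\<And>H y. \<lbrakk>subgroup H G; finite H; y \<in> carrier Y\<rbrakk> \<Longrightarrow> nrm Y (full_avg H y) \<le> B * nrm Y y"
    using full_avg_uniform_bound[OF C] by blast
  have lin: "bounded_linear_map Y Y (full_avg H)" if "subgroup H G" "finite H" for H
    using full_avg_bounded[OF that(2) subgroup.subset[OF that(1)]] .
  have small_add: "small e (w \<oplus>\<^bsub>Y\<^esub> w') (S \<union> S')" if "small e w S" "small e w' S'" "w \<in> carrier Y" "w' \<in> carrier Y" for e w w' S S'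
    unfolding small_def
  proof (intro conjI allI impI)
    fix H assume H: "subgroup H G \<and> finite H \<and> S \<union> S' \<subseteq> H"
    then have "nrm Y (full_avg H w) < e" "nrm Y (full_avg H w') < e" using that by (auto simp: small_def)
    moreover have "full_avg H (w \<oplus>\<^bsub>Y\<^esub> w') = full_avg H w \<oplus>\<^bsub>Y\<^esub> full_avg H w'"
      using bounded_linear_mapD(2)[OF lin] H that by blast
    moreover have "full_avg H w \<in> carrier Y" "full_avg H w' \<in> carrier Y"
      using bounded_linear_mapD(1)[OF lin] H that by blast+
    ultimately show "nrm Y (full_avg H (w \<oplus>\<^bsub>Y\<^esub> w')) < e" using Y.nrm_add[of "full_avg H w" "full_avg H w'"] by auto
  qed (use that in \<open>auto simp: small_def\<close>)
  have M: "closed_subspace Y M"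
    unfolding Y.closed_subspace_iff
  proof (intro conjI ballI impI)
    show "submodule M scalars Y"
    proof (rule Y.submoduleI')
      have "full_avg H \<zero>\<^bsub>Y\<^esub> = \<zero>\<^bsub>Y\<^esub>" if "subgroup H G" "finite H" for H
        using bounded_linear_mapD(3)[OF lin[OF that], of "\<zero>\<^bsub>Y\<^esub>" 0] bounded_linear_mapD(1)[OF lin[OF that], of "\<zero>\<^bsub>Y\<^esub>"] by simp
      then have "small e \<zero>\<^bsub>Y\<^esub> {}" if "e > 0" for e using that by (auto simp: small_def)
      then show "\<zero>\<^bsub>Y\<^esub> \<in> M" by (auto simp: M_def)
      show "w \<oplus>\<^bsub>Y\<^esub> w' \<in> M" if w: "w \<in> M" "w' \<in> M" for w w'
      proof -
        have wc: "w \<in> carrier Y" "w' \<in> carrier Y" using w by (auto simp: M_def)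
        have "\<exists>S. small e (w \<oplus>\<^bsub>Y\<^esub> w') S" if e: "e > 0" for e
        proof -
          obtain S S' where "small e w S" "small e w' S'" using w e unfolding M_def by blast
          from small_add[OF this wc] show ?thesis by blast
        qed
        then show ?thesis using wc by (simp add: M_def)
      qed
      show "c \<odot>\<^bsub>Y\<^esub> w \<in> M" if w: "w \<in> M" for c w
      proof -
        have "\<exists>S. small e (c \<odot>\<^bsub>Y\<^esub> w) S" if e: "e > 0" for e
        proof -
          have pos: "vabs c + 1 > 0" using vabs_nonneg[of c] by linarith
          have "e / (vabs c + 1) > 0" using e pos by simp
          then obtain S where S: "small (e / (vabs c + 1)) w S" using w unfolding M_def by blast
          have "nrm Y (full_avg H (c \<odot>\<^bsub>Y\<^esub> w)) < e" if H: "subgroup H G" "finite H" "S \<subseteq> H" for H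
          proof -
            have wc: "w \<in> carrier Y" using w by (simp add: M_def)
            note fm = bounded_linear_mapD(1)[OF lin[OF H(1,2)] wc]
            have "nrm Y (full_avg H (c \<odot>\<^bsub>Y\<^esub> w)) = vabs c * nrm Y (full_avg H w)"
              using bounded_linear_mapD(3)[OF lin[OF H(1,2)] wc] fm by (simp add: Y.nrm_smult)
            also have "\<dots> \<le> (vabs c + 1) * nrm Y (full_avg H w)"
              using Y.nrm_nonneg[OF fm] by (intro mult_right_mono) auto
            also have "\<dots> < e" using S H pos by (auto simp: small_def field_simps)
            finally show ?thesis .
          qed
          then show ?thesis using S by (auto simp: small_def)
        qed
        then show ?thesis using w by (simp add: M_def)
      qed
    qed (auto simp: M_def)
    fix w assume w: "w \<in> carrier Y" "adherent Y M w"
    have "\<exists>S. small e w S" if e: "e > 0" for e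
    proof -
      have "e / B > 0" using e B by simp
      then obtain v where v: "v \<in> M" "nrm Y (w \<ominus>\<^bsub>Y\<^esub> v) < e / B" using adherentD[OF w(2)] by blast
      have vc: "v \<in> carrier Y" using v by (simp add: M_def)
      obtain S where S: "small e v S" using v e by (auto simp: M_def)
      \<comment> \<open>The uniform bound makes this difference small for every finite subgroup, so
        the empty threshold suffices and \<open>S\<close> serves for \<open>w\<close>.\<close>
      have "small e (w \<ominus>\<^bsub>Y\<^esub> v) {}"
        unfolding small_def
      proof (intro conjI allI impI)
        fix H assume "subgroup H G \<and> finite H \<and> {} \<subseteq> H"
        then have "nrm Y (full_avg H (w \<ominus>\<^bsub>Y\<^esub> v)) \<le> B * nrm Y (w \<ominus>\<^bsub>Y\<^esub> v)" using w vc by (intro B) auto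
        also have "\<dots> < e" using v(2) B(1) by (simp add: field_simps)
        finally show "nrm Y (full_avg H (w \<ominus>\<^bsub>Y\<^esub> v)) < e" .
      qed auto
      from small_add[OF this S] w vc show ?thesis by auto
    qed
    then show "w \<in> M" using w by (simp add: M_def)
  qed
  have "l a y \<ominus>\<^bsub>Y\<^esub> r y a \<in> M" if "a \<in> carrier A" and y: "y \<in> carrier Y" for a y
  proof -
    let ?c = "\<lambda>a. l a y \<ominus>\<^bsub>Y\<^esub> r y a"
    \<comment> \<open>The commutator depends boundedly on \<open>a\<close>, so \<open>A_span\<close>
      reduces to point masses.\<close>
    interpret c: bounded_map A Y ?c
      using y by (intro bounded_mapI bounded_linear_map_diff seminormed_A Y_seminormed
          bounded_bilinear_mapD(2)[OF Y.lact_bilinear] bounded_bilinear_mapD(1)[OF Y.ract_bilinear])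
    have "?c (delta g) \<in> M" if g: "g \<in> carrier G" for g
    proof -
      have "full_avg H (?c (delta g)) = \<zero>\<^bsub>Y\<^esub>" if H: "subgroup H G" "finite H" "{g} \<subseteq> H" for H
      proof -
        interpret f: bounded_map Y Y "full_avg H"
          by (intro bounded_mapI Y_seminormed lin H)
        have "full_avg H (l (delta g) y) = full_avg H (r y (delta g))"
          using avg_commutator[OF H(1) _ y] H(3) degenerate_part_commutator[OF delta_mem[OF g] y]
          by (simp add: full_avg_def)
        then show ?thesis using g y by (simp add: f.diff)
      qed
      then have "small e (?c (delta g)) {g}" if "e > 0" for e
        using that g by (auto simp: small_def)
      then show ?thesis using g y by (auto simp: M_def)
    qed
    then have "carrier A \<subseteq> {a \<in> carrier A. ?c a \<in> M}"
      by (intro A_span[OF c.closed_subspace_vimage[OF M]]) (simp add: delta_mem)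
    then show ?thesis using that by blast
  qed
  then have "N \<subseteq> M" by (rule Y.commutator_span_minimal[OF M])
  then show ?thesis using w e unfolding M_def small_def by blast
qed

end

text \<open>Averages are built from the two actions alone and hence commute with bimodule maps. A
  contracting homotopy has no such compatibility.\<close>

lemma (in group_convolution) full_avg_natural:
  assumes "convolution_bimodule G Y" "convolution_bimodule G Z" and d: "bimodule_hom A Y Z d"
    and H: "H \<subseteq> carrier G" "y \<in> carrier Y"
  shows "d (convolution_bimodule.full_avg G Y H y) = convolution_bimodule.full_avg G Z H (d y)"
proof -
  interpret Y: convolution_bimodule G K Y by fact
  interpret Z: convolution_bimodule G K Z by fact
  have "bounded_linear_map Y Z d" using d by (simp add: bimodule_hom_def)
  then interpret d: bounded_map Y Z d by (intro bounded_mapI Y.Y_seminormed Z.Y_seminormed)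
  have lr: "d (lact Y a u) = lact Z a (d u)" "d (ract Y u a) = ract Z (d u) a"
    if "a \<in> carrier A" "u \<in> carrier Y" for a u
    using d that by (auto simp: bimodule_hom_def)
  have c: "d (Y.conj h y) = Z.conj h (d y)" if "h \<in> carrier G" for h
    using that H by (simp add: Y.conj_def Z.conj_def lr)
  have fm: "finsum Y (\<lambda>h. Y.conj h y) H \<in> carrier Y" using H by (intro Y.Y.M.finsum_closed) auto
  have "d (finsum Y (\<lambda>h. Y.conj h y) H) = finsum Z (\<lambda>h. d (Y.conj h y)) H"
    using H by (intro d.finsum) auto
  also have "\<dots> = finsum Z (\<lambda>h. Z.conj h (d y)) H"
    using H by (intro Z.Y.M.finsum_cong') (auto simp: c)
  finally have "d (Y.avg H y) = Z.avg H (d y)"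
    using fm by (simp add: Y.avg_def Z.avg_def d.smult)
  moreover have "d (Y.degenerate_part y) = Z.degenerate_part (d y)"
    unfolding Y.degenerate_part_def Z.degenerate_part_def using H by (simp add: d.add d.diff lr)
  moreover have "Y.degenerate_part y \<in> carrier Y" "Y.avg H y \<in> carrier Y"
    using H fm bounded_linear_mapD(1)[OF Y.degenerate_part_bounded] by (auto simp: Y.avg_def)
  ultimately show ?thesis by (simp add: Y.full_avg_def Z.full_avg_def d.add)
qed

text \<open>By the ultrametric inequality the distance from the \<open>k\<close>-th term to every
  later one is bounded by the estimate for the single step at \<open>k\<close>; no series has to be
  summed.\<close>

lemma (in nonarch_banach_space) geometric_sequence_converges:
  assumes X: "\<And>k. X k \<in> carrier E" and D: "\<And>k. nrm E (X (Suc k) \<ominus>\<^bsub>E\<^esub> X k) \<le> D * (1/2) ^ k"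
  shows "\<exists>x\<in>carrier E. nrm_tendsto E X x"
proof -
  have D0: "0 \<le> D" using D[of 0] nrm_nonneg[OF minus_mem[OF X X], of "Suc 0" 0] by simp
  have le: "nrm E (X (k + j) \<ominus>\<^bsub>E\<^esub> X k) \<le> D * (1/2) ^ k" for k j
  proof (induction j)
    case (Suc j)
    have "nrm E (X (Suc (k + j)) \<ominus>\<^bsub>E\<^esub> X (k + j)) \<le> D * (1/2) ^ (k + j)" by (rule D)
    also have "\<dots> \<le> D * (1/2) ^ k" using D0 by (intro mult_left_mono power_decreasing) auto
    finally show ?case
      using Suc nrm_diff_triangle[OF X[of "Suc (k + j)"] X[of "k + j"] X[of k]] by simp
  qed (use X D0 in simp)
  have "X \<in> carrier C"
  proof (rule cauchyI[OF _ X])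
    fix e :: real assume e: "e > 0"
    have "(\<lambda>k. D * (1/2) ^ k) \<longlonglongrightarrow> D * 0" by (intro tendsto_mult_left LIMSEQ_realpow_zero) auto
    then obtain k where k: "D * (1/2) ^ k < e"
      using order_tendstoD(2)[of _ "D * 0" sequentially e] e by (auto simp: eventually_sequentially)
    have "nrm E (X m \<ominus>\<^bsub>E\<^esub> X n) < e" if "m \<ge> k" "n \<ge> k" for m n
    proof -
      have "nrm E (X m \<ominus>\<^bsub>E\<^esub> X k) < e" "nrm E (X n \<ominus>\<^bsub>E\<^esub> X k) < e"
        using le[of k "m - k"] le[of k "n - k"] that k by auto
      then show ?thesis
        using nrm_diff_triangle[OF X[of m] X[of k] X[of n]] nrm_diff_commute[OF X X, of n k] by simp
    qed
    then show "\<exists>N. \<forall>m\<ge>N. \<forall>n\<ge>N. nrm E (X m \<ominus>\<^bsub>E\<^esub> X n) < e" by blast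
  qed
  then show ?thesis using X by (intro nrm_complete) (auto simp: cauchy_space_def)
qed

section \<open>Exactness of the coinvariants by successive approximation\<close>

context group_convolution
begin

context
  fixes C :: real and U :: "('k, 'g \<Rightarrow> 'k, 'u, 'n) bimodule_scheme"
    and Z :: "('k, 'g \<Rightarrow> 'k, 'z, 'p) bimodule_scheme" and W :: "('k, 'g \<Rightarrow> 'k, 'w, 'q) bimodule_scheme"
    and d d' s s'
  assumes C: "C > 0" "\<And>H. \<lbrakk>subgroup H G; finite H\<rbrakk> \<Longrightarrow> inverse C \<le> vabs (of_nat (card H) :: 'k)"
    and lf: "\<And>T. \<lbrakk>T \<subseteq> carrier G; finite T\<rbrakk> \<Longrightarrow> \<exists>H. subgroup H G \<and> finite H \<and> T \<subseteq> H"
    and U: "convolution_bimodule G U" and Z: "convolution_bimodule G Z" and W: "convolution_bimodule G W"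
    and d: "bimodule_hom A U Z d" and d': "bimodule_hom A Z W d'"
    and s: "bounded_linear_map Z U s" and s': "bounded_linear_map W Z s'"
    and homotopy: "\<And>z. z \<in> carrier Z \<Longrightarrow> d (s z) \<oplus>\<^bsub>Z\<^esub> s' (d' z) = z"
    and dd: "\<And>u. u \<in> carrier U \<Longrightarrow> d' (d u) = \<zero>\<^bsub>W\<^esub>"
begin

text \<open>The homotopy identity is applied to the average \<open>y\<close> of \<open>z\<close>,
  which represents the same class. Then \<open>d' y\<close> is the average of \<open>d' z\<close>
  and hence small for a suitable subgroup, so \<open>s' (d' y)\<close> is the small remainder and
  \<open>s y\<close> the primitive. The bound on \<open>u\<close> involves neither \<open>e\<close>
  nor the subgroup.\<close>

lemma approximate_primitive:
  obtains B where "B > 0"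
    "\<And>z e. \<lbrakk>z \<in> carrier Z; d' z \<in> commutator_span A W; e > 0\<rbrakk> \<Longrightarrow>
      \<exists>u\<in>carrier U. nrm U u \<le> B * nrm Z z \<and>
        (\<exists>r\<in>carrier Z. nrm Z r < e \<and> (z \<ominus>\<^bsub>Z\<^esub> d u) \<ominus>\<^bsub>Z\<^esub> r \<in> commutator_span A Z)"
proof -
  interpret U: convolution_bimodule G K U by (rule U)
  interpret Z: convolution_bimodule G K Z by (rule Z)
  interpret W: convolution_bimodule G K W by (rule W)
  interpret d: bounded_map U Z d
    using d by (intro bounded_mapI U.Y_seminormed Z.Y_seminormed) (simp add: bimodule_hom_def)
  interpret d': bounded_map Z W d'
    using d' by (intro bounded_mapI W.Y_seminormed Z.Y_seminormed) (simp add: bimodule_hom_def)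
  interpret s: bounded_map Z U s by (intro bounded_mapI U.Y_seminormed Z.Y_seminormed s)
  interpret s': bounded_map W Z s' by (intro bounded_mapI W.Y_seminormed Z.Y_seminormed s')
  obtain B where B: "B > 0"
    "\<And>H y. \<lbrakk>subgroup H G; finite H; y \<in> carrier Z\<rbrakk> \<Longrightarrow> nrm Z (Z.full_avg H y) \<le> B * nrm Z y"
    using Z.full_avg_uniform_bound[OF C] by blast
  obtain S where S: "S > 0" "\<And>z. z \<in> carrier Z \<Longrightarrow> nrm U (s z) \<le> S * nrm Z z" using s.bound by blast
  obtain S' where S': "S' > 0" "\<And>w. w \<in> carrier W \<Longrightarrow> nrm Z (s' w) \<le> S' * nrm W w" using s'.bound by blast
  show ?thesis
  proof (rule that[of "S * B"])
    show "S * B > 0" using S(1) B(1) by simp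
    fix z and e :: real assume z: "z \<in> carrier Z" and dz: "d' z \<in> W.N" and e: "e > 0"
    have "e / S' > 0" using e S'(1) by simp
    then obtain T where T: "finite T" "T \<subseteq> carrier G"
      "\<forall>H. subgroup H G \<and> finite H \<and> T \<subseteq> H \<longrightarrow> nrm W (W.full_avg H (d' z)) < e / S'"
      using W.full_avg_vanishes[OF C dz] by metis
    then obtain H where H: "subgroup H G" "finite H" "T \<subseteq> H" using lf by metis
    have HG: "H \<subseteq> carrier G" using H(1) by (rule subgroup.subset)
    have "0 < vabs (of_nat (card H) :: 'k)" using C(2)[OF H(1,2)] C(1) by (meson less_le_trans positive_imp_inverse_positive)
    then have c: "of_nat (card H) \<noteq> (0 :: 'k)" by auto
    let ?y = "Z.full_avg H z"
    have y: "?y \<in> carrier Z" using bounded_linear_mapD(1)[OF Z.full_avg_bounded[OF H(2) HG] z] .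
    have dy: "d' ?y = W.full_avg H (d' z)" by (rule full_avg_natural[OF Z W d' HG z])
    let ?u = "s ?y" and ?r = "s' (d' ?y)"
    have u: "?u \<in> carrier U" and r: "?r \<in> carrier Z" using y by auto
    have "nrm U ?u \<le> S * nrm Z ?y" using S(2) y by blast
    also have "\<dots> \<le> S * (B * nrm Z z)" using B(2)[OF H(1,2) z] S(1) by (intro mult_left_mono) auto
    finally have 1: "nrm U ?u \<le> S * B * nrm Z z" by simp
    have "nrm Z ?r \<le> S' * nrm W (d' ?y)" using S'(2) y by blast
    also have "\<dots> < e" using T(3) H S'(1) by (simp add: dy field_simps)
    finally have 2: "nrm Z ?r < e" .
    have "(z \<ominus>\<^bsub>Z\<^esub> d ?u) \<ominus>\<^bsub>Z\<^esub> ?r = z \<ominus>\<^bsub>Z\<^esub> (d ?u \<oplus>\<^bsub>Z\<^esub> ?r)"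
      using z u r by (simp add: a_minus_def[of Z] Z.Y.M.minus_add Z.Y.M.a_ac)
    also have "\<dots> = z \<ominus>\<^bsub>Z\<^esub> ?y" by (simp add: homotopy y)
    finally have 3: "(z \<ominus>\<^bsub>Z\<^esub> d ?u) \<ominus>\<^bsub>Z\<^esub> ?r \<in> Z.N"
      using Z.full_avg_congruent[OF H(1,2) c z] by simp
    show "\<exists>u\<in>carrier U. nrm U u \<le> S * B * nrm Z z \<and>
        (\<exists>r\<in>carrier Z. nrm Z r < e \<and> (z \<ominus>\<^bsub>Z\<^esub> d u) \<ominus>\<^bsub>Z\<^esub> r \<in> Z.N)"
      by (intro bexI[OF _ u] conjI 1 bexI[OF _ r] 2 3)
  qed
qed

text \<open>The remainder left by \<open>approximate_primitive\<close> is again a cocycle modulo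
  commutators, so the approximation can be repeated with half the tolerance. Each correction is
  bounded by a multiple of the preceding remainder, and the primitives converge.\<close>

lemma coinvariants_exact:
  assumes z: "z \<in> carrier Z"
  shows "d' z \<in> commutator_span A W \<longleftrightarrow> (\<exists>u\<in>carrier U. z \<ominus>\<^bsub>Z\<^esub> d u \<in> commutator_span A Z)"
proof -
  interpret U: convolution_bimodule G K U by (rule U)
  interpret Z: convolution_bimodule G K Z by (rule Z)
  interpret W: convolution_bimodule G K W by (rule W)
  have ab: "algebra_bimodule A U" "algebra_bimodule A Z" "algebra_bimodule A W"
    by (simp_all add: algebra_bimodule_def A.seminormed_algebra_axioms U.Y.banach_bimodule_axioms
        Z.Y.banach_bimodule_axioms W.Y.banach_bimodule_axioms)
  interpret d: bimodule_map A U Z d using ab d by (simp add: bimodule_map_def bimodule_map_axioms_def)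
  interpret d': bimodule_map A Z W d' using ab d' by (simp add: bimodule_map_def bimodule_map_axioms_def)
  show ?thesis
  proof
    assume "\<exists>u\<in>carrier U. z \<ominus>\<^bsub>Z\<^esub> d u \<in> Z.N"
    then obtain u where u: "u \<in> carrier U" "z \<ominus>\<^bsub>Z\<^esub> d u \<in> Z.N" by blast
    then have "d' (z \<ominus>\<^bsub>Z\<^esub> d u) \<in> W.N" using d'.d_commutator_span by blast
    then show "d' z \<in> W.N" using u(1) z by (simp add: d'.d.diff dd)
  next
    assume dz: "d' z \<in> W.N"
    obtain B where B: "B > 0"
      "\<And>z e. \<lbrakk>z \<in> carrier Z; d' z \<in> W.N; e > 0\<rbrakk> \<Longrightarrow>
        \<exists>u\<in>carrier U. nrm U u \<le> B * nrm Z z \<and>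
          (\<exists>r\<in>carrier Z. nrm Z r < e \<and> (z \<ominus>\<^bsub>Z\<^esub> d u) \<ominus>\<^bsub>Z\<^esub> r \<in> Z.N)"
      using approximate_primitive by blast
    \<comment> \<open>The maximum with 1 keeps the tolerances positive when \<open>z\<close> has
      norm 0.\<close>
    define M where "M = max (nrm Z z) 1"
    have M: "M > 0" by (simp add: M_def)
    \<comment> \<open>The first component is the primitive found after \<open>k\<close> steps, the
      second the remainder that is still to be removed.\<close>
    define P where "P k p \<longleftrightarrow> fst p \<in> carrier U \<and> snd p \<in> carrier Z \<and> nrm Z (snd p) \<le> M * (1/2) ^ k \<and>
        (z \<ominus>\<^bsub>Z\<^esub> d (fst p)) \<ominus>\<^bsub>Z\<^esub> snd p \<in> Z.N" for k p
    \<comment> \<open>\<open>d'\<close> annihilates boundaries and maps commutators to commutators,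
      so the remainder inherits the hypothesis made on \<open>z\<close>.\<close>
    have P_cocycle: "d' (snd p) \<in> W.N" if "P k p" for k p
    proof -
      have p: "fst p \<in> carrier U" "snd p \<in> carrier Z" "(z \<ominus>\<^bsub>Z\<^esub> d (fst p)) \<ominus>\<^bsub>Z\<^esub> snd p \<in> Z.N"
        using that by (auto simp: P_def)
      then have "d' ((z \<ominus>\<^bsub>Z\<^esub> d (fst p)) \<ominus>\<^bsub>Z\<^esub> snd p) \<in> W.N" using d'.d_commutator_span by blast
      then have "d' z \<ominus>\<^bsub>W\<^esub> d' (snd p) \<in> W.N" using p z by (simp add: d'.d.diff dd)
      from W.N(5)[OF dz this] show ?thesis using p z by (simp add: W.Y.diff_diff_cancel)
    qed
    have start: "P 0 (\<zero>\<^bsub>U\<^esub>, z)" using z Z.N(2) by (simp add: P_def M_def)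
    have step: "\<exists>q. P (Suc k) q \<and> nrm U (fst q \<ominus>\<^bsub>U\<^esub> fst p) \<le> (B * M) * (1/2) ^ k" if p: "P k p" for k p
    proof -
      obtain X r where Xr: "p = (X, r)" by (cases p)
      have X: "X \<in> carrier U" "r \<in> carrier Z" "nrm Z r \<le> M * (1/2) ^ k" "(z \<ominus>\<^bsub>Z\<^esub> d X) \<ominus>\<^bsub>Z\<^esub> r \<in> Z.N"
        using p by (auto simp: P_def Xr)
      have dr: "d' r \<in> W.N" using P_cocycle[OF p] by (simp add: Xr)
      have e: "M * (1/2) ^ Suc k > 0" using M by simp
      obtain u r' where u: "u \<in> carrier U" "nrm U u \<le> B * nrm Z r"
        "r' \<in> carrier Z" "nrm Z r' < M * (1/2) ^ Suc k" "(r \<ominus>\<^bsub>Z\<^esub> d u) \<ominus>\<^bsub>Z\<^esub> r' \<in> Z.N"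
        using B(2)[OF X(2) dr e] by blast
      have "(z \<ominus>\<^bsub>Z\<^esub> d (X \<oplus>\<^bsub>U\<^esub> u)) \<ominus>\<^bsub>Z\<^esub> r' = ((z \<ominus>\<^bsub>Z\<^esub> d X) \<ominus>\<^bsub>Z\<^esub> r) \<oplus>\<^bsub>Z\<^esub> ((r \<ominus>\<^bsub>Z\<^esub> d u) \<ominus>\<^bsub>Z\<^esub> r')"
        using X u z Z.Y.diff_add_diff[of "z \<ominus>\<^bsub>Z\<^esub> d X" r "d u \<oplus>\<^bsub>Z\<^esub> r'"]
        by (simp add: d.d.add Z.Y.diff_diff_eq Z.Y.M.a_assoc)
      then have "P (Suc k) (X \<oplus>\<^bsub>U\<^esub> u, r')"
        using X u Z.N(3)[OF X(4) u(5)] by (auto simp: P_def)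
      moreover have "nrm U ((X \<oplus>\<^bsub>U\<^esub> u) \<ominus>\<^bsub>U\<^esub> X) \<le> (B * M) * (1/2) ^ k"
      proof -
        have "nrm U ((X \<oplus>\<^bsub>U\<^esub> u) \<ominus>\<^bsub>U\<^esub> X) = nrm U u" using X u by (simp add: U.Y.add_diff_cancel_left)
        also have "\<dots> \<le> B * nrm Z r" by (rule u)
        also have "\<dots> \<le> B * (M * (1/2) ^ k)" using X(3) B(1) by (intro mult_left_mono) auto
        finally show ?thesis by simp
      qed
      ultimately show ?thesis unfolding Xr by (intro exI[of _ "(X \<oplus>\<^bsub>U\<^esub> u, r')"]) simp
    qed
    obtain p where p: "\<And>k. P k (p k)" "\<And>k. nrm U (fst (p (Suc k)) \<ominus>\<^bsub>U\<^esub> fst (p k)) \<le> (B * M) * (1/2) ^ k"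
      using dependent_nat_choice[of P "\<lambda>k p q. nrm U (fst q \<ominus>\<^bsub>U\<^esub> fst p) \<le> (B * M) * (1/2) ^ k"] start step
      by metis
    have pc: "fst (p k) \<in> carrier U" "snd (p k) \<in> carrier Z" for k using p(1)[of k] by (auto simp: P_def)
    obtain u where u: "u \<in> carrier U" "nrm_tendsto U (\<lambda>k. fst (p k)) u"
      using U.Y.geometric_sequence_converges[OF pc(1) p(2)] by blast
    have "z \<ominus>\<^bsub>Z\<^esub> d u \<in> Z.N"
    proof (rule Z.Y.closed_subspaceD(2)[OF Z.Y.commutator_span_closed])
      show "z \<ominus>\<^bsub>Z\<^esub> d u \<in> carrier Z" using z u by simp
      show "adherent Z Z.N (z \<ominus>\<^bsub>Z\<^esub> d u)"
      proof (rule adherentI)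
        fix e :: real assume e: "e > 0"
        obtain D where D: "D > 0" "\<And>u. u \<in> carrier U \<Longrightarrow> nrm Z (d u) \<le> D * nrm U u" using d.d.bound by blast
        have "(\<lambda>k. M * (1/2) ^ k) \<longlonglongrightarrow> M * 0" by (intro tendsto_mult_left LIMSEQ_realpow_zero) auto
        then have ev1: "eventually (\<lambda>k. M * (1/2) ^ k < e) sequentially"
          using order_tendstoD(2)[of _ "M * 0" sequentially e] e by simp
        have "e / D > 0" using e D(1) by simp
        then have ev2: "eventually (\<lambda>k. nrm U (fst (p k) \<ominus>\<^bsub>U\<^esub> u) < e / D) sequentially"
          using u(2) unfolding nrm_tendsto_def by (rule order_tendstoD(2)[rotated])
        obtain k where k: "M * (1/2) ^ k < e" "nrm U (fst (p k) \<ominus>\<^bsub>U\<^esub> u) < e / D"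
          using eventually_conj[OF ev1 ev2] unfolding eventually_sequentially by blast
        let ?X = "fst (p k)" and ?r = "snd (p k)"
        let ?n = "(z \<ominus>\<^bsub>Z\<^esub> d ?X) \<ominus>\<^bsub>Z\<^esub> ?r"
        have n: "?n \<in> Z.N" "nrm Z ?r < e" using p(1)[of k] k(1) by (auto simp: P_def)
        \<comment> \<open>The element \<open>?n\<close> of the commutator span differs from
          \<open>z - d u\<close> by the image of the error in \<open>u\<close> and by the remainder,
          both of which tend to 0.\<close>
        have "(z \<ominus>\<^bsub>Z\<^esub> d u) \<ominus>\<^bsub>Z\<^esub> ?n = d (?X \<ominus>\<^bsub>U\<^esub> u) \<oplus>\<^bsub>Z\<^esub> ?r"
          using pc[of k] u(1) z
          Z.Y.diff_diff_cancel_left[of z "d u" "d ?X \<oplus>\<^bsub>Z\<^esub> ?r"]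
          by (simp add: d.d.diff Z.Y.diff_diff_eq) (simp add: a_minus_def[of Z] Z.Y.M.a_ac)
        moreover have "nrm Z (d (?X \<ominus>\<^bsub>U\<^esub> u)) < e"
        proof -
          have "nrm Z (d (?X \<ominus>\<^bsub>U\<^esub> u)) \<le> D * nrm U (?X \<ominus>\<^bsub>U\<^esub> u)" using pc[of k] u(1) by (intro D) auto
          also have "\<dots> < e" using k(2) D(1) by (simp add: field_simps)
          finally show ?thesis .
        qed
        ultimately have "nrm Z ((z \<ominus>\<^bsub>Z\<^esub> d u) \<ominus>\<^bsub>Z\<^esub> ?n) < e"
          using n(2) Z.Y.nrm_add[of "d (?X \<ominus>\<^bsub>U\<^esub> u)" ?r] pc[of k] u(1) by auto
        then show "\<exists>y\<in>Z.N. nrm Z ((z \<ominus>\<^bsub>Z\<^esub> d u) \<ominus>\<^bsub>Z\<^esub> y) < e" using n(1) by blast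
      qed
    qed
    then show "\<exists>u\<in>carrier U. z \<ominus>\<^bsub>Z\<^esub> d u \<in> Z.N" using u(1) by blast
  qed
qed

end

lemma johnson_imp_amenable:
  assumes "johnson_amenable TYPE('k) G"
  shows "amenable (T :: 'u itself) A"
proof -
  obtain \<mu> :: "('g \<Rightarrow> 'k) \<Rightarrow> 'k" where \<mu>: "bounded_linear_map L scalars \<mu>"
    "\<And>g f. \<lbrakk>g \<in> carrier G; f \<in> carrier L\<rbrakk> \<Longrightarrow> \<mu> (translate G g f) = \<mu> f" "\<mu> const1 \<noteq> 0"
    using assms unfolding johnson_amenable_def const1_def by blast
  obtain C where C: "C > 0" "\<And>H. \<lbrakk>subgroup H G; finite H\<rbrakk> \<Longrightarrow> inverse C \<le> vabs (of_nat (card H) :: 'k)"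
    using mean_finite_subgroups_bound[OF \<mu>] by blast
  note lf = mean_locally_finite[OF \<mu>]
  show ?thesis
    unfolding A.amenable_iff
  proof (intro allI impI ballI)
    fix Y :: "int \<Rightarrow> ('k, 'g \<Rightarrow> 'k, 'u) bimodule" and d n z
    assume Y: "bimodule_complex A Y d \<and> admissible_complex Y d" and z: "z \<in> carrier (Y n)"
    have cb: "convolution_bimodule G (Y n)" for n
    proof -
      have "banach_bimodule A (Y n)" using Y by (auto simp: bimodule_complex_def)
      then show ?thesis
        by (simp add: convolution_bimodule_def group_convolution_axioms)
    qed
    have h: "bimodule_hom A (Y n) (Y (n - 1)) (d n)" for n using Y by (auto simp: bimodule_complex_def)
    have dd: "d (n - 1) (d n y) = \<zero>\<^bsub>Y (n - 2)\<^esub>" if "y \<in> carrier (Y n)" for n y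
      using Y that by (auto simp: bimodule_complex_def)
    obtain s where s: "\<And>n. bounded_linear_map (Y n) (Y (n + 1)) (s n)"
      "\<And>n y. y \<in> carrier (Y n) \<Longrightarrow> d (n + 1) (s n y) \<oplus>\<^bsub>Y n\<^esub> s (n - 1) (d n y) = y"
      using Y unfolding admissible_complex_def by blast
    show "d n z \<in> commutator_span A (Y (n - 1)) \<longleftrightarrow>
        (\<exists>y\<in>carrier (Y (n + 1)). z \<ominus>\<^bsub>Y n\<^esub> d (n + 1) y \<in> commutator_span A (Y n))"
    proof (rule coinvariants_exact[OF C lf cb cb cb])
      show "bimodule_hom A (Y (n + 1)) (Y n) (d (n + 1))" using h[of "n + 1"] by simp
      show "bounded_linear_map (Y (n - 1)) (Y n) (s (n - 1))" using s(1)[of "n - 1"] by simp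
      show "d n (d (n + 1) u) = \<zero>\<^bsub>Y (n - 1)\<^esub>" if "u \<in> carrier (Y (n + 1))" for u
        using dd[OF that] by simp
    qed (use h s z in auto)
  qed
qed

end

section \<open>Ingleton's theorem\<close>

text \<open>The class axiom concerns nested sequences of balls with positive radii; here any family
  of pairwise meeting balls is treated. If the infimum of the radii is attained, the centre of a
  smallest ball lies in all the others. Otherwise a sequence of balls whose radii decrease to the
  infimum is nested, and each ball of the family contains one of them.\<close>

lemma spherically_complete_balls:
  fixes c :: "'i \<Rightarrow> 'k::spherically_complete_field" and r :: "'i \<Rightarrow> real"
  assumes ne: "I \<noteq> {}" and r: "\<And>i. i \<in> I \<Longrightarrow> 0 \<le> r i"
    and c: "\<And>i j. \<lbrakk>i \<in> I; j \<in> I\<rbrakk> \<Longrightarrow> vabs (c i - c j) \<le> max (r i) (r j)"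
  shows "\<exists>a. \<forall>i\<in>I. vabs (a - c i) \<le> r i"
proof (cases "\<exists>i\<in>I. \<forall>j\<in>I. r i \<le> r j")
  case True
  then obtain i where "i \<in> I" "\<And>j. j \<in> I \<Longrightarrow> r i \<le> r j" by blast
  then show ?thesis using c by (metis max.absorb2)
next
  case False
  define R where "R = Inf (r ` I)"
  have bdd: "bdd_below (r ` I)" using r by (auto intro: bdd_belowI[of _ 0])
  have R: "R < r i" if i: "i \<in> I" for i
  proof -
    obtain j where j: "j \<in> I" "r j < r i" using False i by (meson not_less)
    have "R \<le> r j" unfolding R_def by (rule cInf_lower[OF _ bdd]) (use j in blast)
    then show ?thesis using j by simp
  qed
  have approx: "\<exists>i\<in>I. r i < t" if "R < t" for t
  proof -
    have "\<exists>x\<in>r ` I. x < t" using that ne unfolding R_def by (intro cInf_lessD) auto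
    then show ?thesis by blast
  qed
  define P where "P n i \<longleftrightarrow> i \<in> I \<and> r i < R + inverse (Suc n)" for n i
  have "\<exists>f. \<forall>n. P n (f n) \<and> r (f (Suc n)) \<le> r (f n)"
  proof (rule dependent_nat_choice)
    show "\<exists>i. P 0 i" using approx[of "R + inverse (Suc 0)"] by (auto simp: P_def)
    fix i n assume "P n i"
    \<comment> \<open>Taking the minimum also keeps the radii decreasing, which makes the chosen
      balls nested.\<close>
    then have "R < min (R + inverse (Suc (Suc n))) (r i)" using R by (auto simp: P_def)
    then obtain j where "j \<in> I" "r j < min (R + inverse (Suc (Suc n))) (r i)" using approx by blast
    then show "\<exists>j. P (Suc n) j \<and> r j \<le> r i" by (intro exI[of _ j]) (auto simp: P_def)
  qed
  then obtain f where f: "\<And>n. f n \<in> I" "\<And>n. r (f n) < R + inverse (Suc n)" "\<And>n. r (f (Suc n)) \<le> r (f n)"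
    unfolding P_def by blast
  have "0 \<le> R" unfolding R_def using ne r by (intro cInf_greatest) auto
  \<comment> \<open>As the infimum is not attained, every radius exceeds it and is positive, as the
    class axiom demands.\<close>
  then have pos: "0 < r (f n)" for n using R[OF f(1)] by (rule le_less_trans)
  have "(\<Inter>n. {x. dist (c (f n)) x \<le> r (f n)}) \<noteq> {}"
  proof (rule spherically_complete[OF pos])
    fix n
    have cc: "dist (c (f n)) (c (f (Suc n))) \<le> r (f n)"
      using c[OF f(1) f(1), of n "Suc n"] f(3)[of n] by (simp add: dist_vabs)
    show "{x. dist (c (f (Suc n))) x \<le> r (f (Suc n))} \<subseteq> {x. dist (c (f n)) x \<le> r (f n)}"
    proof
      fix x assume "x \<in> {x. dist (c (f (Suc n))) x \<le> r (f (Suc n))}"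
      then show "x \<in> {x. dist (c (f n)) x \<le> r (f n)}"
        using dist_ultrametric[of "c (f n)" x "c (f (Suc n))"] cc f(3)[of n] by auto
    qed
  qed
  then obtain a where a: "\<And>n. dist (c (f n)) a \<le> r (f n)" by blast
  have "vabs (a - c j) \<le> r j" if j: "j \<in> I" for j
  proof -
    obtain n where "inverse (real (Suc n)) < r j - R" using reals_Archimedean[of "r j - R"] R[OF j] by auto
    then have n: "r (f n) \<le> r j" using f(2)[of n] by simp
    have "vabs (a - c (f n)) \<le> r (f n)" using a[of n] by (simp add: dist_vabs vabs_minus_commute)
    moreover have "vabs (c (f n) - c j) \<le> r j" using c[OF f(1) j, of n] n by simp
    moreover have "vabs (a - c j) \<le> max (vabs (a - c (f n))) (vabs (c (f n) - c j))"
      using vabs_add[of "a - c (f n)" "c (f n) - c j"] by simp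
    ultimately show ?thesis using n by simp
  qed
  then show ?thesis by blast
qed

text \<open>
  Partial functionals of norm at most \<open>C\<close> are represented by their graphs; the norm bound
  makes such a graph single-valued.
\<close>

definition partial_functional ::
  "('k::nonarch_field, 'x, 'm) nspace_scheme \<Rightarrow> real \<Rightarrow> ('x \<times> 'k) set \<Rightarrow> bool" where
  "partial_functional E C \<Gamma> \<longleftrightarrow> (\<zero>\<^bsub>E\<^esub>, 0) \<in> \<Gamma> \<and>
     (\<forall>x j y k. (x, j) \<in> \<Gamma> \<longrightarrow> (y, k) \<in> \<Gamma> \<longrightarrow> (x \<oplus>\<^bsub>E\<^esub> y, j + k) \<in> \<Gamma>) \<and>
     (\<forall>x j c. (x, j) \<in> \<Gamma> \<longrightarrow> (c \<odot>\<^bsub>E\<^esub> x, c * j) \<in> \<Gamma>) \<and>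
     (\<forall>x j. (x, j) \<in> \<Gamma> \<longrightarrow> x \<in> carrier E \<and> vabs j \<le> C * nrm E x)"

lemma partial_functionalD:
  assumes "partial_functional E C \<Gamma>"
  shows "(\<zero>\<^bsub>E\<^esub>, 0) \<in> \<Gamma>" "\<lbrakk>(x, j) \<in> \<Gamma>; (y, k) \<in> \<Gamma>\<rbrakk> \<Longrightarrow> (x \<oplus>\<^bsub>E\<^esub> y, j + k) \<in> \<Gamma>"
    "(x, j) \<in> \<Gamma> \<Longrightarrow> (c \<odot>\<^bsub>E\<^esub> x, c * j) \<in> \<Gamma>" "(x, j) \<in> \<Gamma> \<Longrightarrow> x \<in> carrier E"
    "(x, j) \<in> \<Gamma> \<Longrightarrow> vabs j \<le> C * nrm E x"
  using assms by (simp_all add: partial_functional_def)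

lemma partial_functional_diff:
  fixes E :: "('k::nonarch_field, 'x, 'm) nspace_scheme"
  assumes "nonarch_seminormed_space E" and \<Gamma>: "partial_functional E C \<Gamma>" and "(x, j) \<in> \<Gamma>" "(y, k) \<in> \<Gamma>"
  shows "(x \<ominus>\<^bsub>E\<^esub> y, j - k) \<in> \<Gamma>"
proof -
  interpret nonarch_seminormed_space E by fact
  show ?thesis
    using partial_functionalD(2)[OF \<Gamma> assms(3) partial_functionalD(3)[OF \<Gamma> assms(4), of "- 1"]]
      partial_functionalD(4)[OF \<Gamma> assms(4)]
    by (simp add: a_minus_eq_smult)
qed

text \<open>The value \<open>a\<close> at \<open>x\<close> must lie within
  \<open>C * nrm E (x - y)\<close> of the value at each \<open>y\<close> of the domain. Any two of
  these balls meet because the given functional has norm at most \<open>C\<close>, and spherical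
  completeness provides a common point.\<close>

lemma partial_functional_extend:
  fixes E :: "('k::spherically_complete_field, 'x, 'm) nspace_scheme"
  assumes E: "nonarch_seminormed_space E" and C: "C \<ge> 0" and \<Gamma>: "partial_functional E C \<Gamma>" and x: "x \<in> carrier E"
  shows "\<exists>\<Gamma>' a. partial_functional E C \<Gamma>' \<and> \<Gamma> \<subseteq> \<Gamma>' \<and> (x, a) \<in> \<Gamma>'"
proof -
  interpret nonarch_seminormed_space E by fact
  note D = partial_functionalD[OF \<Gamma>]
  have "\<exists>a. \<forall>p\<in>\<Gamma>. vabs (a - snd p) \<le> C * nrm E (x \<ominus>\<^bsub>E\<^esub> fst p)"
  proof (rule spherically_complete_balls)
    show "\<Gamma> \<noteq> {}" using D(1) by blast
    show "0 \<le> C * nrm E (x \<ominus>\<^bsub>E\<^esub> fst p)" if "p \<in> \<Gamma>" for p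
      using that x C D(4) by (cases p) (auto intro!: mult_nonneg_nonneg nrm_nonneg)
    show "vabs (snd p - snd q) \<le> max (C * nrm E (x \<ominus>\<^bsub>E\<^esub> fst p)) (C * nrm E (x \<ominus>\<^bsub>E\<^esub> fst q))"
      if "p \<in> \<Gamma>" "q \<in> \<Gamma>" for p q
    proof -
      obtain y j z k where pq: "p = (y, j)" "q = (z, k)" by (cases p, cases q)
      have c: "y \<in> carrier E" "z \<in> carrier E" using that D(4) pq by auto
      have "vabs (j - k) \<le> C * nrm E (y \<ominus>\<^bsub>E\<^esub> z)"
        using partial_functional_diff[OF E \<Gamma>] D(5) that pq by blast
      also have "\<dots> \<le> C * max (nrm E (x \<ominus>\<^bsub>E\<^esub> y)) (nrm E (x \<ominus>\<^bsub>E\<^esub> z))"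
        using nrm_diff_triangle[OF c(1) x c(2)] nrm_diff_commute[OF c(1) x] C by (intro mult_left_mono) auto
      finally show ?thesis using C by (simp add: pq max_mult_distrib_left)
    qed
  qed
  then obtain a where a: "\<And>y k. (y, k) \<in> \<Gamma> \<Longrightarrow> vabs (a - k) \<le> C * nrm E (x \<ominus>\<^bsub>E\<^esub> y)" by fastforce
  define \<Gamma>' where "\<Gamma>' = {(y \<oplus>\<^bsub>E\<^esub> c \<odot>\<^bsub>E\<^esub> x, k + c * a) | y k c. (y, k) \<in> \<Gamma>}"
  have mem: "(y \<oplus>\<^bsub>E\<^esub> c \<odot>\<^bsub>E\<^esub> x, k + c * a) \<in> \<Gamma>'" if "(y, k) \<in> \<Gamma>" for y k c
    using that unfolding \<Gamma>'_def by blast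
  have "partial_functional E C \<Gamma>'"
    unfolding partial_functional_def
  proof (intro conjI allI impI)
    show "(\<zero>\<^bsub>E\<^esub>, 0) \<in> \<Gamma>'" using mem[OF D(1), of 0] x by simp
    show "(u \<oplus>\<^bsub>E\<^esub> v, j + k) \<in> \<Gamma>'" if uv: "(u, j) \<in> \<Gamma>'" "(v, k) \<in> \<Gamma>'" for u j v k
    proof -
      obtain y i c where 1: "(y, i) \<in> \<Gamma>" "u = y \<oplus>\<^bsub>E\<^esub> c \<odot>\<^bsub>E\<^esub> x" "j = i + c * a"
        using uv(1) unfolding \<Gamma>'_def by blast
      obtain z l d where 2: "(z, l) \<in> \<Gamma>" "v = z \<oplus>\<^bsub>E\<^esub> d \<odot>\<^bsub>E\<^esub> x" "k = l + d * a"
        using uv(2) unfolding \<Gamma>'_def by blast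
      show ?thesis
        using mem[OF D(2)[OF 1(1) 2(1)], of "c + d"] D(4)[OF 1(1)] D(4)[OF 2(1)] x
        by (simp add: 1 2 smult_add_left M.a_ac algebra_simps)
    qed
    show "(e \<odot>\<^bsub>E\<^esub> u, e * j) \<in> \<Gamma>'" if u: "(u, j) \<in> \<Gamma>'" for u j e
    proof -
      obtain y i c where 1: "(y, i) \<in> \<Gamma>" "u = y \<oplus>\<^bsub>E\<^esub> c \<odot>\<^bsub>E\<^esub> x" "j = i + c * a"
        using u unfolding \<Gamma>'_def by blast
      show ?thesis
        using mem[OF D(3)[OF 1(1)], of e "e * c"] D(4)[OF 1(1)] x
        by (simp add: 1 smult_add_right smult_mult distrib_left mult.assoc)
    qed
    fix u j assume u: "(u, j) \<in> \<Gamma>'"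
    then obtain y i c where 1: "(y, i) \<in> \<Gamma>" "u = y \<oplus>\<^bsub>E\<^esub> c \<odot>\<^bsub>E\<^esub> x" "j = i + c * a"
      unfolding \<Gamma>'_def by blast
    have y: "y \<in> carrier E" by (rule D(4)[OF 1(1)])
    then show "u \<in> carrier E" using x by (simp add: 1)
    show "vabs j \<le> C * nrm E u"
    proof (cases "c = 0")
      case True
      then show ?thesis using 1 D(5)[OF 1(1)] x y by simp
    next
      case False
      \<comment> \<open>Factoring \<open>c\<close> out of \<open>u\<close> leaves the difference of
        \<open>x\<close> and an element of the domain, to which the inequality that defines
        \<open>a\<close> applies.\<close>
      let ?b = "- inverse c"
      have "vabs (a - ?b * i) \<le> C * nrm E (x \<ominus>\<^bsub>E\<^esub> ?b \<odot>\<^bsub>E\<^esub> y)" by (rule a[OF D(3)[OF 1(1)]])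
      from mult_left_mono[OF this, of "vabs c"] have "vabs c * vabs (a - ?b * i) \<le> C * (vabs c * nrm E (x \<ominus>\<^bsub>E\<^esub> ?b \<odot>\<^bsub>E\<^esub> y))"
        by (simp add: mult.left_commute)
      moreover have "c * (a - ?b * i) = j" using False by (simp add: 1 algebra_simps)
      then have "vabs c * vabs (a - ?b * i) = vabs j" by (simp flip: vabs_mult)
      moreover have "vabs c * nrm E (x \<ominus>\<^bsub>E\<^esub> ?b \<odot>\<^bsub>E\<^esub> y) = nrm E u"
      proof -
        have "c \<odot>\<^bsub>E\<^esub> (x \<ominus>\<^bsub>E\<^esub> ?b \<odot>\<^bsub>E\<^esub> y) = u"
          using False x y by (simp add: 1 smult_diff_right smult_add_right smult_minus_left a_minus_def[of E] smult_minus_right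
              M.a_comm flip: smult_mult)
        then show ?thesis using nrm_smult[of "x \<ominus>\<^bsub>E\<^esub> ?b \<odot>\<^bsub>E\<^esub> y" c] x y by simp
      qed
      ultimately show ?thesis by simp
    qed
  qed
  moreover have "\<Gamma> \<subseteq> \<Gamma>'"
  proof
    fix p assume p: "p \<in> \<Gamma>"
    then show "p \<in> \<Gamma>'" using mem[of "fst p" "snd p" 0] D(4)[of "fst p" "snd p"] x by simp
  qed
  moreover have "(x, a) \<in> \<Gamma>'" using mem[OF D(1), of 1] x by simp
  ultimately show ?thesis by blast
qed

text \<open>Zorn's lemma on graphs ordered by inclusion: a maximal graph is defined everywhere,
  since otherwise \<open>partial_functional_extend\<close> would enlarge it.\<close>

lemma ingleton_extension:
  fixes E :: "('k::spherically_complete_field, 'x, 'm) nspace_scheme"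
  assumes E: "nonarch_seminormed_space E" and C: "C \<ge> 0" and \<Gamma>: "partial_functional E C \<Gamma>"
  obtains f where "bounded_linear_map E scalars f" "\<And>x k. (x, k) \<in> \<Gamma> \<Longrightarrow> f x = k"
proof -
  interpret nonarch_seminormed_space E by fact
  let ?\<A> = "{\<Delta>. partial_functional E C \<Delta> \<and> \<Gamma> \<subseteq> \<Delta>}"
  have "\<exists>M\<in>?\<A>. \<forall>X\<in>?\<A>. M \<subseteq> X \<longrightarrow> X = M"
  proof (rule subset_Zorn_nonempty)
    show "?\<A> \<noteq> {}" using \<Gamma> by blast
    fix \<C> assume ne: "\<C> \<noteq> {}" and ch: "subset.chain ?\<A> \<C>"
    have pf: "partial_functional E C \<Delta>" "\<Gamma> \<subseteq> \<Delta>" if "\<Delta> \<in> \<C>" for \<Delta>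
      using ch that by (auto simp: subset.chain_def)
    have "partial_functional E C (\<Union>\<C>)"
      unfolding partial_functional_def
    proof (intro conjI allI impI)
      show "(\<zero>\<^bsub>E\<^esub>, 0) \<in> \<Union>\<C>" using ne partial_functionalD(1)[OF pf(1)] by blast
      show "(x \<oplus>\<^bsub>E\<^esub> y, j + k) \<in> \<Union>\<C>" if xy: "(x, j) \<in> \<Union>\<C>" "(y, k) \<in> \<Union>\<C>" for x j y k
      proof -
        obtain \<Delta>1 \<Delta>2 where 1: "\<Delta>1 \<in> \<C>" "(x, j) \<in> \<Delta>1" "\<Delta>2 \<in> \<C>" "(y, k) \<in> \<Delta>2" using xy by blast
        then have "\<Delta>1 \<subseteq> \<Delta>2 \<or> \<Delta>2 \<subseteq> \<Delta>1" using ch unfolding subset_chain_def by blast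
        then obtain \<Delta> where "\<Delta> \<in> \<C>" "(x, j) \<in> \<Delta>" "(y, k) \<in> \<Delta>" using 1 by blast
        then show ?thesis using partial_functionalD(2)[OF pf(1)] by blast
      qed
      show "(c \<odot>\<^bsub>E\<^esub> x, c * j) \<in> \<Union>\<C>" if "(x, j) \<in> \<Union>\<C>" for x j c
        using that partial_functionalD(3)[OF pf(1)] by blast
      show "x \<in> carrier E" "vabs j \<le> C * nrm E x" if "(x, j) \<in> \<Union>\<C>" for x j
        using that partial_functionalD(4,5)[OF pf(1)] by blast+
    qed
    then show "\<Union>\<C> \<in> ?\<A>" using ne pf(2) by blast
  qed
  then obtain M where M: "partial_functional E C M" "\<Gamma> \<subseteq> M"
    and max: "\<And>X. \<lbrakk>partial_functional E C X; M \<subseteq> X\<rbrakk> \<Longrightarrow> X = M" by auto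
  note D = partial_functionalD[OF M(1)]
  have total: "\<exists>k. (x, k) \<in> M" if x: "x \<in> carrier E" for x
    using partial_functional_extend[OF E C M(1) x] max by blast
  have unique: "j = k" if "(x, j) \<in> M" "(x, k) \<in> M" for x j k
  proof -
    have "vabs (j - k) \<le> C * nrm E (x \<ominus>\<^bsub>E\<^esub> x)"
      using partial_functional_diff[OF E M(1) that] D(5) by blast
    then have "vabs (j - k) \<le> 0" using D(4)[OF that(1)] by simp
    then have "vabs (j - k) = 0" by (intro antisym) auto
    then show ?thesis by simp
  qed
  define f where "f x = (THE k. (x, k) \<in> M)" for x
  have f: "(x, f x) \<in> M" if "x \<in> carrier E" for x
    unfolding f_def using total[OF that] unique by (auto intro: theI)
  have f_eq: "f x = k" if "(x, k) \<in> M" for x k using unique[OF f[OF D(4)[OF that]] that] .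
  show ?thesis
  proof (rule that)
    show "bounded_linear_map E scalars f"
    proof (rule bounded_linear_mapI[where C = C])
      fix x assume x: "x \<in> carrier E"
      show "f (x \<oplus>\<^bsub>E\<^esub> y) = f x \<oplus>\<^bsub>scalars\<^esub> f y" if "y \<in> carrier E" for y
        using f_eq[OF D(2)[OF f[OF x] f[OF that]]] by simp
      show "f (c \<odot>\<^bsub>E\<^esub> x) = c \<odot>\<^bsub>scalars\<^esub> f x" for c
        using f_eq[OF D(3)[OF f[OF x]]] by simp
      show "nrm scalars (f x) \<le> C * nrm E x" using D(5)[OF f[OF x]] by simp
    qed simp
    show "f x = k" if "(x, k) \<in> \<Gamma>" for x k using f_eq that M(2) by blast
  qed
qed

text \<open>On the sum of \<open>N\<close> and the line through \<open>v\<close>, reading off the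
  coefficient of \<open>v\<close> has norm at most \<open>inverse \<delta>\<close>, where
  \<open>\<delta>\<close> is a positive lower bound for the distance from \<open>v\<close> to
  \<open>N\<close>.\<close>

lemma separating_functional:
  fixes E :: "('k::spherically_complete_field, 'x, 'm) nspace_scheme"
  assumes E: "nonarch_seminormed_space E" and N: "closed_subspace E N" and v: "v \<in> carrier E" "v \<notin> N"
  obtains f where "bounded_linear_map E scalars f" "f v = 1" "\<And>x. x \<in> N \<Longrightarrow> f x = 0"
proof -
  interpret nonarch_seminormed_space E by fact
  note N' = submodule_mem[OF closed_subspaceD(1)[OF N]]
  have "\<not> adherent E N v" using closed_subspaceD(2)[OF N v(1)] v(2) by blast
  then obtain \<delta> where \<delta>: "\<delta> > 0" "\<And>y. y \<in> N \<Longrightarrow> \<delta> \<le> nrm E (v \<ominus>\<^bsub>E\<^esub> y)"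
    unfolding adherent_def by (meson not_le)
  define \<Gamma> where "\<Gamma> = {(y \<oplus>\<^bsub>E\<^esub> c \<odot>\<^bsub>E\<^esub> v, c) | y c. y \<in> N}"
  have mem: "(y \<oplus>\<^bsub>E\<^esub> c \<odot>\<^bsub>E\<^esub> v, c) \<in> \<Gamma>" if "y \<in> N" for y c using that unfolding \<Gamma>_def by blast
  have "partial_functional E (inverse \<delta>) \<Gamma>"
    unfolding partial_functional_def
  proof (intro conjI allI impI)
    show "(\<zero>\<^bsub>E\<^esub>, 0) \<in> \<Gamma>" using mem[OF N'(2), of 0] v by simp
    show "(x \<oplus>\<^bsub>E\<^esub> y, j + k) \<in> \<Gamma>" if xy: "(x, j) \<in> \<Gamma>" "(y, k) \<in> \<Gamma>" for x j y k
    proof -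
      obtain a b where ab: "a \<in> N" "x = a \<oplus>\<^bsub>E\<^esub> j \<odot>\<^bsub>E\<^esub> v" "b \<in> N" "y = b \<oplus>\<^bsub>E\<^esub> k \<odot>\<^bsub>E\<^esub> v"
        using xy unfolding \<Gamma>_def by blast
      moreover have "a \<in> carrier E" "b \<in> carrier E" using ab N'(1) by auto
      ultimately show ?thesis
        using mem[OF N'(3)[OF ab(1,3)], of "j + k"] v by (simp add: smult_add_left M.a_ac)
    qed
    show "(c \<odot>\<^bsub>E\<^esub> x, c * j) \<in> \<Gamma>" if x: "(x, j) \<in> \<Gamma>" for x j c
    proof -
      obtain a where a: "a \<in> N" "x = a \<oplus>\<^bsub>E\<^esub> j \<odot>\<^bsub>E\<^esub> v" using x unfolding \<Gamma>_def by blast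
      moreover have "a \<in> carrier E" using a N'(1) by auto
      ultimately show ?thesis
        using mem[OF N'(6)[OF a(1)], of c "c * j"] v by (simp add: smult_add_right smult_mult)
    qed
    fix x j assume x: "(x, j) \<in> \<Gamma>"
    then obtain a where a: "a \<in> N" "x = a \<oplus>\<^bsub>E\<^esub> j \<odot>\<^bsub>E\<^esub> v" unfolding \<Gamma>_def by blast
    then have ac: "a \<in> carrier E" using N'(1) by auto
    then show xc: "x \<in> carrier E" using a v by simp
    show "vabs j \<le> inverse \<delta> * nrm E x"
    proof (cases "j = 0")
      case True
      then show ?thesis using nrm_nonneg[OF xc] \<delta>(1) by simp
    next
      case False
      let ?b = "(- inverse j) \<odot>\<^bsub>E\<^esub> a"
      have "j \<odot>\<^bsub>E\<^esub> (v \<ominus>\<^bsub>E\<^esub> ?b) = x"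
        using False v ac by (simp add: a smult_diff_right smult_add_right smult_minus_left a_minus_def[of E] smult_minus_right
            M.a_comm flip: smult_mult)
      then have "nrm E x = vabs j * nrm E (v \<ominus>\<^bsub>E\<^esub> ?b)" using nrm_smult[of "v \<ominus>\<^bsub>E\<^esub> ?b" j] v ac by simp
      moreover have "vabs j * \<delta> \<le> vabs j * nrm E (v \<ominus>\<^bsub>E\<^esub> ?b)"
        by (intro mult_left_mono \<delta> N'(6) a) auto
      ultimately show ?thesis using \<delta>(1) by (simp add: field_simps)
    qed
  qed
  then obtain f where f: "bounded_linear_map E scalars f" "\<And>x k. (x, k) \<in> \<Gamma> \<Longrightarrow> f x = k"
    using ingleton_extension[OF E, of "inverse \<delta>" \<Gamma>] \<delta>(1) by auto
  show ?thesis
  proof (rule that[OF f(1)])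
    show "f v = 1" using f(2)[OF mem[OF N'(2), of 1]] v by simp
    show "f x = 0" if "x \<in> N" for x
      using f(2)[OF mem[OF that, of 0]] subsetD[OF N'(1) that] v by simp
  qed
qed


section \<open>The test complex\<close>

context group_convolution
begin

text \<open>The sum of all values of \<open>a\<close>, that is, the trivial character of the
  algebra. Expressed by convolution, it inherits linearity, boundedness and multiplicativity from
  \<open>conv\<close>.\<close>

definition augmentation :: "('g \<Rightarrow> 'k) \<Rightarrow> 'k" where
  "augmentation a = conv a const1 \<one>"

lemma conv_const1: "conv a const1 = augmentation a \<odot>\<^bsub>L\<^esub> const1"
  by (auto simp: augmentation_def L_simps const1_def conv_def fun_eq_iff intro!: infsum_cong)

text \<open>A bounded projection onto the constants. In general it does not commute with
  translations; it splits the test complex only as a complex of Banach spaces.\<close>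

definition ev :: "('g \<Rightarrow> 'k) \<Rightarrow> 'g \<Rightarrow> 'k" where
  "ev f = f \<one> \<odot>\<^bsub>L\<^esub> const1"

text \<open>
  The complex \<open>0 \<rightarrow> K1 \<rightarrow> l\<^sup>\<infinity>(G) \<rightarrow> l\<^sup>\<infinity>(G)/K1 \<rightarrow> 0\<close> in degrees \<open>1, 0, -1\<close>; the quotient is
  realised by the functions vanishing at the unit.  All terms are images of projections
  \<open>proj n\<close> of \<open>l\<^sup>\<infinity>(G)\<close>, which also serve as differentials and as contracting homotopy.
\<close>

definition proj :: "int \<Rightarrow> ('g \<Rightarrow> 'k) \<Rightarrow> 'g \<Rightarrow> 'k" where
  "proj n f = (if n = 1 then ev f else if n = 0 then f else if n = -1 then f \<ominus>\<^bsub>L\<^esub> ev f else \<zero>\<^bsub>L\<^esub>)"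

definition image :: "int \<Rightarrow> ('g \<Rightarrow> 'k) set" where
  "image n = {f \<in> carrier L. proj n f = f}"

text \<open>The right action through the augmentation turns the commutator of \<open>delta g\<close>
  with \<open>f\<close> in degree 0 into \<open>translate G g f - f\<close>. Applying
  \<open>proj n\<close> after convolution realises, in degree -1, the action on the quotient by
  constants in terms of representatives vanishing at the unit. \<open>Inl\<close> places all modules
  in the universe over which amenability is assumed.\<close>

definition test_module :: "int \<Rightarrow> ('k, 'g \<Rightarrow> 'k, ('g \<Rightarrow> 'k) + 'u) bimodule" where
  "test_module n = \<lparr>carrier = Inl ` image n, mult = undefined, one = undefined, zero = Inl \<zero>\<^bsub>L\<^esub>,
     add = (\<lambda>x y. Inl (projl x \<oplus>\<^bsub>L\<^esub> projl y)), smult = (\<lambda>c x. Inl (c \<odot>\<^bsub>L\<^esub> projl x)),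
     nrm = (\<lambda>x. nrm L (projl x)), lact = (\<lambda>a x. Inl (proj n (conv a (projl x)))),
     ract = (\<lambda>x a. Inl (augmentation a \<odot>\<^bsub>L\<^esub> projl x))\<rparr>"

lemma test_module_simps:
  "carrier (test_module n) = Inl ` image n" "\<zero>\<^bsub>test_module n\<^esub> = Inl \<zero>\<^bsub>L\<^esub>"
  "Inl f \<oplus>\<^bsub>test_module n\<^esub> Inl h = Inl (f \<oplus>\<^bsub>L\<^esub> h)" "c \<odot>\<^bsub>test_module n\<^esub> Inl f = Inl (c \<odot>\<^bsub>L\<^esub> f)"
  "nrm (test_module n) (Inl f) = nrm L f" "lact (test_module n) a (Inl f) = Inl (proj n (conv a f))"
  "ract (test_module n) (Inl f) a = Inl (augmentation a \<odot>\<^bsub>L\<^esub> f)"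
  by (simp_all add: test_module_def)

lemma ev_bounded: "bounded_linear_map L L ev" and nrm_ev: "f \<in> carrier L \<Longrightarrow> nrm L (ev f) \<le> nrm L f"
proof -
  have bound: "nrm L (ev f) \<le> 1 * nrm L f" if "f \<in> carrier L" for f
    using le_nrm[OF that, of \<one>] by (intro nrm_le) (simp add: ev_def L_simps const1_def)
  then show "f \<in> carrier L \<Longrightarrow> nrm L (ev f) \<le> nrm L f" by simp
  show "bounded_linear_map L L ev"
  proof (rule bounded_linear_mapI[OF _ _ _ bound])
    show "ev f \<in> carrier L" for f using const1_mem by (simp add: ev_def)
    show "ev (f \<oplus>\<^bsub>L\<^esub> h) = ev f \<oplus>\<^bsub>L\<^esub> ev h" for f h
      by (simp add: ev_def L_simps distrib_right)
    show "ev (c \<odot>\<^bsub>L\<^esub> f) = c \<odot>\<^bsub>L\<^esub> ev f" for c f by (simp add: ev_def L_simps mult.assoc)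
  qed
qed

lemmas ev_mem [simp] = bounded_linear_mapD(1)[OF ev_bounded]

lemma ev_const: "ev (c \<odot>\<^bsub>L\<^esub> const1) = c \<odot>\<^bsub>L\<^esub> const1"
  by (auto simp: ev_def L_simps const1_def)

lemma ev_ev: "ev (ev f) = ev f"
  unfolding ev_def[of f] by (rule ev_const)

interpretation ev: bounded_map L L ev
  by (intro bounded_mapI seminormed_L ev_bounded)

lemma proj_bounded: "bounded_linear_map L L (proj n)"
proof -
  have "bounded_linear_map L L (\<lambda>_. \<zero>\<^bsub>L\<^esub>)"
    by (rule bounded_linear_mapI[where C = 0]) auto
  then show ?thesis
    unfolding proj_def[abs_def]
    using ev_bounded bounded_linear_map_id[of L] bounded_linear_map_diff[OF seminormed_L seminormed_L bounded_linear_map_id ev_bounded]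
    by (cases "n = 1"; cases "n = 0"; cases "n = -1") simp_all
qed

interpretation proj: bounded_map L L "proj n" for n
  by (intro bounded_mapI seminormed_L proj_bounded)

lemma nrm_proj: "f \<in> carrier L \<Longrightarrow> nrm L (proj n f) \<le> nrm L f"
  using nrm_ev[of f] L.nrm_diff[of f "ev f"] L.nrm_nonneg[of f] by (auto simp: proj_def)

lemma proj_proj: "f \<in> carrier L \<Longrightarrow> proj n (proj n f) = proj n f"
  by (auto simp: proj_def ev_ev ev.diff)

lemma proj_image: "f \<in> carrier L \<Longrightarrow> proj n f \<in> image n"
  by (simp add: image_def proj_proj)

lemma image_mem: "f \<in> image n \<Longrightarrow> f \<in> carrier L" "f \<in> image n \<Longrightarrow> proj n f = f"
  by (simp_all add: image_def)

text \<open>Fixed points of a bounded projection form the kernel of a bounded map. Closedness makes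
  the test modules complete.\<close>

lemma image_closed: "closed_subspace L (image n)"
proof -
  interpret f: bounded_map L L "\<lambda>f. proj n f \<ominus>\<^bsub>L\<^esub> f"
    by (intro bounded_mapI seminormed_L bounded_linear_map_diff proj_bounded bounded_linear_map_id)
  have "image n = {f \<in> carrier L. proj n f \<ominus>\<^bsub>L\<^esub> f \<in> {\<zero>\<^bsub>L\<^esub>}}"
    by (auto simp: image_def L.minus_eq_zero_iff)
  then show ?thesis using f.closed_subspace_vimage[OF L.closed_subspace_zero] by simp
qed

lemmas image_sub = L.submodule_mem[OF L.closed_subspaceD(1)[OF image_closed]]

lemma conv_ev: "a \<in> carrier A \<Longrightarrow> conv a (ev f) = (f \<one> * augmentation a) \<odot>\<^bsub>L\<^esub> const1"
  using bounded_bilinear_mapD(7)[OF conv_bilinear, of a const1 "f \<one>"] const1_mem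
  by (simp add: ev_def conv_const1 flip: L.smult_mult)

text \<open>On constants convolution is multiplication by the augmentation, so in degree 1 the left
  and the right action coincide.\<close>

lemma conv_image1:
  assumes "a \<in> carrier A" "f \<in> image 1"
  shows "ev (conv a f) = conv a f" "conv a f = augmentation a \<odot>\<^bsub>L\<^esub> f"
proof -
  have f: "f = ev f" using assms(2) by (simp add: image_def proj_def)
  show "ev (conv a f) = conv a f" by (subst (1 2) f) (simp add: conv_ev assms(1) ev_const)
  have "conv a f = (f \<one> * augmentation a) \<odot>\<^bsub>L\<^esub> const1" by (subst f) (simp add: conv_ev assms(1))
  also have "\<dots> = augmentation a \<odot>\<^bsub>L\<^esub> ev f" by (auto simp: ev_def L_simps)
  finally show "conv a f = augmentation a \<odot>\<^bsub>L\<^esub> f" using f by simp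
qed

text \<open>What \<open>proj (-1)\<close> removes is constant, and convolution keeps it constant, so
  it is removed in the end anyway. Degree 1 is excluded because the kernel of \<open>ev\<close> is
  in general not stable under convolution.\<close>

lemma proj_conv_proj:
  assumes "a \<in> carrier A" "f \<in> carrier L" "n \<noteq> 1"
  shows "proj n (conv a (proj n f)) = proj n (conv a f)"
proof (cases "n = -1")
  case True
  interpret c: bounded_map L L "conv a"
    by (intro bounded_mapI seminormed_L bounded_bilinear_mapD(1)[OF conv_bilinear assms(1)])
  have "proj (-1) (conv a (ev f)) = \<zero>\<^bsub>L\<^esub>"
    using const1_mem by (simp add: proj_def conv_ev assms(1) ev_const)
  then show ?thesis
    using assms True by (simp add: proj_def[of "-1" f] c.diff proj.diff conv_mem)
next
  case False
  show ?thesis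
  proof (cases "n = 0")
    case True
    then show ?thesis by (simp add: proj_def)
  qed (use False assms(3) in \<open>simp add: proj_def\<close>)
qed

lemma proj_conv_assoc:
  assumes "a \<in> carrier A" "b \<in> carrier A" "f \<in> image n"
  shows "proj n (conv a (proj n (conv b f))) = proj n (conv (conv a b) f)"
proof (cases "n = 1")
  case True
  then show ?thesis
    using assms conv_image1(1)[of b f] by (simp add: proj_def conv_assoc image_mem)
next
  case False
  then show ?thesis
    using assms by (simp add: proj_conv_proj conv_mem conv_assoc image_mem)
qed

lemma augmentation_bounds:
  shows augmentation_add: "\<lbrakk>a \<in> carrier A; b \<in> carrier A\<rbrakk> \<Longrightarrow> augmentation (a \<oplus>\<^bsub>A\<^esub> b) = augmentation a + augmentation b"
    and augmentation_smult: "a \<in> carrier A \<Longrightarrow> augmentation (c \<odot>\<^bsub>A\<^esub> a) = c * augmentation a"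
    and augmentation_bound: "a \<in> carrier A \<Longrightarrow> vabs (augmentation a) \<le> nrm A a"
    and augmentation_mult: "\<lbrakk>a \<in> carrier A; b \<in> carrier A\<rbrakk> \<Longrightarrow> augmentation (conv a b) = augmentation a * augmentation b"
proof -
  note c = bounded_bilinear_mapD[OF conv_bilinear]
  show "\<lbrakk>a \<in> carrier A; b \<in> carrier A\<rbrakk> \<Longrightarrow> augmentation (a \<oplus>\<^bsub>A\<^esub> b) = augmentation a + augmentation b"
    by (simp add: augmentation_def c(4) const1_mem) (simp add: L_simps)
  show "a \<in> carrier A \<Longrightarrow> augmentation (c \<odot>\<^bsub>A\<^esub> a) = c * augmentation a"
    by (simp add: augmentation_def c(6) const1_mem) (simp add: L_simps)
  have "nrm L const1 \<le> 1" by (rule nrm_le) (simp add: const1_def)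
  then show "vabs (augmentation a) \<le> nrm A a" if a: "a \<in> carrier A"
    using vabs_conv_le[OF a const1_mem, of \<one>] mult_left_mono[of "nrm L const1" 1 "nrm L a"]
      L.nrm_nonneg[OF A_mem_L[OF a]] by (simp add: augmentation_def A_simps)
  assume ab: "a \<in> carrier A" "b \<in> carrier A"
  have "conv (conv a b) const1 = conv a (augmentation b \<odot>\<^bsub>L\<^esub> const1)"
    using ab by (simp add: conv_assoc const1_mem conv_const1[of b])
  also have "\<dots> = augmentation b \<odot>\<^bsub>L\<^esub> (augmentation a \<odot>\<^bsub>L\<^esub> const1)"
    using ab const1_mem by (simp add: c(7) conv_const1[of a])
  finally show "augmentation (conv a b) = augmentation a * augmentation b"
    by (simp add: augmentation_def[of "conv a b"]) (simp add: L_simps const1_def)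
qed

section \<open>The test modules as Banach bimodules\<close>

lemma test_module_seminormed: "nonarch_seminormed_space (test_module n :: ('k, 'g \<Rightarrow> 'k, ('g \<Rightarrow> 'k) + 'u) bimodule)"
proof (rule nonarch_seminormed_spaceI)
  let ?T = "test_module n :: ('k, 'g \<Rightarrow> 'k, ('g \<Rightarrow> 'k) + 'u) bimodule"
  show "\<zero>\<^bsub>?T\<^esub> \<in> carrier ?T" using image_sub(2) by (simp add: test_module_simps)
  fix x assume "x \<in> carrier ?T"
  then obtain f where x: "x = Inl f" "f \<in> image n" by (auto simp: test_module_simps)
  note f = image_mem(1)[OF x(2)]
  show "\<zero>\<^bsub>?T\<^esub> \<oplus>\<^bsub>?T\<^esub> x = x" "1 \<odot>\<^bsub>?T\<^esub> x = x" "0 \<le> nrm ?T x"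
    using f by (simp_all add: x(1) test_module_simps L.nrm_nonneg)
  have "(- 1) \<odot>\<^bsub>L\<^esub> f \<oplus>\<^bsub>L\<^esub> f = \<zero>\<^bsub>L\<^esub>" using f L.smult_add_left[of f "-1" 1] by simp
  then show "(- 1) \<odot>\<^bsub>?T\<^esub> x \<oplus>\<^bsub>?T\<^esub> x = \<zero>\<^bsub>?T\<^esub>" by (simp add: x(1) test_module_simps)
  show "c \<odot>\<^bsub>?T\<^esub> x \<in> carrier ?T" for c using x image_sub(6) by (simp add: test_module_simps)
  show "(c + c') \<odot>\<^bsub>?T\<^esub> x = c \<odot>\<^bsub>?T\<^esub> x \<oplus>\<^bsub>?T\<^esub> c' \<odot>\<^bsub>?T\<^esub> x" "(c * c') \<odot>\<^bsub>?T\<^esub> x = c \<odot>\<^bsub>?T\<^esub> (c' \<odot>\<^bsub>?T\<^esub> x)"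
    "nrm ?T (c \<odot>\<^bsub>?T\<^esub> x) = vabs c * nrm ?T x" for c c'
    using f by (simp_all add: x(1) test_module_simps L.smult_add_left L.smult_mult L.nrm_smult)
  fix y assume "y \<in> carrier ?T"
  then obtain h where y: "y = Inl h" "h \<in> image n" by (auto simp: test_module_simps)
  note h = image_mem(1)[OF y(2)]
  show "x \<oplus>\<^bsub>?T\<^esub> y \<in> carrier ?T" using x y image_sub(3) by (simp add: test_module_simps)
  show "x \<oplus>\<^bsub>?T\<^esub> y = y \<oplus>\<^bsub>?T\<^esub> x" "c \<odot>\<^bsub>?T\<^esub> (x \<oplus>\<^bsub>?T\<^esub> y) = c \<odot>\<^bsub>?T\<^esub> x \<oplus>\<^bsub>?T\<^esub> c \<odot>\<^bsub>?T\<^esub> y"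
    "nrm ?T (x \<oplus>\<^bsub>?T\<^esub> y) \<le> max (nrm ?T x) (nrm ?T y)" for c
    using f h L.nrm_add[OF f h] by (simp_all add: x(1) y(1) test_module_simps L.smult_add_right L.M.a_comm)
  fix z assume "z \<in> carrier ?T"
  then obtain k where z: "z = Inl k" "k \<in> image n" by (auto simp: test_module_simps)
  show "x \<oplus>\<^bsub>?T\<^esub> y \<oplus>\<^bsub>?T\<^esub> z = x \<oplus>\<^bsub>?T\<^esub> (y \<oplus>\<^bsub>?T\<^esub> z)"
    using f h image_mem(1)[OF z(2)] by (simp add: x(1) y(1) z(1) test_module_simps L.M.a_assoc)
qed

lemma test_module_diff:
  assumes "f \<in> image n" "h \<in> image n"
  shows "Inl f \<ominus>\<^bsub>test_module n\<^esub> Inl h = (Inl (f \<ominus>\<^bsub>L\<^esub> h) :: ('g \<Rightarrow> 'k) + 'u)"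
proof -
  interpret T: nonarch_seminormed_space "test_module n :: ('k, 'g \<Rightarrow> 'k, ('g \<Rightarrow> 'k) + 'u) bimodule"
    by (rule test_module_seminormed)
  show ?thesis
    using assms image_mem(1)[OF assms(2)] by (simp add: T.a_minus_eq_smult L.a_minus_eq_smult test_module_simps)
qed

lemma test_module_banach: "nonarch_banach_space (test_module n :: ('k, 'g \<Rightarrow> 'k, ('g \<Rightarrow> 'k) + 'u) bimodule)"
proof -
  let ?T = "test_module n :: ('k, 'g \<Rightarrow> 'k, ('g \<Rightarrow> 'k) + 'u) bimodule"
  interpret T: nonarch_seminormed_space ?T by (rule test_module_seminormed)
  show ?thesis
  proof (intro nonarch_banach_space.intro nonarch_banach_space_axioms.intro T.module_axioms T.nrm_nonneg T.nrm_smult T.nrm_add)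
    show "nrm ?T x = 0 \<longleftrightarrow> x = \<zero>\<^bsub>?T\<^esub>" if "x \<in> carrier ?T" for x
      using that image_mem(1) L_nrm_eq_0 by (auto simp: test_module_simps)
    fix \<sigma> assume s: "range \<sigma> \<subseteq> carrier ?T" and ca: "nrm_Cauchy ?T \<sigma>"
    define \<tau> where "\<tau> n = projl (\<sigma> n)" for n
    have t: "\<sigma> m = Inl (\<tau> m)" "\<tau> m \<in> image n" for m
    proof -
      have "\<sigma> m \<in> Inl ` image n" using s by (auto simp: test_module_simps)
      then show "\<sigma> m = Inl (\<tau> m)" "\<tau> m \<in> image n" by (auto simp: \<tau>_def)
    qed
    have diff: "nrm ?T (\<sigma> m \<ominus>\<^bsub>?T\<^esub> Inl f) = nrm L (\<tau> m \<ominus>\<^bsub>L\<^esub> f)" if "f \<in> image n" for f m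
      by (simp add: t(1) test_module_diff t(2) that test_module_simps)
    have "nrm_Cauchy L \<tau>"
      using ca unfolding nrm_Cauchy_def by (simp add: t(1)[of "_ :: nat"] test_module_diff t(2) test_module_simps)
    then obtain f where f: "f \<in> carrier L" "nrm_tendsto L \<tau> f"
      using L_complete[of \<tau>] t(2) image_mem(1) by blast
    then have "f \<in> image n"
      using image_closed[of n] t(2) unfolding closed_subspace_def by blast
    then show "\<exists>x\<in>carrier ?T. nrm_tendsto ?T \<sigma> x"
      using f(2) diff by (intro bexI[of _ "Inl f"]) (auto simp: nrm_tendsto_def test_module_simps)
  qed
qed

lemma test_module_bimodule: "banach_bimodule A (test_module n :: ('k, 'g \<Rightarrow> 'k, ('g \<Rightarrow> 'k) + 'u) bimodule)"
proof -
  let ?T = "test_module n :: ('k, 'g \<Rightarrow> 'k, ('g \<Rightarrow> 'k) + 'u) bimodule"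
  note c = bounded_bilinear_mapD[OF conv_bilinear]
  have lmem: "lact ?T a x \<in> carrier ?T" if "a \<in> carrier A" "x \<in> carrier ?T" for a x
    using that by (auto simp: test_module_simps proj_image conv_mem image_mem)
  have rmem: "ract ?T x a \<in> carrier ?T" if "x \<in> carrier ?T" for a x
    using that by (auto simp: test_module_simps image_sub)
  have lbound: "nrm ?T (lact ?T a x) \<le> 1 * nrm A a * nrm ?T x" if a: "a \<in> carrier A" and xc: "x \<in> carrier ?T" for a x
  proof -
    obtain f where x: "x = Inl f" "f \<in> carrier L" using xc image_mem(1) by (auto simp: test_module_simps)
    have "nrm L (proj n (conv a f)) \<le> nrm L (conv a f)" using a x by (intro nrm_proj conv_mem)
    also have "\<dots> \<le> nrm A a * nrm L f" unfolding A_simps by (rule nrm_le) (rule vabs_conv_le[OF a x(2)])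
    finally show ?thesis by (simp add: x(1) test_module_simps)
  qed
  have rbound: "nrm ?T (ract ?T x a) \<le> 1 * nrm ?T x * nrm A a" if a: "a \<in> carrier A" and xc: "x \<in> carrier ?T" for a x
  proof -
    obtain f where x: "x = Inl f" "f \<in> carrier L" using xc image_mem(1) by (auto simp: test_module_simps)
    show ?thesis
      using mult_right_mono[OF augmentation_bound[OF a] L.nrm_nonneg[OF x(2)]] x(2)
      by (simp add: x(1) test_module_simps L.nrm_smult mult.commute)
  qed
  have l: "bounded_bilinear_map A ?T ?T (lact ?T)"
    unfolding bounded_bilinear_map_def
  proof (intro conjI ballI exI)
    show "nrm ?T (lact ?T a x) \<le> 1 * nrm A a * nrm ?T x" if "a \<in> carrier A" "x \<in> carrier ?T" for a x
      using lbound that .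
    show "bounded_linear_map ?T ?T (lact ?T a)" if a: "a \<in> carrier A" for a
    proof (rule bounded_linear_mapI[OF lmem _ _ lbound])
      show "lact ?T a (x \<oplus>\<^bsub>?T\<^esub> y) = lact ?T a x \<oplus>\<^bsub>?T\<^esub> lact ?T a y" if "x \<in> carrier ?T" "y \<in> carrier ?T" for x y
        using that a image_mem(1) by (auto simp: test_module_simps c(5) proj.add conv_mem)
      show "lact ?T a (k \<odot>\<^bsub>?T\<^esub> x) = k \<odot>\<^bsub>?T\<^esub> lact ?T a x" if "x \<in> carrier ?T" for k x
        using that a image_mem(1) by (auto simp: test_module_simps c(7) proj.smult conv_mem)
    qed (use a in auto)
    show "bounded_linear_map A ?T (\<lambda>a. lact ?T a x)" if x: "x \<in> carrier ?T" for x
    proof (rule bounded_linear_mapI[where C = "nrm ?T x"])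
      show "nrm ?T (lact ?T a x) \<le> nrm ?T x * nrm A a" if "a \<in> carrier A" for a
        using lbound[OF that x] by (simp add: mult.commute)
      show "lact ?T (a \<oplus>\<^bsub>A\<^esub> b) x = lact ?T a x \<oplus>\<^bsub>?T\<^esub> lact ?T b x" if "a \<in> carrier A" "b \<in> carrier A" for a b
        using that x image_mem(1) by (auto simp: test_module_simps c(4) proj.add conv_mem)
      show "lact ?T (k \<odot>\<^bsub>A\<^esub> a) x = k \<odot>\<^bsub>?T\<^esub> lact ?T a x" if "a \<in> carrier A" for k a
        using that x image_mem(1) by (auto simp: test_module_simps c(6) proj.smult conv_mem)
    qed (use lmem x in auto)
  qed
  have r: "bounded_bilinear_map ?T A ?T (ract ?T)"
    unfolding bounded_bilinear_map_def
  proof (intro conjI ballI exI)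
    show "nrm ?T (ract ?T x a) \<le> 1 * nrm ?T x * nrm A a" if "a \<in> carrier A" "x \<in> carrier ?T" for a x
      using rbound that .
    show "bounded_linear_map ?T ?T (\<lambda>x. ract ?T x a)" if a: "a \<in> carrier A" for a
    proof (rule bounded_linear_mapI[where C = "nrm A a"])
      show "nrm ?T (ract ?T x a) \<le> nrm A a * nrm ?T x" if "x \<in> carrier ?T" for x
        using rbound[OF a that] by (simp add: mult.commute)
      show "ract ?T (x \<oplus>\<^bsub>?T\<^esub> y) a = ract ?T x a \<oplus>\<^bsub>?T\<^esub> ract ?T y a" if "x \<in> carrier ?T" "y \<in> carrier ?T" for x y
        using that image_mem(1) by (auto simp: test_module_simps L.smult_add_right)
      show "ract ?T (k \<odot>\<^bsub>?T\<^esub> x) a = k \<odot>\<^bsub>?T\<^esub> ract ?T x a" if "x \<in> carrier ?T" for k x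
        using that image_mem(1) by (auto simp: test_module_simps mult.commute simp flip: L.smult_mult)
    qed (rule rmem)
    show "bounded_linear_map A ?T (ract ?T x)" if x: "x \<in> carrier ?T" for x
    proof (rule bounded_linear_mapI[where C = "1 * nrm ?T x"])
      show "nrm ?T (ract ?T x a) \<le> 1 * nrm ?T x * nrm A a" if "a \<in> carrier A" for a
        using rbound[OF that x] .
      show "ract ?T x (a \<oplus>\<^bsub>A\<^esub> b) = ract ?T x a \<oplus>\<^bsub>?T\<^esub> ract ?T x b" if "a \<in> carrier A" "b \<in> carrier A" for a b
        using that x image_mem(1) by (auto simp: test_module_simps augmentation_add L.smult_add_left)
      show "ract ?T x (k \<odot>\<^bsub>A\<^esub> a) = k \<odot>\<^bsub>?T\<^esub> ract ?T x a" if "a \<in> carrier A" for k a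
        using that x image_mem(1) by (auto simp: test_module_simps augmentation_smult L.smult_mult)
    qed (use rmem x in auto)
  qed
  show ?thesis
  proof (intro banach_bimodule.intro banach_bimodule_axioms.intro test_module_banach l r)
    fix a b x assume a: "a \<in> carrier A" and b: "b \<in> carrier A" and "x \<in> carrier ?T"
    then obtain f where x: "x = Inl f" "f \<in> image n" by (auto simp: test_module_simps)
    note f = image_mem(1)[OF x(2)]
    show "lact ?T (a \<otimes>\<^bsub>A\<^esub> b) x = lact ?T a (lact ?T b x)"
      using a b x(2) by (simp add: x(1) test_module_simps A_mult proj_conv_assoc)
    show "ract ?T x (a \<otimes>\<^bsub>A\<^esub> b) = ract ?T (ract ?T x a) b"
      using a b f by (simp add: x(1) test_module_simps A_mult augmentation_mult mult.commute flip: L.smult_mult)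
    show "ract ?T (lact ?T a x) b = lact ?T a (ract ?T x b)"
      using a b f by (simp add: x(1) test_module_simps c(7) proj.smult conv_mem)
  qed
qed

lemma proj_conv_hom:
  assumes a: "a \<in> carrier A" and f: "f \<in> image n"
  shows "proj (n - 1) (proj n (conv a f)) = proj (n - 1) (conv a (proj (n - 1) f))"
proof -
  consider "n = 1" | "n = 0" | "n \<noteq> 1" "n \<noteq> 0" by blast
  then show ?thesis
  proof cases
    case 1
    then show ?thesis using conv_image1(1)[OF a] f by (simp add: proj_def)
  next
    case 2
    then show ?thesis using proj_conv_proj[OF a image_mem(1)[OF f], of "-1"] by (simp add: proj_def[of 0])
  next
    case 3
    show ?thesis
    proof (cases "n = 2")
      \<comment> \<open>Here \<open>proj (n - 1)\<close> is \<open>ev\<close> and does not vanish,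
        but the module in degree 2 is zero.\<close>
      case True
      then have "f = \<zero>\<^bsub>L\<^esub>" using f by (auto simp: image_def proj_def)
      moreover have "conv a \<zero>\<^bsub>L\<^esub> = \<zero>\<^bsub>L\<^esub>"
        using bounded_bilinear_mapD(7)[OF conv_bilinear a, of "\<zero>\<^bsub>L\<^esub>" 0] conv_mem[OF a, of "\<zero>\<^bsub>L\<^esub>"] by simp
      ultimately show ?thesis by simp
    qed (use 3 in \<open>simp add: proj_def[of "n - 1"]\<close>)
  qed
qed

section \<open>Admissibility of the test complex and the invariant functional\<close>

definition test_map :: "int \<Rightarrow> ('g \<Rightarrow> 'k) + 'u \<Rightarrow> ('g \<Rightarrow> 'k) + 'u" where
  "test_map n x = Inl (proj n (projl x))"

lemma test_map_Inl [simp]: "test_map n (Inl f) = Inl (proj n f)"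
  by (simp add: test_map_def)

lemma test_map_bounded:
  "bounded_linear_map (test_module n) (test_module m) (test_map m :: ('g \<Rightarrow> 'k) + 'u \<Rightarrow> ('g \<Rightarrow> 'k) + 'u)"
  by (rule bounded_linear_mapI[where C = 1])
    (auto simp: test_module_simps proj.add proj.smult image_mem proj_image nrm_proj)

lemma test_complex:
  "bimodule_complex A (test_module :: int \<Rightarrow> ('k, 'g \<Rightarrow> 'k, ('g \<Rightarrow> 'k) + 'u) bimodule) (\<lambda>n. test_map (n - 1))"
  unfolding bimodule_complex_def bimodule_hom_def
proof (intro conjI allI ballI test_module_bimodule test_map_bounded)
  fix n and x :: "('g \<Rightarrow> 'k) + 'u"
  assume "x \<in> carrier (test_module n)"
  then obtain f where x: "x = Inl f" "f \<in> image n" by (auto simp: test_module_simps)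
  note f = image_mem(1)[OF x(2)]
  have "proj (n - 2) (proj (n - 1) f) = \<zero>\<^bsub>L\<^esub>"
  proof -
    consider "n = 1" | "n = 0" | "n = 2" | "n - 2 \<notin> {-1, 0, 1}" "n \<noteq> 0" | "n = 3" by force
    then show ?thesis
    proof cases
      case 1
      then have "ev f = f" using image_mem(2)[OF x(2)] by (simp add: proj_def)
      then show ?thesis using 1 f by (simp add: proj_def)
    qed (use x(2) f proj.zero in \<open>auto simp: proj_def image_def\<close>)
  qed
  then show "test_map (n - 1 - 1) (test_map (n - 1) x) = \<zero>\<^bsub>test_module (n - 2)\<^esub>"
    by (simp add: x(1) test_module_simps)
  fix a assume a: "a \<in> carrier A"
  show "test_map (n - 1) (lact (test_module n) a x) = lact (test_module (n - 1)) a (test_map (n - 1) x)"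
    by (simp add: x(1) test_module_simps proj_conv_hom[OF a x(2)])
  show "test_map (n - 1) (ract (test_module n) x a) = ract (test_module (n - 1)) (test_map (n - 1) x) a"
    by (simp add: x(1) test_module_simps proj.smult f)
qed

lemma test_complex_admissible:
  "admissible_complex (test_module :: int \<Rightarrow> ('k, 'g \<Rightarrow> 'k, ('g \<Rightarrow> 'k) + 'u) bimodule) (\<lambda>n. test_map (n - 1))"
  unfolding admissible_complex_def
proof (intro exI[of _ "\<lambda>n. test_map (n + 1)"] conjI allI ballI test_map_bounded)
  fix n and x :: "('g \<Rightarrow> 'k) + 'u"
  assume "x \<in> carrier (test_module n)"
  then obtain f where x: "x = Inl f" "f \<in> image n" by (auto simp: test_module_simps)
  note f = image_mem[OF x(2)]
  \<comment> \<open>In degree 0 this is the splitting of \<open>f\<close> into \<open>ev f\<close>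
    and the rest; in degrees 1 and -1 it says that \<open>f\<close> is fixed by its own
    projection.\<close>
  have "proj n (proj (n + 1) f) \<oplus>\<^bsub>L\<^esub> proj n (proj (n - 1) f) = f"
  proof -
    consider "n = 1" | "n = 0" | "n = -1" | "n \<noteq> 1" "n \<noteq> 0" "n \<noteq> -1" by blast
    then show ?thesis
      by cases (use f in \<open>simp_all add: proj_def ev.diff ev_ev\<close>)
  qed
  then show "test_map (n + 1 - 1) (test_map (n + 1) x) \<oplus>\<^bsub>test_module n\<^esub> test_map (n - 1 + 1) (test_map (n - 1) x) = x"
    by (simp add: x(1) test_module_simps)
qed

text \<open>Exactness is used in degree 1, where nothing can absorb \<open>const1\<close>: the
  actions coincide there, so there are no commutators, and the module in degree 2 is zero, so there
  are no boundaries. Hence the image of \<open>const1\<close> in degree 0 is not in the commutator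
  span, and a functional separating the two is invariant.\<close>

lemma amenable_imp_johnson:
  assumes "amenable TYPE(('g \<Rightarrow> 'k) + 'u) A"
  shows "johnson_amenable TYPE('k) G"
proof -
  let ?T = "test_module :: int \<Rightarrow> ('k, 'g \<Rightarrow> 'k, ('g \<Rightarrow> 'k) + 'u) bimodule"
  interpret T0: banach_bimodule A "?T 0" by (rule test_module_bimodule)
  interpret T1: banach_bimodule A "?T 1" by (rule test_module_bimodule)
  have c0: "const1 \<in> image 0" using const1_mem by (simp add: image_def proj_def)
  have c1: "const1 \<in> image 1" using const1_mem by (auto simp: image_def proj_def ev_def const1_def L_simps)
  have im0: "image 0 = carrier L" by (simp add: image_def proj_def)
  have "commutator_span A (?T 1) \<subseteq> {\<zero>\<^bsub>?T 1\<^esub>}"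
  proof (rule T1.commutator_span_minimal[OF T1.closed_subspace_zero])
    fix a x assume a: "a \<in> carrier A" and "x \<in> carrier (?T 1)"
    then obtain f where x: "x = Inl f" "f \<in> image 1" by (auto simp: test_module_simps)
    have "proj 1 (conv a f) = augmentation a \<odot>\<^bsub>L\<^esub> f"
      using conv_image1[OF a x(2)] by (simp add: proj_def)
    then have "lact (?T 1) a x = ract (?T 1) x a" by (simp add: x(1) test_module_simps)
    then show "lact (?T 1) a x \<ominus>\<^bsub>?T 1\<^esub> ract (?T 1) x a \<in> {\<zero>\<^bsub>?T 1\<^esub>}"
      using T1.ract_mem[OF _ a, of x] x by (simp add: test_module_simps)
  qed
  moreover have "Inl const1 \<ominus>\<^bsub>?T 1\<^esub> test_map 1 y \<noteq> \<zero>\<^bsub>?T 1\<^esub>" if "y \<in> carrier (?T 2)" for y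
  proof -
    have "y = Inl \<zero>\<^bsub>L\<^esub>" using that by (auto simp: test_module_simps image_def proj_def)
    moreover have "\<zero>\<^bsub>L\<^esub> \<in> image 1" by (rule image_sub(2))
    moreover have "const1 \<noteq> \<zero>\<^bsub>L\<^esub>" using one_closed by (auto simp: const1_def L_simps fun_eq_iff)
    ultimately show ?thesis using c1 const1_mem by (simp add: test_module_diff test_module_simps)
  qed
  ultimately have "\<not> (\<exists>y\<in>carrier (?T (1 + 1)). Inl const1 \<ominus>\<^bsub>?T 1\<^esub> test_map (1 + 1 - 1) y \<in> commutator_span A (?T 1))"
    by auto
  moreover have "\<forall>z\<in>carrier (?T 1). test_map (1 - 1) z \<in> commutator_span A (?T (1 - 1)) \<longleftrightarrow>
      (\<exists>y\<in>carrier (?T (1 + 1)). z \<ominus>\<^bsub>?T 1\<^esub> test_map (1 + 1 - 1) y \<in> commutator_span A (?T 1))"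
    using assms test_complex test_complex_admissible unfolding A.amenable_iff by blast
  moreover have "Inl const1 \<in> carrier (?T 1)" using c1 by (simp add: test_module_simps)
  ultimately have "test_map (1 - 1) (Inl const1) \<notin> commutator_span A (?T (1 - 1))" by blast
  then have nmem: "Inl const1 \<notin> commutator_span A (?T 0)" by (simp add: proj_def)
  obtain \<phi> where \<phi>: "bounded_linear_map (?T 0) scalars \<phi>" "\<phi> (Inl const1) = 1"
    "\<And>x. x \<in> commutator_span A (?T 0) \<Longrightarrow> \<phi> x = 0"
    using separating_functional[OF test_module_seminormed T0.commutator_span_closed _ nmem] c0
    by (auto simp: test_module_simps)
  define \<mu> where "\<mu> f = \<phi> (Inl f)" for f
  have im: "Inl f \<in> carrier (?T 0)" if "f \<in> carrier L" for f using that by (simp add: test_module_simps im0)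
  have "\<exists>C. \<forall>x\<in>carrier (?T 0). nrm scalars (\<phi> x) \<le> C * nrm (?T 0) x"
    using \<phi>(1) by (simp add: bounded_linear_map_def)
  then obtain C where C: "\<And>x. x \<in> carrier (?T 0) \<Longrightarrow> vabs (\<phi> x) \<le> C * nrm (?T 0) x" by auto
  have \<mu>: "bounded_linear_map L scalars \<mu>"
  proof (rule bounded_linear_mapI[where C = C])
    fix f assume f: "f \<in> carrier L"
    show "\<mu> (f \<oplus>\<^bsub>L\<^esub> h) = \<mu> f \<oplus>\<^bsub>scalars\<^esub> \<mu> h" if "h \<in> carrier L" for h
      using bounded_linear_mapD(2)[OF \<phi>(1) im[OF f] im[OF that]] by (simp add: \<mu>_def test_module_simps)
    show "\<mu> (c \<odot>\<^bsub>L\<^esub> f) = c \<odot>\<^bsub>scalars\<^esub> \<mu> f" for c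
      using bounded_linear_mapD(3)[OF \<phi>(1) im[OF f]] by (simp add: \<mu>_def test_module_simps)
    show "nrm scalars (\<mu> f) \<le> C * nrm L f"
      using C[OF im[OF f]] by (simp add: \<mu>_def test_module_simps)
  qed simp
  have "\<mu> (translate G g f) = \<mu> f" if g: "g \<in> carrier G" and f: "f \<in> carrier L" for g f
  \<comment> \<open>The augmentation of a point mass is 1, so the commutator killed by
    \<open>\<phi>\<close> is the difference between the translate and \<open>f\<close>.\<close>
  proof -
    have "augmentation (delta g) = 1"
      using g by (simp add: augmentation_def conv_delta translate_def const1_def)
    then have "lact (?T 0) (delta g) (Inl f) \<ominus>\<^bsub>?T 0\<^esub> ract (?T 0) (Inl f) (delta g) = Inl (translate G g f \<ominus>\<^bsub>L\<^esub> f)"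
      using g f translate_mem_L[OF g f]
      by (simp add: test_module_simps proj_def conv_delta test_module_diff im0)
    then have "\<mu> (translate G g f \<ominus>\<^bsub>L\<^esub> f) = 0"
      using \<phi>(3)[OF T0.commutator_mem[OF delta_mem[OF g]], of "Inl f"] f by (simp add: \<mu>_def test_module_simps im0)
    moreover have "\<mu> (translate G g f \<ominus>\<^bsub>L\<^esub> f) = \<mu> (translate G g f) - \<mu> f"
      using bounded_linear_mapD(2)[OF \<mu> translate_mem_L[OF g f], of "(- 1) \<odot>\<^bsub>L\<^esub> f"]
        bounded_linear_mapD(3)[OF \<mu> f, of "- 1"] f by (simp add: L.a_minus_eq_smult)
    ultimately show ?thesis by simp
  qed
  moreover have "\<mu> const1 \<noteq> 0" using \<phi>(2) by (simp add: \<mu>_def)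
  ultimately show ?thesis
    using \<mu> unfolding johnson_amenable_def const1_def by blast
qed

end

theorem theorem1:
  fixes G :: "('g, 'm) monoid_scheme"
  assumes "group G"
  shows "amenable TYPE(('g \<Rightarrow> 'k) + 'u)
           (l_algebra G :: ('k::spherically_complete_field, 'g \<Rightarrow> 'k) nspace)
         \<longleftrightarrow> johnson_amenable TYPE('k) G"
proof -
  interpret group_convolution G "TYPE('k)"
    using assms by (simp add: group_convolution_def)
  show ?thesis using amenable_imp_johnson johnson_imp_amenable by blast
qed

end
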